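(* Let $p\in[1,\infty)$, let $\Omega\subset\mathbb R^N$ be a non-empty bounded open set, and let $(\rho_k)_{k\in\mathbb N}$, $(w_k)_{k\in\mathbb N}$, $w$ and $\mu$ be as in the standing assumptions of the context. Assume that $(\rho_k)_{k\in\mathbb N}$ is a strongly $p$-compact family and that $\mu$ is $(p,\Omega)$-Poincaré. Then, for every $\varepsilon>0$, there exists $k_\varepsilon\in\mathbb N$ such that $$\|u\|_{L^p}^p\le\left(A_{p,\mu,\Omega,w}+\varepsilon\right)\mathscr F^{w_k}_{k,p}(u)$$ for all $u\in L^p_0(\Omega)$ and $k\ge k_\varepsilon$.
   Context: Standing assumptions. $p\in[1,\infty)$. Kernels: $(\rho_k)_{k\in\mathbb N}\subset L^1_{\rm loc}(\mathbb R^N)$, $\rho_k\ge0$, with $$\sup_{R>0}\limsup_{k\to\infty}R^p\int_{\mathbb R^N}\frac{\rho_k(z)}{R^p+|z|^p}\,dz<\infty,$$ and, for some $\alpha\ge0$, the measures $\rho_k\mathscr L^N$ converge weakly-* to $\alpha\delta_0$ in $\mathscr M_{\rm loc}(\mathbb R^N)$ (tested against $C_c(\mathbb R^N)$). Measure $\mu$: for $\delta>0$ and $k\in\mathbb N$ let $\mu_k^\delta$ be the measure on the unit sphere $\mathbb S^{N-1}$ given by $\mu_k^\delta(E)=\int_E\big(\int_0^\delta\rho_k(\sigma r)\,r^{N-1}\,dr\big)\,d\mathscr H^{N-1}(\sigma)$. It is assumed (possibly after passing to a subsequence of $(\rho_k)$ once and for all) that for all small $\delta>0$ the measures $\mu_k^\delta$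 converge weakly-* on $\mathbb S^{N-1}$ as $k\to\infty$, and $\mu$ is the weak-* limit of these limits as $\delta\to0^+$, a finite non-negative Radon measure on $\mathbb S^{N-1}$. Weights: $(w_k)_{k\in\mathbb N}\subset L^\infty(\mathbb R^{2N})$, $w_k\ge0$, $w_k\to w$ in $L^\infty(\mathbb R^{2N})$, where $w\in C_b(\mathbb R^{2N})$, $w\ge0$, and $|w(x,y)-w(x',y')|\le\omega(|x-x'|+|y-y'|)$ for all $x,x',y,y'\in\mathbb R^N$, with $\omega\colon[0,\infty)\to[0,\infty)$ non-decreasing and $\lim_{t\to0^+}\omega(t)=\omega(0)=0$. No symmetry is assumed. Functionals: for a non-negative weight $v\in L^\infty(\mathbb R^{2N})$ and $u\in L^p(\mathbb R^N)$, $$\mathscr F^{v}_{k,p}(u)=\int_{\mathbb R^N}\int_{\mathbb R^N}\frac{|u(x)-u(y)|^p}{|x-y|^p}\,\rho_k(x-y)\,v(x,y)\,dx\,dy\in[0,\infty];$$ $\mathscr F^1_{k,p}$ is the case $v\equiv1$. Spaces: $\mathcal S^p(\mathbb R^N)=W^{1,p}(\mathbb R^N)$ if $p>1$ and $\mathcal S^1(\mathbb R^N)=BV(\mathbb R^N)$; $L^p_0(\Omega)=\{u\in L^p(\mathbb R^N):u=0\text{ a.e. on }\mathbb R^N\setminus\Omega\}$; $\mathcal S^p_0(\Omega)=\mathcal S^p(\mathbb R^N)\cap L^p_0(\Omega)$. Limit energies: with $w^0(x)=w(x,x)$, for $u\in\mathcal S^p(\mathbb R^N)$ with distributional gradient $Du$,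 $\mathscr D^\mu_{p,w}(u)=\int_{\mathbb S^{N-1}}\|\sigma\cdot Du\|^p_{L^p(w^0)}\,d\mu(\sigma)$, where $\|\sigma\cdot Du\|_{L^p(w^0)}^p=\int_{\mathbb R^N}w^0|\sigma\cdot Du|^p\,dx$ if $p>1$ and $=\int_{\mathbb R^N}w^0\,d|\sigma\cdot Du|$ (total variation measure) if $p=1$; $\mathscr D^\mu_p$ is the same energy with $w\equiv1$. The measure $\mu$ is $(p,\Omega)$-Poincaré if there exists $C>0$ such that $\|u\|_{L^p}^p\le C\,\mathscr D^\mu_p(u)$ for every $u\in\mathcal S^p_0(\Omega)$; $A_{p,\mu,\Omega}>0$ denotes the optimal such constant. In this case, there exists $C>0$, depending on $A_{p,\mu,\Omega}$ and $\inf_\Omega w^0>0$, such that $\|u\|_{L^p}^p\le C\,\mathscr D^\mu_{p,w}(u)$ for all $u\in\mathcal S^p_0(\Omega)$, and $A_{p,\mu,\Omega,w}>0$ denotes the optimal constant in this last inequality. A sequence $(u_k)\subset L^p(\mathbb R^N)$ is $p$-energy bounded if $\sup_{k}\big(\|u_k\|_{L^p}+\mathscr F^1_{k,p}(u_k)\big)<\infty$. The family $(\rho_k)$ is $p$-compact if any $p$-energy bounded sequence in $L^p(\mathbb R^N)$ is (relatively) compact in $L^p(E)$ for every compact $E\subset\mathbb R^N$. It is strongly $p$-compact if it is $p$-compact and any $L^p_{\rm loc}(\mathbb R^N)$ limit of a $p$-energy bounded sequence is in $\mathcal S^p(\mathbb R^N)$. *)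

theory Defs
  imports "HOL-Probability.Probability"
begin

text \<open>
  \<open>\<real>\<^sup>N\<close> is a type \<open>'a::euclidean_space\<close>, so \<open>N = DIM('a) \<ge> 1\<close>.  Elements of \<open>L\<^sup>p\<close>,
  \<open>L\<^sup>1\<close>-loc and \<open>L\<^sup>\<infinity>\<close> are handled through Borel representatives; every notion below is invariant
  under changes of the representative on Lebesgue null sets.
\<close>

section \<open>Lebesgue spaces\<close>

definition Lp :: "'a measure \<Rightarrow> real \<Rightarrow> ('a \<Rightarrow> 'b::euclidean_space) set" where
  "Lp M p = {f \<in> borel_measurable M. integrable M (\<lambda>x. norm (f x) powr p)}"

definition Lp_norm :: "'a measure \<Rightarrow> real \<Rightarrow> ('a \<Rightarrow> 'b::euclidean_space) \<Rightarrow> real" where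
  "Lp_norm M p f = (\<integral>x. norm (f x) powr p \<partial>M) powr (1 / p)"

definition Lp_loc :: "real \<Rightarrow> ('a::euclidean_space \<Rightarrow> 'b::euclidean_space) set" where
  "Lp_loc p = {f \<in> borel_measurable lborel. \<forall>E. compact E \<longrightarrow> f \<in> Lp (restrict_space lborel E) p}"

definition Lp_zero :: "real \<Rightarrow> 'a::euclidean_space set \<Rightarrow> ('a \<Rightarrow> real) set" where
  "Lp_zero p \<Omega> = {u \<in> Lp lborel p. AE x in lborel. x \<notin> \<Omega> \<longrightarrow> u x = 0}"

definition Linfty :: "'a::euclidean_space itself \<Rightarrow> ('a \<Rightarrow> real) set" where
  "Linfty _ = {f \<in> borel_measurable lborel. esssup lborel (\<lambda>x. ennreal \<bar>f x\<bar>) < \<infinity>}"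


section \<open>Distributional gradients, Sobolev and BV functions\<close>

primrec Ck :: "nat \<Rightarrow> ('a::euclidean_space \<Rightarrow> real) \<Rightarrow> bool" where
  "Ck 0 f \<longleftrightarrow> continuous_on UNIV f"
| "Ck (Suc n) f \<longleftrightarrow> f differentiable_on UNIV \<and> (\<forall>b\<in>Basis. Ck n (\<lambda>x. frechet_derivative f (at x) b))"

definition compact_support :: "('a::euclidean_space \<Rightarrow> real) \<Rightarrow> bool" where
  "compact_support \<phi> \<longleftrightarrow> compact (closure {x. \<phi> x \<noteq> 0})"

definition test_functions :: "('a::euclidean_space \<Rightarrow> real) set" where
  "test_functions = {\<phi>. (\<forall>n. Ck n \<phi>) \<and> compact_support \<phi>}"

definition has_weak_gradient :: "('a::euclidean_space \<Rightarrow> real) \<Rightarrow> ('a \<Rightarrow> 'a) \<Rightarrow> bool" where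
  "has_weak_gradient u g \<longleftrightarrow> (\<forall>\<phi>\<in>test_functions. \<forall>b\<in>Basis.
     (\<integral>x. u x * frechet_derivative \<phi> (at x) b \<partial>lborel) = - (\<integral>x. (g x \<bullet> b) * \<phi> x \<partial>lborel))"

definition W1p :: "real \<Rightarrow> ('a::euclidean_space \<Rightarrow> real) set" where
  "W1p p = {u \<in> Lp lborel p. \<exists>g \<in> Lp lborel p. has_weak_gradient u g}"

text \<open>
  Finite vector-valued Radon measures are set functions, countably additive on the Borel sets
  (the value on other sets is irrelevant).
\<close>

definition vector_measure :: "('a::topological_space set \<Rightarrow> 'b::real_normed_vector) \<Rightarrow> bool" where
  "vector_measure \<nu> \<longleftrightarrow> (\<forall>A :: nat \<Rightarrow> 'a set. range A \<subseteq> sets borel \<longrightarrow> disjoint_family A \<longrightarrow>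
     (\<lambda>i. \<nu> (A i)) sums \<nu> (\<Union>i. A i))"

definition variation :: "('a::topological_space set \<Rightarrow> 'b::real_normed_vector) \<Rightarrow> 'a set \<Rightarrow> ennreal" where
  "variation \<nu> E = (SUP A \<in> {A :: nat \<Rightarrow> 'a set. range A \<subseteq> sets borel \<and> disjoint_family A \<and> (\<Union>i. A i) = E}.
     \<Sum>i. ennreal (norm (\<nu> (A i))))"

definition variation_measure :: "('a::topological_space set \<Rightarrow> 'b::real_normed_vector) \<Rightarrow> 'a measure" where
  "variation_measure \<nu> = measure_of UNIV (sets borel) (variation \<nu>)"

text \<open>
  The integral against a finite signed measure, via the Jordan decomposition
  \<open>\<nu>\<^sup>\<plusminus> = (\<bar>\<nu>\<bar> \<plusminus> \<nu>) / 2\<close>.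
\<close>

definition signed_integral :: "('a::topological_space set \<Rightarrow> real) \<Rightarrow> ('a \<Rightarrow> real) \<Rightarrow> real" where
  "signed_integral \<nu> \<phi> =
     (\<integral>x. \<phi> x \<partial>measure_of UNIV (sets borel) (\<lambda>E. ennreal ((enn2real (variation \<nu> E) + \<nu> E) / 2)))
   - (\<integral>x. \<phi> x \<partial>measure_of UNIV (sets borel) (\<lambda>E. ennreal ((enn2real (variation \<nu> E) - \<nu> E) / 2)))"

definition has_measure_gradient :: "('a::euclidean_space \<Rightarrow> real) \<Rightarrow> ('a set \<Rightarrow> 'a) \<Rightarrow> bool" where
  "has_measure_gradient u D \<longleftrightarrow> vector_measure D \<and> (\<forall>\<phi>\<in>test_functions. \<forall>b\<in>Basis.
     (\<integral>x. u x * frechet_derivative \<phi> (at x) b \<partial>lborel) = - signed_integral (\<lambda>E. D E \<bullet> b) \<phi>)"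

definition BV :: "('a::euclidean_space \<Rightarrow> real) set" where
  "BV = {u \<in> Lp lborel 1. \<exists>D. has_measure_gradient u D}"

definition Sp :: "real \<Rightarrow> ('a::euclidean_space \<Rightarrow> real) set" where
  "Sp p = (if p = 1 then BV else W1p p)"

definition Sp_zero :: "real \<Rightarrow> 'a::euclidean_space set \<Rightarrow> ('a \<Rightarrow> real) set" where
  "Sp_zero p \<Omega> = Sp p \<inter> Lp_zero p \<Omega>"


section \<open>Local energies and the Poincare constant\<close>

text \<open>
  The distributional gradient is unique (almost everywhere, respectively on Borel sets), so that
  the choices below do not affect the energy.
\<close>

definition weak_gradient :: "real \<Rightarrow> ('a::euclidean_space \<Rightarrow> real) \<Rightarrow> 'a \<Rightarrow> 'a" where
  "weak_gradient p u = (SOME g. g \<in> Lp lborel p \<and> has_weak_gradient u g)"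

definition measure_gradient :: "('a::euclidean_space \<Rightarrow> real) \<Rightarrow> 'a set \<Rightarrow> 'a" where
  "measure_gradient u = (SOME D. has_measure_gradient u D)"

definition local_energy ::
    "real \<Rightarrow> ('a::euclidean_space \<Rightarrow> real) \<Rightarrow> 'a measure \<Rightarrow> ('a \<Rightarrow> real) \<Rightarrow> ennreal" where
  "local_energy p w0 \<mu> u =
     (if p = 1
      then \<integral>\<^sup>+\<sigma>. (\<integral>\<^sup>+x. ennreal (w0 x) \<partial>variation_measure (\<lambda>E. \<sigma> \<bullet> measure_gradient u E)) \<partial>\<mu>
      else \<integral>\<^sup>+\<sigma>. (\<integral>\<^sup>+x. ennreal (w0 x * \<bar>\<sigma> \<bullet> weak_gradient p u x\<bar> powr p) \<partial>lborel) \<partial>\<mu>)"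

definition poincare_constants ::
    "real \<Rightarrow> ('a::euclidean_space \<Rightarrow> real) \<Rightarrow> 'a measure \<Rightarrow> 'a set \<Rightarrow> real set" where
  "poincare_constants p w0 \<mu> \<Omega> =
     {C. C > 0 \<and> (\<forall>u\<in>Sp_zero p \<Omega>. ennreal (Lp_norm lborel p u powr p) \<le> ennreal C * local_energy p w0 \<mu> u)}"

definition poincare_measure :: "real \<Rightarrow> 'a::euclidean_space measure \<Rightarrow> 'a set \<Rightarrow> bool" where
  "poincare_measure p \<mu> \<Omega> \<longleftrightarrow> poincare_constants p (\<lambda>_. 1) \<mu> \<Omega> \<noteq> {}"

definition optimal_poincare_constant ::
    "real \<Rightarrow> ('a::euclidean_space \<Rightarrow> real) \<Rightarrow> 'a measure \<Rightarrow> 'a set \<Rightarrow> real" where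
  "optimal_poincare_constant p w0 \<mu> \<Omega> = Inf (poincare_constants p w0 \<mu> \<Omega>)"


section \<open>Hausdorff measure\<close>

text \<open>
  The \<open>n\<close>-dimensional Hausdorff measure, normalised to agree with Lebesgue measure on \<open>\<real>\<^sup>n\<close>.  Empty
  covering sets contribute \<open>0\<close> also for \<open>n = 0\<close>, where \<open>0 ^ 0 = 1\<close> makes it the counting measure.
\<close>

definition hausdorff_pre :: "nat \<Rightarrow> real \<Rightarrow> 'a::euclidean_space set \<Rightarrow> ennreal" where
  "hausdorff_pre n \<delta> E =
     (INF C \<in> {C :: nat \<Rightarrow> 'a set. E \<subseteq> (\<Union>i. C i) \<and> (\<forall>i. bounded (C i) \<and> diameter (C i) \<le> \<delta>)}.
        \<Sum>i. if C i = {} then 0 else ennreal (unit_ball_vol (real n) * (diameter (C i) / 2) ^ n))"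

definition hausdorff_outer :: "nat \<Rightarrow> 'a::euclidean_space set \<Rightarrow> ennreal" where
  "hausdorff_outer n E = (SUP \<delta>\<in>{0<..}. hausdorff_pre n \<delta> E)"

definition hausdorff_measure :: "nat \<Rightarrow> 'a::euclidean_space measure" where
  "hausdorff_measure n = measure_of UNIV (sets borel) (hausdorff_outer n)"


section \<open>Kernels, angular limit measure, weights\<close>

definition admissible_kernels :: "real \<Rightarrow> (nat \<Rightarrow> 'a::euclidean_space \<Rightarrow> real) \<Rightarrow> bool" where
  "admissible_kernels p \<rho> \<longleftrightarrow>
     (\<forall>k. \<rho> k \<in> Lp_loc 1 \<and> (AE z in lborel. 0 \<le> \<rho> k z)) \<and>
     (SUP R\<in>{0<..}. limsup (\<lambda>k. ennreal (R powr p) *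
        (\<integral>\<^sup>+z. ennreal (\<rho> k z / (R powr p + norm z powr p)) \<partial>lborel))) < \<infinity> \<and>
     (\<exists>\<alpha>\<ge>0. \<forall>\<phi>. continuous_on UNIV \<phi> \<and> compact_support \<phi> \<longrightarrow>
        (\<lambda>k. \<integral>z. \<phi> z * \<rho> k z \<partial>lborel) \<longlonglongrightarrow> \<alpha> * \<phi> 0)"

definition finite_sphere_measure :: "'a::euclidean_space measure \<Rightarrow> bool" where
  "finite_sphere_measure \<mu> \<longleftrightarrow>
     sets \<mu> = sets (restrict_space borel (sphere 0 1)) \<and> finite_measure \<mu>"

definition sphere_weak_star ::
    "('i \<Rightarrow> 'a::euclidean_space measure) \<Rightarrow> 'a measure \<Rightarrow> 'i filter \<Rightarrow> bool" where
  "sphere_weak_star M L F \<longleftrightarrow> (\<forall>f :: 'a \<Rightarrow> real. continuous_on (sphere 0 1) f \<longrightarrow>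
     ((\<lambda>i. \<integral>\<sigma>. f \<sigma> \<partial>M i) \<longlongrightarrow> (\<integral>\<sigma>. f \<sigma> \<partial>L)) F)"

definition angular_measure :: "('a::euclidean_space \<Rightarrow> real) \<Rightarrow> real \<Rightarrow> 'a measure" where
  "angular_measure \<rho> \<delta> =
     density (restrict_space (hausdorff_measure (DIM('a) - 1)) (sphere 0 1))
       (\<lambda>\<sigma>. \<integral>\<^sup>+r. ennreal (\<rho> (r *\<^sub>R \<sigma>) * r ^ (DIM('a) - 1)) * indicator {0<..<\<delta>} r \<partial>lborel)"

definition angular_limit :: "(nat \<Rightarrow> 'a::euclidean_space \<Rightarrow> real) \<Rightarrow> 'a measure \<Rightarrow> bool" where
  "angular_limit \<rho> \<mu> \<longleftrightarrow> finite_sphere_measure \<mu> \<and>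
     (\<exists>\<nu> :: real \<Rightarrow> 'a measure.
        (\<forall>\<^sub>F \<delta> in at_right 0. finite_sphere_measure (\<nu> \<delta>) \<and>
           sphere_weak_star (\<lambda>k. angular_measure (\<rho> k) \<delta>) (\<nu> \<delta>) sequentially) \<and>
        sphere_weak_star \<nu> \<mu> (at_right 0))"

definition admissible_weights ::
    "(nat \<Rightarrow> 'a::euclidean_space \<times> 'a \<Rightarrow> real) \<Rightarrow> ('a \<times> 'a \<Rightarrow> real) \<Rightarrow> bool" where
  "admissible_weights wk w \<longleftrightarrow>
     (\<forall>k. wk k \<in> Linfty TYPE('a \<times> 'a) \<and> (AE z in lborel. 0 \<le> wk k z)) \<and>
     (\<lambda>k. esssup lborel (\<lambda>z. ennreal \<bar>wk k z - w z\<bar>)) \<longlonglongrightarrow> 0 \<and>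
     continuous_on UNIV w \<and> bounded (range w) \<and> (\<forall>z. 0 \<le> w z) \<and>
     (\<exists>\<omega> :: real \<Rightarrow> real. (\<forall>t\<ge>0. 0 \<le> \<omega> t) \<and> mono_on {0..} \<omega> \<and> \<omega> 0 = 0 \<and> (\<omega> \<longlongrightarrow> 0) (at_right 0) \<and>
        (\<forall>x x' y y'. \<bar>w (x, y) - w (x', y')\<bar> \<le> \<omega> (norm (x - x') + norm (y - y'))))"


section \<open>Nonlocal energies and compactness of the kernels\<close>

definition nonlocal_energy ::
    "real \<Rightarrow> ('a::euclidean_space \<Rightarrow> real) \<Rightarrow> ('a \<times> 'a \<Rightarrow> real) \<Rightarrow> ('a \<Rightarrow> real) \<Rightarrow> ennreal" where
  "nonlocal_energy p \<rho> v u =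
     (\<integral>\<^sup>+x. \<integral>\<^sup>+y. ennreal (\<bar>u x - u y\<bar> powr p / norm (x - y) powr p * \<rho> (x - y) * v (x, y))
        \<partial>lborel \<partial>lborel)"

definition energy_bounded ::
    "real \<Rightarrow> (nat \<Rightarrow> 'a::euclidean_space \<Rightarrow> real) \<Rightarrow> (nat \<Rightarrow> 'a \<Rightarrow> real) \<Rightarrow> bool" where
  "energy_bounded p \<rho> u \<longleftrightarrow> (\<forall>k. u k \<in> Lp lborel p) \<and>
     (SUP k. ennreal (Lp_norm lborel p (u k)) + nonlocal_energy p (\<rho> k) (\<lambda>_. 1) (u k)) < \<infinity>"

definition p_compact :: "real \<Rightarrow> (nat \<Rightarrow> 'a::euclidean_space \<Rightarrow> real) \<Rightarrow> bool" where
  "p_compact p \<rho> \<longleftrightarrow> (\<forall>u E. energy_bounded p \<rho> u \<and> compact E \<longrightarrow>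
     (\<forall>r :: nat \<Rightarrow> nat. strict_mono r \<longrightarrow>
        (\<exists>s :: nat \<Rightarrow> nat. strict_mono s \<and> (\<exists>v \<in> Lp (restrict_space lborel E) p.
           (\<lambda>j. Lp_norm (restrict_space lborel E) p (\<lambda>x. u (r (s j)) x - v x)) \<longlonglongrightarrow> 0))))"

text \<open>
  A relatively compact sequence need not converge: its \<open>L\<^sup>p\<close>-loc limits are the limits of its
  subsequences.
\<close>

definition strongly_p_compact :: "real \<Rightarrow> (nat \<Rightarrow> 'a::euclidean_space \<Rightarrow> real) \<Rightarrow> bool" where
  "strongly_p_compact p \<rho> \<longleftrightarrow> p_compact p \<rho> \<and>
     (\<forall>u v. \<forall>r :: nat \<Rightarrow> nat. energy_bounded p \<rho> u \<and> strict_mono r \<and> v \<in> Lp_loc p \<and>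
        (\<forall>E. compact E \<longrightarrow>
           (\<lambda>j. Lp_norm (restrict_space lborel E) p (\<lambda>x. u (r j) x - v x)) \<longlonglongrightarrow> 0) \<longrightarrow>
        v \<in> Sp p)"

end

theory Submission
  imports Defs "HOL-Real_Asymp.Real_Asymp"
begin

text \<open>
  The proof is by contradiction and compactness. Put \<open>a = A + \<epsilon>\<close> with \<open>A\<close> the optimal constant. If the inequality fails
  for arbitrarily large \<open>k\<close>, homogeneity gives functions \<open>u\<^sub>k\<close> supported in \<open>\<Omega>\<close> with norm \<open>1\<close> and weighted nonlocal energy at
  most \<open>1 / a\<close> (\<open>normalized_violator\<close>). Their unweighted energies are bounded as well: near the diagonal of \<open>\<Omega>\<close> the weights are
  bounded below, and the long-range part is controlled by the norm and the tails of the kernels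
  (\<open>unweighted_energy_bound\<close>). Strong compactness gives a limit \<open>v\<close> of a subsequence in \<open>L\<^sup>p\<close>, which lies in the Sobolev or
  \<open>BV\<close> space, vanishes outside \<open>\<Omega>\<close> and has norm at least \<open>1\<close> (\<open>compactness_of_normalized_sequence\<close>, \<open>Lp_limit_norm_ge\<close>). The
  liminf inequality \<open>liminf_local_energy\<close> bounds the local energy of \<open>v\<close> by \<open>1 / a\<close>. Hence every constant \<open>C\<close> in the local
  Poincare inequality satisfies \<open>1 \<le> C / a\<close>, so \<open>A + \<epsilon> = a \<le> A\<close>, because there is such a constant
  (\<open>poincare_constants_weighted_nonempty\<close>).

  The liminf inequality is proved by duality rather than by mollification. The local energy in the direction \<open>\<sigma>\<close> is almost
  attained by an expression \<open>\<integral>\<psi> (\<sigma> \<bullet> h) - \<integral>\<kappa>\<close> that is linear in the gradient, where \<open>\<psi>\<close> is a test function and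
  \<open>\<psi> x * t - \<kappa> x \<le> (w0 x + \<eta>) * \<bar>t\<bar> powr p\<close> (\<open>dual_pair_exists\<close>). Inserting difference quotients for \<open>t\<close> and moving the
  translation to \<open>\<psi>\<close> bounds the energy of difference quotients of functions close to \<open>v\<close> from below, uniformly in small
  translations \<open>z\<close>, by the local energy in the direction of \<open>z\<close> (\<open>difference_quotient_energy_liminf\<close>). Integration against the
  kernel in polar coordinates turns this into a bound for integrals over the angular measures, which converge to \<open>\<mu>\<close>.

  Two parts are more general measure theory. The gradient of a \<open>BV\<close> function is written as a vector-valued density with
  respect to a finite measure (Hahn decomposition and Radon-Nikodym, \<open>vector_measure_density\<close>), which puts \<open>p = 1\<close> on the same footing as \<open>p > 1\<close>. The
  angular measures are defined by the Hausdorff measure of the sphere; polar coordinates are available for the cone measure,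
  and the one inequality between the two measures that is needed (\<open>hausdorff_measure_le_surface_measure\<close>) follows from Vitali's covering
  lemma and sharp lower bounds for the cone measures of small caps.
\<close>

section \<open>Smooth functions with compact support\<close>

text \<open>
  The powers \<open>t ^ m\<close> in the denominator make the family closed under differentiation up to linear combinations;
  \<open>m = 0\<close> is the usual function that is smooth but flat at \<open>0\<close>.
\<close>

definition flat_exp :: "nat \<Rightarrow> real \<Rightarrow> real" where
  "flat_exp m t = (if t > 0 then exp (- 1 / t) / t ^ m else 0)"

lemma flat_exp_pos_tendsto_0: "((\<lambda>t. exp (- 1 / t) / t ^ m) \<longlongrightarrow> 0) (at_right (0::real))"
  by real_asymp

lemma flat_exp_DERIV:
  "(flat_exp m has_real_derivative (flat_exp (m + 2) t - real m * flat_exp (m + 1) t)) (at t)"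
proof -
  consider "t > 0" | "t < 0" | "t = 0" by linarith
  then show ?thesis
  proof cases
    case 1
    have "((\<lambda>t. exp (- 1 / t) / t ^ m) has_real_derivative
        (exp (- 1 / t) / t ^ (m + 2) - real m * (exp (- 1 / t) / t ^ (m + 1)))) (at t)"
    proof -
      have "((\<lambda>t. exp (- 1 / t)) has_real_derivative exp (- 1 / t) / t\<^sup>2) (at t)"
        using 1 by (auto intro!: derivative_eq_intros simp: power2_eq_square)
      from DERIV_divide[OF this DERIV_pow, of m] 1
      have "((\<lambda>t. exp (- 1 / t) / t ^ m) has_real_derivative
          (exp (- 1 / t) / t\<^sup>2 * t ^ m - exp (- 1 / t) * (real m * t ^ (m - Suc 0))) / (t ^ m * t ^ m)) (at t)"
        by simp
      moreover have "real m * t ^ (m - Suc 0) = real m * t ^ m / t"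
        using 1 by (cases m) auto
      then have "(exp (- 1 / t) / t\<^sup>2 * t ^ m - exp (- 1 / t) * (real m * t ^ (m - Suc 0))) / (t ^ m * t ^ m)
          = exp (- 1 / t) / t ^ (m + 2) - real m * (exp (- 1 / t) / t ^ (m + 1))"
        using 1 by (simp add: power_add power2_eq_square field_simps) auto
      ultimately show ?thesis by metis
    qed
    moreover have "\<forall>\<^sub>F s in nhds t. exp (- 1 / s) / s ^ m = flat_exp m s"
      using eventually_nhds_in_open[of "{0<..}" t] 1
      by (auto simp: flat_exp_def elim!: eventually_mono)
    ultimately show ?thesis
      using 1 by (subst DERIV_cong_ev[OF refl _ refl, symmetric]) (auto simp: flat_exp_def)
  next
    case 2
    have "\<forall>\<^sub>F s in nhds t. 0 = flat_exp m s"
      using eventually_nhds_in_open[of "{..<0}" t] 2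
      by (auto simp: flat_exp_def elim!: eventually_mono)
    then have "(flat_exp m has_real_derivative 0) (at t)"
      using DERIV_cong_ev[OF refl _ refl, of "\<lambda>_. 0"] DERIV_const by blast
    then show ?thesis using 2 by (simp add: flat_exp_def)
  next
    case 3
    have "((\<lambda>h. (flat_exp m h - flat_exp m 0) / (h - 0)) \<longlongrightarrow> 0) (at 0)"
      unfolding filterlim_at_split
    proof
      have "\<forall>\<^sub>F h in at_left 0. 0 = (flat_exp m h - flat_exp m 0) / (h - 0)"
        by (auto simp: flat_exp_def eventually_at_left_field intro: lt_ex)
      then show "((\<lambda>h. (flat_exp m h - flat_exp m 0) / (h - 0)) \<longlongrightarrow> 0) (at_left 0)"
        by (rule Lim_transform_eventually[OF tendsto_const])
      have "\<forall>\<^sub>F h in at_right 0. exp (- 1 / h) / h ^ Suc m = (flat_exp m h - flat_exp m 0) / (h - 0)"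
        by (auto simp: flat_exp_def eventually_at_right_field intro: gt_ex)
      then show "((\<lambda>h. (flat_exp m h - flat_exp m 0) / (h - 0)) \<longlongrightarrow> 0) (at_right 0)"
        by (rule Lim_transform_eventually[OF flat_exp_pos_tendsto_0])
    qed
    then show ?thesis using 3 by (simp add: has_field_derivative_iff flat_exp_def)
  qed
qed

lemma real_polynomial_function_derivative:
  fixes P :: "'a::euclidean_space \<Rightarrow> real"
  assumes "real_polynomial_function P"
  obtains P' where "\<And>x. (P has_derivative P' x) (at x)"
    "\<And>b. real_polynomial_function (\<lambda>x. P' x b)"
proof -
  have "\<exists>P'. (\<forall>x. (P has_derivative P' x) (at x)) \<and> (\<forall>b. real_polynomial_function (\<lambda>x. P' x b))"
    using assms
  proof induction
    case (linear f)
    then show ?case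
      by (intro exI[of _ "\<lambda>x. f"]) (auto simp: bounded_linear_imp_has_derivative)
  next
    case (const c)
    then show ?case by (intro exI[of _ "\<lambda>x b. 0"]) auto
  next
    case (add f g)
    then obtain f' g' where
      "\<And>x. (f has_derivative f' x) (at x)" "\<And>b. real_polynomial_function (\<lambda>x. f' x b)"
      "\<And>x. (g has_derivative g' x) (at x)" "\<And>b. real_polynomial_function (\<lambda>x. g' x b)"
      by blast
    then show ?case
      by (intro exI[of _ "\<lambda>x b. f' x b + g' x b"]) (auto intro: has_derivative_add)
  next
    case (mult f g)
    then obtain f' g' where
      "\<And>x. (f has_derivative f' x) (at x)" "\<And>b. real_polynomial_function (\<lambda>x. f' x b)"
      "\<And>x. (g has_derivative g' x) (at x)" "\<And>b. real_polynomial_function (\<lambda>x. g' x b)"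
      by blast
    with mult.hyps show ?case
      by (intro exI[of _ "\<lambda>x b. f x * g' x b + f' x b * g x"]) 
        (auto intro!: has_derivative_mult real_polynomial_function.intros(3,4))
  qed
  then show ?thesis using that by blast
qed

text \<open>
  A class of functions that contains a smooth bump on the ball of radius \<open>r\<close> around \<open>c\<close> and all its products
  with polynomials, and that is closed under directional derivatives. Closure turns one derivative into
  arbitrarily many.
\<close>

inductive poly_bump :: "'a::euclidean_space \<Rightarrow> real \<Rightarrow> ('a \<Rightarrow> real) \<Rightarrow> bool" for c r where
  base: "real_polynomial_function P \<Longrightarrow> poly_bump c r (\<lambda>x. P x * flat_exp m (r\<^sup>2 - (x - c) \<bullet> (x - c)))"
| add: "poly_bump c r f \<Longrightarrow> poly_bump c r g \<Longrightarrow> poly_bump c r (\<lambda>x. f x + g x)"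

lemma poly_bump_derivative:
  assumes "poly_bump c r f"
  shows "\<exists>f'. (\<forall>x. (f has_derivative f' x) (at x)) \<and> (\<forall>b. poly_bump c r (\<lambda>x. f' x b))"
  using assms
proof induction
  case (base P m)
  obtain P' where P': "\<And>x. (P has_derivative P' x) (at x)"
    "\<And>b. real_polynomial_function (\<lambda>x. P' x b)"
    using real_polynomial_function_derivative[OF base] by blast
  let ?q = "\<lambda>x. r\<^sup>2 - (x - c) \<bullet> (x - c)"
  let ?f' = "\<lambda>x b. P x * ((flat_exp (m + 2) (?q x) - real m * flat_exp (m + 1) (?q x)) * (- 2 * ((x - c) \<bullet> b)))
      + P' x b * flat_exp m (?q x)"
  have "(?q has_derivative (\<lambda>b. - 2 * ((x - c) \<bullet> b))) (at x)" for x
    by (auto intro!: derivative_eq_intros simp: inner_commute)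
  from has_derivative_compose[OF this flat_exp_DERIV[unfolded has_field_derivative_def]]
  have "((\<lambda>x. P x * flat_exp m (?q x)) has_derivative ?f' x) (at x)" for x
    by (intro has_derivative_mult P')
  moreover have "poly_bump c r (\<lambda>x. ?f' x b)" for b
  proof -
    have lin: "real_polynomial_function (\<lambda>x. (x - c) \<bullet> b)"
      unfolding inner_diff_left
      by (intro real_polynomial_function_diff real_polynomial_function.intros(1)
          real_polynomial_function.intros(2) bounded_linear_inner_left)
    have "poly_bump c r (\<lambda>x. ((- 2 * P x * ((x - c) \<bullet> b)) * flat_exp (m + 2) (?q x)
        + (2 * real m * P x * ((x - c) \<bullet> b)) * flat_exp (m + 1) (?q x)) + P' x b * flat_exp m (?q x))"
      by (intro poly_bump.intros P' real_polynomial_function.intros(4) base lin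
          real_polynomial_function.intros(2))
    then show ?thesis by (simp add: algebra_simps)
  qed
  ultimately show ?case by (intro exI[of _ ?f']) blast
next
  case (add f g)
  then obtain f' g' where
    "\<And>x. (f has_derivative f' x) (at x)" "\<And>b. poly_bump c r (\<lambda>x. f' x b)"
    "\<And>x. (g has_derivative g' x) (at x)" "\<And>b. poly_bump c r (\<lambda>x. g' x b)"
    by blast
  then show ?case
    by (intro exI[of _ "\<lambda>x b. f' x b + g' x b"]) (auto intro: has_derivative_add poly_bump.add)
qed

lemma poly_bump_Ck: "poly_bump c r f \<Longrightarrow> Ck n f"
proof (induction n arbitrary: f)
  case 0
  obtain f' where "\<And>x. (f has_derivative f' x) (at x)"
    using poly_bump_derivative[OF 0] by blast
  then show ?case by (auto intro!: continuous_at_imp_continuous_on has_derivative_continuous)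
next
  case (Suc n)
  obtain f' where f': "\<And>x. (f has_derivative f' x) (at x)" "\<And>b. poly_bump c r (\<lambda>x. f' x b)"
    using poly_bump_derivative[OF Suc.prems] by blast
  have "(\<lambda>x. frechet_derivative f (at x) b) = (\<lambda>x. f' x b)" for b
    using frechet_derivative_at[OF f'(1)] by metis
  then show ?case
    using f' Suc.IH by (auto simp: differentiable_on_def differentiable_def)
qed

text \<open>
  A smooth approximation without mollifiers: divide \<open>\<phi>\<close> by a smooth bump \<open>\<zeta>\<close> that is positive exactly on the
  ball, approximate the quotient by a polynomial (Stone-Weierstrass) and multiply by \<open>\<zeta> \<le> 1\<close> again. The gap
  between \<open>s\<close> and \<open>r\<close> makes the quotient continuous up to the boundary of the ball, where \<open>\<zeta>\<close> vanishes.
\<close>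

lemma test_function_uniform_approximation:
  fixes \<phi> :: "'a::euclidean_space \<Rightarrow> real"
  assumes "continuous_on UNIV \<phi>" "s < r" "\<And>x. \<phi> x \<noteq> 0 \<Longrightarrow> dist c x \<le> s" "0 < e"
  obtains \<psi> where "\<psi> \<in> test_functions" "\<And>x. x \<notin> ball c r \<Longrightarrow> \<psi> x = 0" "\<And>x. \<bar>\<psi> x - \<phi> x\<bar> \<le> e"
proof (cases "r \<le> 0")
  case True
  have "\<phi> x = 0" for x
    using assms(2) assms(3)[of x] True zero_le_dist[of c x] by linarith
  moreover have "poly_bump c r (\<lambda>x. 0 * flat_exp 0 (r\<^sup>2 - (x - c) \<bullet> (x - c)))"
    by (intro poly_bump.base real_polynomial_function.intros(2))
  then have "(\<lambda>x. 0) \<in> (test_functions :: ('a \<Rightarrow> real) set)"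
    by (auto simp: test_functions_def compact_support_def dest: poly_bump_Ck)
  ultimately show thesis using that[of "\<lambda>x. 0"] \<open>0 < e\<close> by auto
next
  case False
  define \<zeta> where "\<zeta> x = flat_exp 0 (r\<^sup>2 - (x - c) \<bullet> (x - c))" for x
  have dist_sq: "(x - c) \<bullet> (x - c) = (dist c x)\<^sup>2" for x
    by (simp add: dist_norm norm_minus_commute[of c] power2_norm_eq_inner)
  have \<zeta>_pos: "\<zeta> x > 0" if "x \<in> ball c r" for x
    using that by (simp add: \<zeta>_def dist_sq flat_exp_def power_strict_mono)
  have \<zeta>_zero: "\<zeta> x = 0" if "x \<notin> ball c r" for x
    using that False by (simp add: \<zeta>_def dist_sq flat_exp_def power_mono not_less)
  have \<zeta>_le: "\<zeta> x \<le> 1" "0 \<le> \<zeta> x" for x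
    by (auto simp: \<zeta>_def flat_exp_def)
  have "poly_bump c r (\<lambda>x. 1 * flat_exp 0 (r\<^sup>2 - (x - c) \<bullet> (x - c)))"
    by (intro poly_bump.base real_polynomial_function.intros(2))
  from poly_bump_Ck[OF this, where n = 0] have \<zeta>_cont: "continuous_on UNIV \<zeta>"
    by (simp add: \<zeta>_def[abs_def])
  have "continuous_on (ball c r \<union> - cball c s) (\<lambda>x. \<phi> x / \<zeta> x)"
  proof (rule continuous_on_open_Un)
    show "continuous_on (ball c r) (\<lambda>x. \<phi> x / \<zeta> x)"
      using \<zeta>_pos by (intro continuous_intros continuous_on_subset[OF \<zeta>_cont]
          continuous_on_subset[OF assms(1)]) force+
    show "continuous_on (- cball c s) (\<lambda>x. \<phi> x / \<zeta> x)"
    proof (rule continuous_on_eq[OF continuous_on_const])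
      fix x assume "x \<in> - cball c s"
      with assms(3)[of x] have "\<phi> x = 0" by auto
      then show "0 = \<phi> x / \<zeta> x" by simp
    qed
  qed auto
  then have "continuous_on (cball c r) (\<lambda>x. \<phi> x / \<zeta> x)"
    by (rule continuous_on_subset) (use assms(2) in auto)
  then obtain P where P: "real_polynomial_function P" "\<And>x. x \<in> cball c r \<Longrightarrow> \<bar>\<phi> x / \<zeta> x - P x\<bar> < e"
    by (rule Stone_Weierstrass_real_polynomial_function[OF compact_cball _ \<open>0 < e\<close>]) blast
  define \<psi> where "\<psi> x = P x * flat_exp 0 (r\<^sup>2 - (x - c) \<bullet> (x - c))" for x
  have \<psi>: "\<psi> x = P x * \<zeta> x" for x by (simp add: \<psi>_def \<zeta>_def)
  have supp: "\<psi> x = 0" if "x \<notin> ball c r" for x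
    using that \<zeta>_zero[of x] by (auto simp: \<psi>)
  have "poly_bump c r \<psi>"
    unfolding \<psi>_def[abs_def] by (intro poly_bump.base P)
  moreover have "closure {x. \<psi> x \<noteq> 0} \<subseteq> cball c r"
    using supp by (intro closure_minimal) (auto, metis less_imp_le)
  then have "compact (closure {x. \<psi> x \<noteq> 0})"
    using compact_Int_closed[OF compact_cball closed_closure] by (metis inf.absorb2)
  ultimately have "\<psi> \<in> test_functions"
    by (auto simp: test_functions_def compact_support_def intro: poly_bump_Ck)
  moreover have "\<bar>\<psi> x - \<phi> x\<bar> \<le> e" for x
  proof (cases "x \<in> ball c r")
    case True
    have "\<psi> x - \<phi> x = \<zeta> x * (P x - \<phi> x / \<zeta> x)"
      using \<zeta>_pos[OF True] by (simp add: \<psi> field_simps)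
    then have "\<bar>\<psi> x - \<phi> x\<bar> = \<zeta> x * \<bar>\<phi> x / \<zeta> x - P x\<bar>"
      using \<zeta>_le(2)[of x] by (simp add: abs_mult abs_minus_commute)
    also have "\<dots> \<le> 1 * e"
      using P(2)[of x] True \<zeta>_le[of x] by (intro mult_mono) auto
    finally show ?thesis by simp
  next
    case False
    then have "\<phi> x = 0" using assms(2) assms(3)[of x] by auto
    then show ?thesis using \<zeta>_zero[OF False] \<open>0 < e\<close> by (simp add: \<psi>)
  qed
  ultimately show thesis using that supp by blast
qed

section \<open>Elementary properties of test functions\<close>

lemma test_function_derivative:
  assumes "\<psi> \<in> test_functions"
  shows "(\<psi> has_derivative frechet_derivative \<psi> (at x)) (at x)"
proof -
  have "Ck (Suc 0) \<psi>" using assms by (auto simp only: test_functions_def mem_Collect_eq)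
  then have "\<psi> differentiable at x" by (simp add: differentiable_on_def)
  then show ?thesis by (simp only: frechet_derivative_works)
qed

lemma test_function_continuous:
  assumes "\<psi> \<in> test_functions"
  shows "continuous_on UNIV \<psi>"
  using test_function_derivative[OF assms]
  by (auto intro!: continuous_at_imp_continuous_on has_derivative_continuous)

lemma test_function_partial_continuous:
  assumes "\<psi> \<in> test_functions" "b \<in> Basis"
  shows "continuous_on UNIV (\<lambda>x. frechet_derivative \<psi> (at x) b)"
proof -
  have "Ck (Suc 0) \<psi>" using assms(1) by (auto simp only: test_functions_def mem_Collect_eq)
  then show ?thesis using assms(2) by simp
qed

lemma test_function_support:
  assumes "\<psi> \<in> test_functions"
  obtains R where "0 < R" "\<And>x. R \<le> norm x \<Longrightarrow> \<psi> x = 0"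
proof -
  have "compact (closure {x. \<psi> x \<noteq> 0})"
    using assms by (simp only: test_functions_def compact_support_def mem_Collect_eq)
  then have "bounded {x. \<psi> x \<noteq> 0}"
    using bounded_subset[OF compact_imp_bounded closure_subset] by blast
  then obtain R where R: "0 < R" "\<forall>x\<in>{x. \<psi> x \<noteq> 0}. norm x \<le> R"
    unfolding bounded_pos by blast
  have "\<psi> x = 0" if "R + 1 \<le> norm x" for x
    using R(2) that by (cases "\<psi> x = 0") auto
  with R(1) show thesis by (intro that[of "R + 1"]) auto
qed

lemma test_function_derivative_outside:
  assumes "\<psi> \<in> test_functions" "open V" "\<And>x. x \<in> V \<Longrightarrow> \<psi> x = 0" "x \<in> V"
  shows "frechet_derivative \<psi> (at x) b = 0"
proof -
  have "(\<psi> has_derivative (\<lambda>_. 0)) (at x)"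
    by (rule has_derivative_transform_within_open[OF has_derivative_const assms(2,4)])
      (simp add: assms(3))
  then have "(\<lambda>_. 0) = frechet_derivative \<psi> (at x)"
    by (rule frechet_derivative_at)
  from fun_cong[OF this, of b] show ?thesis by simp
qed

lemma test_function_derivative_sum:
  assumes "\<psi> \<in> test_functions"
  shows "frechet_derivative \<psi> (at x) h = (\<Sum>b\<in>Basis. (h \<bullet> b) * frechet_derivative \<psi> (at x) b)"
proof -
  interpret linear "frechet_derivative \<psi> (at x)"
    using test_function_derivative[OF assms, of x] has_derivative_linear by blast
  have "frechet_derivative \<psi> (at x) h = frechet_derivative \<psi> (at x) (\<Sum>b\<in>Basis. (h \<bullet> b) *\<^sub>R b)"
    by (simp only: euclidean_representation)
  also have "\<dots> = (\<Sum>b\<in>Basis. (h \<bullet> b) * frechet_derivative \<psi> (at x) b)"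
    by (simp only: sum scale real_scaleR_def)
  finally show ?thesis .
qed

lemma continuous_on_vanishing_bounded:
  fixes f :: "'a::euclidean_space \<Rightarrow> real"
  assumes "continuous_on UNIV f" "\<And>x. R \<le> norm x \<Longrightarrow> f x = 0"
  obtains K where "0 < K" "\<And>x. \<bar>f x\<bar> \<le> K"
proof -
  have "compact (f ` cball 0 R)"
    using assms(1) by (intro compact_continuous_image) (auto intro: continuous_on_subset)
  then obtain K where "0 < K" "\<And>x. norm x \<le> R \<Longrightarrow> \<bar>f x\<bar> \<le> K"
    by (force dest!: compact_imp_bounded simp: bounded_pos)
  then have "\<bar>f x\<bar> \<le> K" for x
    using assms(2)[of x] by (cases "norm x \<le> R") auto
  with \<open>0 < K\<close> show thesis by (rule that)
qed

lemma test_function_Lipschitz: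
  assumes "\<psi> \<in> test_functions"
  obtains L where "0 < L" "\<And>x y. \<bar>\<psi> x - \<psi> y\<bar> \<le> L * norm (x - y)"
    "\<And>x h. \<bar>frechet_derivative \<psi> (at x) h\<bar> \<le> L * norm h"
proof -
  obtain R where R: "0 < R" "\<And>x. R \<le> norm x \<Longrightarrow> \<psi> x = 0"
    using test_function_support[OF assms] by blast
  have "frechet_derivative \<psi> (at x) b = 0" if "R + 1 \<le> norm x" for x b
  proof (rule test_function_derivative_outside[OF assms, of "- cball 0 R"])
    show "\<psi> x = 0" if "x \<in> - cball 0 R" for x using that R(2)[of x] by auto
  qed (use that in auto)
  then have "\<exists>K>0. \<forall>x. \<bar>frechet_derivative \<psi> (at x) b\<bar> \<le> K" if "b \<in> Basis" for b
    by (rule continuous_on_vanishing_bounded[OF test_function_partial_continuous[OF assms that], of "R + 1"])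
      blast+
  then obtain K where K: "\<And>b. b \<in> Basis \<Longrightarrow> K b > 0"
    "\<And>b x. b \<in> Basis \<Longrightarrow> \<bar>frechet_derivative \<psi> (at x) b\<bar> \<le> K b"
    by (metis (no_types))
  define L where "L = (\<Sum>b\<in>Basis. K b)"
  have L: "\<bar>frechet_derivative \<psi> (at x) h\<bar> \<le> L * norm h" for x h
  proof -
    have "\<bar>frechet_derivative \<psi> (at x) h\<bar> \<le> (\<Sum>b\<in>Basis. \<bar>(h \<bullet> b) * frechet_derivative \<psi> (at x) b\<bar>)"
      by (subst test_function_derivative_sum[OF assms]) (rule sum_abs)
    also have "\<dots> \<le> (\<Sum>b\<in>Basis. norm h * K b)"
      unfolding abs_mult by (intro sum_mono mult_mono K Basis_le_norm) auto
    finally show ?thesis by (simp add: L_def sum_distrib_left mult.commute)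
  qed
  have "0 < L" unfolding L_def using K(1) by (intro sum_pos) auto
  moreover have "norm (\<psi> x - \<psi> y) \<le> L * norm (x - y)" for x y
  proof (rule differentiable_bound[of UNIV])
    show "(\<psi> has_derivative frechet_derivative \<psi> (at x)) (at x within UNIV)" for x
      using test_function_derivative[OF assms] by simp
    show "onorm (frechet_derivative \<psi> (at x)) \<le> L" for x
      using L by (intro onorm_le) auto
  qed auto
  ultimately show thesis using that L by auto
qed

section \<open>Almost everywhere approximation by test functions\<close>

lemma finite_borel_regular:
  fixes M :: "'a::euclidean_space measure"
  assumes "finite_measure M" "sets M = sets borel" "A \<in> sets borel" "0 < e"
  obtains K U where "compact K" "open U" "K \<subseteq> A" "A \<subseteq> U" "measure M (U - K) < e"
proof -
  interpret finite_measure M by fact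
  have fin: "emeasure M (space M) \<noteq> \<infinity>" by simp
  have "ennreal (measure M A) < ennreal (measure M A + e / 2)"
    using \<open>0 < e\<close> by (intro ennreal_lessI) (auto simp: add_nonneg_pos)
  then have "(INF U \<in> {U. A \<subseteq> U \<and> open U}. emeasure M U) < ennreal (measure M A + e / 2)"
    using outer_regular[OF assms(2) fin assms(3)] by (simp add: emeasure_eq_measure)
  then obtain U where U: "A \<subseteq> U" "open U" "emeasure M U < ennreal (measure M A + e / 2)"
    by (auto simp: INF_less_iff)
  have "\<exists>K. K \<subseteq> A \<and> compact K \<and> measure M A - e / 2 < measure M K"
  proof (cases "measure M A < e / 2")
    case True
    then show ?thesis by (intro exI[of _ "{}"]) auto
  next
    case False
    have "ennreal (measure M A - e / 2) < ennreal (measure M A)"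
      using \<open>0 < e\<close> False by (intro ennreal_lessI) (auto simp: not_less)
    then have "ennreal (measure M A - e / 2) < (SUP K \<in> {K. K \<subseteq> A \<and> compact K}. emeasure M K)"
      using inner_regular[OF assms(2) fin assms(3)] by (simp add: emeasure_eq_measure)
    then show ?thesis
      using False by (auto simp: less_SUP_iff emeasure_eq_measure ennreal_less_iff)
  qed
  then obtain K where K: "K \<subseteq> A" "compact K" "measure M A - e / 2 < measure M K" by blast
  have "measure M U < measure M A + e / 2"
    using U(3) by (simp add: emeasure_eq_measure ennreal_less_iff del: ennreal_plus)
  moreover have "measure M (U - K) = measure M U - measure M K"
    using U K by (intro finite_measure_Diff) (auto simp: assms(2) compact_imp_closed)
  ultimately show thesis using that[of K U] U K by auto
qed

text \<open>
  Indicators are approximated by Urysohn functions that separate a compact from the complement of an open set,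
  and the general case follows by linearity and dominated convergence.
\<close>

lemma continuous_dense_L1:
  fixes M :: "'a::euclidean_space measure" and f :: "'a \<Rightarrow> real"
  assumes "finite_measure M" "sets M = sets borel" "integrable M f" "0 < e"
  obtains \<phi> where "continuous_on UNIV \<phi>" "integrable M \<phi>" "(\<integral>x. \<bar>f x - \<phi> x\<bar> \<partial>M) < e"
proof -
  interpret finite_measure M by fact
  have borel_cont: "\<phi> \<in> borel_measurable M" if "continuous_on UNIV \<phi>" for \<phi> :: "'a \<Rightarrow> real"
    using borel_measurable_continuous_onI[OF that] measurable_cong_sets[OF assms(2) refl] by blast
  have "\<forall>e>0. \<exists>\<phi>. continuous_on UNIV \<phi> \<and> integrable M \<phi> \<and> (\<integral>x. \<bar>f x - \<phi> x\<bar> \<partial>M) < e"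
    using assms(3)
  proof (induction rule: integrable_induct)
    case (base A c)
    show ?case
    proof (intro allI impI)
      fix e :: real assume "0 < e"
      then have "0 < e / (\<bar>c\<bar> + 1)" by (simp add: add_nonneg_pos)
      then obtain K U where KU: "compact K" "open U" "K \<subseteq> A" "A \<subseteq> U" "measure M (U - K) < e / (\<bar>c\<bar> + 1)"
        using finite_borel_regular[OF assms(1,2)] base assms(2) by metis
      obtain g :: "'a \<Rightarrow> real" where g: "continuous_on UNIV g" "\<And>x. g x \<in> closed_segment 1 0"
        "\<And>x. x \<in> K \<Longrightarrow> g x = 1" "\<And>x. x \<in> - U \<Longrightarrow> g x = 0"
      proof -
        have "closed (- U)" using KU(2) by (simp add: closed_def)
        moreover have "K \<inter> - U = {}" using KU(3,4) by auto
        ultimately show thesis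
          by (rule Urysohn[OF compact_imp_closed[OF KU(1)], of "- U" 1 0]) (rule that)
      qed
      have g01: "0 \<le> g x" "g x \<le> 1" for x
        using g(2)[of x] by (auto simp: closed_segment_eq_real_ivl)
      note [measurable] = borel_cont[OF g(1)]
      have [measurable]: "K \<in> sets M" "U \<in> sets M" "A \<in> sets M"
        using KU base assms(2) by (auto simp: compact_imp_closed)
      have int: "integrable M (\<lambda>x. c * g x)"
      proof (rule integrable_const_bound[of _ "\<bar>c\<bar>"])
        show "AE x in M. norm (c * g x) \<le> \<bar>c\<bar>"
          using g01 by (auto simp: abs_mult mult_left_le)
      qed measurable
      have int2: "integrable M (\<lambda>x. \<bar>c\<bar> * indicator (U - K) x)"
        by (intro integrable_mult_right integrable_real_indicator) (auto simp: emeasure_eq_measure)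
      have "(\<integral>x. \<bar>indicat_real A x *\<^sub>R c - c * g x\<bar> \<partial>M) \<le> (\<integral>x. \<bar>c\<bar> * indicator (U - K) x \<partial>M)"
      proof (rule integral_mono'[OF int2])
        show "0 \<le> \<bar>c\<bar> * indicat_real (U - K) x" for x by simp
        fix x
        have "\<bar>indicat_real A x - g x\<bar> \<le> indicator (U - K) x"
          using g01[of x] g(3,4)[of x] KU(3,4) by (auto simp: indicator_def)
        from mult_left_mono[OF this, of "\<bar>c\<bar>"]
        show "\<bar>indicat_real A x *\<^sub>R c - c * g x\<bar> \<le> \<bar>c\<bar> * indicator (U - K) x"
          by (simp add: abs_mult[symmetric] right_diff_distrib mult.commute)
      qed
      also have "\<dots> = \<bar>c\<bar> * measure M (U - K)" by simp
      also have "\<dots> \<le> \<bar>c\<bar> * (e / (\<bar>c\<bar> + 1))"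
        using KU(5) by (intro mult_left_mono) auto
      also have "\<dots> < e"
        using \<open>0 < e\<close> by (simp add: field_simps)
      finally show "\<exists>\<phi>. continuous_on UNIV \<phi> \<and> integrable M \<phi> \<and> (\<integral>x. \<bar>indicat_real A x *\<^sub>R c - \<phi> x\<bar> \<partial>M) < e"
        using int g(1) by (intro exI[of _ "\<lambda>x. c * g x"]) (auto intro: continuous_intros)
    qed
  next
    case (add f g)
    show ?case
    proof (intro allI impI)
      fix e :: real assume "0 < e"
      then have "0 < e / 2" by simp
      obtain \<phi> where \<phi>: "continuous_on UNIV \<phi>" "integrable M \<phi>" "(\<integral>x. \<bar>f x - \<phi> x\<bar> \<partial>M) < e / 2"
        using add.IH(1) \<open>0 < e / 2\<close> by blast
      obtain \<psi> where \<psi>: "continuous_on UNIV \<psi>" "integrable M \<psi>" "(\<integral>x. \<bar>g x - \<psi> x\<bar> \<partial>M) < e / 2"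
        using add.IH(2) \<open>0 < e / 2\<close> by blast
      have "(\<integral>x. \<bar>f x + g x - (\<phi> x + \<psi> x)\<bar> \<partial>M) \<le> (\<integral>x. \<bar>f x - \<phi> x\<bar> + \<bar>g x - \<psi> x\<bar> \<partial>M)"
        using add.hyps \<phi>(2) \<psi>(2) by (intro integral_mono) auto
      also have "\<dots> = (\<integral>x. \<bar>f x - \<phi> x\<bar> \<partial>M) + (\<integral>x. \<bar>g x - \<psi> x\<bar> \<partial>M)"
        using add.hyps \<phi>(2) \<psi>(2) by (intro Bochner_Integration.integral_add) auto
      finally have "(\<integral>x. \<bar>f x + g x - (\<phi> x + \<psi> x)\<bar> \<partial>M) < e" using \<phi>(3) \<psi>(3) by simp
      with \<phi> \<psi> show "\<exists>\<phi>. continuous_on UNIV \<phi> \<and> integrable M \<phi> \<and> (\<integral>x. \<bar>f x + g x - \<phi> x\<bar> \<partial>M) < e"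
        by (intro exI[of _ "\<lambda>x. \<phi> x + \<psi> x"]) (auto intro: continuous_intros)
    qed
  next
    case (lim f s)
    show ?case
    proof (intro allI impI)
      fix e :: real assume "0 < e"
      then have "0 < e / 2" by simp
      have "(\<lambda>i. \<integral>x. \<bar>f x - s i x\<bar> \<partial>M) \<longlonglongrightarrow> (\<integral>x. 0 \<partial>M)"
      proof (rule integral_dominated_convergence[where w = "\<lambda>x. 3 * \<bar>f x\<bar>"])
        have "(\<lambda>i. \<bar>f x - s i x\<bar>) \<longlonglongrightarrow> \<bar>f x - f x\<bar>" if "x \<in> space M" for x
          using lim.hyps(2)[OF that] by (intro tendsto_intros)
        then show "AE x in M. (\<lambda>i. \<bar>f x - s i x\<bar>) \<longlonglongrightarrow> 0" by simp
        show "AE x in M. norm \<bar>f x - s i x\<bar> \<le> 3 * \<bar>f x\<bar>" for i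
          using lim.hyps(3)[of _ i] by (intro AE_I2) (smt (verit) real_norm_def)
      qed (use lim.hyps(1,4) in auto)
      then have "\<forall>\<^sub>F i in sequentially. (\<integral>x. \<bar>f x - s i x\<bar> \<partial>M) < e / 2"
        using \<open>0 < e / 2\<close> by (intro order_tendstoD(2)[of _ 0]) auto
      then obtain i where i: "(\<integral>x. \<bar>f x - s i x\<bar> \<partial>M) < e / 2"
        by (auto simp: eventually_sequentially)
      obtain \<phi> where \<phi>: "continuous_on UNIV \<phi>" "integrable M \<phi>" "(\<integral>x. \<bar>s i x - \<phi> x\<bar> \<partial>M) < e / 2"
        using lim.IH \<open>0 < e / 2\<close> by blast
      have "(\<integral>x. \<bar>f x - \<phi> x\<bar> \<partial>M) \<le> (\<integral>x. \<bar>f x - s i x\<bar> + \<bar>s i x - \<phi> x\<bar> \<partial>M)"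
        using lim.hyps(1,4) \<phi>(2) by (intro integral_mono) auto
      also have "\<dots> = (\<integral>x. \<bar>f x - s i x\<bar> \<partial>M) + (\<integral>x. \<bar>s i x - \<phi> x\<bar> \<partial>M)"
        using lim.hyps(1,4) \<phi>(2) by (intro Bochner_Integration.integral_add) auto
      finally show "\<exists>\<phi>. continuous_on UNIV \<phi> \<and> integrable M \<phi> \<and> (\<integral>x. \<bar>f x - \<phi> x\<bar> \<partial>M) < e"
        using \<phi> i by (intro exI[of _ \<phi>]) auto
    qed
  qed
  with \<open>0 < e\<close> that show thesis by blast
qed

lemma tendsto_clip:
  fixes a B :: real
  assumes "X \<longlonglongrightarrow> a" "\<bar>a\<bar> \<le> B"
  shows "(\<lambda>n. max (- B) (min B (X n))) \<longlonglongrightarrow> a"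
proof -
  have "(\<lambda>n. max (- B) (min B (X n))) \<longlonglongrightarrow> max (- B) (min B a)"
    by (intro tendsto_max tendsto_min tendsto_const assms)
  moreover have "max (- B) (min B a) = a" using assms(2) by auto
  ultimately show ?thesis by simp
qed

text \<open>
  A bounded measurable function is an almost everywhere limit of test functions that obey almost the same
  continuous pointwise bound \<open>B\<close>. That bound is what puts the test functions into the constraint set of the
  duality formula for the energies, where \<open>B\<close> is the weight.
\<close>

lemma test_functions_approximate_AE:
  fixes M :: "'a::euclidean_space measure" and f B :: "'a \<Rightarrow> real"
  assumes M: "finite_measure M" "sets M = sets borel" "AE x in M. x \<in> ball c r"
    and f: "f \<in> borel_measurable borel" and B: "continuous_on UNIV B" "bounded (range B)"
    and le: "\<And>x. \<bar>f x\<bar> \<le> B x"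
  obtains \<psi> where "\<And>n::nat. \<psi> n \<in> test_functions" "\<And>n x. x \<notin> ball c r \<Longrightarrow> \<psi> n x = 0"
    "\<And>n x. \<bar>\<psi> n x\<bar> \<le> B x + 1 / real (Suc n)" "AE x in M. (\<lambda>n. \<psi> n x) \<longlonglongrightarrow> f x"
proof -
  interpret finite_measure M by fact
  have meas: "g \<in> borel_measurable M \<longleftrightarrow> g \<in> borel_measurable borel" for g :: "'a \<Rightarrow> real"
    using measurable_cong_sets[OF M(2) refl] by blast
  obtain K where K: "\<And>x. \<bar>B x\<bar> \<le> K"
    using B(2) by (auto simp: bounded_iff)
  have int_f: "integrable M f"
  proof (rule integrable_const_bound[of _ K])
    show "AE x in M. norm (f x) \<le> K"
      using le K by (intro AE_I2) (smt (verit, best) real_norm_def)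
  qed (simp add: meas f)
  have "\<forall>n::nat. \<exists>\<phi>. continuous_on UNIV \<phi> \<and> integrable M \<phi> \<and> (\<integral>x. \<bar>f x - \<phi> x\<bar> \<partial>M) < 1 / real (Suc n)"
  proof
    fix n :: nat
    have "0 < 1 / real (Suc n)" by simp
    from continuous_dense_L1[OF M(1,2) int_f this]
    show "\<exists>\<phi>. continuous_on UNIV \<phi> \<and> integrable M \<phi> \<and> (\<integral>x. \<bar>f x - \<phi> x\<bar> \<partial>M) < 1 / real (Suc n)"
      by blast
  qed
  then obtain \<phi> :: "nat \<Rightarrow> 'a \<Rightarrow> real" where \<phi>: "\<And>n. continuous_on UNIV (\<phi> n)" "\<And>n. integrable M (\<phi> n)"
    "\<And>n. (\<integral>x. \<bar>f x - \<phi> n x\<bar> \<partial>M) < 1 / real (Suc n)" by metis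
  have "(\<lambda>n. \<integral>x. norm (f x - \<phi> n x) \<partial>M) \<longlonglongrightarrow> 0"
  proof (rule tendsto_sandwich[OF _ _ tendsto_const LIMSEQ_Suc[OF lim_1_over_n]])
    show "\<forall>\<^sub>F n in sequentially. (\<integral>x. norm (f x - \<phi> n x) \<partial>M) \<le> 1 / real (Suc n)"
      using \<phi>(3) by (intro always_eventually allI less_imp_le) simp
  qed simp
  from tendsto_L1_AE_subseq[OF _ this] obtain s :: "nat \<Rightarrow> nat" where
    s: "AE x in M. (\<lambda>n. f x - \<phi> (s n) x) \<longlonglongrightarrow> 0"
    using int_f \<phi>(2) by blast
  \<comment> \<open>\<open>g\<close> clips the \<open>L\<^sup>1\<close> approximants to the bound \<open>B\<close>; \<open>\<zeta>\<close> is a continuous cut-off whose support stays at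
    distance \<open>1 / n\<close> from the boundary of the ball and which exhausts the ball.\<close>
  define g where "g n x = max (- B x) (min (B x) (\<phi> (s n) x))" for n x
  define \<zeta> where "\<zeta> n x = min 1 (max 0 (real n * (r - dist c x) - 1))" for n :: nat and x
  define h where "h n x = \<zeta> n x * g n x" for n x
  have B0: "0 \<le> B x" for x using le[of x] by linarith
  have \<zeta>01: "0 \<le> \<zeta> n x" "\<zeta> n x \<le> 1" for n x by (auto simp: \<zeta>_def)
  have g_le: "\<bar>g n x\<bar> \<le> B x" for n x using B0[of x] by (auto simp: g_def)
  have h_le: "\<bar>h n x\<bar> \<le> B x" for n x
    using mult_mono[OF \<zeta>01(2) g_le[of n x], of n x] \<zeta>01 by (simp add: h_def abs_mult)
  have h_cont: "continuous_on UNIV (h n)" for n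
    unfolding h_def g_def \<zeta>_def by (intro continuous_intros \<phi> B)
  have h_supp: "dist c x \<le> r - 1 / real (Suc n)" if "h n x \<noteq> 0" for n x
  proof -
    have "0 < real n * (r - dist c x) - 1"
      using that by (auto simp: h_def \<zeta>_def split: if_splits simp: max_def min_def)
    then have n: "1 < real n * (r - dist c x)" by simp
    moreover have "0 < r - dist c x"
      using n by (metis less_numeral_extra(1) less_trans mult_less_0_iff not_less_iff_gr_or_eq of_nat_less_0_iff zero_less_mult_iff)
    ultimately have "1 \<le> real (Suc n) * (r - dist c x)" by (simp add: algebra_simps)
    then have "1 / real (Suc n) \<le> r - dist c x"
      by (subst pos_divide_le_eq) (auto simp: mult.commute)
    then show ?thesis by simp
  qed
  have "\<exists>\<psi>. \<psi> \<in> test_functions \<and> (\<forall>x. x \<notin> ball c r \<longrightarrow> \<psi> x = 0) \<and> (\<forall>x. \<bar>\<psi> x - h n x\<bar> \<le> 1 / real (Suc n))" for n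
    by (rule test_function_uniform_approximation[of "h n" "r - 1 / real (Suc n)" r c "1 / real (Suc n)"])
      (use h_cont h_supp in auto)
  then obtain \<psi> where \<psi>: "\<And>n. \<psi> n \<in> test_functions" "\<And>n x. x \<notin> ball c r \<Longrightarrow> \<psi> n x = 0"
    "\<And>n x. \<bar>\<psi> n x - h n x\<bar> \<le> 1 / real (Suc n)" by metis
  have "\<bar>\<psi> n x\<bar> \<le> B x + 1 / real (Suc n)" for n x
    using \<psi>(3)[of n x] h_le[of n x] by linarith
  moreover have "AE x in M. (\<lambda>n. \<psi> n x) \<longlonglongrightarrow> f x"
    using s M(3)
  proof eventually_elim
    case (elim x)
    have "(\<lambda>n. f x - (f x - \<phi> (s n) x)) \<longlonglongrightarrow> f x - 0"
      by (intro tendsto_diff tendsto_const elim)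
    then have "(\<lambda>n. \<phi> (s n) x) \<longlonglongrightarrow> f x" by simp
    then have "(\<lambda>n. g n x) \<longlonglongrightarrow> f x"
      unfolding g_def using le by (rule tendsto_clip)
    moreover have "\<forall>\<^sub>F n in sequentially. \<zeta> n x = 1"
    proof -
      have "0 < r - dist c x" using elim by simp
      then obtain N :: nat where N: "2 < real N * (r - dist c x)"
        using ex_less_of_nat_mult by blast
      have "\<zeta> n x = 1" if "N \<le> n" for n
      proof -
        have "real N * (r - dist c x) \<le> real n * (r - dist c x)"
          using that \<open>0 < r - dist c x\<close> by (intro mult_right_mono) auto
        with N show ?thesis by (simp add: \<zeta>_def)
      qed
      then show ?thesis by (auto simp: eventually_sequentially)
    qed
    then have "(\<lambda>n. \<zeta> n x) \<longlonglongrightarrow> 1" by (rule tendsto_eventually)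
    ultimately have "(\<lambda>n. h n x) \<longlonglongrightarrow> 1 * f x"
      unfolding h_def by (intro tendsto_mult)
    moreover have "(\<lambda>n. \<psi> n x - h n x) \<longlonglongrightarrow> 0"
      by (rule Lim_null_comparison[OF _ LIMSEQ_Suc[OF lim_1_over_n]])
        (use \<psi>(3) in \<open>auto intro!: always_eventually\<close>)
    ultimately have "(\<lambda>n. (\<psi> n x - h n x) + h n x) \<longlonglongrightarrow> 0 + 1 * f x"
      by (intro tendsto_add)
    then show ?case by simp
  qed
  ultimately show thesis using that \<psi>(1,2) by blast
qed

section \<open>Signed and vector measures as densities\<close>

lemma vector_measureD:
  assumes "vector_measure \<nu>" "\<And>i::nat. A i \<in> sets borel" "disjoint_family A"
  shows "(\<lambda>i. \<nu> (A i)) sums \<nu> (\<Union>i. A i)"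
  using assms by (auto simp: vector_measure_def image_subset_iff)

lemma vector_measure_empty:
  fixes \<nu> :: "'a::topological_space set \<Rightarrow> 'b::real_normed_vector"
  assumes "vector_measure \<nu>"
  shows "\<nu> {} = 0"
proof -
  have "(\<lambda>i::nat. \<nu> {}) sums \<nu> (\<Union>i::nat. {})"
    by (rule vector_measureD[OF assms]) (auto simp: disjoint_family_on_def)
  then have "(\<lambda>i::nat. \<nu> {}) \<longlonglongrightarrow> 0" by (auto dest: sums_summable summable_LIMSEQ_zero)
  then show ?thesis by (simp add: LIMSEQ_const_iff)
qed

lemma vector_measure_Un:
  fixes \<nu> :: "'a::topological_space set \<Rightarrow> 'b::real_normed_vector"
  assumes "vector_measure \<nu>" "A \<in> sets borel" "B \<in> sets borel" "A \<inter> B = {}"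
  shows "\<nu> (A \<union> B) = \<nu> A + \<nu> B"
proof -
  have "(\<lambda>i. \<nu> (binaryset A B i)) sums \<nu> (\<Union>i. binaryset A B i)"
    using assms(2-4)
    by (intro vector_measureD[OF assms(1)]) (auto simp: binaryset_def disjoint_family_on_def)
  moreover have "(\<lambda>i. \<nu> (binaryset A B i)) sums (\<nu> A + \<nu> B)"
    by (rule binaryset_sums[where f = \<nu>, OF vector_measure_empty[OF assms(1)]])
  ultimately show ?thesis by (simp add: UN_binaryset_eq sums_unique2)
qed

lemma vector_measure_Diff:
  fixes \<nu> :: "'a::topological_space set \<Rightarrow> 'b::real_normed_vector"
  assumes "vector_measure \<nu>" "A \<in> sets borel" "B \<in> sets borel" "B \<subseteq> A"
  shows "\<nu> A = \<nu> B + \<nu> (A - B)"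
  using vector_measure_Un[OF assms(1,3), of "A - B"] assms by (simp add: Un_absorb1)

lemma vector_measure_Int:
  assumes "vector_measure \<nu>" "P \<in> sets borel"
  shows "vector_measure (\<lambda>E. \<nu> (E \<inter> P))"
  unfolding vector_measure_def
proof (intro allI impI)
  fix A :: "nat \<Rightarrow> 'a set"
  assume A: "range A \<subseteq> sets borel" "disjoint_family A"
  have "(\<lambda>i. \<nu> (A i \<inter> P)) sums \<nu> (\<Union>i. A i \<inter> P)"
    by (rule vector_measureD[OF assms(1)])
      (use A assms(2) in \<open>auto simp: disjoint_family_on_def image_subset_iff\<close>)
  then show "(\<lambda>i. \<nu> (A i \<inter> P)) sums \<nu> ((\<Union>i. A i) \<inter> P)" by (simp only: UN_extend_simps)
qed

definition positive_set :: "('a::topological_space set \<Rightarrow> real) \<Rightarrow> 'a set \<Rightarrow> bool" where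
  "positive_set \<nu> B \<longleftrightarrow> B \<in> sets borel \<and> (\<forall>E\<in>sets borel. E \<subseteq> B \<longrightarrow> 0 \<le> \<nu> E)"

lemma positive_set_mono:
  assumes "vector_measure \<nu>" "positive_set \<nu> P" "B \<in> sets borel" "B \<subseteq> P"
  shows "\<nu> B \<le> \<nu> P"
  using vector_measure_Diff[OF assms(1) _ assms(3,4)] assms by (auto simp: positive_set_def)

lemma positive_set_UN:
  fixes \<nu> :: "'a::topological_space set \<Rightarrow> real"
  assumes \<nu>: "vector_measure \<nu>" and B: "\<And>n::nat. positive_set \<nu> (B n)"
  shows "positive_set \<nu> (\<Union>n. B n)"
  unfolding positive_set_def
proof (intro conjI ballI impI)
  have [measurable]: "B n \<in> sets borel" for n using B by (simp add: positive_set_def)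
  show "(\<Union>n. B n) \<in> sets borel" by measurable
  fix E assume [measurable]: "E \<in> sets borel" and sub: "E \<subseteq> (\<Union>n. B n)"
  have dm: "disjointed B n \<in> sets borel" for n
    using sets.range_disjointed_sets[of B borel] B by (auto simp: positive_set_def image_subset_iff)
  have "(\<lambda>n. \<nu> (E \<inter> disjointed B n)) sums \<nu> (\<Union>n. E \<inter> disjointed B n)"
    using dm disjoint_family_disjointed[of B]
    by (intro vector_measureD[OF \<nu>]) (auto simp: disjoint_family_on_def)
  moreover have "(\<Union>n. E \<inter> disjointed B n) = E"
    using sub UN_disjointed_eq[of B] by auto
  moreover have "0 \<le> \<nu> (E \<inter> disjointed B n)" for n
  proof -
    have "E \<inter> disjointed B n \<in> sets borel" using dm[of n] by auto
    moreover have "E \<inter> disjointed B n \<subseteq> B n" using disjointed_subset[of B n] by auto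
    ultimately show ?thesis using B[of n] unfolding positive_set_def by blast
  qed
  ultimately show "0 \<le> \<nu> E" by (metis suminf_nonneg sums_iff)
qed

text \<open>
  The exhaustion argument for Hahn's theorem: remove from \<open>A\<close>, one after the other, pieces of negative measure
  that are at least half as negative as possible. The measures of the disjoint pieces form a convergent series, so
  they tend to \<open>0\<close>, and what is left has no subset of negative measure.
\<close>

lemma positive_subset_exists:
  fixes \<nu> :: "'a::topological_space set \<Rightarrow> real"
  assumes \<nu>: "vector_measure \<nu>" and A: "A \<in> sets borel"
  obtains B where "B \<subseteq> A" "positive_set \<nu> B" "\<nu> A \<le> \<nu> B"
proof -
  \<comment> \<open>\<open>- 1\<close> is the fallback for sets on whose subsets the measure might be unbounded below; it can be used
    only finitely often.\<close>
  define good where "good X E \<longleftrightarrow> E \<in> sets borel \<and> E \<subseteq> X \<and> \<nu> E \<le> 0 \<and>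
    (\<nu> E \<le> - 1 \<or> (\<forall>F\<in>sets borel. F \<subseteq> X \<longrightarrow> 2 * \<nu> E \<le> \<nu> F))" for X E
  have "\<exists>E. good X E" for X
  proof (cases "\<exists>F\<in>sets borel. F \<subseteq> X \<and> \<nu> F \<le> - 1")
    case True
    then obtain F where "F \<in> sets borel" "F \<subseteq> X" "\<nu> F \<le> - 1" by blast
    then show ?thesis by (intro exI[of _ F]) (simp add: good_def)
  next
    case False
    let ?V = "\<nu> ` {F \<in> sets borel. F \<subseteq> X}"
    have bdd: "bdd_below ?V" using False by (intro bdd_belowI[of _ "- 1"]) force
    have ne: "?V \<noteq> {}" by blast
    show ?thesis
    proof (cases "Inf ?V < 0")
      case True
      then have "Inf ?V < Inf ?V / 2" by simp
      then obtain F where F: "F \<in> sets borel" "F \<subseteq> X" "\<nu> F < Inf ?V / 2"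
        unfolding cInf_less_iff[OF ne bdd] by blast
      have "2 * \<nu> F \<le> \<nu> G" if "G \<in> sets borel" "G \<subseteq> X" for G
      proof -
        have "Inf ?V \<le> \<nu> G" by (rule cInf_lower[OF _ bdd]) (use that in blast)
        with F(3) show ?thesis by linarith
      qed
      then show ?thesis using F True by (intro exI[of _ F]) (auto simp: good_def)
    next
      case False
      have "0 \<le> \<nu> F" if "F \<in> sets borel" "F \<subseteq> X" for F
      proof -
        have "Inf ?V \<le> \<nu> F" by (rule cInf_lower[OF _ bdd]) (use that in blast)
        with False show ?thesis by linarith
      qed
      then show ?thesis
        using vector_measure_empty[OF \<nu>] by (intro exI[of _ "{}"]) (simp add: good_def)
    qed
  qed
  then obtain N where N: "\<And>X. good X (N X)" by metis
  define X where "X = rec_nat A (\<lambda>_ X. X - N X)"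
  have X0: "X 0 = A" and XS: "X (Suc n) = X n - N (X n)" for n by (simp_all add: X_def)
  define E where "E n = N (X n)" for n
  have E: "E n \<in> sets borel" "E n \<subseteq> X n" "\<nu> (E n) \<le> 0" for n
    using N[of "X n"] by (auto simp: E_def good_def)
  have anti: "X m \<subseteq> X n" if "n \<le> m" for m n
    using that by (induction rule: dec_induct) (auto simp: XS)
  have "E n \<inter> E m = {}" if "n < m" for n m
    using E(2)[of m] anti[of "Suc n" m] that by (auto simp: XS E_def)
  then have disj: "disjoint_family E"
    unfolding disjoint_family_on_def by (metis Int_commute nat_neq_iff)
  define B where "B = A - (\<Union>n. E n)"
  have B_sets: "B \<in> sets borel" using A E(1) by (auto simp: B_def)
  have E_A: "(\<Union>n. E n) \<subseteq> A" using E(2) anti[of 0] by (auto simp: X0)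
  have B_X: "B \<subseteq> X n" for n
    by (induction n) (auto simp: X0 XS B_def E_def)
  have sums: "(\<lambda>n. \<nu> (E n)) sums \<nu> (\<Union>n. E n)"
    by (rule vector_measureD[OF \<nu> E(1) disj])
  then have lim: "(\<lambda>n. \<nu> (E n)) \<longlonglongrightarrow> 0" by (auto dest: sums_summable summable_LIMSEQ_zero)
  have "\<nu> (\<Union>n. E n) \<le> 0"
    by (rule sums_le[OF _ sums sums_zero]) (rule E(3))
  moreover have "\<nu> A = \<nu> (\<Union>n. E n) + \<nu> B"
    unfolding B_def using E(1) by (intro vector_measure_Diff[OF \<nu> A _ E_A]) auto
  ultimately have "\<nu> A \<le> \<nu> B" by linarith
  moreover have "0 \<le> \<nu> F" if F: "F \<in> sets borel" "F \<subseteq> B" for F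
  proof (rule LIMSEQ_le_const2)
    show "(\<lambda>n. 2 * \<nu> (E n)) \<longlonglongrightarrow> 0" using tendsto_mult_left[OF lim, of 2] by simp
    have "\<forall>\<^sub>F n in sequentially. - 1 < \<nu> (E n)"
      by (rule order_tendstoD(1)[OF lim]) simp
    then obtain m where "\<And>n. m \<le> n \<Longrightarrow> - 1 < \<nu> (E n)" by (auto simp: eventually_sequentially)
    moreover have "\<nu> (E n) \<le> - 1 \<or> 2 * \<nu> (E n) \<le> \<nu> F" for n
    proof -
      have "F \<subseteq> X n" using F(2) B_X[of n] by (rule order_trans)
      then show ?thesis using N[of "X n"] F(1) unfolding good_def E_def by blast
    qed
    ultimately show "\<exists>m. \<forall>n\<ge>m. 2 * \<nu> (E n) \<le> \<nu> F" by (meson not_less)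
  qed
  ultimately show thesis using that[of B] B_sets by (auto simp: B_def positive_set_def)
qed

text \<open>
  A countable union of positive sets that realises the supremum of the measures of positive sets. A subset of
  positive measure in its complement would contain a positive set that could be added.
\<close>

lemma Hahn_decomposition:
  fixes \<nu> :: "'a::topological_space set \<Rightarrow> real"
  assumes \<nu>: "vector_measure \<nu>"
  obtains P where "P \<in> sets borel" "\<And>E. E \<in> sets borel \<Longrightarrow> 0 \<le> \<nu> (E \<inter> P)"
    "\<And>E. E \<in> sets borel \<Longrightarrow> \<nu> (E \<inter> - P) \<le> 0"
proof -
  have pos_empty: "positive_set \<nu> {}"
    using vector_measure_empty[OF \<nu>] by (simp add: positive_set_def)
  then have ne: "{B. positive_set \<nu> B} \<noteq> {}" by blast
  obtain v :: "nat \<Rightarrow> ennreal" where v: "range v \<subseteq> (\<lambda>B. ennreal (\<nu> B)) ` {B. positive_set \<nu> B}"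
    "(SUP B\<in>{B. positive_set \<nu> B}. ennreal (\<nu> B)) = Sup (range v)"
    using ennreal_SUP_countable_SUP[OF ne] by blast
  then have "\<forall>n. \<exists>B. positive_set \<nu> B \<and> v n = ennreal (\<nu> B)" by (auto simp: image_subset_iff image_iff)
  then obtain B where B: "\<And>n. positive_set \<nu> (B n)" "\<And>n. v n = ennreal (\<nu> (B n))" by metis
  define P where "P = (\<Union>n. B n)"
  have pos: "positive_set \<nu> P" unfolding P_def by (rule positive_set_UN[OF \<nu> B(1)])
  have "v n \<le> ennreal (\<nu> P)" for n
    unfolding B(2) by (intro ennreal_leI positive_set_mono[OF \<nu> pos]) (use B in \<open>auto simp: P_def positive_set_def\<close>)
  then have "Sup (range v) \<le> ennreal (\<nu> P)" by (auto intro: SUP_least)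
  then have max: "\<nu> C \<le> \<nu> P" if "positive_set \<nu> C" for C
    using SUP_upper[of C "{B. positive_set \<nu> B}" "\<lambda>B. ennreal (\<nu> B)"] that v(2) pos
    by (auto simp: positive_set_def ennreal_le_iff dest: order_trans)
  have "\<nu> (E \<inter> - P) \<le> 0" if E: "E \<in> sets borel" for E
  proof -
    have "E \<inter> - P \<in> sets borel" using E pos by (auto simp: positive_set_def)
    then obtain C where C: "C \<subseteq> E \<inter> - P" "positive_set \<nu> C" "\<nu> (E \<inter> - P) \<le> \<nu> C"
      using positive_subset_exists[OF \<nu>] by blast
    have "positive_set \<nu> (\<Union>n::nat. if n = 0 then P else C)"
      using pos C by (intro positive_set_UN[OF \<nu>]) auto
    moreover have "(\<Union>n::nat. if n = 0 then P else C) = P \<union> C" by (auto split: if_splits)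
    ultimately have "\<nu> (P \<union> C) \<le> \<nu> P" using max by simp
    moreover have "\<nu> (P \<union> C) = \<nu> P + \<nu> C"
      using pos C by (intro vector_measure_Un[OF \<nu>]) (auto simp: positive_set_def)
    ultimately show ?thesis using C(3) by simp
  qed
  then show thesis using that[of P] pos by (auto simp: positive_set_def)
qed

lemma measure_of_nonneg_vector_measure:
  fixes \<nu> :: "'a::topological_space set \<Rightarrow> real"
  assumes \<nu>: "vector_measure \<nu>" and nonneg: "\<And>E. E \<in> sets borel \<Longrightarrow> 0 \<le> \<nu> E"
  obtains M where "finite_measure M" "sets M = sets borel"
    "\<And>E. E \<in> sets borel \<Longrightarrow> measure M E = \<nu> E"
proof -
  define M where "M = measure_of UNIV (sets borel) (\<lambda>E. ennreal (\<nu> E))"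
  have sets: "sets M = sets borel"
    unfolding M_def by (simp add: sets.sigma_sets_eq[of borel, simplified])
  have em: "emeasure M E = ennreal (\<nu> E)" if "E \<in> sets borel" for E
    unfolding M_def
  proof (rule emeasure_measure_of_sigma[OF _ _ _ that])
    show "sigma_algebra UNIV (sets borel)" using sets.sigma_algebra_axioms[of borel] by simp
    show "positive (sets borel) (\<lambda>E. ennreal (\<nu> E))"
      using vector_measure_empty[OF \<nu>] by (simp add: positive_def)
    show "countably_additive (sets borel) (\<lambda>E. ennreal (\<nu> E))"
    proof (rule countably_additiveI)
      fix A :: "nat \<Rightarrow> 'a set" assume A: "range A \<subseteq> sets borel" "disjoint_family A"
      then have "(\<lambda>i. \<nu> (A i)) sums \<nu> (\<Union>i. A i)" by (intro vector_measureD[OF \<nu>]) auto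
      then have "(\<lambda>i. ennreal (\<nu> (A i))) sums ennreal (\<nu> (\<Union>i. A i))"
        using A nonneg by (subst sums_ennreal) (auto simp: image_subset_iff)
      then show "(\<Sum>i. ennreal (\<nu> (A i))) = ennreal (\<nu> (\<Union>i. A i))" by (simp add: sums_iff)
    qed
  qed
  have "space M = UNIV" unfolding M_def by simp
  then have "finite_measure M"
    by (intro finite_measureI) (simp add: em)
  moreover have "measure M E = \<nu> E" if "E \<in> sets borel" for E
    using em[OF that] nonneg[OF that] by (simp add: measure_def)
  ultimately show thesis using that sets by blast
qed

lemma vector_measure_minus: "vector_measure \<nu> \<Longrightarrow> vector_measure (\<lambda>E. - \<nu> E)"
  unfolding vector_measure_def by (auto intro: sums_minus)

lemma vector_measure_sum:
  "(\<And>i. i \<in> I \<Longrightarrow> vector_measure (\<nu> i)) \<Longrightarrow> vector_measure (\<lambda>E. \<Sum>i\<in>I. \<nu> i E)"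
  unfolding vector_measure_def by (auto intro: sums_sum)

lemma vector_measure_inner:
  "vector_measure D \<Longrightarrow> vector_measure (\<lambda>E. D E \<bullet> b)"
  unfolding vector_measure_def
  by (auto intro: bounded_linear.sums[OF bounded_linear_inner_left])

text \<open>
  Radon-Nikodym, for a set function that is dominated by a measure: it is a measure itself, absolutely continuous
  with respect to \<open>M\<close>.
\<close>

lemma dominated_vector_measure_density:
  fixes \<nu> :: "'a::topological_space set \<Rightarrow> real"
  assumes \<nu>: "vector_measure \<nu>" and M: "finite_measure M" "sets M = sets borel"
    and le: "\<And>E. E \<in> sets borel \<Longrightarrow> 0 \<le> \<nu> E \<and> \<nu> E \<le> measure M E"
  obtains h where "integrable M h" "\<And>E. E \<in> sets borel \<Longrightarrow> \<nu> E = (\<integral>x. indicator E x * h x \<partial>M)"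
proof -
  interpret finite_measure M by fact
  obtain N where N: "finite_measure N" "sets N = sets borel" "\<And>E. E \<in> sets borel \<Longrightarrow> measure N E = \<nu> E"
    using measure_of_nonneg_vector_measure[OF \<nu>] le by metis
  interpret N: finite_measure N by fact
  have sNM: "sets N = sets M" using N(2) M(2) by simp
  have ac: "absolutely_continuous M N"
    unfolding absolutely_continuous_def
  proof
    fix E assume "E \<in> null_sets M"
    then have "E \<in> sets borel" "measure M E = 0" using M(2) by (auto simp: measure_def)
    then have "measure N E = 0" using le[of E] N(3)[of E] by auto
    then show "E \<in> null_sets N"
      using \<open>E \<in> sets borel\<close> N(2) by (auto simp: N.emeasure_eq_measure)
  qed
  obtain h where h: "h \<in> borel_measurable M" "AE x in M. RN_deriv M N x = ennreal (h x)" "\<And>x. 0 \<le> h x"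
    using real_RN_deriv[OF N(1) ac sNM] by blast
  have dens: "emeasure N E = (\<integral>\<^sup>+x. ennreal (h x) * indicator E x \<partial>M)" if "E \<in> sets M" for E
  proof -
    have "emeasure N E = emeasure (density M (RN_deriv M N)) E"
      using density_RN_deriv[OF ac sNM] by simp
    also have "\<dots> = (\<integral>\<^sup>+x. RN_deriv M N x * indicator E x \<partial>M)"
      using that by (intro emeasure_density) auto
    also have "\<dots> = (\<integral>\<^sup>+x. ennreal (h x) * indicator E x \<partial>M)"
      using h(2) by (intro nn_integral_cong_AE) auto
    finally show ?thesis .
  qed
  have int: "integrable M h"
  proof (rule integrableI_bounded)
    have "(\<integral>\<^sup>+x. ennreal (norm (h x)) \<partial>M) = emeasure N (space M)"
      using h(3) by (subst dens) (auto intro!: nn_integral_cong)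
    also have "\<dots> < \<infinity>" by (simp add: N.emeasure_eq_measure)
    finally show "(\<integral>\<^sup>+x. ennreal (norm (h x)) \<partial>M) < \<infinity>" .
  qed (fact h(1))
  have "\<nu> E = (\<integral>x. indicator E x * h x \<partial>M)" if E: "E \<in> sets borel" for E
  proof -
    have "ennreal (\<nu> E) = (\<integral>\<^sup>+x. ennreal (indicator E x * h x) \<partial>M)"
      using dens[of E] E M(2) N(3)[OF E]
      by (auto simp: N.emeasure_eq_measure indicator_def intro!: nn_integral_cong)
    also have "\<dots> = ennreal (\<integral>x. indicator E x * h x \<partial>M)"
      using E M(2) h(3) integrable_mult_indicator[OF _ int, of E]
      by (intro nn_integral_eq_integral AE_I2) auto
    finally show ?thesis
      using le[OF E] h(3) by (subst (asm) ennreal_inj) (auto intro!: integral_nonneg_AE)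
  qed
  with int that show thesis by blast
qed

text \<open>
  \<open>M\<close> is the sum of the positive and negative parts of the components, which dominates each of the parts. This turns
  integrals against vector measures into ordinary integrals against one finite measure.
\<close>

lemma vector_measure_density:
  fixes D :: "'a::topological_space set \<Rightarrow> 'b::euclidean_space"
  assumes D: "vector_measure D"
  obtains M h where "finite_measure M" "sets M = sets borel" "integrable M h"
    "\<And>E \<sigma>. E \<in> sets borel \<Longrightarrow> D E \<bullet> \<sigma> = (\<integral>x. indicator E x * (h x \<bullet> \<sigma>) \<partial>M)"
proof -
  define \<nu> where "\<nu> b E = D E \<bullet> b" for b E
  have \<nu>: "vector_measure (\<nu> b)" for b unfolding \<nu>_def by (rule vector_measure_inner[OF D])
  have "\<exists>P. P \<in> sets borel \<and> (\<forall>E\<in>sets borel. 0 \<le> \<nu> b (E \<inter> P)) \<and> (\<forall>E\<in>sets borel. \<nu> b (E \<inter> - P) \<le> 0)" for b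
    using Hahn_decomposition[OF \<nu>[of b]] by metis
  then obtain P where P: "\<And>b. P b \<in> sets borel" "\<And>b E. E \<in> sets borel \<Longrightarrow> 0 \<le> \<nu> b (E \<inter> P b)"
    "\<And>b E. E \<in> sets borel \<Longrightarrow> \<nu> b (E \<inter> - P b) \<le> 0" by metis
  have P': "- P b \<in> sets borel" for b using P(1) by auto
  note pos = vector_measure_Int[OF \<nu> P(1)]
  note neg = vector_measure_minus[OF vector_measure_Int[OF \<nu> P']]
  \<comment> \<open>the sum of the total variations of all components\<close>
  define \<tau> where "\<tau> E = (\<Sum>b\<in>Basis. \<nu> b (E \<inter> P b)) + (\<Sum>b\<in>Basis. - \<nu> b (E \<inter> - P b))" for E
  have "vector_measure (\<lambda>E. (\<Sum>b\<in>Basis. \<nu> b (E \<inter> P b)))" "vector_measure (\<lambda>E. (\<Sum>b\<in>Basis. - \<nu> b (E \<inter> - P b)))"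
    by (intro vector_measure_sum pos neg)+
  then have "vector_measure \<tau>"
    unfolding vector_measure_def \<tau>_def by (auto intro: sums_add)
  moreover have \<tau>0: "0 \<le> \<tau> E" if "E \<in> sets borel" for E
    unfolding \<tau>_def using P(2,3) that by (intro add_nonneg_nonneg sum_nonneg) auto
  ultimately obtain M where M: "finite_measure M" "sets M = sets borel" "\<And>E. E \<in> sets borel \<Longrightarrow> measure M E = \<tau> E"
    using measure_of_nonneg_vector_measure by metis
  have "\<exists>h. integrable M h \<and> (\<forall>E\<in>sets borel. \<nu> b (E \<inter> P b) = (\<integral>x. indicator E x * h x \<partial>M))" if b: "b \<in> Basis" for b
  proof -
    have "0 \<le> \<nu> b (E \<inter> P b) \<and> \<nu> b (E \<inter> P b) \<le> measure M E" if E: "E \<in> sets borel" for E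
    proof -
      have "\<nu> b (E \<inter> P b) \<le> (\<Sum>b\<in>Basis. \<nu> b (E \<inter> P b))"
        using P(2)[OF E] b by (intro member_le_sum) auto
      moreover have "0 \<le> (\<Sum>b\<in>Basis. - \<nu> b (E \<inter> - P b))"
        using P(3)[OF E] by (intro sum_nonneg) auto
      ultimately show ?thesis using P(2)[OF E] M(3)[OF E] by (simp add: \<tau>_def)
    qed
    from dominated_vector_measure_density[OF pos M(1,2) this] show ?thesis by metis
  qed
  then obtain hp where hp: "\<And>b. b \<in> Basis \<Longrightarrow> integrable M (hp b)"
    "\<And>b E. b \<in> Basis \<Longrightarrow> E \<in> sets borel \<Longrightarrow> \<nu> b (E \<inter> P b) = (\<integral>x. indicator E x * hp b x \<partial>M)" by metis
  have "\<exists>h. integrable M h \<and> (\<forall>E\<in>sets borel. - \<nu> b (E \<inter> - P b) = (\<integral>x. indicator E x * h x \<partial>M))" if b: "b \<in> Basis" for b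
  proof -
    have "0 \<le> - \<nu> b (E \<inter> - P b) \<and> - \<nu> b (E \<inter> - P b) \<le> measure M E" if E: "E \<in> sets borel" for E
    proof -
      have "- \<nu> b (E \<inter> - P b) \<le> (\<Sum>b\<in>Basis. - \<nu> b (E \<inter> - P b))"
        using P(3)[OF E] b by (intro member_le_sum[where f = "\<lambda>b. - \<nu> b (E \<inter> - P b)"]) auto
      moreover have "0 \<le> (\<Sum>b\<in>Basis. \<nu> b (E \<inter> P b))"
        using P(2)[OF E] by (intro sum_nonneg) auto
      ultimately show ?thesis using P(3)[OF E] M(3)[OF E] by (simp add: \<tau>_def)
    qed
    from dominated_vector_measure_density[OF neg M(1,2) this] show ?thesis by metis
  qed
  then obtain hn where hn: "\<And>b. b \<in> Basis \<Longrightarrow> integrable M (hn b)"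
    "\<And>b E. b \<in> Basis \<Longrightarrow> E \<in> sets borel \<Longrightarrow> - \<nu> b (E \<inter> - P b) = (\<integral>x. indicator E x * hn b x \<partial>M)" by metis
  define h where "h x = (\<Sum>b\<in>Basis. (hp b x - hn b x) *\<^sub>R b)" for x
  have "integrable M h"
    unfolding h_def by (intro Bochner_Integration.integrable_sum integrable_scaleR_left Bochner_Integration.integrable_diff hp hn)
  moreover have "D E \<bullet> \<sigma> = (\<integral>x. indicator E x * (h x \<bullet> \<sigma>) \<partial>M)" if E: "E \<in> sets borel" for E \<sigma>
  proof -
    have EM: "E \<in> sets M" using E M(2) by simp
    have Db: "D E \<bullet> b = (\<integral>x. indicator E x * (hp b x - hn b x) \<partial>M)" if b: "b \<in> Basis" for b
    proof -
      have "D E \<bullet> b = \<nu> b ((E \<inter> P b) \<union> (E \<inter> - P b))"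
        unfolding \<nu>_def by (simp add: Int_Un_distrib[symmetric])
      also have "\<dots> = \<nu> b (E \<inter> P b) + \<nu> b (E \<inter> - P b)"
        using E P(1) P' by (intro vector_measure_Un[OF \<nu>]) auto
      also have "\<dots> = (\<integral>x. indicator E x * hp b x \<partial>M) - (\<integral>x. indicator E x * hn b x \<partial>M)"
        using hp(2)[OF b E] hn(2)[OF b E] by simp
      also have "\<dots> = (\<integral>x. indicator E x * hp b x - indicator E x * hn b x \<partial>M)"
        using integrable_mult_indicator[OF EM hp(1)[OF b]] integrable_mult_indicator[OF EM hn(1)[OF b]]
        by (intro Bochner_Integration.integral_diff[symmetric]) auto
      finally show ?thesis by (simp add: right_diff_distrib)
    qed
    have "D E \<bullet> \<sigma> = (\<Sum>b\<in>Basis. (D E \<bullet> b) * (\<sigma> \<bullet> b))" by (rule euclidean_inner)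
    also have "\<dots> = (\<Sum>b\<in>Basis. (\<integral>x. (indicator E x * (hp b x - hn b x)) * (\<sigma> \<bullet> b) \<partial>M))"
      using Db by simp
    also have "\<dots> = (\<integral>x. (\<Sum>b\<in>Basis. (indicator E x * (hp b x - hn b x)) * (\<sigma> \<bullet> b)) \<partial>M)"
    proof (rule Bochner_Integration.integral_sum[symmetric])
      fix b :: 'b assume b: "b \<in> Basis"
      show "integrable M (\<lambda>x. (indicator E x * (hp b x - hn b x)) * (\<sigma> \<bullet> b))"
        using integrable_mult_indicator[OF EM Bochner_Integration.integrable_diff[OF hp(1)[OF b] hn(1)[OF b]]]
        by (intro integrable_mult_left) simp
    qed
    also have "\<dots> = (\<integral>x. indicator E x * (h x \<bullet> \<sigma>) \<partial>M)"
      by (intro Bochner_Integration.integral_cong)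
        (simp_all only: h_def inner_sum_left inner_scaleR_left sum_distrib_left mult.assoc inner_commute[of \<sigma>])
    finally show ?thesis .
  qed
  ultimately show thesis using that M(1,2) by blast
qed

text \<open>
  The supremum over partitions is attained at the partition into the sets where \<open>f\<close> is non-negative and negative.
\<close>

lemma variation_density:
  fixes \<nu> :: "'a::topological_space set \<Rightarrow> real"
  assumes M: "sets M = sets borel" and f: "integrable M f"
    and \<nu>: "\<And>E. E \<in> sets borel \<Longrightarrow> \<nu> E = (\<integral>x. indicator E x * f x \<partial>M)" and E: "E \<in> sets borel"
  shows "variation \<nu> E = emeasure (density M (\<lambda>x. ennreal \<bar>f x\<bar>)) E"
proof -
  let ?N = "density M (\<lambda>x. ennreal \<bar>f x\<bar>)"
  have fm [measurable]: "f \<in> borel_measurable M" using f by auto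
  have int: "integrable M (\<lambda>x. indicator A x * f x)" if "A \<in> sets borel" for A
    using integrable_mult_indicator[OF _ f, of A] that M by simp
  have em: "emeasure ?N A = ennreal (\<integral>x. \<bar>indicator A x * f x\<bar> \<partial>M)" if "A \<in> sets borel" for A
  proof -
    have "emeasure ?N A = (\<integral>\<^sup>+x. ennreal \<bar>indicator A x * f x\<bar> \<partial>M)"
      using that M by (subst emeasure_density) (auto intro!: nn_integral_cong simp: indicator_def abs_mult)
    also have "\<dots> = ennreal (\<integral>x. \<bar>indicator A x * f x\<bar> \<partial>M)"
      using int[OF that] by (intro nn_integral_eq_integral) auto
    finally show ?thesis .
  qed
  have le: "ennreal (norm (\<nu> A)) \<le> emeasure ?N A" if "A \<in> sets borel" for A
    unfolding em[OF that] \<nu>[OF that] real_norm_def by (intro ennreal_leI integral_abs_bound)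
  show ?thesis
  proof (rule antisym)
    show "variation \<nu> E \<le> emeasure ?N E"
      unfolding variation_def
    proof (rule SUP_least)
      fix A :: "nat \<Rightarrow> 'a set"
      assume "A \<in> {A. range A \<subseteq> sets borel \<and> disjoint_family A \<and> (\<Union>i. A i) = E}"
      then have A: "range A \<subseteq> sets ?N" "disjoint_family A" "(\<Union>i. A i) = E" using M by auto
      have "(\<Sum>i. ennreal (norm (\<nu> (A i)))) \<le> (\<Sum>i. emeasure ?N (A i))"
        using A M by (intro suminf_le le) auto
      also have "\<dots> = emeasure ?N E" using suminf_emeasure[OF A(1,2)] A(3) by simp
      finally show "(\<Sum>i. ennreal (norm (\<nu> (A i)))) \<le> emeasure ?N E" .
    qed
    define P where "P = {x \<in> space M. 0 \<le> f x}"
    have P: "P \<in> sets borel" unfolding P_def M[symmetric] by measurable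
    define A where "A = binaryset (E \<inter> P) (E - P)"
    have A: "range A \<subseteq> sets borel" "disjoint_family A" "(\<Union>i. A i) = E"
      using E P by (auto simp: A_def UN_binaryset_eq binaryset_def disjoint_family_on_def)
    have sp: "space M = UNIV" using sets_eq_imp_space_eq[OF M] by simp
    have eq: "emeasure ?N (A i) = ennreal (norm (\<nu> (A i)))" for i
    proof -
      have Ai: "A i \<in> sets borel" using A(1) by auto
      have "A i \<subseteq> P \<or> A i \<inter> P = {}" by (auto simp: A_def binaryset_def)
      then have "(\<integral>x. \<bar>indicator (A i) x * f x\<bar> \<partial>M) = \<bar>\<integral>x. indicator (A i) x * f x \<partial>M\<bar>"
      proof
        assume "A i \<subseteq> P"
        then have nn: "0 \<le> indicator (A i) x * f x" for x by (auto simp: indicator_def P_def)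
        then show ?thesis by (simp add: integral_nonneg_AE del: mult_eq_0_iff abs_mult)
      next
        assume "A i \<inter> P = {}"
        then have "indicator (A i) x * f x \<le> 0" for x
          using sp by (auto simp: indicator_def P_def)
        then have eq: "\<bar>indicator (A i) x * f x\<bar> = - (indicator (A i) x * f x)" for x
          by (simp add: abs_of_nonpos)
        have "0 \<le> (\<integral>x. \<bar>indicator (A i) x * f x\<bar> \<partial>M)" by simp
        then show ?thesis unfolding eq by simp
      qed
      then show ?thesis unfolding em[OF Ai] \<nu>[OF Ai] by simp
    qed
    have "emeasure ?N E = (\<Sum>i. emeasure ?N (A i))"
      using suminf_emeasure[of A ?N] A M by simp
    also have "\<dots> = (\<Sum>i. ennreal (norm (\<nu> (A i))))" using eq by simp
    also have "\<dots> \<le> variation \<nu> E"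
      unfolding variation_def by (rule SUP_upper) (use A in auto)
    finally show "emeasure ?N E \<le> variation \<nu> E" .
  qed
qed

lemma measure_of_borel_cong:
  assumes "sets N = sets borel" "\<And>E. E \<in> sets borel \<Longrightarrow> m E = emeasure N E"
  shows "measure_of UNIV (sets borel) m = N"
proof -
  have "space N = UNIV" using sets_eq_imp_space_eq[OF assms(1)] by simp
  then have "N = measure_of UNIV (sets borel) (emeasure N)"
    using measure_of_of_measure[of N] assms(1) by simp
  moreover have "measure_of UNIV (sets borel) m = measure_of UNIV (sets borel) (emeasure N)"
    using assms(2) sets.sigma_sets_eq[of borel] by (intro measure_of_eq) auto
  ultimately show ?thesis by simp
qed

lemma variation_measure_density:
  assumes "sets M = sets borel" "integrable M f"
    "\<And>E. E \<in> sets borel \<Longrightarrow> \<nu> E = (\<integral>x. indicator E x * f x \<partial>M)"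
  shows "variation_measure \<nu> = density M (\<lambda>x. ennreal \<bar>f x\<bar>)"
  unfolding variation_measure_def
  using assms by (intro measure_of_borel_cong variation_density) auto

lemma signed_integral_density:
  fixes \<nu> :: "'a::topological_space set \<Rightarrow> real"
  assumes M: "sets M = sets borel" and f: "integrable M f"
    and \<nu>: "\<And>E. E \<in> sets borel \<Longrightarrow> \<nu> E = (\<integral>x. indicator E x * f x \<partial>M)"
    and \<phi>: "\<phi> \<in> borel_measurable borel" "\<And>x. \<bar>\<phi> x\<bar> \<le> K"
  shows "signed_integral \<nu> \<phi> = (\<integral>x. \<phi> x * f x \<partial>M)"
proof -
  have [measurable]: "f \<in> borel_measurable M" using f by auto
  have \<phi>m [measurable]: "\<phi> \<in> borel_measurable M" using \<phi>(1) measurable_cong_sets[OF M refl] by blast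
  have int: "integrable M (\<lambda>x. indicator A x * f x)" if "A \<in> sets borel" for A
    using integrable_mult_indicator[OF _ f, of A] that M by simp
  have part: "measure_of UNIV (sets borel) (\<lambda>E. ennreal ((enn2real (variation \<nu> E) + s * \<nu> E) / 2))
      = density M (\<lambda>x. ennreal ((\<bar>f x\<bar> + s * f x) / 2))" if s: "s \<in> {1, - 1}" for s
  proof (rule measure_of_borel_cong)
    fix E :: "'a set" assume E: "E \<in> sets borel"
    have "variation \<nu> E = (\<integral>\<^sup>+x. ennreal \<bar>indicator E x * f x\<bar> \<partial>M)"
      using E M by (subst variation_density[OF M f \<nu> E], simp, subst emeasure_density)
        (auto intro!: nn_integral_cong simp: indicator_def abs_mult)
    also have "\<dots> = ennreal (\<integral>x. \<bar>indicator E x * f x\<bar> \<partial>M)"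
      using int[OF E] by (intro nn_integral_eq_integral) auto
    finally have var: "enn2real (variation \<nu> E) = (\<integral>x. \<bar>indicator E x * f x\<bar> \<partial>M)" by simp
    have "enn2real (variation \<nu> E) + s * \<nu> E
        = (\<integral>x. \<bar>indicator E x * f x\<bar> + s * (indicator E x * f x) \<partial>M)"
      unfolding var \<nu>[OF E] using int[OF E] by (subst Bochner_Integration.integral_add) auto
    then have "(enn2real (variation \<nu> E) + s * \<nu> E) / 2
        = (\<integral>x. (\<bar>indicator E x * f x\<bar> + s * (indicator E x * f x)) / 2 \<partial>M)" by simp
    then have "ennreal ((enn2real (variation \<nu> E) + s * \<nu> E) / 2)
        = ennreal (\<integral>x. (\<bar>indicator E x * f x\<bar> + s * (indicator E x * f x)) / 2 \<partial>M)" by (simp only:)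
    also have "\<dots> = (\<integral>\<^sup>+x. ennreal ((\<bar>indicator E x * f x\<bar> + s * (indicator E x * f x)) / 2) \<partial>M)"
      using s int[OF E] by (intro nn_integral_eq_integral[symmetric]) (auto intro!: AE_I2)
    also have "\<dots> = emeasure (density M (\<lambda>x. ennreal ((\<bar>f x\<bar> + s * f x) / 2))) E"
      using E M by (subst emeasure_density) (auto intro!: nn_integral_cong simp: indicator_def)
    finally show "ennreal ((enn2real (variation \<nu> E) + s * \<nu> E) / 2)
        = emeasure (density M (\<lambda>x. ennreal ((\<bar>f x\<bar> + s * f x) / 2))) E" .
  qed (simp add: M)
  have intp: "integrable M (\<lambda>x. ((\<bar>f x\<bar> + s * f x) / 2) * \<phi> x)" for s
  proof (rule Bochner_Integration.integrable_bound)
    show "integrable M (\<lambda>x. ((\<bar>f x\<bar> + \<bar>s\<bar> * \<bar>f x\<bar>) / 2) * K)"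
      using f by (intro integrable_mult_left integrable_divide Bochner_Integration.integrable_add integrable_mult_right) auto
    have "norm (((\<bar>f x\<bar> + s * f x) / 2) * \<phi> x) \<le> ((\<bar>f x\<bar> + \<bar>s\<bar> * \<bar>f x\<bar>) / 2) * K" for x
      unfolding real_norm_def abs_mult[of _ "\<phi> x"]
    proof (rule mult_mono)
      show "\<bar>(\<bar>f x\<bar> + s * f x) / 2\<bar> \<le> (\<bar>f x\<bar> + \<bar>s\<bar> * \<bar>f x\<bar>) / 2"
        by (simp add: abs_mult[symmetric])
    qed (auto simp: \<phi>(2))
    then show "AE x in M. norm (((\<bar>f x\<bar> + s * f x) / 2) * \<phi> x) \<le> norm (((\<bar>f x\<bar> + \<bar>s\<bar> * \<bar>f x\<bar>) / 2) * K)"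
      unfolding real_norm_def by (intro AE_I2) (rule order_trans[OF _ abs_ge_self])
  qed measurable
  have dens: "(\<integral>x. \<phi> x \<partial>density M (\<lambda>x. ennreal ((\<bar>f x\<bar> + s * f x) / 2))) = (\<integral>x. ((\<bar>f x\<bar> + s * f x) / 2) * \<phi> x \<partial>M)"
    if "s \<in> {1, - 1}" for s
    using that by (subst integral_density) auto
  have "signed_integral \<nu> \<phi>
      = (\<integral>x. ((\<bar>f x\<bar> + 1 * f x) / 2) * \<phi> x \<partial>M) - (\<integral>x. ((\<bar>f x\<bar> + (- 1) * f x) / 2) * \<phi> x \<partial>M)"
    unfolding signed_integral_def dens[of 1, simplified, symmetric] using part[of 1] part[of "- 1"] dens[of 1] dens[of "- 1"]
    by simp
  also have "\<dots> = (\<integral>x. ((\<bar>f x\<bar> + 1 * f x) / 2) * \<phi> x - ((\<bar>f x\<bar> + (- 1) * f x) / 2) * \<phi> x \<partial>M)"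
    by (rule Bochner_Integration.integral_diff[symmetric]) (rule intp)+
  also have "\<dots> = (\<integral>x. \<phi> x * f x \<partial>M)"
    by (intro Bochner_Integration.integral_cong) (auto simp: field_simps)
  finally show ?thesis .
qed

section \<open>Invariance of Lebesgue measure\<close>

lemma nn_integral_lborel_affine:
  fixes g :: "'a::euclidean_space \<Rightarrow> ennreal"
  assumes [measurable]: "g \<in> borel_measurable borel" and c: "c \<noteq> 0"
  shows "(\<integral>\<^sup>+x. g x \<partial>lborel) = ennreal (\<bar>c\<bar> ^ DIM('a)) * (\<integral>\<^sup>+x. g (t + c *\<^sub>R x) \<partial>lborel)"
proof -
  have "(\<integral>\<^sup>+x. g x \<partial>lborel)
      = (\<integral>\<^sup>+x. g x \<partial>density (distr lborel borel (\<lambda>x. t + c *\<^sub>R x)) (\<lambda>_. ennreal (\<bar>c\<bar> ^ DIM('a))))"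
    by (subst lborel_affine[OF c, of t]) simp
  also have "\<dots> = ennreal (\<bar>c\<bar> ^ DIM('a)) * (\<integral>\<^sup>+x. g (t + c *\<^sub>R x) \<partial>lborel)"
    by (simp add: nn_integral_density nn_integral_distr nn_integral_cmult)
  finally show ?thesis .
qed

lemma nn_integral_lborel_shift:
  fixes g :: "'a::euclidean_space \<Rightarrow> ennreal"
  assumes "g \<in> borel_measurable borel"
  shows "(\<integral>\<^sup>+x. g (t + x) \<partial>lborel) = (\<integral>\<^sup>+x. g x \<partial>lborel)"
  using nn_integral_lborel_affine[OF assms, of 1 t] by simp

lemma nn_integral_lborel_reflect:
  fixes g :: "'a::euclidean_space \<Rightarrow> ennreal"
  assumes "g \<in> borel_measurable borel"
  shows "(\<integral>\<^sup>+x. g (t - x) \<partial>lborel) = (\<integral>\<^sup>+x. g x \<partial>lborel)"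
  using nn_integral_lborel_affine[OF assms, of "- 1" t] by simp

text \<open>
  Double integration of \<open>f (T x) * g (T x + y)\<close>, with \<open>f\<close> the indicator of the unit ball: translation invariance turns
  one order of integration into \<open>c * \<integral>g\<close> and the other into \<open>c * \<integral>(g \<circ> T)\<close>, where \<open>c\<close> is the volume of the ball. This
  avoids determinants, hence the choice of coordinates.
\<close>

lemma nn_integral_lborel_isometry:
  fixes T :: "'a::euclidean_space \<Rightarrow> 'a" and g :: "'a \<Rightarrow> ennreal"
  assumes T: "linear T" "\<And>x. norm (T x) = norm x" "\<And>x. T (T x) = x"
    and g [measurable]: "g \<in> borel_measurable borel"
  shows "(\<integral>\<^sup>+x. g (T x) \<partial>lborel) = (\<integral>\<^sup>+x. g x \<partial>lborel)"
proof -
  have [measurable]: "T \<in> borel_measurable borel"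
    using linear_continuous_on[OF linear_conv_bounded_linear[THEN iffD1, OF T(1)]]
    by (intro borel_measurable_continuous_onI)
  define f where "f = (indicator (ball 0 1) :: 'a \<Rightarrow> ennreal)"
  have [measurable]: "f \<in> borel_measurable borel"
    unfolding f_def by (intro borel_measurable_indicator borel_open open_ball)
  have fT: "f (T x) = f x" for x by (simp add: f_def T(2) indicator_def)
  define c where "c = (\<integral>\<^sup>+x. f x \<partial>lborel)"
  have c: "c = emeasure lborel (ball (0::'a) 1)" by (simp add: c_def f_def)
  have c0: "c \<noteq> 0" "c \<noteq> \<top>"
    unfolding c by (simp_all add: emeasure_ball less_imp_neq[OF unit_ball_vol_pos, symmetric])
  have "c * (\<integral>\<^sup>+y. g y \<partial>lborel) = (\<integral>\<^sup>+x. f (T x) * (\<integral>\<^sup>+y. g y \<partial>lborel) \<partial>lborel)"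
    by (simp add: fT c_def nn_integral_multc)
  also have "\<dots> = (\<integral>\<^sup>+x. f (T x) * (\<integral>\<^sup>+y. g (T x + y) \<partial>lborel) \<partial>lborel)"
    by (simp add: nn_integral_lborel_shift)
  also have "\<dots> = (\<integral>\<^sup>+x. (\<integral>\<^sup>+y. f (T x) * g (T x + y) \<partial>lborel) \<partial>lborel)"
    by (simp add: nn_integral_cmult)
  also have "\<dots> = (\<integral>\<^sup>+y. (\<integral>\<^sup>+x. f (T x) * g (T x + y) \<partial>lborel) \<partial>lborel)"
    by (rule lborel_pair.Fubini') measurable
  also have "\<dots> = (\<integral>\<^sup>+y. (\<integral>\<^sup>+x. f (T x - y) * g (T x) \<partial>lborel) \<partial>lborel)"
  proof (rule nn_integral_cong)
    fix y :: 'a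
    have "(\<integral>\<^sup>+x. f (T x) * g (T x + y) \<partial>lborel)
        = (\<integral>\<^sup>+x. f (T (- T y + x)) * g (T (- T y + x) + y) \<partial>lborel)"
      by (rule nn_integral_lborel_shift[symmetric]) measurable
    also have "\<dots> = (\<integral>\<^sup>+x. f (T x - y) * g (T x) \<partial>lborel)"
    proof -
      have "T (- T y + x) = T x - y" for x
        using linear_diff[OF T(1), of x "T y"] T(3)[of y] by (simp add: add.commute)
      then show ?thesis by simp
    qed
    finally show "(\<integral>\<^sup>+x. f (T x) * g (T x + y) \<partial>lborel) = (\<integral>\<^sup>+x. f (T x - y) * g (T x) \<partial>lborel)" .
  qed
  also have "\<dots> = (\<integral>\<^sup>+x. (\<integral>\<^sup>+y. f (T x - y) * g (T x) \<partial>lborel) \<partial>lborel)"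
    by (rule lborel_pair.Fubini') measurable
  also have "\<dots> = (\<integral>\<^sup>+x. c * g (T x) \<partial>lborel)"
    by (simp add: nn_integral_multc nn_integral_lborel_reflect c_def)
  also have "\<dots> = c * (\<integral>\<^sup>+x. g (T x) \<partial>lborel)"
    by (simp add: nn_integral_cmult)
  finally show ?thesis
    using c0 by (simp add: ennreal_mult_cancel_left)
qed

text \<open>
  The reflection in the hyperplane orthogonal to \<open>x - b\<close>. It transports a statement about caps around a basis
  vector to caps around an arbitrary point of the sphere.
\<close>

lemma reflection_exists:
  fixes b x :: "'a::euclidean_space"
  assumes "norm b = norm x"
  obtains T where "linear T" "\<And>z. norm (T z) = norm z" "\<And>z. T (T z) = z" "T b = (x::'a)"
proof (cases "x = b")
  case True
  show thesis by (rule that[of "\<lambda>z. z"]) (auto simp: True linear_iff)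
next
  case False
  define v where "v = x - b"
  define T where "T z = z - (2 * (z \<bullet> v) / (v \<bullet> v)) *\<^sub>R v" for z
  have v: "v \<bullet> v \<noteq> 0" using False by (simp add: v_def)
  have lin: "linear T"
    by (rule linearI) (simp_all add: T_def inner_add_left algebra_simps add_divide_distrib)
  have Tv: "T z \<bullet> v = - (z \<bullet> v)" for z
    using v by (simp add: T_def inner_diff_left)
  have norm_sq: "T z \<bullet> T z = z \<bullet> z" for z
  proof -
    have "T z \<bullet> T z = T z \<bullet> z - (2 * (z \<bullet> v) / (v \<bullet> v)) * (T z \<bullet> v)"
      by (subst (2) T_def) (simp add: inner_diff_right)
    also have "T z \<bullet> z = z \<bullet> z - (2 * (z \<bullet> v) / (v \<bullet> v)) * (v \<bullet> z)"
      by (simp add: T_def inner_diff_left)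
    finally show ?thesis by (simp add: Tv inner_commute[of v z])
  qed
  have norm_eq: "norm (T z) = norm z" for z
    unfolding norm_eq_sqrt_inner[of "T z"] norm_eq_sqrt_inner[of z] norm_sq by (rule refl)
  have inv: "T (T z) = z" for z
  proof -
    have "T (T z) = T z - (2 * (T z \<bullet> v) / (v \<bullet> v)) *\<^sub>R v" by (rule T_def)
    moreover have "T z = z - (2 * (z \<bullet> v) / (v \<bullet> v)) *\<^sub>R v" by (rule T_def)
    ultimately show ?thesis unfolding Tv by simp
  qed
  have "T b = x"
  proof -
    have "x \<bullet> x = b \<bullet> b" using assms by (metis power2_norm_eq_inner)
    then have "v \<bullet> v = - 2 * (b \<bullet> v)"
      by (simp add: v_def inner_diff_left inner_diff_right inner_commute[of x b])
    then have "2 * (b \<bullet> v) / (v \<bullet> v) = - 1" using v by (simp add: field_simps)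
    then show ?thesis by (simp add: T_def v_def)
  qed
  with lin norm_eq inv show thesis by (rule that)
qed

section \<open>The cone measure of the sphere and polar coordinates\<close>

text \<open>
  The measure of \<open>E\<close> is the dimension times the volume of the cone over \<open>E\<close> in the unit ball. It equals the Hausdorff
  measure of the sphere, but it has polar coordinates built in.
\<close>

definition surface_measure :: "'a::euclidean_space measure" where
  "surface_measure =
     distr (density lborel (\<lambda>z. if z \<noteq> 0 \<and> norm z < 1 then ennreal (real DIM('a)) else 0)) borel sgn"

lemma borel_measurable_sgn_vector [measurable (raw)]:
  fixes f :: "'b \<Rightarrow> 'a::euclidean_space"
  assumes [measurable]: "f \<in> borel_measurable M"
  shows "(\<lambda>x. sgn (f x)) \<in> borel_measurable M"
  unfolding sgn_div_norm by measurable

lemma sets_surface_measure [simp, measurable_cong]: "sets surface_measure = sets borel"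
  by (simp add: surface_measure_def)

lemma space_surface_measure [simp]: "space surface_measure = UNIV"
  by (simp add: surface_measure_def)

lemma nn_integral_surface_measure:
  fixes g :: "'a::euclidean_space \<Rightarrow> ennreal"
  assumes [measurable]: "g \<in> borel_measurable borel"
  shows "(\<integral>\<^sup>+\<sigma>. g \<sigma> \<partial>surface_measure)
      = ennreal (real DIM('a)) * (\<integral>\<^sup>+z. (if z \<noteq> 0 \<and> norm z < 1 then g (sgn z) else 0) \<partial>lborel)"
proof -
  have "(\<integral>\<^sup>+\<sigma>. g \<sigma> \<partial>surface_measure)
      = (\<integral>\<^sup>+z. g (sgn z) \<partial>density lborel (\<lambda>z. if z \<noteq> 0 \<and> norm z < 1 then ennreal (real DIM('a)) else 0))"
    unfolding surface_measure_def by (rule nn_integral_distr) measurable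
  also have "\<dots> = (\<integral>\<^sup>+z. (if z \<noteq> 0 \<and> norm z < 1 then ennreal (real DIM('a)) else 0) * g (sgn z) \<partial>lborel)"
    by (rule nn_integral_density) measurable
  also have "\<dots> = (\<integral>\<^sup>+z. ennreal (real DIM('a)) * (if z \<noteq> 0 \<and> norm z < 1 then g (sgn z) else 0) \<partial>lborel)"
    by (rule nn_integral_cong) auto
  also have "\<dots> = ennreal (real DIM('a)) * (\<integral>\<^sup>+z. (if z \<noteq> 0 \<and> norm z < 1 then g (sgn z) else 0) \<partial>lborel)"
    by (rule nn_integral_cmult) measurable
  finally show ?thesis .
qed

definition unit_cone :: "'a::euclidean_space set \<Rightarrow> 'a set" where
  "unit_cone E = {z. z \<noteq> 0 \<and> norm z < 1 \<and> sgn z \<in> E}"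

lemma unit_cone_borel: "(E :: 'a::euclidean_space set) \<in> sets borel \<Longrightarrow> unit_cone E \<in> sets borel"
proof -
  assume E: "E \<in> sets borel"
  have "unit_cone E = (ball 0 1 - {0}) \<inter> (sgn -` E \<inter> space borel)"
    by (auto simp: unit_cone_def)
  moreover have "sgn -` E \<inter> space borel \<in> sets borel"
    by (rule measurable_sets[OF _ E]) measurable
  moreover have "ball 0 1 - {0::'a} \<in> sets borel" by (intro borel_open) auto
  ultimately show ?thesis by auto
qed

lemma emeasure_surface_measure:
  fixes E :: "'a::euclidean_space set"
  assumes "E \<in> sets borel"
  shows "emeasure surface_measure E = ennreal (real DIM('a)) * emeasure lborel (unit_cone E)"
proof -
  have "emeasure surface_measure E = (\<integral>\<^sup>+\<sigma>. indicator E \<sigma> \<partial>surface_measure)" using assms by simp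
  also have "\<dots> = ennreal (real DIM('a))
      * (\<integral>\<^sup>+z. (if z \<noteq> 0 \<and> norm z < 1 then indicator E (sgn z) else 0) \<partial>lborel)"
    using assms by (intro nn_integral_surface_measure borel_measurable_indicator)
  also have "(\<integral>\<^sup>+z. (if z \<noteq> 0 \<and> norm z < 1 then indicator E (sgn z) else 0) \<partial>lborel)
      = (\<integral>\<^sup>+z. indicator (unit_cone E) z \<partial>lborel)"
    by (rule nn_integral_cong) (simp add: indicator_def unit_cone_def)
  also have "\<dots> = emeasure lborel (unit_cone E)"
    using unit_cone_borel[OF assms] by (intro nn_integral_indicator) simp
  finally show ?thesis .
qed

lemma finite_measure_surface_measure: "finite_measure (surface_measure :: 'a::euclidean_space measure)"
proof (rule finite_measureI)
  have "emeasure lborel (unit_cone (UNIV :: 'a set)) \<le> emeasure lborel (ball (0::'a) 1)"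
    by (intro emeasure_mono) (auto simp: unit_cone_def)
  also have "\<dots> < \<top>" by (simp add: emeasure_ball)
  finally have "emeasure lborel (unit_cone (UNIV :: 'a set)) \<noteq> \<top>" by simp
  then show "emeasure surface_measure (space (surface_measure :: 'a measure)) \<noteq> \<infinity>"
    by (simp add: emeasure_surface_measure ennreal_mult_eq_top_iff)
qed

interpretation surface: finite_measure "surface_measure :: 'a::euclidean_space measure"
  by (rule finite_measure_surface_measure)

lemma surface_measure_Int_sphere:
  fixes E :: "'a::euclidean_space set"
  assumes "E \<in> sets borel"
  shows "measure surface_measure (E \<inter> sphere 0 1) = measure surface_measure E"
proof -
  have "unit_cone (E \<inter> sphere 0 1) = unit_cone E" by (auto simp: unit_cone_def norm_sgn)
  then show ?thesis using assms by (simp add: measure_def emeasure_surface_measure)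
qed

lemma nn_integral_power_tail:
  assumes "0 < a" "0 < N"
  shows "(\<integral>\<^sup>+t. (if a < t then ennreal (1 / t ^ Suc N) else 0) \<partial>lborel) = ennreal (1 / (real N * a ^ N))"
proof -
  have "(\<integral>\<^sup>+t. (if a < t then ennreal (1 / t ^ Suc N) else 0) \<partial>lborel)
      = (\<integral>\<^sup>+t. ennreal (1 / t ^ Suc N) * indicator {a..} t \<partial>lborel)"
    by (intro nn_integral_cong_AE AE_I[of _ _ "{a}"]) (auto simp: indicator_def)
  also have "\<dots> = ennreal (0 - (- 1 / (real N * a ^ N)))"
  proof (rule nn_integral_FTC_atLeast)
    fix t assume "a \<le> t"
    then have t: "0 < t" using assms by simp
    show "((\<lambda>t. - 1 / (real N * t ^ N)) has_real_derivative 1 / t ^ Suc N) (at t)"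
    proof -
      obtain m where m: "N = Suc m" using assms(2) by (cases N) auto
      have "((\<lambda>t. - 1 / (real N * t ^ N)) has_real_derivative
          (real N * (real N * t ^ (N - 1))) / (real N * t ^ N)\<^sup>2) (at t)"
        using t assms(2) by (auto intro!: derivative_eq_intros simp: power2_eq_square)
      moreover have "(real N * (real N * t ^ (N - 1))) / (real N * t ^ N)\<^sup>2 = 1 / t ^ Suc N"
        using t by (simp add: m power2_eq_square divide_simps)
      ultimately show ?thesis by simp
    qed
    show "0 \<le> 1 / t ^ Suc N" using t by simp
  next
    show "((\<lambda>t. - 1 / (real N * t ^ N)) \<longlongrightarrow> 0) at_top"
      using assms(2) by real_asymp
  qed simp
  finally show ?thesis by simp
qed

text \<open>
  With the definition of the surface measure, the left-hand side is an integral over \<open>y\<close> in the unit ball and over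
  the radius. Substituting \<open>r = t \<bar>y\<bar>\<close> and then \<open>z = t y\<close> leaves, for each \<open>z\<close>, the integral of \<open>t\<^sup>-\<^sup>N\<^sup>-\<^sup>1\<close> over
  \<open>t > \<bar>z\<bar>\<close>, which cancels the Jacobian factors.
\<close>

lemma nn_integral_polar:
  fixes F :: "'a::euclidean_space \<Rightarrow> ennreal"
  assumes F [measurable]: "F \<in> borel_measurable borel"
  shows "(\<integral>\<^sup>+\<sigma>. (\<integral>\<^sup>+r. (if 0 < r then F (r *\<^sub>R \<sigma>) * ennreal (r ^ (DIM('a) - 1)) else 0) \<partial>lborel) \<partial>surface_measure)
      = (\<integral>\<^sup>+z. F z \<partial>lborel)"
proof -
  define N where "N = DIM('a)"
  have N: "0 < N" by (simp add: N_def)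
  have N': "t ^ N = t * t ^ (N - 1)" for t :: real using N by (cases N) auto
  define R where "R \<sigma> = (\<integral>\<^sup>+r. (if 0 < r then F (r *\<^sub>R \<sigma>) * ennreal (r ^ (N - 1)) else 0) \<partial>lborel)" for \<sigma>
  have R_meas: "R \<in> borel_measurable borel" unfolding R_def by measurable
  define G where "G y t = (if y \<noteq> 0 \<and> norm y < 1 \<and> 0 < t
      then F (t *\<^sub>R y) * ennreal (t ^ (N - 1)) * ennreal (norm y ^ N) else 0)" for y t
  define H where "H z t = (if z \<noteq> 0 \<and> norm z < t then F z * ennreal (norm z ^ N) * ennreal (1 / t ^ Suc N) else 0)" for z t
  have radial: "(if y \<noteq> 0 \<and> norm y < 1 then R (sgn y) else 0) = (\<integral>\<^sup>+t. G y t \<partial>lborel)" for y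
  proof (cases "y \<noteq> 0 \<and> norm y < 1")
    case True
    have meas: "(\<lambda>r. if 0 < r then F (r *\<^sub>R sgn y) * ennreal (r ^ (N - 1)) else 0) \<in> borel_measurable borel"
      by measurable
    have "R (sgn y) = ennreal (\<bar>norm y\<bar> ^ DIM(real)) * (\<integral>\<^sup>+t. (if 0 < 0 + norm y *\<^sub>R t
        then F ((0 + norm y *\<^sub>R t) *\<^sub>R sgn y) * ennreal ((0 + norm y *\<^sub>R t) ^ (N - 1)) else 0) \<partial>lborel)"
      unfolding R_def by (rule nn_integral_lborel_affine[OF meas]) (use True in simp)
    also have "\<dots> = (\<integral>\<^sup>+t. ennreal (\<bar>norm y\<bar> ^ DIM(real)) * (if 0 < 0 + norm y *\<^sub>R t
        then F ((0 + norm y *\<^sub>R t) *\<^sub>R sgn y) * ennreal ((0 + norm y *\<^sub>R t) ^ (N - 1)) else 0) \<partial>lborel)"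
      by (rule nn_integral_cmult[symmetric]) measurable
    also have "\<dots> = (\<integral>\<^sup>+t. G y t \<partial>lborel)"
    proof (rule nn_integral_cong)
      fix t :: real
      show "ennreal (\<bar>norm y\<bar> ^ DIM(real)) * (if 0 < 0 + norm y *\<^sub>R t
        then F ((0 + norm y *\<^sub>R t) *\<^sub>R sgn y) * ennreal ((0 + norm y *\<^sub>R t) ^ (N - 1)) else 0) = G y t"
      proof (cases "0 < t")
        case t: True
        have 1: "(0 + norm y *\<^sub>R t) *\<^sub>R sgn y = t *\<^sub>R y"
          using True by (simp add: sgn_div_norm)
        have "norm y * (norm y * t) ^ (N - 1) = t ^ (N - 1) * norm y ^ N"
          by (simp add: power_mult_distrib N')
        then have 2: "ennreal (norm y) * ennreal ((norm y * t) ^ (N - 1)) = ennreal (t ^ (N - 1)) * ennreal (norm y ^ N)"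
          using t by (simp add: ennreal_mult[symmetric] del: One_nat_def)
        have "ennreal (norm y) * (F (t *\<^sub>R y) * ennreal ((norm y * t) ^ (N - 1)))
            = F (t *\<^sub>R y) * (ennreal (norm y) * ennreal ((norm y * t) ^ (N - 1)))"
          by (simp only: mult.left_commute)
        also have "\<dots> = F (t *\<^sub>R y) * ennreal (t ^ (N - 1)) * ennreal (norm y ^ N)"
          unfolding 2 by (simp only: mult.assoc)
        finally show ?thesis
          using True t unfolding 1 by (simp add: G_def del: One_nat_def)
      next
        case False
        then have "\<not> 0 < 0 + norm y *\<^sub>R t" by (simp add: mult_nonneg_nonpos not_less)
        with False show ?thesis by (simp add: G_def)
      qed
    qed
    finally show ?thesis using True by simp
  next
    case False
    then have "G y t = 0" for t by (auto simp: G_def)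
    then show ?thesis unfolding if_not_P[OF False] by simp
  qed
  have scaling: "(\<integral>\<^sup>+y. G y t \<partial>lborel) = (\<integral>\<^sup>+z. H z t \<partial>lborel)" for t
  proof (cases "0 < t")
    case True
    have meas: "(\<lambda>z. H z t) \<in> borel_measurable borel" unfolding H_def by measurable
    have "(\<integral>\<^sup>+z. H z t \<partial>lborel) = ennreal (\<bar>t\<bar> ^ DIM('a)) * (\<integral>\<^sup>+y. H (0 + t *\<^sub>R y) t \<partial>lborel)"
      by (rule nn_integral_lborel_affine[OF meas]) (use True in simp)
    also have "\<dots> = (\<integral>\<^sup>+y. ennreal (\<bar>t\<bar> ^ DIM('a)) * H (0 + t *\<^sub>R y) t \<partial>lborel)"
      unfolding H_def by (rule nn_integral_cmult[symmetric]) measurable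
    also have "\<dots> = (\<integral>\<^sup>+y. G y t \<partial>lborel)"
    proof (rule nn_integral_cong)
      fix y :: 'a
      have cond: "0 + t *\<^sub>R y \<noteq> 0 \<and> norm (0 + t *\<^sub>R y) < t \<longleftrightarrow> y \<noteq> 0 \<and> norm y < 1"
        using True by (auto simp: field_simps)
      have "t ^ N * ((t * norm y) ^ N * (1 / t ^ Suc N)) = t ^ (N - 1) * norm y ^ N"
        using True by (simp add: power_mult_distrib N')
      then have 2: "ennreal (t ^ N) * (ennreal ((t * norm y) ^ N) * ennreal (1 / t ^ Suc N)) = ennreal (t ^ (N - 1)) * ennreal (norm y ^ N)"
        using True by (simp add: ennreal_mult[symmetric] del: power_Suc One_nat_def)
      have "ennreal (t ^ N) * (F (t *\<^sub>R y) * ennreal ((t * norm y) ^ N) * ennreal (1 / t ^ Suc N))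
          = F (t *\<^sub>R y) * (ennreal (t ^ N) * (ennreal ((t * norm y) ^ N) * ennreal (1 / t ^ Suc N)))"
        by (simp only: mult.left_commute mult.assoc)
      also have "\<dots> = F (t *\<^sub>R y) * ennreal (t ^ (N - 1)) * ennreal (norm y ^ N)"
        unfolding 2 by (simp only: mult.assoc)
      finally show "ennreal (\<bar>t\<bar> ^ DIM('a)) * H (0 + t *\<^sub>R y) t = G y t"
        unfolding H_def G_def cond using True by (simp add: N_def del: power_Suc One_nat_def)
    qed
    finally show ?thesis by simp
  next
    case False
    then have "G y t = 0" "H y t = 0" for y
      using norm_ge_zero[of y] by (auto simp: G_def H_def simp del: norm_ge_zero)
    then show ?thesis by simp
  qed
  have tail: "(\<integral>\<^sup>+t. H z t \<partial>lborel) = ennreal (1 / real N) * F z" if z: "z \<noteq> 0" for z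
  proof -
    have nz: "0 < norm z" using z by simp
    have "(\<integral>\<^sup>+t. H z t \<partial>lborel)
        = (\<integral>\<^sup>+t. (F z * ennreal (norm z ^ N)) * (if norm z < t then ennreal (1 / t ^ Suc N) else 0) \<partial>lborel)"
      using z by (intro nn_integral_cong) (simp add: H_def del: power_Suc)
    also have "\<dots> = (F z * ennreal (norm z ^ N)) * ennreal (1 / (real N * norm z ^ N))"
      unfolding nn_integral_power_tail[OF nz N, symmetric] by (rule nn_integral_cmult) measurable
    also have "\<dots> = F z * ennreal (norm z ^ N * (1 / (real N * norm z ^ N)))"
      by (subst ennreal_mult) (auto simp: mult.assoc)
    also have "norm z ^ N * (1 / (real N * norm z ^ N)) = 1 / real N"
      using z by simp
    finally show ?thesis by (simp add: mult.commute)
  qed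
  have "(\<integral>\<^sup>+\<sigma>. R \<sigma> \<partial>surface_measure)
      = ennreal (real N) * (\<integral>\<^sup>+y. (if y \<noteq> 0 \<and> norm y < 1 then R (sgn y) else 0) \<partial>lborel)"
    unfolding N_def by (rule nn_integral_surface_measure[OF R_meas])
  also have "(\<integral>\<^sup>+y. (if y \<noteq> 0 \<and> norm y < 1 then R (sgn y) else 0) \<partial>lborel) = (\<integral>\<^sup>+y. (\<integral>\<^sup>+t. G y t \<partial>lborel) \<partial>lborel)"
    by (rule nn_integral_cong) (rule radial)
  also have "\<dots> = (\<integral>\<^sup>+t. (\<integral>\<^sup>+y. G y t \<partial>lborel) \<partial>lborel)"
    unfolding G_def by (rule lborel_pair.Fubini') measurable
  also have "\<dots> = (\<integral>\<^sup>+t. (\<integral>\<^sup>+z. H z t \<partial>lborel) \<partial>lborel)"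
    by (rule nn_integral_cong) (rule scaling)
  also have "\<dots> = (\<integral>\<^sup>+z. (\<integral>\<^sup>+t. H z t \<partial>lborel) \<partial>lborel)"
    unfolding H_def by (rule lborel_pair.Fubini') measurable
  also have "\<dots> = (\<integral>\<^sup>+z. ennreal (1 / real N) * F z \<partial>lborel)"
  proof (rule nn_integral_cong_AE)
    have "AE z in lborel. z \<noteq> (0::'a)" by (intro AE_I[of _ _ "{0}"]) auto
    then show "AE z in lborel. (\<integral>\<^sup>+t. H z t \<partial>lborel) = ennreal (1 / real N) * F z"
      by eventually_elim (rule tail)
  qed
  also have "\<dots> = ennreal (1 / real N) * (\<integral>\<^sup>+z. F z \<partial>lborel)"
    by (rule nn_integral_cmult) measurable
  also have "ennreal (real N) * \<dots> = (ennreal (real N) * ennreal (1 / real N)) * (\<integral>\<^sup>+z. F z \<partial>lborel)"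
    by (simp only: mult.assoc)
  also have "ennreal (real N) * ennreal (1 / real N) = 1"
    using N by (simp add: ennreal_mult[symmetric])
  finally show ?thesis unfolding R_def N_def mult_1_left .
qed

section \<open>Measures of spherical caps\<close>

text \<open>
  The slices orthogonal to the axis are balls of dimension one less. The cone is the model of the cone over a cap.
\<close>

lemma emeasure_axis_cone:
  fixes b :: "'a::euclidean_space"
  assumes b: "b \<in> Basis" and m: "0 < m" and c: "0 < c"
  shows "emeasure lborel {z. 0 < z \<bullet> b \<and> z \<bullet> b < c \<and> norm (z - (z \<bullet> b) *\<^sub>R b) \<le> m * (z \<bullet> b)}
    = ennreal (unit_ball_vol (real (DIM('a) - 1)) * m ^ (DIM('a) - 1) * c ^ DIM('a) / real DIM('a))"
proof -
  define A where "A = (Basis :: 'a set) - {b}"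
  define n where "n = DIM('a) - 1"
  have A: "finite A" "b \<notin> A" "insert b A = Basis" "card A = n"
    using b by (auto simp: A_def n_def)
  have N: "DIM('a) = Suc n" using b by (simp add: n_def DIM_positive)
  interpret product_sigma_finite "\<lambda>_::'a. lborel :: real measure" by standard
  let ?e = "\<lambda>f. (\<Sum>i\<in>Basis. f i *\<^sub>R i) :: 'a"
  let ?Z = "{z::'a. 0 < z \<bullet> b \<and> z \<bullet> b < c \<and> norm (z - (z \<bullet> b) *\<^sub>R b) \<le> m * (z \<bullet> b)}"
  have Z [measurable]: "?Z \<in> sets borel" by measurable
  have coord: "?e f \<bullet> b = f b" for f using b by simp
  have rest: "norm (?e f - f b *\<^sub>R b) = sqrt (\<Sum>i\<in>A. (f i)\<^sup>2)" for f
  proof -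
    have "?e f = f b *\<^sub>R b + (\<Sum>i\<in>A. f i *\<^sub>R i)"
      unfolding A(3)[symmetric] by (rule sum.insert[OF A(1,2)])
    then have "norm (?e f - f b *\<^sub>R b) = norm (\<Sum>i\<in>A. f i *\<^sub>R i)" by simp
    also have "\<dots> = sqrt (\<Sum>i\<in>A. (f i)\<^sup>2)"
    proof -
      have "(norm (\<Sum>i\<in>A. f i *\<^sub>R i))\<^sup>2 = (\<Sum>i\<in>A. (norm (f i *\<^sub>R i))\<^sup>2)"
        using A(1) by (intro norm_sum_Pythagorean)
          (auto simp: pairwise_def A_def orthogonal_def inner_Basis)
      also have "\<dots> = (\<Sum>i\<in>A. (f i)\<^sup>2)" by (intro sum.cong) (auto simp: A_def)
      finally show ?thesis by (metis norm_ge_zero real_sqrt_unique)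
    qed
    finally show ?thesis .
  qed
  define I where "I f = (if 0 < f b \<and> f b < c \<and> sqrt (\<Sum>i\<in>A. (f i)\<^sup>2) \<le> m * f b then 1 else 0 :: ennreal)" for f
  have I_meas: "I \<in> borel_measurable (PiM (insert b A) (\<lambda>_. lborel))"
  proof -
    let ?P = "PiM (insert b A) (\<lambda>_. borel :: real measure)"
    define g where "g f = sqrt (\<Sum>i\<in>A. (f i)\<^sup>2)" for f :: "'a \<Rightarrow> real"
    define h where "h f = f b" for f :: "'a \<Rightarrow> real"
    have comp: "(\<lambda>f. f i) \<in> borel_measurable ?P" if "i \<in> insert b A" for i
      using measurable_component_singleton[OF that, of "\<lambda>_. borel :: real measure"] by simp
    have gm: "g \<in> borel_measurable ?P"
      unfolding g_def
      by (rule measurable_compose[OF _ borel_measurable_sqrt])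
        (intro borel_measurable_sum borel_measurable_power comp, simp)
    have hm: "h \<in> borel_measurable ?P" unfolding h_def by (rule comp) simp
    have I_eq: "I = (\<lambda>f. if 0 < h f \<and> h f < c \<and> g f \<le> m * h f then 1 else 0)"
      by (simp add: I_def g_def h_def fun_eq_iff)
    have 2: "I \<in> borel_measurable ?P" unfolding I_eq
      by (intro measurable_If measurable_const sets.sets_Collect_conj borel_measurable_less
          borel_measurable_le borel_measurable_times gm hm) simp_all
    have "sets (PiM (insert b A) (\<lambda>_. lborel :: real measure)) = sets (PiM (insert b A) (\<lambda>_. borel))"
      by (rule sets_PiM_cong) auto
    then show ?thesis using 2 measurable_cong_sets by blast
  qed
  have "emeasure lborel ?Z = (\<integral>\<^sup>+z. indicator ?Z z \<partial>lborel)" by simp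
  also have "\<dots> = (\<integral>\<^sup>+z. indicator ?Z z \<partial>distr (PiM Basis (\<lambda>_. lborel)) borel ?e)"
    by (subst lborel_eq) (rule refl)
  also have "\<dots> = (\<integral>\<^sup>+f. indicator ?Z (?e f) \<partial>PiM Basis (\<lambda>_. lborel))"
    by (rule nn_integral_distr) measurable
  also have "\<dots> = (\<integral>\<^sup>+f. I f \<partial>PiM (insert b A) (\<lambda>_. lborel))"
    unfolding A(3) by (rule nn_integral_cong) (simp add: indicator_def I_def coord rest)
  also have "\<dots> = (\<integral>\<^sup>+y. (\<integral>\<^sup>+f. I (f(b := y)) \<partial>PiM A (\<lambda>_. lborel)) \<partial>lborel)"
    by (rule product_nn_integral_insert_rev[OF A(1,2) I_meas])
  also have "\<dots> = (\<integral>\<^sup>+y. ennreal (unit_ball_vol (real n) * (m * y) ^ n) * indicator {0..c} y \<partial>lborel)"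
  proof (rule nn_integral_cong_AE)
    have "AE y in lborel. y \<notin> {0, c}"
      by (intro AE_not_in countable_imp_null_set_lborel) auto
    then show "AE y in lborel. (\<integral>\<^sup>+f. I (f(b := y)) \<partial>PiM A (\<lambda>_. lborel))
        = ennreal (unit_ball_vol (real n) * (m * y) ^ n) * indicator {0..c} y"
    proof eventually_elim
      case (elim y)
      have sum: "(\<Sum>i\<in>A. ((f(b := y)) i)\<^sup>2) = (\<Sum>i\<in>A. (f i)\<^sup>2)" for f :: "'a \<Rightarrow> real"
        using A(2) by (intro sum.cong) auto
      show ?case
      proof (cases "0 < y \<and> y < c")
        case True
        have "(\<integral>\<^sup>+f. I (f(b := y)) \<partial>PiM A (\<lambda>_. lborel))
            = (\<integral>\<^sup>+f. indicator ({f. sqrt (\<Sum>i\<in>A. (f i)\<^sup>2) \<le> m * y} \<inter> space (PiM A (\<lambda>_. lborel))) f \<partial>PiM A (\<lambda>_. lborel))"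
          unfolding I_def sum using True by (intro nn_integral_cong) (simp add: indicator_def)
        also have "\<dots> = emeasure (PiM A (\<lambda>_. lborel)) ({f. sqrt (\<Sum>i\<in>A. (f i)\<^sup>2) \<le> m * y} \<inter> space (PiM A (\<lambda>_. lborel)))"
          using A(1) by (intro nn_integral_indicator) measurable
        also have "\<dots> = ennreal (unit_ball_vol (real n) * (m * y) ^ n)"
          using emeasure_cball_aux[OF A(1), of "m * y"] True m A(4) by simp
        finally show ?thesis using True by simp
      next
        case False
        then have "I (f(b := y)) = 0" for f by (auto simp: I_def)
        then show ?thesis using False elim by (auto simp: indicator_def)
      qed
    qed
  qed
  also have "\<dots> = ennreal (unit_ball_vol (real n) * m ^ n * c ^ Suc n / real (Suc n) - 0)"
  proof -
    define V where "V = unit_ball_vol (real n) * m ^ n"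
    have "(\<integral>\<^sup>+y. ennreal (V * y ^ n) * indicator {0..c} y \<partial>lborel)
        = ennreal (V * c ^ Suc n / real (Suc n) - V * 0 ^ Suc n / real (Suc n))"
    proof (rule nn_integral_FTC_Icc)
      fix y :: real assume y: "y \<in> {0..c}"
      have "((\<lambda>y. V * y ^ Suc n / real (Suc n)) has_real_derivative
          V * (real (Suc n) * y ^ n) / real (Suc n)) (at y)"
        using DERIV_cdivide[OF DERIV_cmult[OF DERIV_pow[of "Suc n" y UNIV]], of V "real (Suc n)"]
        by (simp only: diff_Suc_Suc diff_zero)
      then show "((\<lambda>y. V * y ^ Suc n / real (Suc n)) has_real_derivative V * y ^ n) (at y)"
        by (simp del: power_Suc of_nat_Suc)
      show "0 \<le> V * y ^ n" using m y by (simp add: V_def)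
    qed (use c in auto)
    then show ?thesis by (simp add: V_def power_mult_distrib mult.assoc)
  qed
  finally show ?thesis by (simp add: N)
qed

text \<open>
  The cone over the cap contains a circular cone of slope \<open>r\<close> that is cut off at height \<open>1 / sqrt (1 + r\<^sup>2)\<close>, where
  its rim reaches the unit sphere. The constant is asymptotically sharp: caps of small radius have at least
  almost the measure of a flat ball of the same radius.
\<close>

lemma surface_measure_cap_lower:
  fixes x :: "'a::euclidean_space"
  assumes x: "norm x = 1" and r: "0 < r"
  shows "unit_ball_vol (real (DIM('a) - 1)) * r ^ (DIM('a) - 1)
    \<le> sqrt (1 + r\<^sup>2) ^ DIM('a) * measure surface_measure (cball x r)"
proof -
  define N where "N = DIM('a)"
  define q where "q = sqrt (1 + r\<^sup>2)"
  define c where "c = 1 / q"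
  have s: "1 \<le> q" by (simp add: q_def)
  have qq: "q\<^sup>2 = 1 + r\<^sup>2" by (simp add: q_def)
  have c: "0 < c" using s by (simp add: c_def)
  obtain b :: 'a where b: "b \<in> Basis" using nonempty_Basis by blast
  obtain T where T: "linear T" "\<And>z. norm (T z) = norm z" "\<And>z. T (T z) = z" "T b = x"
    using reflection_exists[of b x] x b by auto
  have [measurable]: "T \<in> borel_measurable borel"
    using linear_continuous_on[OF linear_conv_bounded_linear[THEN iffD1, OF T(1)]]
    by (intro borel_measurable_continuous_onI)
  define Z where "Z = {z::'a. 0 < z \<bullet> b \<and> z \<bullet> b < c \<and> norm (z - (z \<bullet> b) *\<^sub>R b) \<le> r * (z \<bullet> b)}"
  have sgnT: "sgn (T z) = T (sgn z)" for z
    by (simp add: sgn_div_norm T(2) linear_scale[OF T(1)])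
  have sub: "T z \<in> unit_cone (cball x r)" if "z \<in> Z" for z
  proof -
    define t where "t = z \<bullet> b"
    have t: "0 < t" "t < c" "norm (z - t *\<^sub>R b) \<le> r * t" using that by (auto simp: Z_def t_def)
    have zz: "(norm z)\<^sup>2 = t\<^sup>2 + (norm (z - t *\<^sub>R b))\<^sup>2"
      using b unfolding power2_norm_eq_inner
      by (simp add: inner_diff_left inner_diff_right inner_commute[of b z] t_def[symmetric] power2_eq_square)
    have "(norm (z - t *\<^sub>R b))\<^sup>2 \<le> (r * t)\<^sup>2" using t(3) by (intro power_mono) auto
    with zz have "(norm z)\<^sup>2 \<le> t\<^sup>2 * (1 + r\<^sup>2)" by (simp add: power_mult_distrib algebra_simps)
    then have "(norm z)\<^sup>2 \<le> (t * q)\<^sup>2" by (simp add: power_mult_distrib qq)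
    then have nz: "norm z \<le> t * q"
      by (rule power2_le_imp_le) (use t(1) s in simp)
    have z0: "z \<noteq> 0" using t(1) by (auto simp: t_def)
    have "norm z < 1"
    proof -
      have "t * q < c * q" using t(2) s by (intro mult_strict_right_mono) auto
      also have "c * q = 1" using s by (simp add: c_def)
      finally show ?thesis using nz by linarith
    qed
    have "c * norm z \<le> c * (t * q)" using nz c by (intro mult_left_mono) auto
    also have "\<dots> = t" using s by (simp add: c_def)
    finally have "c \<le> t / norm z" using z0 by (simp add: pos_le_divide_eq)
    moreover have "1 - r\<^sup>2 / 2 \<le> c"
    proof -
      \<comment> \<open>\<open>1 - r\<^sup>2 / 2 \<le> 1 / q\<close>, written in \<open>q\<close>, is \<open>q\<^sup>3 - 3 q + 2 \<ge> 0\<close>, and this polynomial factors.\<close>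
      have "0 \<le> (q - 1)\<^sup>2 * (q + 2)" using s by (intro mult_nonneg_nonneg) auto
      then have "(1 - (q\<^sup>2 - 1) / 2) * q \<le> 1"
        by (simp add: power2_eq_square algebra_simps) (simp add: field_simps)
      then have "(1 - r\<^sup>2 / 2) * q \<le> 1" by (simp add: qq)
      then show ?thesis using s by (simp add: c_def pos_le_divide_eq)
    qed
    ultimately have ang: "2 - 2 * (t / norm z) \<le> r\<^sup>2" by linarith
    have "(norm (sgn z - b))\<^sup>2 = 2 - 2 * (t / norm z)"
    proof -
      have "sgn z \<bullet> sgn z = 1" using z0 by (simp add: norm_sgn power2_norm_eq_inner[symmetric])
      moreover have "sgn z \<bullet> b = t / norm z" by (simp add: sgn_div_norm t_def divide_inverse_commute)
      ultimately show ?thesis using b unfolding power2_norm_eq_inner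
        by (simp add: inner_diff_left inner_diff_right inner_commute[of b "sgn z"])
    qed
    then have "norm (sgn z - b) \<le> r" using ang r by (metis less_imp_le power2_le_imp_le)
    moreover have "norm (sgn (T z) - x) = norm (sgn z - b)"
      unfolding sgnT T(4)[symmetric] linear_diff[OF T(1), symmetric] by (rule T(2))
    ultimately have "sgn (T z) \<in> cball x r" by (simp add: dist_norm norm_minus_commute)
    moreover have "T z \<noteq> 0" using z0 T(2)[of z] by (metis norm_eq_zero)
    ultimately show ?thesis using \<open>norm z < 1\<close> by (simp add: unit_cone_def T(2) del: mem_cball)
  qed
  have cone: "unit_cone (cball x r) \<in> sets borel" by (rule unit_cone_borel) auto
  have "ennreal (unit_ball_vol (real (N - 1)) * r ^ (N - 1) * c ^ N / real N) = emeasure lborel Z"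
    unfolding N_def Z_def by (rule emeasure_axis_cone[OF b r c, symmetric])
  also have "\<dots> = (\<integral>\<^sup>+z. indicator Z z \<partial>lborel)"
    by (rule nn_integral_indicator[symmetric]) (simp add: Z_def)
  also have "\<dots> \<le> (\<integral>\<^sup>+z. indicator (unit_cone (cball x r)) (T z) \<partial>lborel)"
    using sub by (intro nn_integral_mono) (auto simp: indicator_def)
  also have "\<dots> = (\<integral>\<^sup>+z. indicator (unit_cone (cball x r)) z \<partial>lborel)"
    by (rule nn_integral_lborel_isometry[OF T(1-3)]) (use cone in simp)
  also have "\<dots> = emeasure lborel (unit_cone (cball x r))"
    using cone by simp
  finally have "ennreal (real N) * ennreal (unit_ball_vol (real (N - 1)) * r ^ (N - 1) * c ^ N / real N)
      \<le> ennreal (real N) * emeasure lborel (unit_cone (cball x r))"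
    by (rule mult_left_mono) simp
  also have "ennreal (real N) * emeasure lborel (unit_cone (cball x r)) = emeasure surface_measure (cball x r)"
    unfolding N_def by (rule emeasure_surface_measure[symmetric]) auto
  also have "\<dots> = ennreal (measure surface_measure (cball x r))"
    by (rule surface.emeasure_eq_measure)
  also have "ennreal (real N) * ennreal (unit_ball_vol (real (N - 1)) * r ^ (N - 1) * c ^ N / real N)
      = ennreal (unit_ball_vol (real (N - 1)) * r ^ (N - 1) * c ^ N)"
    using r c by (subst ennreal_mult[symmetric]) (auto simp: N_def)
  finally have "unit_ball_vol (real (N - 1)) * r ^ (N - 1) * c ^ N \<le> measure surface_measure (cball x r)"
    by simp
  then have "q ^ N * (unit_ball_vol (real (N - 1)) * r ^ (N - 1) * c ^ N)
      \<le> q ^ N * measure surface_measure (cball x r)"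
    using s by (intro mult_left_mono) auto
  moreover have "q ^ N * (unit_ball_vol (real (N - 1)) * r ^ (N - 1) * c ^ N)
      = unit_ball_vol (real (N - 1)) * r ^ (N - 1)"
    using s by (simp add: c_def power_one_over)
  ultimately show ?thesis by (simp only: N_def q_def)
qed

text \<open>
  A crude bound by a covering: the cone over the cap is covered by about \<open>1 / r\<close> balls of radius \<open>2 r\<close> with centres on
  the axis. Only the order of magnitude in \<open>r\<close> matters.
\<close>

lemma surface_measure_cap_upper:
  obtains C where "0 < C"
    "\<And>(x :: 'a::euclidean_space) r. norm x = 1 \<Longrightarrow> 0 < r \<Longrightarrow> r \<le> 1 \<Longrightarrow>
      measure surface_measure (cball x r) \<le> C * r ^ (DIM('a) - 1)"
proof -
  define N where "N = DIM('a)"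
  have N: "N = Suc (N - 1)" by (simp add: N_def)
  define C where "C = real N * 2 * unit_ball_vol (real N) * 2 ^ N"
  have "0 < C" by (simp add: C_def N_def)
  moreover have "measure surface_measure (cball x r) \<le> C * r ^ (DIM('a) - 1)"
    if x: "norm x = 1" and r: "0 < r" "r \<le> 1" for x :: 'a and r
  proof -
    define k where "k = nat \<lfloor>1 / r\<rfloor>"
    have sub: "unit_cone (cball x r) \<subseteq> (\<Union>j\<le>k. cball ((real j * r) *\<^sub>R x) (2 * r))"
    proof
      fix z assume "z \<in> unit_cone (cball x r)"
      then have z: "z \<noteq> 0" "norm z < 1" "norm (sgn z - x) \<le> r"
        by (auto simp: unit_cone_def dist_norm norm_minus_commute)
      define j where "j = nat \<lfloor>norm z / r\<rfloor>"
      have j: "real j = of_int \<lfloor>norm z / r\<rfloor>" using r by (simp add: j_def)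
      have "norm z / r \<le> 1 / r" using z(2) r by (simp add: divide_right_mono)
      then have "j \<le> k" unfolding j_def k_def by (intro nat_mono floor_mono)
      have "real j \<le> norm z / r" "norm z / r < real j + 1" unfolding j by linarith+
      then have "real j * r \<le> norm z" "norm z < real j * r + r" using r by (simp_all add: field_simps)
      then have "\<bar>norm z - real j * r\<bar> \<le> r" by simp
      then have 1: "norm (norm z *\<^sub>R x - (real j * r) *\<^sub>R x) \<le> r"
        unfolding scaleR_diff_left[symmetric] using x by simp
      have "z = norm z *\<^sub>R sgn z" using z(1) by (simp add: sgn_div_norm)
      then have "z - norm z *\<^sub>R x = norm z *\<^sub>R (sgn z - x)" by (metis scaleR_diff_right)
      then have "norm (z - norm z *\<^sub>R x) = norm z * norm (sgn z - x)" by simp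
      also have "\<dots> \<le> 1 * r" using z by (intro mult_mono) auto
      finally have "norm (z - (real j * r) *\<^sub>R x) \<le> 2 * r"
        using 1 norm_triangle_ineq[of "z - norm z *\<^sub>R x" "norm z *\<^sub>R x - (real j * r) *\<^sub>R x"] by simp
      then show "z \<in> (\<Union>j\<le>k. cball ((real j * r) *\<^sub>R x) (2 * r))"
        using \<open>j \<le> k\<close> by (auto simp: dist_norm norm_minus_commute)
    qed
    have "emeasure lborel (unit_cone (cball x r)) \<le> emeasure lborel (\<Union>j\<le>k. cball ((real j * r) *\<^sub>R x) (2 * r))"
      by (rule emeasure_mono[OF sub]) auto
    also have "\<dots> \<le> (\<Sum>j\<le>k. emeasure lborel (cball ((real j * r) *\<^sub>R x) (2 * r)))"
      by (rule emeasure_subadditive_finite) auto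
    also have "\<dots> = ennreal (real (Suc k) * (unit_ball_vol (real N) * (2 * r) ^ N))"
      using r by (simp add: emeasure_cball N_def ennreal_mult ennreal_of_nat_eq_real_of_nat del: of_nat_Suc)
    finally have "emeasure surface_measure (cball x r)
        \<le> ennreal (real N) * ennreal (real (Suc k) * (unit_ball_vol (real N) * (2 * r) ^ N))"
      unfolding N_def by (subst emeasure_surface_measure, simp) (rule mult_left_mono, auto)
    also have "\<dots> = ennreal (real N * (real (Suc k) * (unit_ball_vol (real N) * (2 * r) ^ N)))"
      using r by (intro ennreal_mult[symmetric]) auto
    finally have "measure surface_measure (cball x r) \<le> real N * (real (Suc k) * (unit_ball_vol (real N) * (2 * r) ^ N))"
      unfolding surface.emeasure_eq_measure by (subst (asm) ennreal_le_iff) (use r in auto)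
    also have "\<dots> \<le> real N * ((2 / r) * (unit_ball_vol (real N) * (2 * r) ^ N))"
    proof (intro mult_left_mono mult_right_mono)
      have "real k \<le> 1 / r" using r by (simp add: k_def)
      moreover have "1 \<le> 1 / r" using r by simp
      ultimately show "real (Suc k) \<le> 2 / r" by simp
    qed (use r in auto)
    also have "\<dots> = C * r ^ (N - 1)"
    proof -
      have "r ^ N = r * r ^ (N - 1)" by (subst N) (rule power_Suc)
      then show ?thesis using r by (simp add: C_def power_mult_distrib)
    qed
    finally show ?thesis by (simp add: N_def)
  qed
  ultimately show thesis by (rule that)
qed

section \<open>Hausdorff measure of the sphere is at most the cone measure\<close>

lemma emeasure_UN_le_count_space:
  assumes "countable I" "\<And>i. i \<in> I \<Longrightarrow> X i \<in> sets M"
  shows "emeasure M (\<Union>i\<in>I. X i) \<le> (\<integral>\<^sup>+i. emeasure M (X i) \<partial>count_space I)"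
proof -
  have U: "(\<Union>i\<in>I. X i) \<in> sets M" using assms by (intro sets.countable_UN') auto
  have "emeasure M (\<Union>i\<in>I. X i) = (\<integral>\<^sup>+x. indicator (\<Union>i\<in>I. X i) x \<partial>M)" using U by simp
  also have "\<dots> \<le> (\<integral>\<^sup>+x. (\<integral>\<^sup>+i. indicator (X i) x \<partial>count_space I) \<partial>M)"
  proof (rule nn_integral_mono)
    fix x
    show "indicator (\<Union>i\<in>I. X i) x \<le> (\<integral>\<^sup>+i. indicator (X i) x \<partial>count_space I)"
    proof (cases "\<exists>i\<in>I. x \<in> X i")
      case True
      then obtain i where i: "i \<in> I" "x \<in> X i" by blast
      have "indicator (X i) x \<le> (\<integral>\<^sup>+i. indicator (X i) x \<partial>count_space I)"
        by (rule nn_integral_ge_point[OF i(1)])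
      then show ?thesis using i by (auto simp: indicator_def)
    qed (auto simp: indicator_def)
  qed
  also have "\<dots> = (\<integral>\<^sup>+i. (\<integral>\<^sup>+x. indicator (X i) x \<partial>M) \<partial>count_space I)"
    using assms by (intro nn_integral_count_space_nn_integral) auto
  also have "\<dots> = (\<integral>\<^sup>+i. emeasure M (X i) \<partial>count_space I)"
    using assms by (intro nn_integral_cong) simp
  finally show ?thesis .
qed

abbreviation cover_weight :: "nat \<Rightarrow> 'a::euclidean_space set \<Rightarrow> ennreal" where
  "cover_weight n C \<equiv> (if C = {} then 0 else ennreal (unit_ball_vol (real n) * (diameter C / 2) ^ n))"

text \<open>
  Covers indexed by an arbitrary countable set, such as the centres of a Vitali family, in place of the natural
  numbers. The enumeration is padded by empty sets, which have weight \<open>0\<close>.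
\<close>

lemma hausdorff_pre_le_countable_cover:
  fixes C :: "'i \<Rightarrow> 'a::euclidean_space set"
  assumes I: "countable I" and E: "E \<subseteq> (\<Union>i\<in>I. C i)" and \<delta>: "0 \<le> \<delta>"
    and C: "\<And>i. i \<in> I \<Longrightarrow> bounded (C i) \<and> diameter (C i) \<le> \<delta>"
  shows "hausdorff_pre n \<delta> E \<le> (\<integral>\<^sup>+i. cover_weight n (C i) \<partial>count_space I)"
proof -
  let ?J = "to_nat_on I ` I"
  define D where "D k = (if k \<in> ?J then C (from_nat_into I k) else {})" for k
  have inv: "from_nat_into I (to_nat_on I i) = i" if "i \<in> I" for i
    using I that by simp
  have "hausdorff_pre n \<delta> E \<le> (\<Sum>k. cover_weight n (D k))"
    unfolding hausdorff_pre_def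
  proof (rule INF_lower, intro CollectI conjI allI)
    show "E \<subseteq> (\<Union>k. D k)"
    proof
      fix x assume "x \<in> E"
      then obtain i where "i \<in> I" "x \<in> C i" using E by blast
      then have "x \<in> D (to_nat_on I i)" using inv by (auto simp: D_def)
      then show "x \<in> (\<Union>k. D k)" by blast
    qed
    show "bounded (D k)" "diameter (D k) \<le> \<delta>" for k
      using C \<delta> inv by (auto simp: D_def)
  qed
  also have "\<dots> = (\<integral>\<^sup>+k. cover_weight n (D k) \<partial>count_space UNIV)"
    by (rule nn_integral_count_space_nat[symmetric])
  also have "\<dots> = (\<integral>\<^sup>+k. cover_weight n (D k) * indicator ?J k \<partial>count_space UNIV)"
    by (rule nn_integral_cong) (auto simp: D_def)
  also have "\<dots> = (\<integral>\<^sup>+k. cover_weight n (D k) \<partial>count_space ?J)"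
    by (rule nn_integral_count_space_indicator[symmetric]) simp
  also have "\<dots> = (\<integral>\<^sup>+i. cover_weight n (D (to_nat_on I i)) \<partial>count_space I)"
    using inj_on_to_nat_on[OF I] by (intro nn_integral_bij_count_space[symmetric]) (simp add: bij_betw_def)
  also have "\<dots> = (\<integral>\<^sup>+i. cover_weight n (C i) \<partial>count_space I)"
    by (rule nn_integral_cong) (auto simp: D_def inv)
  finally show ?thesis .
qed

lemma hausdorff_pre_Un:
  fixes A B :: "'a::euclidean_space set"
  assumes \<delta>: "0 \<le> \<delta>"
  shows "hausdorff_pre n \<delta> (A \<union> B) \<le> hausdorff_pre n \<delta> A + hausdorff_pre n \<delta> B"
proof (rule ennreal_le_epsilon)
  fix e :: real
  assume fin: "hausdorff_pre n \<delta> A + hausdorff_pre n \<delta> B < \<top>" and e: "0 < e"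
  have ex: "\<exists>C. E \<subseteq> (\<Union>i::nat. C i) \<and> (\<forall>i. bounded (C i) \<and> diameter (C i) \<le> \<delta>)
      \<and> (\<Sum>i. cover_weight n (C i)) \<le> hausdorff_pre n \<delta> E + ennreal (e / 2)"
    if "hausdorff_pre n \<delta> E < \<top>" for E :: "'a set"
  proof -
    have "hausdorff_pre n \<delta> E < hausdorff_pre n \<delta> E + ennreal (e / 2)"
      using that e
      by (cases "hausdorff_pre n \<delta> E") (auto simp: ennreal_less_iff simp flip: ennreal_plus)
    then show ?thesis
      unfolding hausdorff_pre_def[of n \<delta> E] INF_less_iff by (auto intro: less_imp_le)
  qed
  obtain C D where C: "A \<subseteq> (\<Union>i::nat. C i)" "\<And>i. bounded (C i) \<and> diameter (C i) \<le> \<delta>"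
      "(\<Sum>i. cover_weight n (C i)) \<le> hausdorff_pre n \<delta> A + ennreal (e / 2)"
    and D: "B \<subseteq> (\<Union>i::nat. D i)" "\<And>i. bounded (D i) \<and> diameter (D i) \<le> \<delta>"
      "(\<Sum>i. cover_weight n (D i)) \<le> hausdorff_pre n \<delta> B + ennreal (e / 2)"
    using ex[of A] ex[of B] fin by (auto simp: less_top[symmetric])
  define F where "F = (\<lambda>(s :: bool, i :: nat). if s then C i else D i)"
  have "hausdorff_pre n \<delta> (A \<union> B) \<le> (\<integral>\<^sup>+p. cover_weight n (F p) \<partial>count_space UNIV)"
  proof (rule hausdorff_pre_le_countable_cover[OF _ _ \<delta>])
    show "A \<union> B \<subseteq> (\<Union>p\<in>UNIV. F p)"
    proof
      fix x assume "x \<in> A \<union> B"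
      then obtain i where "x \<in> F (True, i) \<or> x \<in> F (False, i)" using C(1) D(1) by (auto simp: F_def)
      then show "x \<in> (\<Union>p\<in>UNIV. F p)" by blast
    qed
  qed (use C(2) D(2) in \<open>auto simp: F_def split: prod.splits\<close>)
  also have "\<dots> = (\<integral>\<^sup>+s. (\<integral>\<^sup>+i. cover_weight n (F (s, i)) \<partial>count_space UNIV) \<partial>count_space UNIV)"
    by (rule nn_integral_fst_count_space[symmetric])
  also have "\<dots> = (\<integral>\<^sup>+i. cover_weight n (F (True, i)) \<partial>count_space UNIV) + (\<integral>\<^sup>+i. cover_weight n (F (False, i)) \<partial>count_space UNIV)"
    by (subst nn_integral_count_space_finite) (simp_all add: UNIV_bool add.commute)
  also have "\<dots> = (\<Sum>i. cover_weight n (C i)) + (\<Sum>i. cover_weight n (D i))"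
    by (simp only: nn_integral_count_space_nat F_def prod.case if_True if_False)
  also have "\<dots> \<le> (hausdorff_pre n \<delta> A + ennreal (e / 2)) + (hausdorff_pre n \<delta> B + ennreal (e / 2))"
    by (rule add_mono[OF C(3) D(3)])
  also have "\<dots> = hausdorff_pre n \<delta> A + hausdorff_pre n \<delta> B + (ennreal (e / 2) + ennreal (e / 2))"
    by (simp only: ac_simps)
  also have "ennreal (e / 2) + ennreal (e / 2) = ennreal e"
    using e by (simp flip: ennreal_plus)
  finally show "hausdorff_pre n \<delta> (A \<union> B) \<le> hausdorff_pre n \<delta> A + hausdorff_pre n \<delta> B + ennreal e" .
qed

lemma hausdorff_pre_mono: "A \<subseteq> B \<Longrightarrow> hausdorff_pre n \<delta> A \<le> hausdorff_pre n \<delta> B"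
  unfolding hausdorff_pre_def by (rule INF_superset_mono) auto

lemma cover_weight_cball:
  fixes x :: "'a::euclidean_space"
  assumes "0 \<le> r"
  shows "cover_weight n (cball x r) = ennreal (unit_ball_vol (real n) * r ^ n)"
  using assms by (simp add: diameter_cball)

text \<open>
  The constants of the Vitali iteration: \<open>K\<close> compares the weight of the enlarged balls with the measure of the
  original ones, and \<open>1 - \<theta>\<close> is half the reciprocal of the doubling constant for the factor \<open>5\<close>.
\<close>

lemma surface_measure_cap_constants:
  obtains \<theta> K :: real where "0 \<le> \<theta>" "\<theta> < 1" "0 \<le> K"
    "\<And>(x :: 'a::euclidean_space) r. norm x = 1 \<Longrightarrow> 0 < r \<Longrightarrow> r \<le> 1 / 5 \<Longrightarrow>
      unit_ball_vol (real (DIM('a) - 1)) * (5 * r) ^ (DIM('a) - 1) \<le> K * measure surface_measure (cball x r)"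
    "\<And>(x :: 'a::euclidean_space) r. norm x = 1 \<Longrightarrow> 0 < r \<Longrightarrow> r \<le> 1 / 5 \<Longrightarrow>
      (1 - \<theta>) * measure surface_measure (cball x (5 * r)) \<le> measure surface_measure (cball x r) / 2"
proof -
  define N where "N = DIM('a)"
  define v where "v = unit_ball_vol (real (N - 1))"
  have v: "0 < v" by (simp add: v_def)
  obtain C where C: "0 < C" "\<And>(x :: 'a) r. norm x = 1 \<Longrightarrow> 0 < r \<Longrightarrow> r \<le> 1 \<Longrightarrow>
      measure surface_measure (cball x r) \<le> C * r ^ (N - 1)"
    using surface_measure_cap_upper unfolding N_def by blast
  have low: "v * r ^ (N - 1) \<le> 2 ^ N * measure surface_measure (cball x r)"
    if "norm x = 1" "0 < r" "r \<le> 1 / 5" for x :: 'a and r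
  proof -
    have "r\<^sup>2 \<le> 1" using that by (simp add: power_le_one)
    then have "sqrt (1 + r\<^sup>2) \<le> 2" by (intro real_le_lsqrt) auto
    then have "sqrt (1 + r\<^sup>2) ^ N \<le> 2 ^ N" by (intro power_mono) auto
    then have "sqrt (1 + r\<^sup>2) ^ N * measure surface_measure (cball x r) \<le> 2 ^ N * measure surface_measure (cball x r)"
      by (intro mult_right_mono) auto
    with surface_measure_cap_lower[OF that(1,2)] show ?thesis by (simp add: v_def N_def)
  qed
  define K where "K = (5 ^ (N - 1) * 2 ^ N :: real)"
  define D where "D = max 1 (C * 5 ^ (N - 1) * 2 ^ N / v)"
  have D: "1 \<le> D" by (simp add: D_def)
  have "v * (5 * r) ^ (N - 1) \<le> K * measure surface_measure (cball x r)"
    if "norm x = 1" "0 < r" "r \<le> 1 / 5" for x :: 'a and r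
    using mult_left_mono[OF low[OF that], of "5 ^ (N - 1)"] by (simp add: K_def power_mult_distrib mult_ac)
  moreover have "(1 - (1 - 1 / (2 * D))) * measure surface_measure (cball x (5 * r)) \<le> measure surface_measure (cball x r) / 2"
    if xr: "norm x = 1" "0 < r" "r \<le> 1 / 5" for x :: 'a and r
  proof -
    have "measure surface_measure (cball x (5 * r)) \<le> C * (5 * r) ^ (N - 1)" using xr by (intro C(2)) auto
    also have "\<dots> = (C * 5 ^ (N - 1) / v) * (v * r ^ (N - 1))" using v by (simp add: power_mult_distrib)
    also have "\<dots> \<le> (C * 5 ^ (N - 1) / v) * (2 ^ N * measure surface_measure (cball x r))"
      using low[OF xr] C(1) v by (intro mult_left_mono) auto
    also have "\<dots> = (C * 5 ^ (N - 1) * 2 ^ N / v) * measure surface_measure (cball x r)" by simp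
    also have "\<dots> \<le> D * measure surface_measure (cball x r)"
      by (intro mult_right_mono) (auto simp: D_def)
    finally show ?thesis using D by (simp add: field_simps)
  qed
  ultimately show thesis
    using that[of "1 - 1 / (2 * D)" K] D by (simp add: K_def v_def N_def field_simps)
qed

lemma finite_subunion_half:
  fixes M :: "'a measure"
  assumes M: "finite_measure M" and I: "countable I" and X: "\<And>i. i \<in> I \<Longrightarrow> X i \<in> sets M"
    and c: "0 < c" "c \<le> measure M (\<Union>i\<in>I. X i)"
  obtains F where "finite F" "F \<subseteq> I" "c / 2 \<le> measure M (\<Union>i\<in>F. X i)"
proof -
  interpret finite_measure M by fact
  have ne: "I \<noteq> {}" using c by auto
  define G where "G k = from_nat_into I ` {..k}" for k :: nat
  have GI: "G k \<subseteq> I" for k using from_nat_into[OF ne] by (auto simp: G_def)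
  have "(\<Union>k. G k) = I"
  proof (intro antisym subsetI)
    fix x assume "x \<in> I"
    then obtain k where "x = from_nat_into I k" using range_from_nat_into[OF ne I] by blast
    then show "x \<in> (\<Union>k. G k)" by (auto simp: G_def)
  qed (use GI in blast)
  then have UN: "(\<Union>k. (\<Union>i\<in>G k. X i)) = (\<Union>i\<in>I. X i)" by blast
  have "(\<lambda>k. measure M (\<Union>i\<in>G k. X i)) \<longlonglongrightarrow> measure M (\<Union>k. (\<Union>i\<in>G k. X i))"
  proof (rule finite_Lim_measure_incseq)
    show "range (\<lambda>k. \<Union>i\<in>G k. X i) \<subseteq> sets M"
      using X GI by (auto intro!: sets.finite_UN simp: G_def) 
    show "incseq (\<lambda>k. \<Union>i\<in>G k. X i)" by (force simp: incseq_def G_def)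
  qed
  moreover have "c / 2 < measure M (\<Union>k. (\<Union>i\<in>G k. X i))" using c by (simp only: UN)
  ultimately have "\<forall>\<^sub>F k in sequentially. c / 2 < measure M (\<Union>i\<in>G k. X i)"
    by (rule order_tendstoD(1))
  then obtain k where "c / 2 < measure M (\<Union>i\<in>G k. X i)" by (auto simp: eventually_sequentially)
  then show thesis using that[of "G k"] GI by (auto simp: G_def)
qed

text \<open>
  By Vitali's covering lemma, disjoint small balls in \<open>U\<close> with centres on the sphere can be chosen so that the
  fivefold balls cover \<open>U \<inter> sphere 0 1\<close>. By the doubling property, finitely many of the disjoint balls already carry
  the fraction \<open>1 - \<theta>\<close> of the measure of \<open>U\<close>, and on these balls the sharp estimate of \<open>surface_measure_cap_lower\<close>
  applies. The rest is open again and has at most the fraction \<open>\<theta>\<close> of the measure. After \<open>m\<close> rounds the crude constant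
  \<open>K\<close> is applied to a remainder of measure \<open>\<theta> ^ m * s U\<close> only.
\<close>

lemma hausdorff_pre_le_surface_measure_open:
  fixes U :: "'a::euclidean_space set"
  assumes U: "open U" and \<delta>: "0 < \<delta>"
  shows "hausdorff_pre (DIM('a) - 1) \<delta> (U \<inter> sphere 0 1) \<le> emeasure surface_measure U"
proof -
  define n where "n = DIM('a) - 1"
  define v where "v = unit_ball_vol (real n)"
  define s where "s = measure (surface_measure :: 'a measure)"
  have s0: "0 \<le> s A" for A by (simp add: s_def)
  have s_mono: "s A \<le> s B" if "A \<subseteq> B" "B \<in> sets borel" for A B
    unfolding s_def using that by (intro surface.finite_measure_mono) auto
  have es: "emeasure surface_measure A = ennreal (s A)" for A :: "'a set"
    unfolding s_def by (rule surface.emeasure_eq_measure)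
  obtain \<theta> K where \<theta>: "0 \<le> \<theta>" "\<theta> < 1" and K: "0 \<le> K"
    and KK: "\<And>(x :: 'a) r. norm x = 1 \<Longrightarrow> 0 < r \<Longrightarrow> r \<le> 1 / 5 \<Longrightarrow> v * (5 * r) ^ n \<le> K * s (cball x r)"
    and \<theta>\<theta>: "\<And>(x :: 'a) r. norm x = 1 \<Longrightarrow> 0 < r \<Longrightarrow> r \<le> 1 / 5 \<Longrightarrow> (1 - \<theta>) * s (cball x (5 * r)) \<le> s (cball x r) / 2"
    by (rule surface_measure_cap_constants[where 'a = 'a, folded n_def v_def s_def]) (rule that)
  have main: "hausdorff_pre n \<delta> (V \<inter> sphere 0 1) \<le> ennreal ((1 + \<eta>) * s V + K * \<theta> ^ m * s V)"
    if \<eta>: "0 < \<eta>" and V: "open V" for \<eta> V m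
  proof -
    have "((\<lambda>r. sqrt (1 + r\<^sup>2) ^ DIM('a)) \<longlongrightarrow> sqrt (1 + 0\<^sup>2) ^ DIM('a)) (at_right 0)"
      by (intro tendsto_intros)
    then have "\<forall>\<^sub>F r in at_right 0. sqrt (1 + r\<^sup>2) ^ DIM('a) < 1 + \<eta>"
      using \<eta> by (intro order_tendstoD(2)) auto
    then obtain r1 where r1: "0 < r1" "\<And>r. 0 < r \<Longrightarrow> r < r1 \<Longrightarrow> sqrt (1 + r\<^sup>2) ^ DIM('a) < 1 + \<eta>"
      by (auto simp: eventually_at_right_field)
    define r0 where "r0 = min (r1 / 2) (min (1 / 5) (\<delta> / 10))"
    have r0: "0 < r0" "r0 < r1" "r0 \<le> 1 / 5" "r0 \<le> \<delta> / 10" using r1(1) \<delta> by (auto simp: r0_def)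
    have cap: "v * r ^ n \<le> (1 + \<eta>) * s (cball x r)" if "norm x = 1" "0 < r" "r \<le> r0" for x :: 'a and r
    proof -
      have "v * r ^ n \<le> sqrt (1 + r\<^sup>2) ^ DIM('a) * s (cball x r)"
        unfolding v_def n_def s_def by (rule surface_measure_cap_lower[OF that(1,2)])
      also have "\<dots> \<le> (1 + \<eta>) * s (cball x r)"
        using r1(2)[of r] that r0 s0 by (intro mult_right_mono) auto
      finally show ?thesis .
    qed
    \<comment> \<open>The radii are bounded by \<open>r0\<close>, so that the sharp cap estimate holds and the fivefold balls have diameter at
      most \<open>\<delta>\<close>.\<close>
    have vitali: "\<exists>C r. countable C \<and> C \<subseteq> W \<inter> sphere 0 1 \<and>
        (\<forall>x\<in>C. 0 < r x \<and> r x \<le> r0 \<and> cball x (r x) \<subseteq> W) \<and>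
        disjoint_family_on (\<lambda>x. cball x (r x)) C \<and> W \<inter> sphere 0 1 \<subseteq> (\<Union>x\<in>C. cball x (5 * r x))"
      if W: "open W" for W :: "'a set"
    proof -
      have "\<forall>x\<in>W \<inter> sphere 0 1. \<exists>r. 0 < r \<and> r \<le> r0 \<and> cball x r \<subseteq> W"
      proof
        fix x assume "x \<in> W \<inter> sphere 0 1"
        then obtain e where e: "0 < e" "cball x e \<subseteq> W" using W open_contains_cball by blast
        then have "cball x (min e r0) \<subseteq> W" by auto
        then show "\<exists>r. 0 < r \<and> r \<le> r0 \<and> cball x r \<subseteq> W"
          using e r0 by (intro exI[of _ "min e r0"]) auto
      qed
      then obtain r where r: "\<And>x. x \<in> W \<inter> sphere 0 1 \<Longrightarrow> 0 < r x \<and> r x \<le> r0 \<and> cball x (r x) \<subseteq> W"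
        by metis
      obtain C where C: "countable C" "C \<subseteq> W \<inter> sphere 0 1"
        "pairwise (\<lambda>i j. disjnt (cball i (r i)) (cball j (r j))) C"
        "\<And>i. i \<in> W \<inter> sphere 0 1 \<Longrightarrow> \<exists>j. j \<in> C \<and> \<not> disjnt (cball i (r i)) (cball j (r j)) \<and> cball i (r i) \<subseteq> ball j (5 * r j)"
      proof (rule Vitali_covering_lemma_cballs_balls[of "W \<inter> sphere 0 1" r r0 "\<lambda>x. x"])
        show "0 < r i \<and> r i \<le> r0" if "i \<in> W \<inter> sphere 0 1" for i using r[OF that] by simp
      qed blast
      have "W \<inter> sphere 0 1 \<subseteq> (\<Union>x\<in>C. cball x (5 * r x))"
      proof
        fix x assume x: "x \<in> W \<inter> sphere 0 1"
        obtain j where j: "j \<in> C" "cball x (r x) \<subseteq> ball j (5 * r j)" using C(4)[OF x] by blast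
        have "x \<in> cball x (r x)" using r[OF x] by simp
        then have "x \<in> cball j (5 * r j)" using j(2) ball_subset_cball by blast
        with j(1) show "x \<in> (\<Union>x\<in>C. cball x (5 * r x))" by blast
      qed
      moreover have "disjoint_family_on (\<lambda>x. cball x (r x)) C"
        using C(3) unfolding disjoint_family_on_def pairwise_def disjnt_def by blast
      ultimately show ?thesis using C(1,2) r by (intro exI[of _ C] exI[of _ r]) blast
    qed
    show ?thesis using V
    proof (induction m arbitrary: V)
      case (0 W)
      obtain C r where CC: "countable C" "C \<subseteq> W \<inter> sphere 0 1"
        "\<forall>x\<in>C. 0 < r x \<and> r x \<le> r0 \<and> cball x (r x) \<subseteq> W"
        "disjoint_family_on (\<lambda>x. cball x (r x)) C" "W \<inter> sphere 0 1 \<subseteq> (\<Union>x\<in>C. cball x (5 * r x))"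
        using vitali[OF 0] by (elim exE conjE) (rule that)
      note C = CC(1,2) CC(3)[rule_format] CC(4,5)
      have "hausdorff_pre n \<delta> (W \<inter> sphere 0 1) \<le> (\<integral>\<^sup>+x. cover_weight n (cball x (5 * r x)) \<partial>count_space C)"
      proof (rule hausdorff_pre_le_countable_cover[OF C(1,5)])
        fix x assume "x \<in> C"
        then show "bounded (cball x (5 * r x)) \<and> diameter (cball x (5 * r x)) \<le> \<delta>"
          using C(3)[of x] r0(4) by (simp add: diameter_cball)
      qed (use \<delta> in simp)
      also have "\<dots> \<le> (\<integral>\<^sup>+x. ennreal K * emeasure surface_measure (cball x (r x)) \<partial>count_space C)"
      proof (rule nn_integral_mono)
        fix x assume "x \<in> space (count_space C)"
        then have x: "x \<in> C" by simp
        then have r: "0 < r x" "r x \<le> r0" "norm x = 1" using C(2,3) by auto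
        have "cover_weight n (cball x (5 * r x)) = ennreal (v * (5 * r x) ^ n)"
          unfolding v_def by (rule cover_weight_cball) (use r in simp)
        also have "\<dots> \<le> ennreal (K * s (cball x (r x)))"
          using KK[OF r(3,1)] r r0 by (intro ennreal_leI) auto
        also have "\<dots> = ennreal K * emeasure surface_measure (cball x (r x))"
          unfolding es using K s0 by (rule ennreal_mult)
        finally show "cover_weight n (cball x (5 * r x)) \<le> ennreal K * emeasure surface_measure (cball x (r x))" .
      qed
      also have "\<dots> = ennreal K * (\<integral>\<^sup>+x. emeasure surface_measure (cball x (r x)) \<partial>count_space C)"
        by (rule nn_integral_cmult) simp
      also have "(\<integral>\<^sup>+x. emeasure surface_measure (cball x (r x)) \<partial>count_space C)
          = emeasure surface_measure (\<Union>x\<in>C. cball x (r x))"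
        using C(1,4) by (intro emeasure_UN_countable[symmetric]) auto
      also have "ennreal K * emeasure surface_measure (\<Union>x\<in>C. cball x (r x)) \<le> ennreal K * emeasure surface_measure W"
        using C(3) 0 by (intro mult_left_mono emeasure_mono) auto
      also have "ennreal K * emeasure surface_measure W = ennreal (K * s W)"
        unfolding es using K s0 by (rule ennreal_mult[symmetric])
      also have "\<dots> \<le> ennreal ((1 + \<eta>) * s W + K * \<theta> ^ 0 * s W)"
        using \<eta> s0[of W] by (intro ennreal_leI) simp
      finally show ?case .
    next
      case (Suc m W)
      obtain C r where CC: "countable C" "C \<subseteq> W \<inter> sphere 0 1"
        "\<forall>x\<in>C. 0 < r x \<and> r x \<le> r0 \<and> cball x (r x) \<subseteq> W"
        "disjoint_family_on (\<lambda>x. cball x (r x)) C" "W \<inter> sphere 0 1 \<subseteq> (\<Union>x\<in>C. cball x (5 * r x))"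
        using vitali[OF Suc.prems] by (elim exE conjE) (rule that)
      note C = CC(1,2) CC(3)[rule_format] CC(4,5)
      have Wb: "W \<in> sets borel" using Suc.prems by simp
      have CW: "s (\<Union>x\<in>C. cball x (r x)) \<ge> 2 * (1 - \<theta>) * s W"
      proof -
        have "ennreal (s W) = emeasure surface_measure (W \<inter> sphere 0 1)"
          using Wb surface_measure_Int_sphere[OF Wb] by (simp add: es s_def)
        also have "\<dots> \<le> emeasure surface_measure (\<Union>x\<in>C. cball x (5 * r x))"
          using C(1,5) by (intro emeasure_mono) (auto intro: sets.countable_UN')
        also have "\<dots> \<le> (\<integral>\<^sup>+x. emeasure surface_measure (cball x (5 * r x)) \<partial>count_space C)"
          by (rule emeasure_UN_le_count_space[OF C(1)]) auto
        also have "\<dots> \<le> (\<integral>\<^sup>+x. ennreal (1 / (2 * (1 - \<theta>))) * emeasure surface_measure (cball x (r x)) \<partial>count_space C)"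
        proof (rule nn_integral_mono)
          fix x assume "x \<in> space (count_space C)"
          then have x: "x \<in> C" by simp
          then have r: "0 < r x" "r x \<le> r0" "norm x = 1" using C(2,3) by auto
          have "s (cball x (5 * r x)) \<le> 1 / (2 * (1 - \<theta>)) * s (cball x (r x))"
            using \<theta>\<theta>[OF r(3,1)] r r0 \<theta> by (simp add: field_simps)
          then have "ennreal (s (cball x (5 * r x))) \<le> ennreal (1 / (2 * (1 - \<theta>))) * ennreal (s (cball x (r x)))"
            using \<theta> s0 by (subst ennreal_mult[symmetric]) (auto intro: ennreal_leI)
          then show "emeasure surface_measure (cball x (5 * r x)) \<le> ennreal (1 / (2 * (1 - \<theta>))) * emeasure surface_measure (cball x (r x))"
            by (simp only: es)
        qed
        also have "\<dots> = ennreal (1 / (2 * (1 - \<theta>))) * (\<integral>\<^sup>+x. emeasure surface_measure (cball x (r x)) \<partial>count_space C)"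
          by (rule nn_integral_cmult) simp
        also have "(\<integral>\<^sup>+x. emeasure surface_measure (cball x (r x)) \<partial>count_space C)
            = emeasure surface_measure (\<Union>x\<in>C. cball x (r x))"
          using C(1,4) by (intro emeasure_UN_countable[symmetric]) auto
        also have "ennreal (1 / (2 * (1 - \<theta>))) * emeasure surface_measure (\<Union>x\<in>C. cball x (r x))
            = ennreal (1 / (2 * (1 - \<theta>)) * s (\<Union>x\<in>C. cball x (r x)))"
          unfolding es using \<theta> s0 by (intro ennreal_mult[symmetric]) auto
        finally have "s W \<le> 1 / (2 * (1 - \<theta>)) * s (\<Union>x\<in>C. cball x (r x))"
          using \<theta> s0 by (subst (asm) ennreal_le_iff) auto
        then show ?thesis using \<theta> by (simp add: field_simps)
      qed
      have "\<exists>F. finite F \<and> F \<subseteq> C \<and> (1 - \<theta>) * s W \<le> s (\<Union>x\<in>F. cball x (r x))"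
      proof (cases "s W = 0")
        case True
        then show ?thesis by (intro exI[of _ "{}"]) (simp add: s_def)
      next
        case False
        then have "0 < 2 * (1 - \<theta>) * s W" using \<theta> s0[of W] by (simp add: order_less_le)
        then obtain F where "finite F" "F \<subseteq> C" "2 * (1 - \<theta>) * s W / 2 \<le> s (\<Union>x\<in>F. cball x (r x))"
          using finite_subunion_half[OF finite_measure_surface_measure C(1), of "\<lambda>x. cball x (r x)" "2 * (1 - \<theta>) * s W"] CW
          unfolding s_def by auto
        then show ?thesis by (intro exI[of _ F]) (simp add: algebra_simps)
      qed
      then obtain F where F: "finite F" "F \<subseteq> C" "(1 - \<theta>) * s W \<le> s (\<Union>x\<in>F. cball x (r x))" by blast
      define B where "B = (\<Union>x\<in>F. cball x (r x))"
      have B: "closed B" "B \<subseteq> W" using F C(3) by (auto simp: B_def intro!: closed_UN)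
      then have Bb: "B \<in> sets borel" by simp
      have W': "open (W - B)" using Suc.prems B(1) by (rule open_Diff)
      have sW': "s (W - B) = s W - s B"
        unfolding s_def using B(2) Wb Bb by (intro surface.finite_measure_Diff) auto
      have sB: "s B = (\<Sum>x\<in>F. s (cball x (r x)))"
        unfolding s_def B_def using F(1,2) C(4)
        by (intro surface.finite_measure_finite_Union) (auto intro: disjoint_family_on_mono)
      have "hausdorff_pre n \<delta> B \<le> (\<integral>\<^sup>+x. cover_weight n (cball x (r x)) \<partial>count_space F)"
      proof (rule hausdorff_pre_le_countable_cover)
        fix x assume "x \<in> F"
        then show "bounded (cball x (r x)) \<and> diameter (cball x (r x)) \<le> \<delta>"
          using C(3)[of x] F(2) r0(4) \<delta> by (auto simp: diameter_cball)
      qed (use F(1) \<delta> in \<open>auto simp: B_def countable_finite\<close>)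
      also have "\<dots> = (\<Sum>x\<in>F. cover_weight n (cball x (r x)))"
        by (rule nn_integral_count_space_finite[OF F(1)])
      also have "\<dots> \<le> (\<Sum>x\<in>F. ennreal ((1 + \<eta>) * s (cball x (r x))))"
      proof (rule sum_mono)
        fix x assume "x \<in> F"
        then have r: "0 < r x" "r x \<le> r0" "norm x = 1" using C(2,3) F(2) by auto
        have "cover_weight n (cball x (r x)) = ennreal (v * r x ^ n)"
          unfolding v_def by (rule cover_weight_cball) (use r in simp)
        also have "\<dots> \<le> ennreal ((1 + \<eta>) * s (cball x (r x)))"
          using cap[OF r(3,1,2)] by (rule ennreal_leI)
        finally show "cover_weight n (cball x (r x)) \<le> ennreal ((1 + \<eta>) * s (cball x (r x)))" .
      qed
      also have "\<dots> = ennreal (\<Sum>x\<in>F. (1 + \<eta>) * s (cball x (r x)))"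
        using \<eta> s0 by (intro sum_ennreal) auto
      also have "(\<Sum>x\<in>F. (1 + \<eta>) * s (cball x (r x))) = (1 + \<eta>) * s B"
        by (simp add: sB sum_distrib_left)
      finally have preB: "hausdorff_pre n \<delta> B \<le> ennreal ((1 + \<eta>) * s B)" .
      have "hausdorff_pre n \<delta> (W \<inter> sphere 0 1) \<le> hausdorff_pre n \<delta> (B \<union> ((W - B) \<inter> sphere 0 1))"
        by (rule hausdorff_pre_mono) auto
      also have "\<dots> \<le> hausdorff_pre n \<delta> B + hausdorff_pre n \<delta> ((W - B) \<inter> sphere 0 1)"
        by (rule hausdorff_pre_Un) (use \<delta> in simp)
      also have "\<dots> \<le> ennreal ((1 + \<eta>) * s B) + ennreal ((1 + \<eta>) * s (W - B) + K * \<theta> ^ m * s (W - B))"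
        by (rule add_mono[OF preB Suc.IH[OF W']])
      also have "\<dots> = ennreal ((1 + \<eta>) * s B + ((1 + \<eta>) * s (W - B) + K * \<theta> ^ m * s (W - B)))"
        using \<eta> s0 K \<theta> by (intro ennreal_plus[symmetric]) auto
      also have "\<dots> \<le> ennreal ((1 + \<eta>) * s W + K * \<theta> ^ Suc m * s W)"
      proof (rule ennreal_leI)
        have "s (W - B) \<le> \<theta> * s W" using F(3) unfolding sW' B_def[symmetric] by (simp add: algebra_simps)
        then have "K * \<theta> ^ m * s (W - B) \<le> K * \<theta> ^ m * (\<theta> * s W)"
          using K \<theta> by (intro mult_left_mono) auto
        then show "(1 + \<eta>) * s B + ((1 + \<eta>) * s (W - B) + K * \<theta> ^ m * s (W - B)) \<le> (1 + \<eta>) * s W + K * \<theta> ^ Suc m * s W"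
          unfolding sW' by (simp add: algebra_simps)
      qed
      finally show ?case .
    qed
  qed
  have "hausdorff_pre n \<delta> (U \<inter> sphere 0 1) \<le> ennreal ((1 + \<eta>) * s U)" if \<eta>: "0 < \<eta>" for \<eta>
  proof (rule LIMSEQ_le_const)
    have "(\<lambda>m. (1 + \<eta>) * s U + K * \<theta> ^ m * s U) \<longlonglongrightarrow> (1 + \<eta>) * s U + K * 0 * s U"
      using \<theta> by (intro tendsto_intros LIMSEQ_power_zero) auto
    then show "(\<lambda>m. ennreal ((1 + \<eta>) * s U + K * \<theta> ^ m * s U)) \<longlonglongrightarrow> ennreal ((1 + \<eta>) * s U)"
      by (intro tendsto_ennrealI) simp
    show "\<exists>N. \<forall>m\<ge>N. hausdorff_pre n \<delta> (U \<inter> sphere 0 1) \<le> ennreal ((1 + \<eta>) * s U + K * \<theta> ^ m * s U)"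
      using main[OF \<eta> U] by blast
  qed
  then have "hausdorff_pre n \<delta> (U \<inter> sphere 0 1) \<le> ennreal (s U)"
  proof (intro LIMSEQ_le_const[where X = "\<lambda>k. ennreal ((1 + 1 / real (Suc k)) * s U)"])
    have "(\<lambda>k. (1 + 1 / real (Suc k)) * s U) \<longlonglongrightarrow> (1 + 0) * s U"
      by (intro tendsto_intros LIMSEQ_Suc[OF lim_1_over_n])
    then show "(\<lambda>k. ennreal ((1 + 1 / real (Suc k)) * s U)) \<longlonglongrightarrow> ennreal (s U)"
      by (intro tendsto_ennrealI) simp
  qed auto
  then show ?thesis by (simp add: es n_def)
qed

text \<open>
  Outer regularity reduces the estimate to open sets. The direction of the inequality suits lower bounds of the nonlocal
  energy: integrals of non-negative functions over the angular measures are at most integrals in polar coordinates.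
\<close>

lemma hausdorff_measure_le_surface_measure:
  fixes E :: "'a::euclidean_space set"
  assumes E: "E \<in> sets borel" "E \<subseteq> sphere 0 1"
  shows "emeasure (hausdorff_measure (DIM('a) - 1)) E \<le> emeasure surface_measure E"
proof -
  have "hausdorff_pre (DIM('a) - 1) \<delta> E \<le> emeasure surface_measure E" if "0 < \<delta>" for \<delta>
  proof -
    have "hausdorff_pre (DIM('a) - 1) \<delta> E \<le> emeasure surface_measure U" if "open U" "E \<subseteq> U" for U
    proof -
      have "hausdorff_pre (DIM('a) - 1) \<delta> E \<le> hausdorff_pre (DIM('a) - 1) \<delta> (U \<inter> sphere 0 1)"
        using that E(2) by (intro hausdorff_pre_mono) auto
      also have "\<dots> \<le> emeasure surface_measure U"
        by (rule hausdorff_pre_le_surface_measure_open[OF that(1) \<open>0 < \<delta>\<close>])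
      finally show ?thesis .
    qed
    then have "hausdorff_pre (DIM('a) - 1) \<delta> E \<le> (INF U \<in> {U. E \<subseteq> U \<and> open U}. emeasure surface_measure U)"
      by (intro INF_greatest) auto
    also have "\<dots> = emeasure surface_measure E"
      using E(1) by (intro outer_regular[symmetric]) auto
    finally show ?thesis .
  qed
  then have "hausdorff_outer (DIM('a) - 1) E \<le> emeasure surface_measure E"
    unfolding hausdorff_outer_def by (intro SUP_least) auto
  then show ?thesis
    \<comment> \<open>A measure built from a set function takes its values, or is \<open>0\<close> if the set function is not
      countably additive; the bound holds in both cases.\<close>
    unfolding hausdorff_measure_def by (simp add: emeasure_measure_of_conv)
qed

section \<open>Gradients as densities\<close>

text \<open>
  A common form for the gradients of \<open>W\<^sup>1\<^sup>p\<close> and \<open>BV\<close> functions: the distributional gradient is \<open>h\<close> times a measure \<open>M\<close>,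
  which is Lebesgue measure for \<open>p > 1\<close> and some finite measure for \<open>p = 1\<close>. Most of the proof then treats all exponents
  alike.
\<close>

definition gradient_density ::
    "real \<Rightarrow> ('a::euclidean_space \<Rightarrow> real) \<Rightarrow> 'a measure \<Rightarrow> ('a \<Rightarrow> 'a) \<Rightarrow> bool" where
  "gradient_density p u M h \<longleftrightarrow> sets M = sets borel \<and> (if p = 1 then finite_measure M else M = lborel) \<and>
     h \<in> borel_measurable borel \<and> integrable M (\<lambda>x. norm (h x) powr p) \<and>
     (\<forall>\<psi>\<in>test_functions. \<forall>\<sigma>. (\<integral>x. u x * frechet_derivative \<psi> (at x) \<sigma> \<partial>lborel) = - (\<integral>x. \<psi> x * (\<sigma> \<bullet> h x) \<partial>M))"

lemma gradient_densityD:
  assumes "gradient_density p u M h"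
  shows "sets M = sets borel" "h \<in> borel_measurable borel" "h \<in> borel_measurable M"
    "integrable M (\<lambda>x. norm (h x) powr p)"
    "\<psi> \<in> test_functions \<Longrightarrow> (\<integral>x. u x * frechet_derivative \<psi> (at x) \<sigma> \<partial>lborel) = - (\<integral>x. \<psi> x * (\<sigma> \<bullet> h x) \<partial>M)"
proof -
  show s: "sets M = sets borel" and h: "h \<in> borel_measurable borel"
    and "integrable M (\<lambda>x. norm (h x) powr p)"
    using assms by (simp_all add: gradient_density_def)
  show "h \<in> borel_measurable M" using h measurable_cong_sets[OF s refl] by blast
  show "\<psi> \<in> test_functions \<Longrightarrow> (\<integral>x. u x * frechet_derivative \<psi> (at x) \<sigma> \<partial>lborel) = - (\<integral>x. \<psi> x * (\<sigma> \<bullet> h x) \<partial>M)"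
    using assms by (simp add: gradient_density_def)
qed

lemma gradient_density_ball_finite:
  assumes "gradient_density p u M h"
  shows "emeasure M (ball c r) < \<top>"
proof (cases "p = 1")
  case True
  then interpret finite_measure M using assms by (simp add: gradient_density_def)
  show ?thesis by (simp add: emeasure_eq_measure)
next
  case False
  then have "M = lborel" using assms by (simp add: gradient_density_def)
  then show ?thesis using emeasure_bounded_finite[of "ball c r"] by simp
qed

lemma le_one_plus_powr:
  fixes x p :: real
  assumes "1 \<le> p" "0 \<le> x"
  shows "x \<le> 1 + x powr p"
proof (cases "x \<le> 1")
  case False
  then have "x powr 1 \<le> x powr p" using assms by (intro powr_mono) auto
  then show ?thesis using False by simp
qed (use assms in \<open>auto intro: order_trans[of _ 1]\<close>)

lemma integrable_bounded_mult_powr: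
  fixes f :: "'a::euclidean_space \<Rightarrow> 'b::euclidean_space" and \<phi> g :: "'a \<Rightarrow> real"
  assumes p: "1 \<le> p" and M: "sets M = sets borel" "emeasure M (ball 0 R) < \<top>"
    and f: "f \<in> borel_measurable M" "integrable M (\<lambda>x. norm (f x) powr p)"
    and \<phi>: "\<phi> \<in> borel_measurable M" "\<And>x. \<bar>\<phi> x\<bar> \<le> K" "\<And>x. R \<le> norm x \<Longrightarrow> \<phi> x = 0"
    and g: "g \<in> borel_measurable M" "\<And>x. \<bar>g x\<bar> \<le> L * norm (f x)"
  shows "integrable M (\<lambda>x. \<phi> x * g x)"
proof (rule Bochner_Integration.integrable_bound)
  have K: "0 \<le> K" using \<phi>(2)[of 0] by linarith
  have ib: "integrable M (\<lambda>x. indicator (ball 0 R) x :: real)"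
    using M by (intro integrable_real_indicator) auto
  show "integrable M (\<lambda>x. K * \<bar>L\<bar> * (indicator (ball 0 R) x + norm (f x) powr p))"
    using ib f(2) by (intro integrable_mult_right Bochner_Integration.integrable_add)
  show "(\<lambda>x. \<phi> x * g x) \<in> borel_measurable M" using \<phi>(1) g(1) by simp
  show "AE x in M. norm (\<phi> x * g x) \<le> norm (K * \<bar>L\<bar> * (indicator (ball 0 R) x + norm (f x) powr p))"
  proof (rule AE_I2)
    fix x
    have "\<bar>\<phi> x\<bar> * \<bar>g x\<bar> \<le> K * \<bar>L\<bar> * (indicator (ball 0 R) x + norm (f x) powr p)"
    proof (cases "norm x < R")
      case True
      have "\<bar>g x\<bar> \<le> \<bar>L\<bar> * norm (f x)"
        using g(2)[of x] by (rule order_trans) (intro mult_right_mono, auto)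
      also have "\<dots> \<le> \<bar>L\<bar> * (1 + norm (f x) powr p)"
        using le_one_plus_powr[OF p] by (intro mult_left_mono) auto
      finally have "\<bar>\<phi> x\<bar> * \<bar>g x\<bar> \<le> K * (\<bar>L\<bar> * (1 + norm (f x) powr p))"
        using \<phi>(2)[of x] K by (intro mult_mono) auto
      then show ?thesis using True by (simp add: mult.assoc)
    qed (use \<phi>(3)[of x] K in \<open>simp add: not_less\<close>)
    then show "norm (\<phi> x * g x) \<le> norm (K * \<bar>L\<bar> * (indicator (ball 0 R) x + norm (f x) powr p))"
      unfolding real_norm_def abs_mult[of "\<phi> x"] by (rule order_trans[OF _ abs_ge_self])
  qed
qed

lemma Lp_lborelD:
  assumes "u \<in> Lp lborel p"
  shows "u \<in> borel_measurable borel" "integrable lborel (\<lambda>x. norm (u x) powr p)"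
  using assms by (simp_all add: Lp_def)

lemma test_function_bounded:
  assumes "\<psi> \<in> test_functions"
  obtains K where "0 < K" "\<And>x. \<bar>\<psi> x\<bar> \<le> K"
proof -
  obtain R where R: "0 < R" "\<And>x. R \<le> norm x \<Longrightarrow> \<psi> x = 0"
    using test_function_support[OF assms] by blast
  show thesis
    using continuous_on_vanishing_bounded[OF test_function_continuous[OF assms], of R] R(2) that by blast
qed

lemma test_function_derivative_vanishes:
  assumes "\<psi> \<in> test_functions" "\<And>x. R \<le> norm x \<Longrightarrow> \<psi> x = 0" "R + 1 \<le> norm x"
  shows "frechet_derivative \<psi> (at x) h = 0"
proof (rule test_function_derivative_outside[OF assms(1), of "- cball 0 R"])
  show "\<psi> y = 0" if "y \<in> - cball 0 R" for y using that assms(2)[of y] by simp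
qed (use assms(3) in auto)

lemma test_function_derivative_borel:
  assumes "\<psi> \<in> test_functions"
  shows "(\<lambda>x. frechet_derivative \<psi> (at x) h) \<in> borel_measurable borel"
  unfolding test_function_derivative_sum[OF assms, of _ h]
  by (intro borel_measurable_sum borel_measurable_times borel_measurable_const
      borel_measurable_continuous_onI test_function_partial_continuous[OF assms])

lemma integrable_mult_test_derivative:
  fixes u :: "'a::euclidean_space \<Rightarrow> real"
  assumes p: "1 \<le> p" and u: "u \<in> Lp lborel p" and \<psi>: "\<psi> \<in> test_functions"
  shows "integrable lborel (\<lambda>x. u x * frechet_derivative \<psi> (at x) h)"
proof -
  obtain R where R: "0 < R" "\<And>x. R \<le> norm x \<Longrightarrow> \<psi> x = 0"
    using test_function_support[OF \<psi>] by blast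
  obtain L where L: "0 < L" "\<And>x h. \<bar>frechet_derivative \<psi> (at x) h\<bar> \<le> L * norm h"
    by (rule test_function_Lipschitz[OF \<psi>]) (rule that)
  have "integrable lborel (\<lambda>x. frechet_derivative \<psi> (at x) h * u x)"
  proof (rule integrable_bounded_mult_powr[OF p, where R = "R + 1" and f = u and K = "L * norm h" and L = 1])
    show "emeasure lborel (ball (0::'a) (R + 1)) < \<top>"
      using emeasure_bounded_finite[of "ball (0::'a) (R + 1)"] by simp
    show "frechet_derivative \<psi> (at x) h = 0" if "R + 1 \<le> norm x" for x
      by (rule test_function_derivative_vanishes[OF \<psi> _ that]) (rule R(2))
  qed (use Lp_lborelD[OF u] L test_function_derivative_borel[OF \<psi>] in auto)
  then show ?thesis by (simp add: mult.commute)
qed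

lemma integrable_test_mult_gradient:
  fixes h :: "'a::euclidean_space \<Rightarrow> 'a"
  assumes p: "1 \<le> p" and M: "sets M = sets borel" "\<And>R. emeasure M (ball 0 R) < \<top>"
    and h: "h \<in> borel_measurable M" "integrable M (\<lambda>x. norm (h x) powr p)" and \<psi>: "\<psi> \<in> test_functions"
  shows "integrable M (\<lambda>x. \<psi> x * (\<sigma> \<bullet> h x))"
proof -
  obtain R where R: "0 < R" "\<And>x. R \<le> norm x \<Longrightarrow> \<psi> x = 0"
    using test_function_support[OF \<psi>] by blast
  obtain K where K: "0 < K" "\<And>x. \<bar>\<psi> x\<bar> \<le> K" using test_function_bounded[OF \<psi>] by blast
  have m: "\<psi> \<in> borel_measurable M"
    using borel_measurable_continuous_onI[OF test_function_continuous[OF \<psi>]] measurable_cong_sets[OF M(1) refl] by blast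
  show ?thesis
  proof (rule integrable_bounded_mult_powr[OF p M(1) M(2)[of R] h m K(2), where L = "norm \<sigma>"])
    show "(\<lambda>x. \<sigma> \<bullet> h x) \<in> borel_measurable M" using h(1) by simp
    show "\<bar>\<sigma> \<bullet> h x\<bar> \<le> norm \<sigma> * norm (h x)" for x by (rule Cauchy_Schwarz_ineq2)
  qed (rule R(2))
qed

text \<open>
  Both definitions of a gradient test the partial derivatives only; linearity gives all directions.
\<close>

lemma gradient_density_from_partials:
  fixes u :: "'a::euclidean_space \<Rightarrow> real"
  assumes p: "1 \<le> p" and u: "u \<in> Lp lborel p" and M: "sets M = sets borel"
    and fin: "if p = 1 then finite_measure M else M = lborel"
    and h: "h \<in> borel_measurable borel" "integrable M (\<lambda>x. norm (h x) powr p)"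
    and eq: "\<And>\<psi> b. \<psi> \<in> test_functions \<Longrightarrow> b \<in> Basis \<Longrightarrow>
      (\<integral>x. u x * frechet_derivative \<psi> (at x) b \<partial>lborel) = - (\<integral>x. \<psi> x * (b \<bullet> h x) \<partial>M)"
  shows "gradient_density p u M h"
proof -
  have hM: "h \<in> borel_measurable M" using h(1) measurable_cong_sets[OF M refl] by blast
  have balls: "emeasure M (ball 0 R) < \<top>" for R
  proof (cases "p = 1")
    case True
    then interpret finite_measure M using fin by simp
    show ?thesis by (simp add: emeasure_eq_measure)
  next
    case False
    then show ?thesis using fin emeasure_bounded_finite[of "ball (0::'a) R"] by simp
  qed
  have "(\<integral>x. u x * frechet_derivative \<psi> (at x) \<sigma> \<partial>lborel) = - (\<integral>x. \<psi> x * (\<sigma> \<bullet> h x) \<partial>M)"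
    if \<psi>: "\<psi> \<in> test_functions" for \<psi> \<sigma>
  proof -
    have "(\<integral>x. u x * frechet_derivative \<psi> (at x) \<sigma> \<partial>lborel)
        = (\<integral>x. (\<Sum>b\<in>Basis. (\<sigma> \<bullet> b) * (u x * frechet_derivative \<psi> (at x) b)) \<partial>lborel)"
      by (subst test_function_derivative_sum[OF \<psi>]) (simp add: sum_distrib_left mult_ac)
    also have "\<dots> = (\<Sum>b\<in>Basis. (\<integral>x. (\<sigma> \<bullet> b) * (u x * frechet_derivative \<psi> (at x) b) \<partial>lborel))"
      by (intro Bochner_Integration.integral_sum integrable_mult_right integrable_mult_test_derivative[OF p u \<psi>])
    also have "\<dots> = (\<Sum>b\<in>Basis. - (\<integral>x. (\<sigma> \<bullet> b) * (\<psi> x * (b \<bullet> h x)) \<partial>M))"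
      by (intro sum.cong refl) (simp add: eq[OF \<psi>])
    also have "\<dots> = - (\<integral>x. (\<Sum>b\<in>Basis. (\<sigma> \<bullet> b) * (\<psi> x * (b \<bullet> h x))) \<partial>M)"
      unfolding sum_negf
      by (intro arg_cong[where f = uminus] Bochner_Integration.integral_sum[symmetric] integrable_mult_right
          integrable_test_mult_gradient[OF p M balls hM h(2) \<psi>])
    also have "(\<lambda>x. \<Sum>b\<in>Basis. (\<sigma> \<bullet> b) * (\<psi> x * (b \<bullet> h x))) = (\<lambda>x. \<psi> x * (\<sigma> \<bullet> h x))"
      by (simp add: fun_eq_iff euclidean_inner[of \<sigma>] sum_distrib_left mult_ac inner_commute)
    finally show ?thesis .
  qed
  then show ?thesis using M fin h by (simp add: gradient_density_def)
qed

text \<open>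
  For \<open>p = 1\<close> the density comes from \<open>vector_measure_density\<close>; it turns the variation of \<open>\<sigma> \<bullet> D\<close> into \<open>\<bar>\<sigma> \<bullet> h\<bar>\<close> times \<open>M\<close>.
\<close>

lemma gradient_density_exists:
  fixes u :: "'a::euclidean_space \<Rightarrow> real"
  assumes p: "1 \<le> p" and u: "u \<in> Sp p"
  obtains M h where "gradient_density p u M h"
    "\<And>\<mu> w0. continuous_on UNIV w0 \<Longrightarrow> (\<And>x. 0 \<le> w0 x) \<Longrightarrow> local_energy p w0 \<mu> u
      = (\<integral>\<^sup>+\<sigma>. (\<integral>\<^sup>+x. ennreal (w0 x * \<bar>\<sigma> \<bullet> h x\<bar> powr p) \<partial>M) \<partial>\<mu>)"
proof (cases "p = 1")
  case True
  have uBV: "u \<in> Lp lborel 1" "\<exists>D. has_measure_gradient u D"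
    using u True by (auto simp: Sp_def BV_def)
  define D where "D = measure_gradient u"
  have D: "has_measure_gradient u D"
    unfolding D_def measure_gradient_def using uBV(2) by (rule someI_ex)
  then have vm: "vector_measure D" by (simp add: has_measure_gradient_def)
  obtain M h where Mh: "finite_measure M" "sets M = sets borel" "integrable M h"
    "\<And>E \<sigma>. E \<in> sets borel \<Longrightarrow> D E \<bullet> \<sigma> = (\<integral>x. indicator E x * (h x \<bullet> \<sigma>) \<partial>M)"
    using vector_measure_density[OF vm] by blast
  have hb: "h \<in> borel_measurable borel"
    using borel_measurable_integrable[OF Mh(3)] measurable_cong_sets[OF Mh(2) refl] by blast
  have ints: "integrable M (\<lambda>x. h x \<bullet> \<sigma>)" for \<sigma> using Mh(3) by simp
  have grad: "gradient_density p u M h"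
  proof (rule gradient_density_from_partials[OF p _ Mh(2) _ hb])
    show "u \<in> Lp lborel p" using uBV True by simp
    show "if p = 1 then finite_measure M else M = lborel" using Mh True by simp
    show "integrable M (\<lambda>x. norm (h x) powr p)" using Mh(3) True by simp
    fix \<psi> :: "'a \<Rightarrow> real" and b :: 'a assume \<psi>: "\<psi> \<in> test_functions" and b: "b \<in> Basis"
    obtain K where K: "0 < K" "\<And>x. \<bar>\<psi> x\<bar> \<le> K" using test_function_bounded[OF \<psi>] by blast
    have "signed_integral (\<lambda>E. D E \<bullet> b) \<psi> = (\<integral>x. \<psi> x * (h x \<bullet> b) \<partial>M)"
      by (rule signed_integral_density[OF Mh(2) ints Mh(4) borel_measurable_continuous_onI[OF test_function_continuous[OF \<psi>]] K(2)])
    then show "(\<integral>x. u x * frechet_derivative \<psi> (at x) b \<partial>lborel) = - (\<integral>x. \<psi> x * (b \<bullet> h x) \<partial>M)"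
      using D \<psi> b by (simp add: has_measure_gradient_def inner_commute)
  qed
  have "local_energy p w0 \<mu> u = (\<integral>\<^sup>+\<sigma>. (\<integral>\<^sup>+x. ennreal (w0 x * \<bar>\<sigma> \<bullet> h x\<bar> powr p) \<partial>M) \<partial>\<mu>)"
    if w0: "continuous_on UNIV w0" "\<And>x. 0 \<le> w0 x" for \<mu> w0
  proof -
    have w0m: "w0 \<in> borel_measurable M"
      using borel_measurable_continuous_onI[OF w0(1)] measurable_cong_sets[OF Mh(2) refl] by blast
    have "(\<integral>\<^sup>+x. ennreal (w0 x) \<partial>variation_measure (\<lambda>E. \<sigma> \<bullet> D E))
        = (\<integral>\<^sup>+x. ennreal (w0 x * \<bar>\<sigma> \<bullet> h x\<bar> powr p) \<partial>M)" for \<sigma>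
    proof -
      have "variation_measure (\<lambda>E. \<sigma> \<bullet> D E) = density M (\<lambda>x. ennreal \<bar>h x \<bullet> \<sigma>\<bar>)"
        by (rule variation_measure_density[OF Mh(2) ints]) (simp add: inner_commute[of \<sigma>] Mh(4))
      then have "(\<integral>\<^sup>+x. ennreal (w0 x) \<partial>variation_measure (\<lambda>E. \<sigma> \<bullet> D E))
          = (\<integral>\<^sup>+x. ennreal \<bar>h x \<bullet> \<sigma>\<bar> * ennreal (w0 x) \<partial>M)"
        using w0m Mh(3) by (simp add: nn_integral_density)
      also have "\<dots> = (\<integral>\<^sup>+x. ennreal (w0 x * \<bar>\<sigma> \<bullet> h x\<bar> powr p) \<partial>M)"
        using w0(2) True by (intro nn_integral_cong) (simp add: ennreal_mult[symmetric] inner_commute mult.commute)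
      finally show ?thesis .
    qed
    then show ?thesis using True by (simp add: local_energy_def D_def)
  qed
  with grad show thesis by (rule that)
next
  case False
  have uW: "u \<in> Lp lborel p" "\<exists>g. g \<in> Lp lborel p \<and> has_weak_gradient u g"
    using u False by (auto simp: Sp_def W1p_def)
  define g where "g = weak_gradient p u"
  have g: "g \<in> Lp lborel p" "has_weak_gradient u g"
    unfolding g_def weak_gradient_def using someI_ex[OF uW(2)] by auto
  have grad: "gradient_density p u lborel g"
  proof (rule gradient_density_from_partials[OF p uW(1)])
    fix \<psi> :: "'a \<Rightarrow> real" and b :: 'a assume "\<psi> \<in> test_functions" "b \<in> Basis"
    then show "(\<integral>x. u x * frechet_derivative \<psi> (at x) b \<partial>lborel) = - (\<integral>x. \<psi> x * (b \<bullet> g x) \<partial>lborel)"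
      using g(2) by (simp add: has_weak_gradient_def inner_commute mult.commute)
  qed (use Lp_lborelD[OF g(1)] False in auto)
  have "local_energy p w0 \<mu> u = (\<integral>\<^sup>+\<sigma>. (\<integral>\<^sup>+x. ennreal (w0 x * \<bar>\<sigma> \<bullet> g x\<bar> powr p) \<partial>lborel) \<partial>\<mu>)" for \<mu> w0
    using False by (simp add: local_energy_def g_def)
  with grad show thesis by (rule that)
qed

definition directional_energy ::
    "real \<Rightarrow> ('a::euclidean_space \<Rightarrow> real) \<Rightarrow> 'a measure \<Rightarrow> ('a \<Rightarrow> 'a) \<Rightarrow> 'a \<Rightarrow> real" where
  "directional_energy p w0 M h \<sigma> = (\<integral>x. w0 x * \<bar>\<sigma> \<bullet> h x\<bar> powr p \<partial>M)"

lemma directional_energy_integrable: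
  fixes w0 :: "'a::euclidean_space \<Rightarrow> real"
  assumes p: "1 \<le> p" and grad: "gradient_density p u M h"
    and w0: "continuous_on UNIV w0" "\<And>x. \<bar>w0 x\<bar> \<le> K"
  shows "integrable M (\<lambda>x. w0 x * \<bar>\<sigma> \<bullet> h x\<bar> powr p)"
    "\<bar>w0 x * \<bar>\<sigma> \<bullet> h x\<bar> powr p\<bar> \<le> K * (norm \<sigma> powr p * norm (h x) powr p)"
proof -
  note gd = gradient_densityD[OF grad]
  note [measurable] = gd(3)
  have [measurable]: "w0 \<in> borel_measurable M"
    using borel_measurable_continuous_onI[OF w0(1)] measurable_cong_sets[OF gd(1) refl] by blast
  have bound: "\<bar>w0 x * \<bar>\<sigma> \<bullet> h x\<bar> powr p\<bar> \<le> K * (norm \<sigma> powr p * norm (h x) powr p)" for x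
  proof -
    have "\<bar>\<sigma> \<bullet> h x\<bar> powr p \<le> (norm \<sigma> * norm (h x)) powr p"
      using p Cauchy_Schwarz_ineq2[of \<sigma> "h x"] by (intro powr_mono2) auto
    then have "\<bar>\<sigma> \<bullet> h x\<bar> powr p \<le> norm \<sigma> powr p * norm (h x) powr p" by (simp add: powr_mult)
    then show ?thesis
      unfolding abs_mult using w0(2)[of x] by (intro mult_mono) (auto intro: order_trans[OF abs_ge_zero])
  qed
  then show "\<bar>w0 x * \<bar>\<sigma> \<bullet> h x\<bar> powr p\<bar> \<le> K * (norm \<sigma> powr p * norm (h x) powr p)" .
  show "integrable M (\<lambda>x. w0 x * \<bar>\<sigma> \<bullet> h x\<bar> powr p)"
  proof (rule Bochner_Integration.integrable_bound)
    show "integrable M (\<lambda>x. K * (norm \<sigma> powr p * norm (h x) powr p))"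
      using gd(4) by (intro integrable_mult_right)
    show "AE x in M. norm (w0 x * \<bar>\<sigma> \<bullet> h x\<bar> powr p) \<le> norm (K * (norm \<sigma> powr p * norm (h x) powr p))"
      unfolding real_norm_def using bound by (intro AE_I2) (rule order_trans[OF _ abs_ge_self])
  qed measurable
qed

text \<open>
  Dominated convergence: the integrand is at most a constant times \<open>norm (h x) powr p\<close> for \<open>\<sigma>\<close> in a bounded set.
\<close>

lemma directional_energy_continuous:
  fixes w0 :: "'a::euclidean_space \<Rightarrow> real"
  assumes p: "1 \<le> p" and grad: "gradient_density p u M h"
    and w0: "continuous_on UNIV w0" "\<And>x. \<bar>w0 x\<bar> \<le> K"
  shows "continuous_on UNIV (directional_energy p w0 M h)"
proof (rule continuous_on_sequentiallyI)
  fix s :: "nat \<Rightarrow> 'a" and \<sigma> assume s: "s \<longlonglongrightarrow> \<sigma>"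
  note gd = gradient_densityD[OF grad]
  have K: "0 \<le> K" using w0(2)[of 0] by linarith
  obtain R where R: "0 < R" "\<And>n. norm (s n) \<le> R"
    using convergent_imp_Bseq[of s] s by (auto simp: convergent_def Bseq_def)
  show "(\<lambda>n. directional_energy p w0 M h (s n)) \<longlonglongrightarrow> directional_energy p w0 M h \<sigma>"
    unfolding directional_energy_def
  proof (rule integral_dominated_convergence[where w = "\<lambda>x. K * (R powr p * norm (h x) powr p)"])
    show "integrable M (\<lambda>x. K * (R powr p * norm (h x) powr p))"
      using gd(4) by (intro integrable_mult_right)
    show "AE x in M. (\<lambda>n. w0 x * \<bar>s n \<bullet> h x\<bar> powr p) \<longlonglongrightarrow> w0 x * \<bar>\<sigma> \<bullet> h x\<bar> powr p"
      using p by (intro AE_I2 tendsto_intros tendsto_powr' s) auto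
    show "AE x in M. norm (w0 x * \<bar>s n \<bullet> h x\<bar> powr p) \<le> K * (R powr p * norm (h x) powr p)" for n
    proof (rule AE_I2)
      fix x
      have "norm (w0 x * \<bar>s n \<bullet> h x\<bar> powr p) \<le> K * (norm (s n) powr p * norm (h x) powr p)"
        unfolding real_norm_def by (rule directional_energy_integrable(2)[OF p grad w0])
      also have "\<dots> \<le> K * (R powr p * norm (h x) powr p)"
        using K R p by (intro mult_left_mono mult_right_mono powr_mono2) auto
      finally show "norm (w0 x * \<bar>s n \<bullet> h x\<bar> powr p) \<le> K * (R powr p * norm (h x) powr p)" .
    qed
  qed (use directional_energy_integrable(1)[OF p grad w0] in auto)
qed

lemma nn_integral_directional_energy:
  fixes w0 :: "'a::euclidean_space \<Rightarrow> real"
  assumes "1 \<le> p" "gradient_density p u M h" "continuous_on UNIV w0" "\<And>x. \<bar>w0 x\<bar> \<le> K" "\<And>x. 0 \<le> w0 x"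
  shows "(\<integral>\<^sup>+x. ennreal (w0 x * \<bar>\<sigma> \<bullet> h x\<bar> powr p) \<partial>M) = ennreal (directional_energy p w0 M h \<sigma>)"
  unfolding directional_energy_def
  using assms(5) by (intro nn_integral_eq_integral directional_energy_integrable(1)[OF assms(1-4)]) auto

text \<open>
  On a ball \<open>M\<close> is finite for every \<open>p\<close> and \<open>h\<close> is integrable, which is the situation in which test functions
  approximate measurable ones.
\<close>

lemma gradient_density_ball:
  fixes M :: "'a::euclidean_space measure" and c :: 'a and r :: real
  assumes p: "1 \<le> p" and grad: "gradient_density p u M h"
  defines "MB \<equiv> density M (\<lambda>x. indicator (ball c r) x)"
  shows "finite_measure MB" "sets MB = sets borel" "AE x in MB. x \<in> ball c r"
    "integrable MB (\<lambda>x. \<sigma> \<bullet> h x)"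
    "\<And>f :: 'a \<Rightarrow> real. f \<in> borel_measurable borel \<Longrightarrow> (\<integral>x. f x \<partial>MB) = (\<integral>x. indicator (ball c r) x * f x \<partial>M)"
    "\<And>P. (AE x in MB. P x) \<longleftrightarrow> (AE x in M. x \<in> ball c r \<longrightarrow> P x)"
proof -
  note gd = gradient_densityD[OF grad]
  have bM [measurable]: "ball c r \<in> sets M" using gd(1) by simp
  have ind: "(\<lambda>x. indicator (ball c r) x :: ennreal) \<in> borel_measurable M"
    by (rule borel_measurable_indicator[OF bM])
  show sMB: "sets MB = sets borel" using gd(1) by (simp add: MB_def)
  show AEMB: "(AE x in MB. P x) \<longleftrightarrow> (AE x in M. x \<in> ball c r \<longrightarrow> P x)" for P
    unfolding MB_def AE_density[OF ind] by (simp add: indicator_def)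
  show "AE x in MB. x \<in> ball c r" unfolding AEMB by simp
  show fin: "finite_measure MB"
  proof (rule finite_measureI)
    have "emeasure MB (space MB) = emeasure M (ball c r)"
      unfolding MB_def space_density using bM ind sets.sets_into_space[OF bM]
      by (subst emeasure_density) (auto simp: indicator_inter_arith[symmetric] Int_absorb2)
    then show "emeasure MB (space MB) \<noteq> \<infinity>" using gradient_density_ball_finite[OF grad, of c r] by simp
  qed
  have eqd: "MB = density M (\<lambda>x. ennreal (indicator (ball c r) x))"
    unfolding MB_def by (intro arg_cong[where f = "density M"] ext) (simp add: ennreal_indicator)
  show "(\<integral>x. f x \<partial>MB) = (\<integral>x. indicator (ball c r) x * f x \<partial>M)" if "f \<in> borel_measurable borel" for f :: "'a \<Rightarrow> real"
  proof -
    have "f \<in> borel_measurable M" using that measurable_cong_sets[OF gd(1) refl] by blast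
    then show ?thesis unfolding eqd using bM by (subst integral_density) auto
  qed
  have "integrable M (\<lambda>x. indicator (ball c r) x * (\<sigma> \<bullet> h x))"
  proof (rule integrable_bounded_mult_powr[OF p gd(1), where R = "norm c + r" and f = h and K = 1 and L = "norm \<sigma>"])
    show "emeasure M (ball 0 (norm c + r)) < \<top>" by (rule gradient_density_ball_finite[OF grad])
    show "indicator (ball c r) x = (0::real)" if "norm c + r \<le> norm x" for x
    proof -
      have "norm x \<le> norm c + dist c x" by (metis dist_norm norm_minus_commute norm_triangle_sub)
      then show ?thesis using that by (auto simp: indicator_def)
    qed
    show "\<bar>\<sigma> \<bullet> h x\<bar> \<le> norm \<sigma> * norm (h x)" for x by (rule Cauchy_Schwarz_ineq2)
  qed (use gd bM in \<open>auto simp: indicator_def\<close>)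
  then show "integrable MB (\<lambda>x. \<sigma> \<bullet> h x)"
    unfolding eqd using gd(3) bM by (subst integrable_density) auto
qed

text \<open>
  On a ball away from \<open>\<Omega>\<close>, test the gradient with approximations of \<open>sgn (\<sigma> \<bullet> h)\<close>: the derivatives of these test
  functions live where \<open>u = 0\<close>, so \<open>\<integral>\<bar>\<sigma> \<bullet> h\<bar> = 0\<close>. Countably many balls suffice (Lindelof). The points of the boundary of
  \<open>\<Omega>\<close> cannot be excluded, because a \<open>BV\<close> function may jump there.
\<close>

lemma gradient_density_zero_outside:
  fixes u :: "'a::euclidean_space \<Rightarrow> real"
  assumes p: "1 \<le> p" and grad: "gradient_density p u M h"
    and uL: "u \<in> Lp lborel p" and u: "AE x in lborel. x \<notin> \<Omega> \<longrightarrow> u x = 0"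
  shows "AE x in M. x \<notin> closure \<Omega> \<longrightarrow> h x = 0"
proof -
  note gd = gradient_densityD[OF grad]
  have local: "AE x in M. x \<in> ball c r \<longrightarrow> \<sigma> \<bullet> h x = 0" if sub: "cball c r \<subseteq> - closure \<Omega>" for c r \<sigma>
  proof -
    define MB where "MB = density M (\<lambda>x. indicator (ball c r) x)"
    note mb = gradient_density_ball[OF p grad, where c = c and r = r, folded MB_def]
    have sm: "(\<lambda>x. sgn (\<sigma> \<bullet> h x)) \<in> borel_measurable borel" using gd(2) by measurable
    obtain \<psi> where \<psi>: "\<And>n::nat. \<psi> n \<in> test_functions" "\<And>n x. x \<notin> ball c r \<Longrightarrow> \<psi> n x = 0"
      "\<And>n x. \<bar>\<psi> n x\<bar> \<le> 1 + 1 / real (Suc n)" "AE x in MB. (\<lambda>n. \<psi> n x) \<longlonglongrightarrow> sgn (\<sigma> \<bullet> h x)"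
      by (rule test_functions_approximate_AE[OF mb(1-3) sm, of "\<lambda>_. 1"]) (auto simp: sgn_if)
    have zero: "(\<integral>x. \<psi> n x * (\<sigma> \<bullet> h x) \<partial>MB) = 0" for n
    proof -
      have \<psi>m: "\<psi> n \<in> borel_measurable borel"
        by (rule borel_measurable_continuous_onI[OF test_function_continuous[OF \<psi>(1)]])
      have "(\<integral>x. \<psi> n x * (\<sigma> \<bullet> h x) \<partial>MB) = (\<integral>x. indicator (ball c r) x * (\<psi> n x * (\<sigma> \<bullet> h x)) \<partial>M)"
        using \<psi>m gd(2) by (intro mb(5) borel_measurable_times borel_measurable_inner borel_measurable_const)
      also have "\<dots> = (\<integral>x. \<psi> n x * (\<sigma> \<bullet> h x) \<partial>M)"
        using \<psi>(2) by (intro Bochner_Integration.integral_cong refl) (auto simp: indicator_def)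
      also have "\<dots> = - (\<integral>x. u x * frechet_derivative (\<psi> n) (at x) \<sigma> \<partial>lborel)"
        using gd(5)[OF \<psi>(1)] by simp
      also have "(\<integral>x. u x * frechet_derivative (\<psi> n) (at x) \<sigma> \<partial>lborel) = (\<integral>x. 0 \<partial>(lborel :: 'a measure))"
      proof (rule integral_cong_AE)
        have out: "frechet_derivative (\<psi> n) (at x) \<sigma> = 0" if "x \<notin> cball c r" for x
          by (rule test_function_derivative_outside[OF \<psi>(1), of "- cball c r"]) (use that \<psi>(2) in auto)
        show "AE x in lborel. u x * frechet_derivative (\<psi> n) (at x) \<sigma> = 0"
          using u
        proof eventually_elim
          case (elim x)
          show ?case
          proof (cases "x \<in> cball c r")
            case True
            then have "x \<notin> \<Omega>" using sub closure_subset by blast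
            then show ?thesis using elim by simp
          qed (simp add: out)
        qed
        show "(\<lambda>x. u x * frechet_derivative (\<psi> n) (at x) \<sigma>) \<in> borel_measurable lborel"
          by (rule borel_measurable_integrable[OF integrable_mult_test_derivative[OF p uL \<psi>(1)]])
      qed simp
      finally show ?thesis by simp
    qed
    have "(\<lambda>n. \<integral>x. \<psi> n x * (\<sigma> \<bullet> h x) \<partial>MB) \<longlonglongrightarrow> (\<integral>x. sgn (\<sigma> \<bullet> h x) * (\<sigma> \<bullet> h x) \<partial>MB)"
    proof (rule integral_dominated_convergence[where w = "\<lambda>x. 2 * \<bar>\<sigma> \<bullet> h x\<bar>"])
      have hMB: "h \<in> borel_measurable MB" using gd(2) measurable_cong_sets[OF mb(2) refl] by blast
      then show "(\<lambda>x. sgn (\<sigma> \<bullet> h x) * (\<sigma> \<bullet> h x)) \<in> borel_measurable MB" by measurable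
      show "(\<lambda>x. \<psi> n x * (\<sigma> \<bullet> h x)) \<in> borel_measurable MB" for n
      proof -
        have "\<psi> n \<in> borel_measurable MB"
          using borel_measurable_continuous_onI[OF test_function_continuous[OF \<psi>(1)]] measurable_cong_sets[OF mb(2) refl] by blast
        with hMB show ?thesis by measurable
      qed
      show "integrable MB (\<lambda>x. 2 * \<bar>\<sigma> \<bullet> h x\<bar>)" using mb(4) by simp
      show "AE x in MB. (\<lambda>n. \<psi> n x * (\<sigma> \<bullet> h x)) \<longlonglongrightarrow> sgn (\<sigma> \<bullet> h x) * (\<sigma> \<bullet> h x)"
        using \<psi>(4) by eventually_elim (intro tendsto_intros)
      show "AE x in MB. norm (\<psi> n x * (\<sigma> \<bullet> h x)) \<le> 2 * \<bar>\<sigma> \<bullet> h x\<bar>" for n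
      proof (rule AE_I2)
        fix x
        have "1 / real (Suc n) \<le> 1" by simp
        then have "\<bar>\<psi> n x\<bar> \<le> 2" using \<psi>(3)[of n x] by linarith
        then show "norm (\<psi> n x * (\<sigma> \<bullet> h x)) \<le> 2 * \<bar>\<sigma> \<bullet> h x\<bar>"
          unfolding real_norm_def abs_mult by (rule mult_right_mono) simp
      qed
    qed
    then have "(\<integral>x. sgn (\<sigma> \<bullet> h x) * (\<sigma> \<bullet> h x) \<partial>MB) = 0"
      unfolding zero by (simp add: LIMSEQ_const_iff)
    moreover have "sgn (\<sigma> \<bullet> h x) * (\<sigma> \<bullet> h x) = \<bar>\<sigma> \<bullet> h x\<bar>" for x by (simp add: abs_sgn mult.commute)
    ultimately have "(\<integral>x. \<bar>\<sigma> \<bullet> h x\<bar> \<partial>MB) = 0" by simp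
    then have "AE x in MB. \<bar>\<sigma> \<bullet> h x\<bar> = 0"
      using mb(4) by (subst (asm) integral_nonneg_eq_0_iff_AE) auto
    then show ?thesis unfolding mb(6) by simp
  qed
  have ball: "AE x in M. x \<in> ball c r \<longrightarrow> h x = 0" if sub: "cball c r \<subseteq> - closure \<Omega>" for c r
  proof -
    have "AE x in M. \<forall>b\<in>Basis. x \<in> ball c r \<longrightarrow> b \<bullet> h x = 0"
      using local[OF sub] by (intro AE_finite_allI) auto
    then show ?thesis
      by eventually_elim (rule impI, rule euclidean_eqI, simp add: inner_commute)
  qed
  define F where "F = {B. \<exists>c r. B = ball c r \<and> cball c r \<subseteq> - closure \<Omega>}"
  have open_F: "open S" if "S \<in> F" for S using that by (auto simp: F_def)
  obtain F' where F': "F' \<subseteq> F" "countable F'" "\<Union>F' = \<Union>F"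
  proof (rule Lindelof[of F])
    show "open S" if "S \<in> F" for S using that by (rule open_F)
  qed (rule that)
  have "AE x in M. \<forall>B\<in>F'. x \<in> B \<longrightarrow> h x = 0"
  proof (subst AE_ball_countable[OF F'(2)], intro ballI)
    fix B assume "B \<in> F'"
    then obtain c r where "B = ball c r" "cball c r \<subseteq> - closure \<Omega>" using F'(1) by (auto simp: F_def)
    then show "AE x in M. x \<in> B \<longrightarrow> h x = 0" using ball by simp
  qed
  then show ?thesis
  proof eventually_elim
    case (elim x)
    show ?case
    proof
      assume x: "x \<notin> closure \<Omega>"
      obtain e where "0 < e" "cball x e \<subseteq> - closure \<Omega>"
        using x open_contains_cball[of "- closure \<Omega>"] by auto
      then have "x \<in> \<Union>F" unfolding F_def by (intro UnionI[of "ball x e"]) auto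
      then show "h x = 0" using elim F'(3) by blast
    qed
  qed
qed

lemma finite_sphere_measure_borel:
  fixes f :: "'a::euclidean_space \<Rightarrow> 'b::topological_space"
  assumes "finite_sphere_measure \<mu>" "f \<in> borel_measurable borel"
  shows "f \<in> borel_measurable \<mu>"
proof -
  have "f \<in> borel_measurable (restrict_space borel (sphere 0 1))"
    using assms(2) by (rule measurable_restrict_space1)
  moreover have "sets \<mu> = sets (restrict_space borel (sphere 0 1))"
    using assms(1) by (simp add: finite_sphere_measure_def)
  ultimately show ?thesis using measurable_cong_sets by blast
qed

text \<open>
  Hence the optimal weighted constant is the infimum of a non-empty set. The lower bound \<open>c\<close> for the weight on
  \<open>\<Omega>\<close> extends to the closure by continuity, and the gradient vanishes off the closure.
\<close>

lemma poincare_constants_weighted_nonempty: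
  fixes w0 :: "'a::euclidean_space \<Rightarrow> real"
  assumes p: "1 \<le> p" and \<mu>: "finite_sphere_measure \<mu>"
    and w0: "continuous_on UNIV w0" "\<And>x. \<bar>w0 x\<bar> \<le> K" "\<And>x. 0 \<le> w0 x"
    and c: "0 < c" "\<And>x. x \<in> \<Omega> \<Longrightarrow> c \<le> w0 x" and poincare: "poincare_measure p \<mu> \<Omega>"
  shows "poincare_constants p w0 \<mu> \<Omega> \<noteq> {}"
proof -
  obtain C where C: "0 < C" "\<And>u. u \<in> Sp_zero p \<Omega> \<Longrightarrow>
      ennreal (Lp_norm lborel p u powr p) \<le> ennreal C * local_energy p (\<lambda>_. 1) \<mu> u"
    using poincare by (auto simp: poincare_measure_def poincare_constants_def)
  have closed: "closed {x. c \<le> w0 x}" using w0(1) by (intro closed_Collect_le continuous_on_const)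
  have c_closure: "c \<le> w0 x" if "x \<in> closure \<Omega>" for x
    using closure_minimal[OF _ closed, of \<Omega>] c(2) that by blast
  have "ennreal (Lp_norm lborel p u powr p) \<le> ennreal (C / c) * local_energy p w0 \<mu> u" if u: "u \<in> Sp_zero p \<Omega>" for u
  proof -
    have uS: "u \<in> Sp p" "u \<in> Lp lborel p" "AE x in lborel. x \<notin> \<Omega> \<longrightarrow> u x = 0"
      using u by (auto simp: Sp_zero_def Lp_zero_def)
    obtain M h where grad: "gradient_density p u M h"
      and le: "\<And>\<mu> w0. continuous_on UNIV w0 \<Longrightarrow> (\<And>x. 0 \<le> w0 x) \<Longrightarrow> local_energy p w0 \<mu> u
        = (\<integral>\<^sup>+\<sigma>. (\<integral>\<^sup>+x. ennreal (w0 x * \<bar>\<sigma> \<bullet> h x\<bar> powr p) \<partial>M) \<partial>\<mu>)"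
    proof (rule gradient_density_exists[OF p uS(1)], goal_cases)
      case (1 M h)
      show thesis by (rule 1(1)[OF 1(2)]) (rule 1(3))
    qed
    have zero: "AE x in M. x \<notin> closure \<Omega> \<longrightarrow> h x = 0"
      by (rule gradient_density_zero_outside[OF p grad uS(2,3)])
    have one: "continuous_on UNIV (\<lambda>_::'a. 1::real)" "\<And>x::'a. \<bar>1::real\<bar> \<le> 1" "\<And>x::'a. (0::real) \<le> 1" by auto
    have "directional_energy p (\<lambda>_. 1) M h \<sigma> \<le> 1 / c * directional_energy p w0 M h \<sigma>" for \<sigma>
    proof -
      have "directional_energy p (\<lambda>_. 1) M h \<sigma> \<le> (\<integral>x. 1 / c * (w0 x * \<bar>\<sigma> \<bullet> h x\<bar> powr p) \<partial>M)"
        unfolding directional_energy_def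
      proof (rule integral_mono_AE)
        show "integrable M (\<lambda>x. 1 * \<bar>\<sigma> \<bullet> h x\<bar> powr p)"
          by (rule directional_energy_integrable(1)[OF p grad one(1,2)])
        show "integrable M (\<lambda>x. 1 / c * (w0 x * \<bar>\<sigma> \<bullet> h x\<bar> powr p))"
          by (intro integrable_mult_right directional_energy_integrable(1)[OF p grad w0(1,2)])
        show "AE x in M. 1 * \<bar>\<sigma> \<bullet> h x\<bar> powr p \<le> 1 / c * (w0 x * \<bar>\<sigma> \<bullet> h x\<bar> powr p)"
          using zero
        proof eventually_elim
          case (elim x)
          show ?case
          proof (cases "x \<in> closure \<Omega>")
            case True
            have "1 \<le> 1 / c * w0 x" using c_closure[OF True] c(1) by (simp add: field_simps)
            then have "1 * \<bar>\<sigma> \<bullet> h x\<bar> powr p \<le> (1 / c * w0 x) * \<bar>\<sigma> \<bullet> h x\<bar> powr p"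
              by (rule mult_right_mono) simp
            then show ?thesis by (simp only: mult.assoc)
          qed (use elim p in simp)
        qed
      qed
      also have "\<dots> = 1 / c * directional_energy p w0 M h \<sigma>" by (simp add: directional_energy_def)
      finally show ?thesis .
    qed
    then have de: "ennreal (directional_energy p (\<lambda>_. 1) M h \<sigma>) \<le> ennreal (1 / c) * ennreal (directional_energy p w0 M h \<sigma>)" for \<sigma>
      using c(1) by (subst ennreal_mult'[symmetric]) (auto intro: ennreal_leI)
    have meas: "(\<lambda>\<sigma>. ennreal (directional_energy p w0 M h \<sigma>)) \<in> borel_measurable \<mu>"
      using finite_sphere_measure_borel[OF \<mu> borel_measurable_continuous_onI[OF directional_energy_continuous[OF p grad w0(1,2)]]]
      by simp
    have "local_energy p (\<lambda>_. 1) \<mu> u = (\<integral>\<^sup>+\<sigma>. ennreal (directional_energy p (\<lambda>_. 1) M h \<sigma>) \<partial>\<mu>)"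
      unfolding le[OF one(1,3)] nn_integral_directional_energy[OF p grad one] by (rule refl)
    also have "\<dots> \<le> (\<integral>\<^sup>+\<sigma>. ennreal (1 / c) * ennreal (directional_energy p w0 M h \<sigma>) \<partial>\<mu>)"
      by (rule nn_integral_mono) (rule de)
    also have "\<dots> = ennreal (1 / c) * (\<integral>\<^sup>+\<sigma>. ennreal (directional_energy p w0 M h \<sigma>) \<partial>\<mu>)"
      by (rule nn_integral_cmult[OF meas])
    also have "(\<integral>\<^sup>+\<sigma>. ennreal (directional_energy p w0 M h \<sigma>) \<partial>\<mu>) = local_energy p w0 \<mu> u"
      unfolding le[OF w0(1,3)] nn_integral_directional_energy[OF p grad w0] by (rule refl)
    finally have "ennreal C * local_energy p (\<lambda>_. 1) \<mu> u \<le> ennreal C * (ennreal (1 / c) * local_energy p w0 \<mu> u)"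
      by (rule mult_left_mono) simp
    also have "\<dots> = ennreal (C / c) * local_energy p w0 \<mu> u"
      using C(1) c(1) by (simp add: mult.assoc[symmetric] ennreal_mult[symmetric])
    finally show ?thesis using C(2)[OF u] by (rule order_trans[rotated])
  qed
  then have "C / c \<in> poincare_constants p w0 \<mu> \<Omega>"
    using C(1) c(1) by (simp add: poincare_constants_def)
  then show ?thesis by blast
qed

section \<open>Duality for the directional energies\<close>

text \<open>
  Test functions for the energy density \<open>W x * \<bar>t\<bar> powr p\<close> with a cost: the best cost is the Legendre conjugate of the
  density at \<open>\<psi> x\<close>. Lower bounds of an energy by means of a dual pair are linear in \<open>t\<close>, so they survive weak
  convergence and integration by parts.
\<close>

definition dual_pair :: "real \<Rightarrow> ('a::euclidean_space \<Rightarrow> real) \<Rightarrow> ('a \<Rightarrow> real) \<Rightarrow> ('a \<Rightarrow> real) \<Rightarrow> bool" where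
  "dual_pair p W \<psi> \<kappa> \<longleftrightarrow> \<psi> \<in> test_functions \<and> integrable lborel \<kappa> \<and>
     (\<forall>x t. \<psi> x * t - \<kappa> x \<le> W x * \<bar>t\<bar> powr p)"

lemma integral_ball_exhaustion:
  fixes f :: "'a::euclidean_space \<Rightarrow> real"
  assumes M: "sets M = sets borel" and f: "integrable M f" and g: "g \<in> borel_measurable M"
  shows "(\<lambda>n::nat. \<integral>x. indicator {x. norm x < real n \<and> \<bar>g x\<bar> \<le> real n} x * f x \<partial>M) \<longlonglongrightarrow> (\<integral>x. f x \<partial>M)"
proof (rule integral_dominated_convergence[where w = "\<lambda>x. \<bar>f x\<bar>"])
  have sp: "space M = UNIV" using sets_eq_imp_space_eq[OF M] by simp
  have "(\<lambda>x. x) \<in> measurable M borel" using M by (simp add: measurable_ident_sets)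
  then have nm: "(\<lambda>x. norm x) \<in> borel_measurable M" by measurable
  have "{x \<in> space M. norm x < real n \<and> \<bar>g x\<bar> \<le> real n} \<in> sets M" for n
    using nm g by (intro sets.sets_Collect_conj borel_measurable_less borel_measurable_le borel_measurable_abs) auto
  then have "{x. norm x < real n \<and> \<bar>g x\<bar> \<le> real n} \<in> sets M" for n by (simp add: sp)
  then show "(\<lambda>x. indicator {x. norm x < real n \<and> \<bar>g x\<bar> \<le> real n} x * f x) \<in> borel_measurable M" for n
    using f by (intro borel_measurable_times borel_measurable_indicator) auto
  show "AE x in M. (\<lambda>n. indicator {x. norm x < real n \<and> \<bar>g x\<bar> \<le> real n} x * f x) \<longlonglongrightarrow> f x"
  proof (rule AE_I2)
    fix x
    obtain m :: nat where m: "max (norm x) \<bar>g x\<bar> < real m" using reals_Archimedean2 by blast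
    have "\<forall>\<^sub>F n in sequentially. indicator {x. norm x < real n \<and> \<bar>g x\<bar> \<le> real n} x * f x = f x"
      using eventually_ge_at_top[of m]
    proof eventually_elim
      case (elim n)
      then have "real m \<le> real n" by simp
      with m show ?case by (auto simp: indicator_def)
    qed
    then show "(\<lambda>n. indicator {x. norm x < real n \<and> \<bar>g x\<bar> \<le> real n} x * f x) \<longlonglongrightarrow> f x"
      by (rule tendsto_eventually)
  qed
  show "AE x in M. norm (indicator {x. norm x < real n \<and> \<bar>g x\<bar> \<le> real n} x * f x) \<le> \<bar>f x\<bar>" for n
    by (intro AE_I2) (simp add: indicator_def)
qed (use f in auto)

text \<open>
  For \<open>p = 1\<close> the energy is the supremum of \<open>\<integral>\<psi> (\<sigma> \<bullet> h)\<close> over \<open>\<bar>\<psi>\<bar> \<le> w0\<close>, attained at \<open>w0 * sgn (\<sigma> \<bullet> h)\<close>; this measurable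
  function is approximated by test functions, at the price of \<open>\<eta>\<close> in the bound. There is no cost.
\<close>

lemma dual_pair_exists_1:
  fixes w0 :: "'a::euclidean_space \<Rightarrow> real"
  assumes grad: "gradient_density 1 u M h"
    and w0: "continuous_on UNIV w0" "\<And>x. \<bar>w0 x\<bar> \<le> K" "\<And>x. 0 \<le> w0 x"
    and \<eta>: "0 < \<eta>" and \<epsilon>: "0 < \<epsilon>"
  shows "\<exists>\<psi> \<kappa>. dual_pair 1 (\<lambda>x. w0 x + \<eta>) \<psi> \<kappa> \<and>
    directional_energy 1 w0 M h \<sigma> - \<epsilon> \<le> (\<integral>x. \<psi> x * (\<sigma> \<bullet> h x) \<partial>M) - (\<integral>x. \<kappa> x \<partial>lborel)"
proof -
  note gd = gradient_densityD[OF grad]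
  let ?s = "\<lambda>x. \<sigma> \<bullet> h x"
  have int: "integrable M (\<lambda>x. w0 x * \<bar>?s x\<bar>)"
    using directional_energy_integrable(1)[OF _ grad w0(1,2), of \<sigma>] by simp
  have sm: "?s \<in> borel_measurable borel" using gd(2) by (intro borel_measurable_inner borel_measurable_const)
  have w0m: "w0 \<in> borel_measurable borel" by (rule borel_measurable_continuous_onI[OF w0(1)])
  have "(\<lambda>n::nat. \<integral>x. indicator {x. norm x < real n \<and> \<bar>0::real\<bar> \<le> real n} x * (w0 x * \<bar>?s x\<bar>) \<partial>M)
      \<longlonglongrightarrow> (\<integral>x. w0 x * \<bar>?s x\<bar> \<partial>M)"
    by (rule integral_ball_exhaustion[OF gd(1) int]) simp
  then have "\<forall>\<^sub>F n in sequentially. directional_energy 1 w0 M h \<sigma> - \<epsilon> / 2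
      < (\<integral>x. indicator {x. norm x < real n \<and> \<bar>0::real\<bar> \<le> real n} x * (w0 x * \<bar>?s x\<bar>) \<partial>M)"
    using \<epsilon> by (intro order_tendstoD(1)) (auto simp: directional_energy_def)
  then obtain n :: nat where n: "directional_energy 1 w0 M h \<sigma> - \<epsilon> / 2
      < (\<integral>x. indicator {x. norm x < real n \<and> \<bar>0::real\<bar> \<le> real n} x * (w0 x * \<bar>?s x\<bar>) \<partial>M)"
    by (auto simp: eventually_sequentially)
  have ball: "{x. norm x < real n \<and> \<bar>0::real\<bar> \<le> real n} = ball (0::'a) (real n)" by auto
  define MB where "MB = density M (\<lambda>x. indicator (ball 0 (real n)) x)"
  note mb = gradient_density_ball[OF order_refl grad, where c = 0 and r = "real n", folded MB_def]
  have limit: "directional_energy 1 w0 M h \<sigma> - \<epsilon> / 2 < (\<integral>x. w0 x * \<bar>?s x\<bar> \<partial>MB)"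
    using n unfolding ball by (subst mb(5)) (use sm w0m in auto)
  have am: "(\<lambda>x. w0 x * sgn (?s x)) \<in> borel_measurable borel" using sm w0m by measurable
  have w0b: "bounded (range w0)" using w0(2) by (auto simp: bounded_iff)
  obtain \<psi> where \<psi>: "\<And>k::nat. \<psi> k \<in> test_functions" "\<And>k x. x \<notin> ball 0 (real n) \<Longrightarrow> \<psi> k x = 0"
    "\<And>k x. \<bar>\<psi> k x\<bar> \<le> w0 x + 1 / real (Suc k)" "AE x in MB. (\<lambda>k. \<psi> k x) \<longlonglongrightarrow> w0 x * sgn (?s x)"
  proof (rule test_functions_approximate_AE[OF mb(1-3) am w0(1) w0b])
    show "\<bar>w0 x * sgn (?s x)\<bar> \<le> w0 x" for x using w0(3)[of x] by (auto simp: sgn_if)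
  qed (rule that)
  have \<psi>m: "\<psi> k \<in> borel_measurable borel" for k
    by (rule borel_measurable_continuous_onI[OF test_function_continuous[OF \<psi>(1)]])
  have mMB: "f \<in> borel_measurable MB" if "f \<in> borel_measurable borel" for f :: "'a \<Rightarrow> real"
    using that measurable_cong_sets[OF mb(2) refl] by blast
  have "(\<lambda>k. \<integral>x. \<psi> k x * ?s x \<partial>MB) \<longlonglongrightarrow> (\<integral>x. w0 x * \<bar>?s x\<bar> \<partial>MB)"
  proof (rule integral_dominated_convergence[where w = "\<lambda>x. (K + 1) * \<bar>?s x\<bar>"])
    show "(\<lambda>x. w0 x * \<bar>?s x\<bar>) \<in> borel_measurable MB" using sm w0m by (intro mMB borel_measurable_times borel_measurable_abs)
    show "(\<lambda>x. \<psi> k x * ?s x) \<in> borel_measurable MB" for k using sm \<psi>m[of k] by (intro mMB borel_measurable_times)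
    show "integrable MB (\<lambda>x. (K + 1) * \<bar>?s x\<bar>)" using mb(4)[of \<sigma>] by simp
    show "AE x in MB. (\<lambda>k. \<psi> k x * ?s x) \<longlonglongrightarrow> w0 x * \<bar>?s x\<bar>"
      using \<psi>(4)
    proof eventually_elim
      case (elim x)
      have "(\<lambda>k. \<psi> k x * ?s x) \<longlonglongrightarrow> (w0 x * sgn (?s x)) * ?s x" by (intro tendsto_intros elim)
      moreover have "(w0 x * sgn (?s x)) * ?s x = w0 x * \<bar>?s x\<bar>" by (simp add: sgn_if)
      ultimately show ?case by simp
    qed
    show "AE x in MB. norm (\<psi> k x * ?s x) \<le> (K + 1) * \<bar>?s x\<bar>" for k
    proof (rule AE_I2)
      fix x
      have "1 / real (Suc k) \<le> 1" by simp
      then have "\<bar>\<psi> k x\<bar> \<le> K + 1" using \<psi>(3)[of k x] w0(2)[of x] by linarith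
      then show "norm (\<psi> k x * ?s x) \<le> (K + 1) * \<bar>?s x\<bar>"
        unfolding real_norm_def abs_mult by (rule mult_right_mono) simp
    qed
  qed
  then have "\<forall>\<^sub>F k in sequentially. directional_energy 1 w0 M h \<sigma> - \<epsilon> / 2 < (\<integral>x. \<psi> k x * ?s x \<partial>MB)"
    using limit by (rule order_tendstoD(1))
  moreover have "\<forall>\<^sub>F k in sequentially. 1 / real (Suc k) < \<eta>"
    using \<eta> by (intro order_tendstoD(2)[OF LIMSEQ_Suc[OF lim_1_over_n]])
  ultimately have "\<forall>\<^sub>F k in sequentially. directional_energy 1 w0 M h \<sigma> - \<epsilon> / 2 < (\<integral>x. \<psi> k x * ?s x \<partial>MB)
      \<and> 1 / real (Suc k) < \<eta>" by (rule eventually_conj)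
  then obtain k where k: "directional_energy 1 w0 M h \<sigma> - \<epsilon> / 2 < (\<integral>x. \<psi> k x * ?s x \<partial>MB)" "1 / real (Suc k) < \<eta>"
    unfolding eventually_sequentially by blast
  have "(\<integral>x. \<psi> k x * ?s x \<partial>MB) = (\<integral>x. indicator (ball 0 (real n)) x * (\<psi> k x * ?s x) \<partial>M)"
    using sm \<psi>m[of k] by (intro mb(5) borel_measurable_times)
  also have "\<dots> = (\<integral>x. \<psi> k x * ?s x \<partial>M)"
    using \<psi>(2) by (intro Bochner_Integration.integral_cong refl) (auto simp: indicator_def)
  finally have "directional_energy 1 w0 M h \<sigma> - \<epsilon> \<le> (\<integral>x. \<psi> k x * ?s x \<partial>M) - (\<integral>x. 0 \<partial>(lborel :: 'a measure))"
    using k(1) \<epsilon> by simp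
  moreover have "dual_pair 1 (\<lambda>x. w0 x + \<eta>) (\<psi> k) (\<lambda>_. 0)"
    unfolding dual_pair_def
  proof (intro conjI allI)
    fix x t
    have "\<psi> k x * t \<le> \<bar>\<psi> k x\<bar> * \<bar>t\<bar>" by (metis abs_ge_self abs_mult)
    also have "\<dots> \<le> (w0 x + \<eta>) * \<bar>t\<bar>"
      using \<psi>(3)[of k x] k(2) by (intro mult_right_mono) auto
    finally show "\<psi> k x * t - 0 \<le> (w0 x + \<eta>) * \<bar>t\<bar> powr 1" by simp
  qed (use \<psi>(1) in auto)
  ultimately show ?thesis by blast
qed

text \<open>
  The Legendre conjugate of \<open>\<bar>t\<bar> powr p\<close>.
\<close>

definition power_conjugate :: "real \<Rightarrow> real \<Rightarrow> real" where
  "power_conjugate p a = (p - 1) * (\<bar>a\<bar> / p) powr (p / (p - 1))"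

lemma power_conjugate_Young:
  assumes "1 < p"
  shows "a * t \<le> \<bar>t\<bar> powr p + power_conjugate p a"
proof -
  define q where "q = p / (p - 1)"
  have q: "1 < q" "1 / p + 1 / q = 1" using assms by (simp_all add: q_def field_simps)
  have "\<bar>t\<bar> * (\<bar>a\<bar> / p) \<le> \<bar>t\<bar> powr p / p + (\<bar>a\<bar> / p) powr q / q"
    by (rule Youngs_inequality[OF assms q]) (use assms in auto)
  then have "p * (\<bar>t\<bar> * (\<bar>a\<bar> / p)) \<le> p * (\<bar>t\<bar> powr p / p + (\<bar>a\<bar> / p) powr q / q)"
    using assms by (intro mult_left_mono) auto
  also have "\<dots> = \<bar>t\<bar> powr p + (p / q) * (\<bar>a\<bar> / p) powr q"
    using assms by (simp add: distrib_left)
  also have "p / q = p - 1" using assms by (simp add: q_def)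
  also have "p * (\<bar>t\<bar> * (\<bar>a\<bar> / p)) = \<bar>a * t\<bar>" using assms by (simp add: abs_mult mult.commute)
  finally show ?thesis using abs_ge_self[of "a * t"] by (simp add: power_conjugate_def q_def)
qed

lemma power_conjugate_equality:
  assumes "1 < p"
  shows "(p * \<bar>s\<bar> powr (p - 1) * sgn s) * s - power_conjugate p (p * \<bar>s\<bar> powr (p - 1) * sgn s) = \<bar>s\<bar> powr p"
proof (cases "s = 0")
  case False
  have 1: "\<bar>s\<bar> powr (p - 1) * \<bar>s\<bar> = \<bar>s\<bar> powr p"
    using False powr_add[of "\<bar>s\<bar>" "p - 1" 1] by simp
  have "\<bar>p * \<bar>s\<bar> powr (p - 1) * sgn s\<bar> / p = \<bar>s\<bar> powr (p - 1)"
    using assms False by (simp add: abs_mult)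
  then have "power_conjugate p (p * \<bar>s\<bar> powr (p - 1) * sgn s) = (p - 1) * \<bar>s\<bar> powr p"
    using assms by (simp add: power_conjugate_def powr_powr)
  moreover have "(p * \<bar>s\<bar> powr (p - 1) * sgn s) * s = p * (\<bar>s\<bar> powr (p - 1) * \<bar>s\<bar>)"
    by (simp add: abs_sgn mult_ac)
  ultimately show ?thesis unfolding 1 by (simp add: algebra_simps)
qed (use assms in \<open>simp add: power_conjugate_def\<close>)

lemma power_conjugate_mono:
  assumes "1 < p" "\<bar>a\<bar> \<le> b"
  shows "0 \<le> power_conjugate p a" "power_conjugate p a \<le> power_conjugate p b"
proof -
  show "0 \<le> power_conjugate p a" using assms(1) by (simp add: power_conjugate_def)
  have "(\<bar>a\<bar> / p) powr (p / (p - 1)) \<le> (\<bar>b\<bar> / p) powr (p / (p - 1))"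
    using assms by (intro powr_mono2 divide_right_mono) auto
  then show "power_conjugate p a \<le> power_conjugate p b"
    using assms(1) by (simp add: power_conjugate_def)
qed

lemma power_conjugate_tendsto:
  assumes "1 < p" "(X \<longlongrightarrow> a) F"
  shows "((\<lambda>n. power_conjugate p (X n)) \<longlongrightarrow> power_conjugate p a) F"
  unfolding power_conjugate_def
  using assms by (intro tendsto_mult tendsto_const tendsto_powr' tendsto_divide tendsto_rabs) auto

lemma integrable_bounded_support:
  fixes f :: "'a::euclidean_space \<Rightarrow> real"
  assumes "f \<in> borel_measurable borel" "\<And>x. \<bar>f x\<bar> \<le> K" "\<And>x. x \<notin> ball c r \<Longrightarrow> f x = 0"
  shows "integrable lborel f"
proof (rule Bochner_Integration.integrable_bound)
  show "integrable lborel (\<lambda>x. K * indicator (ball c r) x :: real)"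
    using emeasure_bounded_finite[of "ball c r"] by (intro integrable_mult_right integrable_real_indicator) auto
  show "AE x in lborel. norm (f x) \<le> norm (K * indicator (ball c r) x :: real)"
    using assms(2,3) by (intro AE_I2) (auto simp: indicator_def intro: order_trans[OF _ abs_ge_self])
qed (use assms(1) in simp)

text \<open>
  The optimal function is the derivative \<open>W p \<bar>s\<bar>\<^sup>p\<^sup>-\<^sup>1 sgn s\<close> of the density at \<open>s = \<sigma> \<bullet> h x\<close>, for which Young's inequality is
  an equality. Cut off where \<open>s\<close> or the point is large, it is bounded, hence the limit of test functions \<open>\<psi>\<close>, and the
  conjugate \<open>\<kappa>\<close> of each \<open>\<psi>\<close> is bounded with bounded support. The weight \<open>W = w0 + \<eta>\<close> is used in place of \<open>w0\<close> because the
  conjugate contains a division by it.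
\<close>

lemma dual_pair_exists_gt_1:
  fixes w0 :: "'a::euclidean_space \<Rightarrow> real"
  assumes p: "1 < p" and grad: "gradient_density p u M h"
    and w0: "continuous_on UNIV w0" "\<And>x. \<bar>w0 x\<bar> \<le> K" "\<And>x. 0 \<le> w0 x"
    and \<eta>: "0 < \<eta>" and \<epsilon>: "0 < \<epsilon>"
  shows "\<exists>\<psi> \<kappa>. dual_pair p (\<lambda>x. w0 x + \<eta>) \<psi> \<kappa> \<and>
    directional_energy p w0 M h \<sigma> - \<epsilon> \<le> (\<integral>x. \<psi> x * (\<sigma> \<bullet> h x) \<partial>M) - (\<integral>x. \<kappa> x \<partial>lborel)"
proof -
  note gd = gradient_densityD[OF grad]
  have p1: "1 \<le> p" using p by simp
  have Ml: "M = lborel" using grad p by (simp add: gradient_density_def)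
  let ?s = "\<lambda>x. \<sigma> \<bullet> h x"
  define W where "W x = w0 x + \<eta>" for x
  have W: "\<eta> \<le> W x" "W x \<le> K + \<eta>" "0 < W x" for x
    using w0(2)[of x] w0(3)[of x] \<eta> by (auto simp: W_def)
  have K: "0 \<le> K" using w0(2)[of 0] by linarith
  have int: "integrable M (\<lambda>x. w0 x * \<bar>?s x\<bar> powr p)"
    by (rule directional_energy_integrable(1)[OF p1 grad w0(1,2)])
  have sm: "?s \<in> borel_measurable borel" using gd(2) by (intro borel_measurable_inner borel_measurable_const)
  have w0m: "w0 \<in> borel_measurable borel" by (rule borel_measurable_continuous_onI[OF w0(1)])
  have Wm: "W \<in> borel_measurable borel" unfolding W_def using w0m by measurable
  have "(\<lambda>n::nat. \<integral>x. indicator {x. norm x < real n \<and> \<bar>?s x\<bar> \<le> real n} x * (w0 x * \<bar>?s x\<bar> powr p) \<partial>M)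
      \<longlonglongrightarrow> (\<integral>x. w0 x * \<bar>?s x\<bar> powr p \<partial>M)"
    by (rule integral_ball_exhaustion[OF gd(1) int]) (use sm Ml in simp)
  then have "\<forall>\<^sub>F n in sequentially. directional_energy p w0 M h \<sigma> - \<epsilon> / 2
      < (\<integral>x. indicator {x. norm x < real n \<and> \<bar>?s x\<bar> \<le> real n} x * (w0 x * \<bar>?s x\<bar> powr p) \<partial>M)"
    using \<epsilon> by (intro order_tendstoD(1)) (auto simp: directional_energy_def)
  then obtain n :: nat where n: "directional_energy p w0 M h \<sigma> - \<epsilon> / 2
      < (\<integral>x. indicator {x. norm x < real n \<and> \<bar>?s x\<bar> \<le> real n} x * (w0 x * \<bar>?s x\<bar> powr p) \<partial>M)"
    by (auto simp: eventually_sequentially)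
  define MB where "MB = density M (\<lambda>x. indicator (ball 0 (real n)) x)"
  note mb = gradient_density_ball[OF p1 grad, where c = 0 and r = "real n", folded MB_def]
  interpret MB: finite_measure MB by (rule mb(1))
  have mMB: "f \<in> borel_measurable MB" if "f \<in> borel_measurable borel" for f :: "'a \<Rightarrow> real"
    using that measurable_cong_sets[OF mb(2) refl] by blast
  define T where "T x = (if \<bar>?s x\<bar> \<le> real n then ?s x else 0)" for x
  have Tm: "T \<in> borel_measurable borel" unfolding T_def using sm by measurable
  define a where "a x = W x * (p * \<bar>T x\<bar> powr (p - 1) * sgn (T x))" for x
  have am: "a \<in> borel_measurable borel" unfolding a_def using Tm Wm by measurable
  define B where "B = (K + \<eta>) * (p * real n powr (p - 1))"
  have aB: "\<bar>a x\<bar> \<le> B" for x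
  proof -
    have "\<bar>T x\<bar> \<le> real n" by (simp add: T_def)
    then have "\<bar>T x\<bar> powr (p - 1) \<le> real n powr (p - 1)" using p by (intro powr_mono2) auto
    then have "\<bar>T x\<bar> powr (p - 1) * \<bar>sgn (T x)\<bar> \<le> real n powr (p - 1) * 1"
      by (intro mult_mono) (auto simp: sgn_if)
    then have "\<bar>p * \<bar>T x\<bar> powr (p - 1) * sgn (T x)\<bar> \<le> p * real n powr (p - 1)"
      using p by (simp add: abs_mult mult.assoc)
    then show ?thesis unfolding a_def abs_mult[of "W x"] B_def
      using W[of x] by (intro mult_mono) auto
  qed
  obtain \<psi> where \<psi>: "\<And>k::nat. \<psi> k \<in> test_functions" "\<And>k x. x \<notin> ball 0 (real n) \<Longrightarrow> \<psi> k x = 0"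
    "\<And>k x. \<bar>\<psi> k x\<bar> \<le> B + 1 / real (Suc k)" "AE x in MB. (\<lambda>k. \<psi> k x) \<longlonglongrightarrow> a x"
    by (rule test_functions_approximate_AE[OF mb(1-3) am, of "\<lambda>_. B"]) (use aB that in \<open>auto\<close>)
  have \<psi>B: "\<bar>\<psi> k x\<bar> \<le> B + 1" for k x
  proof -
    have "1 / real (Suc k) \<le> 1" by simp
    then show ?thesis using \<psi>(3)[of k x] by linarith
  qed
  have \<psi>m: "\<psi> k \<in> borel_measurable borel" for k
    by (rule borel_measurable_continuous_onI[OF test_function_continuous[OF \<psi>(1)]])
  define \<kappa> where "\<kappa> k x = W x * power_conjugate p (\<psi> k x / W x)" for k x
  have \<kappa>m: "\<kappa> k \<in> borel_measurable borel" for k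
    unfolding \<kappa>_def power_conjugate_def using \<psi>m[of k] Wm by measurable
  have \<kappa>B: "\<bar>\<kappa> k x\<bar> \<le> (K + \<eta>) * power_conjugate p ((B + 1) / \<eta>)" for k x
  proof -
    have "\<bar>\<psi> k x / W x\<bar> \<le> (B + 1) / \<eta>"
      using \<psi>B[of k x] W[of x] \<eta> by (simp add: abs_divide frac_le)
    from power_conjugate_mono[OF p this] show ?thesis
      unfolding \<kappa>_def abs_mult using W[of x] by (intro mult_mono) auto
  qed
  have \<kappa>0: "\<kappa> k x = 0" if "x \<notin> ball 0 (real n)" for k x
    using \<psi>(2)[OF that] p by (simp add: \<kappa>_def power_conjugate_def)
  have \<kappa>int: "integrable lborel (\<kappa> k)" for k
    by (rule integrable_bounded_support[OF \<kappa>m \<kappa>B \<kappa>0])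
  have lower: "directional_energy p w0 M h \<sigma> - \<epsilon> / 2 < (\<integral>x. a x * ?s x - W x * power_conjugate p (a x / W x) \<partial>MB)"
  proof -
    have eq: "a x * ?s x - W x * power_conjugate p (a x / W x) = W x * \<bar>T x\<bar> powr p" for x
    proof -
      have "a x * ?s x = W x * ((p * \<bar>T x\<bar> powr (p - 1) * sgn (T x)) * T x)"
        by (simp add: a_def T_def)
      moreover have "a x / W x = p * \<bar>T x\<bar> powr (p - 1) * sgn (T x)" using W(3)[of x] by (simp add: a_def)
      ultimately have "a x * ?s x - W x * power_conjugate p (a x / W x)
          = W x * ((p * \<bar>T x\<bar> powr (p - 1) * sgn (T x)) * T x - power_conjugate p (p * \<bar>T x\<bar> powr (p - 1) * sgn (T x)))"
        by (simp add: right_diff_distrib)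
      then show ?thesis unfolding power_conjugate_equality[OF p] .
    qed
    have WTm: "(\<lambda>x. W x * \<bar>T x\<bar> powr p) \<in> borel_measurable borel" using Wm Tm by measurable
    have Tint: "integrable M (\<lambda>x. indicator (ball 0 (real n)) x * (W x * \<bar>T x\<bar> powr p))"
      unfolding Ml
    proof (rule integrable_bounded_support[where K = "(K + \<eta>) * real n powr p" and c = 0 and r = "real n"])
      show "(\<lambda>x. indicator (ball 0 (real n)) x * (W x * \<bar>T x\<bar> powr p)) \<in> borel_measurable borel"
        by (rule borel_measurable_times[OF borel_measurable_indicator WTm]) simp
      fix x
      have "\<bar>T x\<bar> powr p \<le> real n powr p" using p by (intro powr_mono2) (auto simp: T_def)
      then have "W x * \<bar>T x\<bar> powr p \<le> (K + \<eta>) * real n powr p" using W[of x] by (intro mult_mono) auto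
      moreover have "0 \<le> W x * \<bar>T x\<bar> powr p" "0 \<le> (K + \<eta>) * real n powr p" using W(3)[of x] K \<eta> by auto
      ultimately show "\<bar>indicator (ball 0 (real n)) x * (W x * \<bar>T x\<bar> powr p)\<bar> \<le> (K + \<eta>) * real n powr p"
        by (auto simp: indicator_def)
    qed (auto simp: indicator_def)
    have "(\<integral>x. indicator {x. norm x < real n \<and> \<bar>?s x\<bar> \<le> real n} x * (w0 x * \<bar>?s x\<bar> powr p) \<partial>M)
        \<le> (\<integral>x. indicator (ball 0 (real n)) x * (W x * \<bar>T x\<bar> powr p) \<partial>M)"
    proof (rule integral_mono'[OF Tint])
      fix x
      show "0 \<le> indicator (ball 0 (real n)) x * (W x * \<bar>T x\<bar> powr p)"
        using W(3)[of x] by simp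
      show "indicator {x. norm x < real n \<and> \<bar>?s x\<bar> \<le> real n} x * (w0 x * \<bar>?s x\<bar> powr p)
          \<le> indicator (ball 0 (real n)) x * (W x * \<bar>T x\<bar> powr p)"
        using W(3)[of x] \<eta> by (auto simp: indicator_def T_def W_def intro!: mult_right_mono)
    qed
    also have "\<dots> = (\<integral>x. W x * \<bar>T x\<bar> powr p \<partial>MB)"
      by (rule mb(5)[OF WTm, symmetric])
    finally show ?thesis using n unfolding eq by linarith
  qed
  have "(\<lambda>k. \<integral>x. \<psi> k x * ?s x - \<kappa> k x \<partial>MB) \<longlonglongrightarrow> (\<integral>x. a x * ?s x - W x * power_conjugate p (a x / W x) \<partial>MB)"
  proof (rule integral_dominated_convergence[where w = "\<lambda>x. (B + 1) * \<bar>?s x\<bar> + (K + \<eta>) * power_conjugate p ((B + 1) / \<eta>)"])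
    show "(\<lambda>x. a x * ?s x - W x * power_conjugate p (a x / W x)) \<in> borel_measurable MB"
    proof (intro mMB borel_measurable_diff)
      show "(\<lambda>x. a x * ?s x) \<in> borel_measurable borel" using am sm by (rule borel_measurable_times)
      show "(\<lambda>x. W x * power_conjugate p (a x / W x)) \<in> borel_measurable borel"
        unfolding power_conjugate_def using am Wm by measurable
    qed
    show "(\<lambda>x. \<psi> k x * ?s x - \<kappa> k x) \<in> borel_measurable MB" for k
      using \<psi>m[of k] sm \<kappa>m[of k] by (intro mMB borel_measurable_diff borel_measurable_times)
    show "integrable MB (\<lambda>x. (B + 1) * \<bar>?s x\<bar> + (K + \<eta>) * power_conjugate p ((B + 1) / \<eta>))"
      using mb(4)[of \<sigma>] by (intro Bochner_Integration.integrable_add integrable_mult_right integrable_abs MB.integrable_const)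
    show "AE x in MB. (\<lambda>k. \<psi> k x * ?s x - \<kappa> k x) \<longlonglongrightarrow> a x * ?s x - W x * power_conjugate p (a x / W x)"
      using \<psi>(4)
    proof eventually_elim
      case (elim x)
      have "W x \<noteq> 0" using W(3)[of x] by simp
      then show ?case unfolding \<kappa>_def
        by (intro tendsto_diff tendsto_mult tendsto_const power_conjugate_tendsto[OF p] tendsto_divide elim)
    qed
    show "AE x in MB. norm (\<psi> k x * ?s x - \<kappa> k x) \<le> (B + 1) * \<bar>?s x\<bar> + (K + \<eta>) * power_conjugate p ((B + 1) / \<eta>)" for k
    proof (rule AE_I2)
      fix x
      have "norm (\<psi> k x * ?s x - \<kappa> k x) \<le> \<bar>\<psi> k x\<bar> * \<bar>?s x\<bar> + \<bar>\<kappa> k x\<bar>"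
        unfolding real_norm_def abs_mult[symmetric] by (rule abs_triangle_ineq4)
      also have "\<dots> \<le> (B + 1) * \<bar>?s x\<bar> + (K + \<eta>) * power_conjugate p ((B + 1) / \<eta>)"
        by (intro add_mono mult_right_mono \<psi>B \<kappa>B) simp
      finally show "norm (\<psi> k x * ?s x - \<kappa> k x) \<le> (B + 1) * \<bar>?s x\<bar> + (K + \<eta>) * power_conjugate p ((B + 1) / \<eta>)" .
    qed
  qed
  then have "\<forall>\<^sub>F k in sequentially. directional_energy p w0 M h \<sigma> - \<epsilon> / 2 < (\<integral>x. \<psi> k x * ?s x - \<kappa> k x \<partial>MB)"
    using lower by (rule order_tendstoD(1))
  then obtain k where k: "directional_energy p w0 M h \<sigma> - \<epsilon> / 2 < (\<integral>x. \<psi> k x * ?s x - \<kappa> k x \<partial>MB)"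
    unfolding eventually_sequentially by blast
  have "(\<integral>x. \<psi> k x * ?s x - \<kappa> k x \<partial>MB) = (\<integral>x. indicator (ball 0 (real n)) x * (\<psi> k x * ?s x - \<kappa> k x) \<partial>M)"
    using sm \<psi>m[of k] \<kappa>m[of k] by (intro mb(5) borel_measurable_diff borel_measurable_times)
  also have "\<dots> = (\<integral>x. \<psi> k x * ?s x - \<kappa> k x \<partial>M)"
    using \<psi>(2) \<kappa>0 by (intro Bochner_Integration.integral_cong refl) (auto simp: indicator_def)
  also have "\<dots> = (\<integral>x. \<psi> k x * ?s x \<partial>M) - (\<integral>x. \<kappa> k x \<partial>M)"
  proof (rule Bochner_Integration.integral_diff)
    show "integrable M (\<lambda>x. \<psi> k x * ?s x)"
      by (rule integrable_test_mult_gradient[OF p1 gd(1) gradient_density_ball_finite[OF grad] gd(3,4) \<psi>(1)])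
    show "integrable M (\<kappa> k)" unfolding Ml by (rule \<kappa>int)
  qed
  finally have "directional_energy p w0 M h \<sigma> - \<epsilon> \<le> (\<integral>x. \<psi> k x * ?s x \<partial>M) - (\<integral>x. \<kappa> k x \<partial>lborel)"
    using k \<epsilon> by (simp add: Ml)
  moreover have "dual_pair p (\<lambda>x. w0 x + \<eta>) (\<psi> k) (\<kappa> k)"
    unfolding dual_pair_def
  proof (intro conjI allI)
    fix x t
    have "W x * (\<psi> k x / W x * t) \<le> W x * (\<bar>t\<bar> powr p + power_conjugate p (\<psi> k x / W x))"
      using W(3)[of x] by (intro mult_left_mono power_conjugate_Young[OF p]) simp
    moreover have "W x * (\<psi> k x / W x * t) = \<psi> k x * t" using W(3)[of x] by simp
    ultimately show "\<psi> k x * t - \<kappa> k x \<le> (w0 x + \<eta>) * \<bar>t\<bar> powr p"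
      by (simp add: \<kappa>_def distrib_left W_def)
  qed (use \<psi>(1) \<kappa>int in auto)
  ultimately show ?thesis by blast
qed

lemma dual_pair_exists:
  fixes w0 :: "'a::euclidean_space \<Rightarrow> real"
  assumes p: "1 \<le> p" and grad: "gradient_density p u M h"
    and w0: "continuous_on UNIV w0" "\<And>x. \<bar>w0 x\<bar> \<le> K" "\<And>x. 0 \<le> w0 x"
    and \<eta>: "0 < \<eta>" and \<epsilon>: "0 < \<epsilon>"
  shows "\<exists>\<psi> \<kappa>. dual_pair p (\<lambda>x. w0 x + \<eta>) \<psi> \<kappa> \<and>
    directional_energy p w0 M h \<sigma> - \<epsilon> \<le> (\<integral>x. \<psi> x * (\<sigma> \<bullet> h x) \<partial>M) - (\<integral>x. \<kappa> x \<partial>lborel)"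
proof (cases "p = 1")
  case True
  show ?thesis
    using dual_pair_exists_1[OF grad[unfolded True] w0 \<eta> \<epsilon>] unfolding True .
next
  case False
  with p have "1 < p" by simp
  from dual_pair_exists_gt_1[OF this grad w0 \<eta> \<epsilon>] show ?thesis .
qed

section \<open>Lower bound for directional difference quotients\<close>

lemma integral_lborel_shift:
  fixes f :: "'a::euclidean_space \<Rightarrow> real"
  assumes "f \<in> borel_measurable borel"
  shows "(\<integral>x. f (t + x) \<partial>lborel) = (\<integral>x. f x \<partial>lborel)"
    "integrable lborel (\<lambda>x. f (t + x)) \<longleftrightarrow> integrable lborel f"
proof -
  have d: "distr lborel borel ((+) t) = (lborel :: 'a measure)" by (rule lborel_distr_plus)
  have "(\<integral>x. f x \<partial>distr lborel borel ((+) t)) = (\<integral>x. f (t + x) \<partial>lborel)"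
    by (rule integral_distr) (use assms in auto)
  then show "(\<integral>x. f (t + x) \<partial>lborel) = (\<integral>x. f x \<partial>lborel)" unfolding d by simp
  have "integrable (distr lborel borel ((+) t)) f \<longleftrightarrow> integrable lborel (\<lambda>x. f (t + x))"
    by (rule integrable_distr_eq) (use assms in auto)
  then show "integrable lborel (\<lambda>x. f (t + x)) \<longleftrightarrow> integrable lborel f" unfolding d by simp
qed

lemma integrable_bounded_mult:
  fixes f g :: "'a \<Rightarrow> real"
  assumes "integrable M g" "f \<in> borel_measurable M" "\<And>x. \<bar>f x\<bar> \<le> K"
  shows "integrable M (\<lambda>x. f x * g x)"
proof (rule Bochner_Integration.integrable_bound)
  show "integrable M (\<lambda>x. K * \<bar>g x\<bar>)" using assms(1) by simp
  show "(\<lambda>x. f x * g x) \<in> borel_measurable M" using assms(1,2) by simp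
  show "AE x in M. norm (f x * g x) \<le> norm (K * \<bar>g x\<bar>)"
  proof (rule AE_I2)
    fix x
    have "norm (f x * g x) \<le> K * \<bar>g x\<bar>"
      unfolding real_norm_def abs_mult by (rule mult_right_mono[OF assms(3)]) simp
    then show "norm (f x * g x) \<le> norm (K * \<bar>g x\<bar>)"
      unfolding real_norm_def by (rule order_trans[OF _ abs_ge_self])
  qed
qed

lemma ennreal_integral_le_nn_integral:
  assumes "integrable M f"
  shows "ennreal (\<integral>x. f x \<partial>M) \<le> (\<integral>\<^sup>+x. ennreal (f x) \<partial>M)"
proof -
  have "(\<integral>x. f x \<partial>M) \<le> (\<integral>x. max 0 (f x) \<partial>M)"
    using assms by (intro integral_mono) auto
  then have "ennreal (\<integral>x. f x \<partial>M) \<le> ennreal (\<integral>x. max 0 (f x) \<partial>M)" by (rule ennreal_leI)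
  also have "\<dots> = (\<integral>\<^sup>+x. ennreal (max 0 (f x)) \<partial>M)"
    using assms by (intro nn_integral_eq_integral[symmetric]) auto
  also have "\<dots> = (\<integral>\<^sup>+x. ennreal (f x) \<partial>M)"
    by (intro nn_integral_cong) (simp add: max_def ennreal_neg)
  finally show ?thesis .
qed

lemma test_difference_quotient_tendsto:
  fixes \<psi> :: "'a::euclidean_space \<Rightarrow> real"
  assumes \<psi>: "\<psi> \<in> test_functions" and z: "\<And>n. z n \<noteq> 0" "z \<longlonglongrightarrow> 0" and \<sigma>: "(\<lambda>n. sgn (z n)) \<longlonglongrightarrow> \<sigma>"
  shows "(\<lambda>n. (\<psi> (x + z n) - \<psi> x) / norm (z n)) \<longlonglongrightarrow> frechet_derivative \<psi> (at x) \<sigma>"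
proof -
  let ?D = "frechet_derivative \<psi> (at x)"
  have D: "(\<psi> has_derivative ?D) (at x)" by (rule test_function_derivative[OF \<psi>])
  then have bl: "bounded_linear ?D" by (rule has_derivative_bounded_linear)
  have "((\<lambda>h. norm (\<psi> (x + h) - \<psi> x - ?D h) / norm h) \<longlongrightarrow> 0) (at 0)"
    using D unfolding has_derivative_at by blast
  moreover have "filterlim z (at 0) sequentially"
    using z by (auto simp: filterlim_at)
  ultimately have "(\<lambda>n. norm (\<psi> (x + z n) - \<psi> x - ?D (z n)) / norm (z n)) \<longlonglongrightarrow> 0"
    by (rule filterlim_compose)
  then have "(\<lambda>n. \<bar>(\<psi> (x + z n) - \<psi> x - ?D (z n)) / norm (z n)\<bar>) \<longlonglongrightarrow> 0"
    by (simp add: abs_divide)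
  then have 1: "(\<lambda>n. (\<psi> (x + z n) - \<psi> x - ?D (z n)) / norm (z n)) \<longlonglongrightarrow> 0"
    by (rule tendsto_rabs_zero_cancel)
  have 2: "(\<lambda>n. ?D (sgn (z n))) \<longlonglongrightarrow> ?D \<sigma>" by (rule bounded_linear.tendsto[OF bl \<sigma>])
  have "(\<psi> (x + z n) - \<psi> x - ?D (z n)) / norm (z n) + ?D (sgn (z n)) = (\<psi> (x + z n) - \<psi> x) / norm (z n)" for n
  proof -
    have "?D (sgn (z n)) = ?D (z n) / norm (z n)"
      unfolding sgn_div_norm using linear_scale[OF bounded_linear.linear[OF bl]] by (simp add: divide_inverse mult.commute)
    then show ?thesis by (simp add: diff_divide_distrib)
  qed
  then show ?thesis using tendsto_add[OF 1 2] by simp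
qed

text \<open>
  The heart of the liminf inequality. For a dual pair \<open>(\<psi>, \<kappa>)\<close> the right-hand side is at least
  \<open>\<integral>\<psi> (U - U (\<cdot> - z)) / \<bar>z\<bar> - \<integral>\<kappa>\<close>. Moving the translation to \<open>\<psi>\<close> gives difference quotients of \<open>\<psi>\<close>, which are bounded and
  converge to a directional derivative, so the convergence of \<open>U j\<close> to \<open>v\<close> in \<open>L\<^sup>1\<close> suffices to pass to the limit
  \<open>\<integral>\<psi> (\<sigma> \<bullet> h) - \<integral>\<kappa>\<close>, which is as close to the directional energy as desired. The uniformity in the direction of \<open>z\<close> comes
  from compactness of the sphere: a sequence of counterexamples \<open>z n\<close> has directions that converge to some \<open>\<sigma>\<close>, and a dual
  pair for \<open>\<sigma>\<close> refutes it.
\<close>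

lemma difference_quotient_energy_liminf:
  fixes v w0 :: "'a::euclidean_space \<Rightarrow> real" and U :: "nat \<Rightarrow> 'a \<Rightarrow> real"
  assumes p: "1 \<le> p" and grad: "gradient_density p v M h"
    and w0: "continuous_on UNIV w0" "\<And>x. \<bar>w0 x\<bar> \<le> K" "\<And>x. 0 \<le> w0 x"
    and v: "integrable lborel v" and U: "\<And>j. integrable lborel (U j)"
    and conv: "(\<lambda>j. \<integral>x. \<bar>U j x - v x\<bar> \<partial>lborel) \<longlonglongrightarrow> 0" and \<eta>: "0 < \<eta>"
  shows "\<exists>\<delta>>0. \<exists>J. \<forall>j\<ge>J. \<forall>z. z \<noteq> 0 \<and> norm z < \<delta> \<longrightarrow>
    ennreal (directional_energy p w0 M h (sgn z) - \<eta>)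
      \<le> (\<integral>\<^sup>+x. ennreal ((w0 x + \<eta>) * (\<bar>U j x - U j (x - z)\<bar> powr p / norm z powr p)) \<partial>lborel)"
proof (rule ccontr)
  define f where "f = directional_energy p w0 M h"
  define \<Phi> where "\<Phi> j z = (\<integral>\<^sup>+x. ennreal ((w0 x + \<eta>) * (\<bar>U j x - U j (x - z)\<bar> powr p / norm z powr p)) \<partial>lborel)" for j z
  assume "\<not> ?thesis"
  then have neg: "\<forall>\<delta>>0. \<forall>J. \<exists>j\<ge>J. \<exists>z. z \<noteq> 0 \<and> norm z < \<delta> \<and> \<not> ennreal (f (sgn z) - \<eta>) \<le> \<Phi> j z"
    unfolding f_def \<Phi>_def by blast
  have "\<exists>j z. n \<le> j \<and> z \<noteq> 0 \<and> norm z < 1 / real (Suc n) \<and> \<not> ennreal (f (sgn z) - \<eta>) \<le> \<Phi> j z" for n :: nat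
    using neg[rule_format, of "1 / real (Suc n)" n] by auto
  then obtain jj zz where jz: "\<And>n. n \<le> jj n" "\<And>n. zz n \<noteq> 0" "\<And>n. norm (zz n) < 1 / real (Suc n)"
    "\<And>n. \<not> ennreal (f (sgn (zz n)) - \<eta>) \<le> \<Phi> (jj n) (zz n)" by metis
  have sph: "sgn (zz n) \<in> sphere 0 1" for n using jz(2)[of n] by (simp add: norm_sgn)
  have "\<exists>l\<in>sphere 0 1. \<exists>r. strict_mono r \<and> ((\<lambda>n. sgn (zz n)) \<circ> r) \<longlonglongrightarrow> l"
    by (rule compact_sphere[of 0 1, unfolded compact_def, THEN spec, THEN mp]) (rule allI, rule sph)
  then obtain \<sigma> r where r: "strict_mono r" "((\<lambda>n. sgn (zz n)) \<circ> r) \<longlonglongrightarrow> \<sigma>"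
    by blast
  define z where "z n = zz (r n)" for n
  define j where "j n = jj (r n)" for n
  have z0: "z n \<noteq> 0" for n using jz(2) by (simp add: z_def)
  have z_lim: "z \<longlonglongrightarrow> 0"
  proof (rule tendsto_norm_zero_cancel, rule tendsto_sandwich[OF _ _ tendsto_const LIMSEQ_Suc[OF lim_1_over_n]])
    have "norm (z n) \<le> 1 / real (Suc n)" for n
    proof -
      have "norm (z n) < 1 / real (Suc (r n))" unfolding z_def by (rule jz(3))
      also have "\<dots> \<le> 1 / real (Suc n)" using seq_suble[OF r(1), of n] by (simp add: frac_le)
      finally show ?thesis by simp
    qed
    then show "\<forall>\<^sub>F n in sequentially. norm (z n) \<le> 1 / real (Suc n)" by simp
  qed simp
  have j_lim: "filterlim j at_top sequentially"
  proof (rule filterlim_at_top_mono[OF filterlim_ident])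
    have "n \<le> j n" for n using seq_suble[OF r(1), of n] jz(1)[of "r n"] unfolding j_def by (rule order_trans)
    then show "\<forall>\<^sub>F n in sequentially. n \<le> j n" by simp
  qed
  have \<sigma>_lim: "(\<lambda>n. sgn (z n)) \<longlonglongrightarrow> \<sigma>" using r(2) by (simp add: z_def o_def)
  have \<eta>3: "0 < \<eta> / 3" using \<eta> by simp
  obtain \<psi> \<kappa> where dp: "dual_pair p (\<lambda>x. w0 x + \<eta>) \<psi> \<kappa>"
    and low: "f \<sigma> - \<eta> / 3 \<le> (\<integral>x. \<psi> x * (\<sigma> \<bullet> h x) \<partial>M) - (\<integral>x. \<kappa> x \<partial>lborel)"
    using dual_pair_exists[OF p grad w0 \<eta> \<eta>3, of \<sigma>] unfolding f_def by blast
  have \<psi>: "\<psi> \<in> test_functions" and \<kappa>: "integrable lborel \<kappa>"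
    and Young: "\<And>x t. \<psi> x * t - \<kappa> x \<le> (w0 x + \<eta>) * \<bar>t\<bar> powr p"
    using dp by (auto simp: dual_pair_def)
  obtain L where L: "0 < L" "\<And>x y. \<bar>\<psi> x - \<psi> y\<bar> \<le> L * norm (x - y)"
    by (rule test_function_Lipschitz[OF \<psi>]) (rule that)
  obtain B where B: "\<And>x. \<bar>\<psi> x\<bar> \<le> B" using test_function_bounded[OF \<psi>] by blast
  have \<psi>m: "\<psi> \<in> borel_measurable borel"
    by (rule borel_measurable_continuous_onI[OF test_function_continuous[OF \<psi>]])
  have shift_m: "(\<lambda>x. g (x + c)) \<in> borel_measurable borel" if "g \<in> borel_measurable borel" for g :: "'a \<Rightarrow> real" and c
    using that by measurable
  have Um: "U k \<in> borel_measurable borel" for k using borel_measurable_integrable[OF U[of k]] by simp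
  define Q where "Q n x = (\<psi> (x + z n) - \<psi> x) / norm (z n)" for n x
  have Qm: "Q n \<in> borel_measurable borel" for n
    unfolding Q_def using \<psi>m shift_m[OF \<psi>m] by (intro borel_measurable_divide borel_measurable_diff borel_measurable_const)
  have QL: "\<bar>Q n x\<bar> \<le> L" for n x
  proof -
    have "\<bar>\<psi> (x + z n) - \<psi> x\<bar> \<le> L * norm (z n)" using L(2)[of "x + z n" x] by simp
    then show ?thesis using z0[of n] by (simp add: Q_def abs_divide pos_divide_le_eq)
  qed
  have Qv: "integrable lborel (\<lambda>x. Q n x * v x)" for n
    by (rule integrable_bounded_mult[OF v _ QL]) (use Qm in simp)
  have lim_v: "(\<lambda>n. \<integral>x. Q n x * v x \<partial>lborel) \<longlonglongrightarrow> (\<integral>x. frechet_derivative \<psi> (at x) \<sigma> * v x \<partial>lborel)"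
  proof (rule integral_dominated_convergence[where w = "\<lambda>x. L * \<bar>v x\<bar>"])
    show "(\<lambda>x. frechet_derivative \<psi> (at x) \<sigma> * v x) \<in> borel_measurable lborel"
      using test_function_derivative_borel[OF \<psi>] v by simp
    show "(\<lambda>x. Q n x * v x) \<in> borel_measurable lborel" for n using borel_measurable_integrable[OF Qv] .
    show "integrable lborel (\<lambda>x. L * \<bar>v x\<bar>)" using v by simp
    show "AE x in lborel. (\<lambda>n. Q n x * v x) \<longlonglongrightarrow> frechet_derivative \<psi> (at x) \<sigma> * v x"
      unfolding Q_def by (intro AE_I2 tendsto_mult tendsto_const test_difference_quotient_tendsto[OF \<psi> z0 z_lim \<sigma>_lim])
    show "AE x in lborel. norm (Q n x * v x) \<le> L * \<bar>v x\<bar>" for n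
      unfolding real_norm_def abs_mult using QL by (intro AE_I2 mult_right_mono) auto
  qed
  have lim_diff: "(\<lambda>n. \<integral>x. Q n x * (U (j n) x - v x) \<partial>lborel) \<longlonglongrightarrow> 0"
  proof (rule Lim_null_comparison)
    have "norm (\<integral>x. Q n x * (U (j n) x - v x) \<partial>lborel) \<le> L * (\<integral>x. \<bar>U (j n) x - v x\<bar> \<partial>lborel)" for n
    proof -
      have d: "integrable lborel (\<lambda>x. U (j n) x - v x)" using U v by (rule Bochner_Integration.integrable_diff)
      have "norm (\<integral>x. Q n x * (U (j n) x - v x) \<partial>lborel) \<le> (\<integral>x. norm (Q n x * (U (j n) x - v x)) \<partial>lborel)"
        by (rule integral_norm_bound)
      also have "\<dots> \<le> (\<integral>x. L * \<bar>U (j n) x - v x\<bar> \<partial>lborel)"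
      proof (rule integral_mono')
        show "integrable lborel (\<lambda>x. L * \<bar>U (j n) x - v x\<bar>)" using d by simp
        show "norm (Q n x * (U (j n) x - v x)) \<le> L * \<bar>U (j n) x - v x\<bar>" for x
          unfolding real_norm_def abs_mult by (intro mult_right_mono QL) simp
        show "0 \<le> L * \<bar>U (j n) x - v x\<bar>" for x using L(1) by simp
      qed
      finally show ?thesis by simp
    qed
    then show "\<forall>\<^sub>F n in sequentially. norm (\<integral>x. Q n x * (U (j n) x - v x) \<partial>lborel) \<le> L * (\<integral>x. \<bar>U (j n) x - v x\<bar> \<partial>lborel)"
      by simp
    show "(\<lambda>n. L * (\<integral>x. \<bar>U (j n) x - v x\<bar> \<partial>lborel)) \<longlonglongrightarrow> 0"
      using tendsto_mult_right_zero[OF filterlim_compose[OF conv j_lim]] by simp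
  qed
  have QU: "(\<integral>x. Q n x * U (j n) x \<partial>lborel) = (\<integral>x. Q n x * (U (j n) x - v x) \<partial>lborel) + (\<integral>x. Q n x * v x \<partial>lborel)" for n
  proof -
    have "integrable lborel (\<lambda>x. Q n x * (U (j n) x - v x))"
      by (rule integrable_bounded_mult[OF Bochner_Integration.integrable_diff[OF U v] _ QL]) (use Qm in simp)
    from Bochner_Integration.integral_add[OF this Qv[of n]] show ?thesis by (simp add: algebra_simps)
  qed
  have "(\<lambda>n. \<integral>x. Q n x * U (j n) x \<partial>lborel) \<longlonglongrightarrow> (\<integral>x. frechet_derivative \<psi> (at x) \<sigma> * v x \<partial>lborel)"
    unfolding QU using tendsto_add[OF lim_diff lim_v] by simp
  \<comment> \<open>the definition of the gradient of \<open>v\<close>, read as an integration by parts\<close>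
  then have I_lim: "(\<lambda>n. - (\<integral>x. Q n x * U (j n) x \<partial>lborel)) \<longlonglongrightarrow> (\<integral>x. \<psi> x * (\<sigma> \<bullet> h x) \<partial>M)"
    using gradient_densityD(5)[OF grad \<psi>, of \<sigma>] by (auto simp: mult.commute dest: tendsto_minus)
  have f_lim: "(\<lambda>n. f (sgn (z n))) \<longlonglongrightarrow> f \<sigma>"
    using continuous_on_tendsto_compose[OF directional_energy_continuous[OF p grad w0(1,2)] \<sigma>_lim] by (simp add: f_def)
  have "\<forall>\<^sub>F n in sequentially. (\<integral>x. \<psi> x * (\<sigma> \<bullet> h x) \<partial>M) - \<eta> / 3 < - (\<integral>x. Q n x * U (j n) x \<partial>lborel)"
    using \<eta> by (intro order_tendstoD(1)[OF I_lim]) simp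
  moreover have "\<forall>\<^sub>F n in sequentially. f (sgn (z n)) < f \<sigma> + \<eta> / 3"
    using \<eta> by (intro order_tendstoD(2)[OF f_lim]) simp
  ultimately have "\<forall>\<^sub>F n in sequentially. (\<integral>x. \<psi> x * (\<sigma> \<bullet> h x) \<partial>M) - \<eta> / 3 < - (\<integral>x. Q n x * U (j n) x \<partial>lborel)
      \<and> f (sgn (z n)) < f \<sigma> + \<eta> / 3" by (rule eventually_conj)
  then obtain n where n: "(\<integral>x. \<psi> x * (\<sigma> \<bullet> h x) \<partial>M) - \<eta> / 3 < - (\<integral>x. Q n x * U (j n) x \<partial>lborel)"
    "f (sgn (z n)) < f \<sigma> + \<eta> / 3"
    unfolding eventually_sequentially by blast
  \<comment> \<open>For one late \<open>n\<close>, the chain below is the dual lower bound for the energy of the difference quotient \<open>t\<close>,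
    with the three errors of size \<open>\<eta> / 3\<close> from the dual pair, the limit of the integrals and the continuity of \<open>f\<close>.\<close>
  define t where "t x = (U (j n) x - U (j n) (x - z n)) / norm (z n)" for x
  have i1: "integrable lborel (\<lambda>x. \<psi> x * U (j n) x)"
    by (rule integrable_bounded_mult[OF U _ B]) (use \<psi>m in simp)
  have i2: "integrable lborel (\<lambda>x. \<psi> (x + z n) * U (j n) x)"
    by (rule integrable_bounded_mult[OF U _ B]) (use shift_m[OF \<psi>m] in simp)
  have m3: "(\<lambda>x. \<psi> (x + z n) * U (j n) x) \<in> borel_measurable borel"
    by (rule borel_measurable_times[OF shift_m[OF \<psi>m] Um])
  have s3: "\<psi> (- z n + x + z n) * U (j n) (- z n + x) = \<psi> x * U (j n) (x - z n)" for x
    by simp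
  have i3: "integrable lborel (\<lambda>x. \<psi> x * U (j n) (x - z n))"
    using integral_lborel_shift(2)[OF m3, of "- z n"] i2 unfolding s3 by simp
  have e3: "(\<integral>x. \<psi> x * U (j n) (x - z n) \<partial>lborel) = (\<integral>x. \<psi> (x + z n) * U (j n) x \<partial>lborel)"
    using integral_lborel_shift(1)[OF m3, of "- z n"] unfolding s3 .
  have t_eq: "\<psi> x * t x = (\<psi> x * U (j n) x - \<psi> x * U (j n) (x - z n)) / norm (z n)" for x
    by (simp add: t_def right_diff_distrib)
  have it: "integrable lborel (\<lambda>x. \<psi> x * t x)"
    unfolding t_eq by (intro integrable_divide Bochner_Integration.integrable_diff i1 i3)
  have "(\<integral>x. \<psi> x * t x \<partial>lborel) = ((\<integral>x. \<psi> x * U (j n) x \<partial>lborel) - (\<integral>x. \<psi> (x + z n) * U (j n) x \<partial>lborel)) / norm (z n)"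
    unfolding t_eq e3[symmetric] integral_divide_zero Bochner_Integration.integral_diff[OF i1 i3] by (rule refl)
  also have "\<dots> = - (\<integral>x. Q n x * U (j n) x \<partial>lborel)"
  proof -
    have "(\<integral>x. Q n x * U (j n) x \<partial>lborel) = (\<integral>x. (\<psi> (x + z n) * U (j n) x - \<psi> x * U (j n) x) / norm (z n) \<partial>lborel)"
      by (intro Bochner_Integration.integral_cong refl) (simp add: Q_def left_diff_distrib)
    also have "\<dots> = ((\<integral>x. \<psi> (x + z n) * U (j n) x \<partial>lborel) - (\<integral>x. \<psi> x * U (j n) x \<partial>lborel)) / norm (z n)"
      unfolding integral_divide_zero Bochner_Integration.integral_diff[OF i2 i1] by (rule refl)
    finally show ?thesis by (simp add: minus_divide_left)
  qed
  finally have "f (sgn (z n)) - \<eta> \<le> (\<integral>x. \<psi> x * t x \<partial>lborel) - (\<integral>x. \<kappa> x \<partial>lborel)"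
    using n low by linarith
  also have "\<dots> = (\<integral>x. \<psi> x * t x - \<kappa> x \<partial>lborel)"
    by (rule Bochner_Integration.integral_diff[OF it \<kappa>, symmetric])
  finally have "ennreal (f (sgn (z n)) - \<eta>) \<le> ennreal (\<integral>x. \<psi> x * t x - \<kappa> x \<partial>lborel)" by (rule ennreal_leI)
  also have "\<dots> \<le> (\<integral>\<^sup>+x. ennreal (\<psi> x * t x - \<kappa> x) \<partial>lborel)"
    by (rule ennreal_integral_le_nn_integral[OF Bochner_Integration.integrable_diff[OF it \<kappa>]])
  also have "\<dots> \<le> \<Phi> (j n) (z n)"
    unfolding \<Phi>_def
  proof (intro nn_integral_mono ennreal_leI)
    fix x
    have "\<bar>t x\<bar> powr p = \<bar>U (j n) x - U (j n) (x - z n)\<bar> powr p / norm (z n) powr p"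
      by (simp add: t_def abs_divide powr_divide)
    then show "\<psi> x * t x - \<kappa> x \<le> (w0 x + \<eta>) * (\<bar>U (j n) x - U (j n) (x - z n)\<bar> powr p / norm (z n) powr p)"
      using Young[of x "t x"] by simp
  qed
  finally show False using jz(4)[of "r n"] by (simp add: z_def j_def)
qed

section \<open>Bounds for the nonlocal energy\<close>

text \<open>
  Substituting \<open>y = x - z\<close> (Fubini), the left-hand side is the part of a nonlocal energy with \<open>\<bar>x - y\<bar> < \<delta>\<close>, and with
  weight \<open>w0 x + \<eta>\<close>. This weight exceeds \<open>wk (x, y)\<close> by at most \<open>e + \<bar>\<eta>\<bar>\<close>, whence the unweighted energy.
\<close>

lemma nonlocal_energy_lower_bound:
  fixes U \<rho> w0 :: "'a::euclidean_space \<Rightarrow> real" and wk :: "'a \<times> 'a \<Rightarrow> real"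
  assumes U [measurable]: "U \<in> borel_measurable borel" and \<rho> [measurable]: "\<rho> \<in> borel_measurable borel"
    and w0: "w0 \<in> borel_measurable borel" "\<And>x. 0 \<le> w0 x"
    and wk: "wk \<in> borel_measurable borel" "AE z in lborel. 0 \<le> wk z"
    and e: "0 \<le> e" and close: "AE z in lborel. dist (fst z) (snd z) < \<delta> \<longrightarrow> w0 (fst z) \<le> wk z + e"
  shows "(\<integral>\<^sup>+z. (if z \<noteq> 0 \<and> norm z < \<delta> then ennreal (\<rho> z)
        * (\<integral>\<^sup>+x. ennreal ((w0 x + \<eta>) * (\<bar>U x - U (x - z)\<bar> powr p / norm z powr p)) \<partial>lborel) else 0) \<partial>lborel)
    \<le> nonlocal_energy p \<rho> wk U + ennreal (e + \<bar>\<eta>\<bar>) * nonlocal_energy p \<rho> (\<lambda>_. 1) U"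
proof -
  have [measurable]: "w0 \<in> borel_measurable borel" by (rule w0(1))
  have wkm [measurable]: "wk \<in> borel_measurable (borel \<Otimes>\<^sub>M borel)" using wk(1) by (simp add: borel_prod)
  define q where "q x y = \<bar>U x - U y\<bar> powr p / norm (x - y) powr p" for x y
  define G where "G x z = (if z \<noteq> 0 \<and> norm z < \<delta> then ennreal (\<rho> z) * ennreal ((w0 x + \<eta>) * (\<bar>U x - U (x - z)\<bar> powr p / norm z powr p)) else 0)" for x z
  have Gm: "(\<lambda>(x, z). G x z) \<in> borel_measurable (borel \<Otimes>\<^sub>M borel)"
    unfolding G_def by measurable
  have "(\<integral>\<^sup>+z. (if z \<noteq> 0 \<and> norm z < \<delta> then ennreal (\<rho> z)
        * (\<integral>\<^sup>+x. ennreal ((w0 x + \<eta>) * (\<bar>U x - U (x - z)\<bar> powr p / norm z powr p)) \<partial>lborel) else 0) \<partial>lborel)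
      = (\<integral>\<^sup>+z. (\<integral>\<^sup>+x. G x z \<partial>lborel) \<partial>lborel)"
  proof (rule nn_integral_cong)
    fix z :: 'a
    show "(if z \<noteq> 0 \<and> norm z < \<delta> then ennreal (\<rho> z)
        * (\<integral>\<^sup>+x. ennreal ((w0 x + \<eta>) * (\<bar>U x - U (x - z)\<bar> powr p / norm z powr p)) \<partial>lborel) else 0)
      = (\<integral>\<^sup>+x. G x z \<partial>lborel)"
    proof (cases "z \<noteq> 0 \<and> norm z < \<delta>")
      case True
      have "(\<integral>\<^sup>+x. G x z \<partial>lborel) = (\<integral>\<^sup>+x. ennreal (\<rho> z) * ennreal ((w0 x + \<eta>) * (\<bar>U x - U (x - z)\<bar> powr p / norm z powr p)) \<partial>lborel)"
        using True by (simp add: G_def)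
      also have "\<dots> = ennreal (\<rho> z) * (\<integral>\<^sup>+x. ennreal ((w0 x + \<eta>) * (\<bar>U x - U (x - z)\<bar> powr p / norm z powr p)) \<partial>lborel)"
        by (rule nn_integral_cmult) measurable
      finally show ?thesis using True by simp
    next
      case False
      then have "G x z = 0" for x by (auto simp: G_def)
      then show ?thesis unfolding if_not_P[OF False] by simp
    qed
  qed
  also have "\<dots> = (\<integral>\<^sup>+x. (\<integral>\<^sup>+z. G x z \<partial>lborel) \<partial>lborel)"
    unfolding G_def by (rule lborel_pair.Fubini') measurable
  also have "\<dots> = (\<integral>\<^sup>+x. (\<integral>\<^sup>+y. G x (x - y) \<partial>lborel) \<partial>lborel)"
  proof (rule nn_integral_cong)
    fix x :: 'a
    have "G x \<in> borel_measurable borel" unfolding G_def by measurable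
    from nn_integral_lborel_reflect[OF this, of x]
    show "(\<integral>\<^sup>+z. G x z \<partial>lborel) = (\<integral>\<^sup>+y. G x (x - y) \<partial>lborel)" by simp
  qed
  also have "\<dots> \<le> (\<integral>\<^sup>+x. (\<integral>\<^sup>+y. ennreal (q x y * \<rho> (x - y) * wk (x, y)) + ennreal (e + \<bar>\<eta>\<bar>) * ennreal (q x y * \<rho> (x - y) * 1) \<partial>lborel) \<partial>lborel)"
  proof (rule nn_integral_mono_AE)
    have "AE z in lborel \<Otimes>\<^sub>M lborel. 0 \<le> wk z \<and> (dist (fst z) (snd z) < \<delta> \<longrightarrow> w0 (fst z) \<le> wk z + e)"
      unfolding lborel_prod using wk(2) close by eventually_elim simp
    from lborel_pair.AE_pair[OF this]
    show "AE x in lborel. (\<integral>\<^sup>+y. G x (x - y) \<partial>lborel) \<le> (\<integral>\<^sup>+y. ennreal (q x y * \<rho> (x - y) * wk (x, y)) + ennreal (e + \<bar>\<eta>\<bar>) * ennreal (q x y * \<rho> (x - y) * 1) \<partial>lborel)"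
    proof eventually_elim
      case (elim x)
      have "AE y in lborel. G x (x - y) \<le> ennreal (q x y * \<rho> (x - y) * wk (x, y)) + ennreal (e + \<bar>\<eta>\<bar>) * ennreal (q x y * \<rho> (x - y) * 1)"
        using elim
      proof eventually_elim
        case (elim y)
        note y = elim
        show "G x (x - y) \<le> ennreal (q x y * \<rho> (x - y) * wk (x, y)) + ennreal (e + \<bar>\<eta>\<bar>) * ennreal (q x y * \<rho> (x - y) * 1)"
        proof (cases "x - y \<noteq> 0 \<and> norm (x - y) < \<delta> \<and> 0 \<le> \<rho> (x - y)")
          case True
          have q: "0 \<le> q x y" by (simp add: q_def)
          have w: "w0 x + \<eta> \<le> wk (x, y) + (e + \<bar>\<eta>\<bar>)" 
            using y True abs_ge_self[of \<eta>] by (simp add: dist_norm)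
          have "G x (x - y) = ennreal (\<rho> (x - y)) * ennreal ((w0 x + \<eta>) * q x y)"
            using True by (simp add: G_def q_def)
          also have "\<dots> = ennreal ((q x y * \<rho> (x - y)) * (w0 x + \<eta>))"
            using True by (simp add: ennreal_mult'[symmetric] mult_ac)
          also have "\<dots> \<le> ennreal ((q x y * \<rho> (x - y)) * (wk (x, y) + (e + \<bar>\<eta>\<bar>)))"
            using True q w by (intro ennreal_leI mult_left_mono) auto
          also have "\<dots> = ennreal (q x y * \<rho> (x - y) * wk (x, y) + (e + \<bar>\<eta>\<bar>) * (q x y * \<rho> (x - y) * 1))"
            by (simp add: algebra_simps)
          also have "\<dots> = ennreal (q x y * \<rho> (x - y) * wk (x, y)) + ennreal ((e + \<bar>\<eta>\<bar>) * (q x y * \<rho> (x - y) * 1))"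
            using True q y e by (intro ennreal_plus) auto
          also have "ennreal ((e + \<bar>\<eta>\<bar>) * (q x y * \<rho> (x - y) * 1)) = ennreal (e + \<bar>\<eta>\<bar>) * ennreal (q x y * \<rho> (x - y) * 1)"
            using True q e by (intro ennreal_mult) auto
          finally show ?thesis .
        next
          case False
          then have "G x (x - y) = 0" by (auto simp: G_def ennreal_neg)
          then show ?thesis by simp
        qed
      qed
      then show ?case by (rule nn_integral_mono_AE)
    qed
  qed
  also have "\<dots> = (\<integral>\<^sup>+x. (\<integral>\<^sup>+y. ennreal (q x y * \<rho> (x - y) * wk (x, y)) \<partial>lborel)
      + ennreal (e + \<bar>\<eta>\<bar>) * (\<integral>\<^sup>+y. ennreal (q x y * \<rho> (x - y) * 1) \<partial>lborel) \<partial>lborel)"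
  proof (rule nn_integral_cong)
    fix x :: 'a
    have 1: "(\<lambda>y. ennreal (q x y * \<rho> (x - y) * wk (x, y))) \<in> borel_measurable lborel"
      unfolding q_def by measurable
    have 2: "(\<lambda>y. ennreal (q x y * \<rho> (x - y) * 1)) \<in> borel_measurable lborel"
      unfolding q_def by measurable
    show "(\<integral>\<^sup>+y. ennreal (q x y * \<rho> (x - y) * wk (x, y)) + ennreal (e + \<bar>\<eta>\<bar>) * ennreal (q x y * \<rho> (x - y) * 1) \<partial>lborel)
        = (\<integral>\<^sup>+y. ennreal (q x y * \<rho> (x - y) * wk (x, y)) \<partial>lborel) + ennreal (e + \<bar>\<eta>\<bar>) * (\<integral>\<^sup>+y. ennreal (q x y * \<rho> (x - y) * 1) \<partial>lborel)"
    proof -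
      have 3: "(\<lambda>y. ennreal (e + \<bar>\<eta>\<bar>) * ennreal (q x y * \<rho> (x - y) * 1)) \<in> borel_measurable lborel"
        using 2 by measurable
      show ?thesis unfolding nn_integral_add[OF 1 3] nn_integral_cmult[OF 2] by (rule refl)
    qed
  qed
  also have "\<dots> = (\<integral>\<^sup>+x. (\<integral>\<^sup>+y. ennreal (q x y * \<rho> (x - y) * wk (x, y)) \<partial>lborel) \<partial>lborel)
      + (\<integral>\<^sup>+x. ennreal (e + \<bar>\<eta>\<bar>) * (\<integral>\<^sup>+y. ennreal (q x y * \<rho> (x - y) * 1) \<partial>lborel) \<partial>lborel)"
    unfolding q_def by (rule nn_integral_add) measurable
  also have "(\<integral>\<^sup>+x. ennreal (e + \<bar>\<eta>\<bar>) * (\<integral>\<^sup>+y. ennreal (q x y * \<rho> (x - y) * 1) \<partial>lborel) \<partial>lborel)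
      = ennreal (e + \<bar>\<eta>\<bar>) * (\<integral>\<^sup>+x. (\<integral>\<^sup>+y. ennreal (q x y * \<rho> (x - y) * 1) \<partial>lborel) \<partial>lborel)"
    unfolding q_def by (rule nn_integral_cmult) measurable
  finally show ?thesis by (simp add: nonlocal_energy_def q_def)
qed

text \<open>
  Polar coordinates, after replacing the Hausdorff measure by the larger surface measure.
\<close>

lemma nn_integral_angular_measure_le:
  fixes \<rho> g :: "'a::euclidean_space \<Rightarrow> real"
  assumes \<rho> [measurable]: "\<rho> \<in> borel_measurable borel" and g [measurable]: "g \<in> borel_measurable borel"
  shows "(\<integral>\<^sup>+\<sigma>. ennreal (g \<sigma>) \<partial>angular_measure \<rho> \<delta>)
    \<le> (\<integral>\<^sup>+z. (if z \<noteq> 0 \<and> norm z < \<delta> then ennreal (\<rho> z) * ennreal (g (sgn z)) else 0) \<partial>lborel)"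
proof -
  define n where "n = DIM('a) - 1"
  define H where "H = (hausdorff_measure n :: 'a measure)"
  let ?S = "sphere 0 1 :: 'a set"
  define d where "d \<sigma> = (\<integral>\<^sup>+r. ennreal (\<rho> (r *\<^sub>R \<sigma>) * r ^ n) * indicator {0<..<\<delta>} r \<partial>lborel)" for \<sigma>
  define F where "F z = (if z \<noteq> 0 \<and> norm z < \<delta> then ennreal (\<rho> z) * ennreal (g (sgn z)) else 0)" for z
  have Fm: "F \<in> borel_measurable borel" unfolding F_def by measurable
  have sH: "sets H = sets borel"
    unfolding H_def hausdorff_measure_def by (simp add: sets.sigma_sets_eq[of borel, simplified])
  have S: "?S \<in> sets borel" by simp
  have dm: "d \<in> borel_measurable borel" unfolding d_def by measurable
  have gm: "(\<lambda>\<sigma>. ennreal (g \<sigma>)) \<in> borel_measurable borel" by measurable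
  have meas: "f \<in> borel_measurable (restrict_space H ?S)" if "f \<in> borel_measurable borel" for f :: "'a \<Rightarrow> ennreal"
  proof (rule measurable_restrict_space1)
    show "f \<in> borel_measurable H" unfolding measurable_cong_sets[OF sH refl] by (rule that)
  qed
  have sR: "sets (restrict_space H ?S) = sets (restrict_space surface_measure ?S)"
    by (rule sets_restrict_space_cong) (simp only: sH sets_surface_measure)
  have le: "emeasure (restrict_space H ?S) A \<le> emeasure (restrict_space surface_measure ?S) A" if "A \<in> sets (restrict_space H ?S)" for A
  proof -
    have "A \<in> (\<inter>) ?S ` sets borel" using that by (simp only: sets_restrict_space sH)
    then obtain B where B: "A = ?S \<inter> B" "B \<in> sets borel" by (rule imageE)
    then have A: "A \<in> sets borel" "A \<subseteq> ?S" using S by auto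
    have "?S \<inter> space H \<in> sets H" using S by (simp only: sH sets_eq_imp_space_eq[OF sH] space_borel Int_UNIV_right)
    then have "emeasure (restrict_space H ?S) A = emeasure H A"
      using A(2) by (rule emeasure_restrict_space)
    also have "\<dots> \<le> emeasure surface_measure A"
      unfolding H_def n_def by (rule hausdorff_measure_le_surface_measure[OF A])
    also have "\<dots> = emeasure (restrict_space surface_measure ?S) A"
      by (rule emeasure_restrict_space[symmetric]) (use S A(2) in simp_all)
    finally show ?thesis .
  qed
  have "(\<integral>\<^sup>+\<sigma>. ennreal (g \<sigma>) \<partial>angular_measure \<rho> \<delta>) = (\<integral>\<^sup>+\<sigma>. d \<sigma> * ennreal (g \<sigma>) \<partial>restrict_space H ?S)"
    unfolding angular_measure_def n_def[symmetric] H_def[symmetric] d_def[symmetric]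
    by (rule nn_integral_density[OF meas[OF dm] meas[OF gm]])
  also have "\<dots> \<le> (\<integral>\<^sup>+\<sigma>. d \<sigma> * ennreal (g \<sigma>) \<partial>restrict_space surface_measure ?S)"
    using le by (intro nn_integral_mono_measure[OF sR]) (simp add: le_measure[OF sR])
  also have "\<dots> = (\<integral>\<^sup>+\<sigma>. d \<sigma> * ennreal (g \<sigma>) * indicator ?S \<sigma> \<partial>surface_measure)"
    by (rule nn_integral_restrict_space) (use S in simp)
  also have "\<dots> \<le> (\<integral>\<^sup>+\<sigma>. (\<integral>\<^sup>+r. (if 0 < r then F (r *\<^sub>R \<sigma>) * ennreal (r ^ n) else 0) \<partial>lborel) \<partial>surface_measure)"
  proof (rule nn_integral_mono)
    fix \<sigma> :: 'a
    show "d \<sigma> * ennreal (g \<sigma>) * indicator ?S \<sigma> \<le> (\<integral>\<^sup>+r. (if 0 < r then F (r *\<^sub>R \<sigma>) * ennreal (r ^ n) else 0) \<partial>lborel)"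
    proof (cases "norm \<sigma> = 1")
      case True
      have "d \<sigma> * ennreal (g \<sigma>) = (\<integral>\<^sup>+r. ennreal (\<rho> (r *\<^sub>R \<sigma>) * r ^ n) * indicator {0<..<\<delta>} r * ennreal (g \<sigma>) \<partial>lborel)"
        unfolding d_def by (rule nn_integral_multc[symmetric]) measurable
      also have "\<dots> = (\<integral>\<^sup>+r. (if 0 < r then F (r *\<^sub>R \<sigma>) * ennreal (r ^ n) else 0) \<partial>lborel)"
      proof (rule nn_integral_cong)
        fix r :: real
        show "ennreal (\<rho> (r *\<^sub>R \<sigma>) * r ^ n) * indicator {0<..<\<delta>} r * ennreal (g \<sigma>)
            = (if 0 < r then F (r *\<^sub>R \<sigma>) * ennreal (r ^ n) else 0)"
        proof (cases "0 < r \<and> r < \<delta>")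
          case r: True
          have "\<sigma> \<noteq> 0" using True by auto
          moreover have "sgn (r *\<^sub>R \<sigma>) = \<sigma>" using r True by (simp add: sgn_scaleR sgn_div_norm)
          ultimately have "F (r *\<^sub>R \<sigma>) = ennreal (\<rho> (r *\<^sub>R \<sigma>)) * ennreal (g \<sigma>)"
            using r True by (simp add: F_def)
          then show ?thesis using r by (simp add: ennreal_mult' mult_ac)
        next
          case False
          then show ?thesis using True by (auto simp: F_def)
        qed
      qed
      finally show ?thesis using True by simp
    qed simp
  qed
  also have "\<dots> = (\<integral>\<^sup>+z. F z \<partial>lborel)"
    unfolding n_def by (rule nn_integral_polar[OF Fm])
  finally show ?thesis by (simp only: F_def)
qed

lemma Lp_locD:
  assumes "\<rho> \<in> Lp_loc p"
  shows "\<rho> \<in> borel_measurable borel"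
  using assms by (simp add: Lp_loc_def)

text \<open>
  The part of \<open>\<rho> z / norm z powr p\<close> away from the origin. Up to a constant, its integral is the coefficient of
  \<open>\<integral>\<bar>U\<bar>\<^sup>p\<close> in the bound for the long-range interactions.
\<close>

definition kernel_tail :: "real \<Rightarrow> real \<Rightarrow> ('a::euclidean_space \<Rightarrow> real) \<Rightarrow> 'a \<Rightarrow> ennreal" where
  "kernel_tail p \<delta> \<rho> z = (if \<delta> \<le> norm z then ennreal (\<rho> z / norm z powr p) else 0)"

lemma kernel_tail_borel:
  fixes \<rho> :: "'a::euclidean_space \<Rightarrow> real"
  assumes [measurable]: "\<rho> \<in> borel_measurable borel"
  shows "kernel_tail p \<delta> \<rho> \<in> borel_measurable borel"
  unfolding kernel_tail_def[abs_def] by measurable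

text \<open>
  The hypothesis on the kernels for the single radius \<open>R = \<delta>\<close>: on \<open>\<bar>z\<bar> \<ge> \<delta>\<close> the quotient \<open>1 / \<bar>z\<bar>\<^sup>p\<close> is at most
  \<open>2 / (\<delta>\<^sup>p + \<bar>z\<bar>\<^sup>p)\<close>.
\<close>

lemma kernel_tail_bound:
  fixes \<rho> :: "nat \<Rightarrow> 'a::euclidean_space \<Rightarrow> real"
  assumes p: "1 \<le> p" and \<rho>: "admissible_kernels p \<rho>" and \<delta>: "0 < \<delta>"
  obtains T where "0 \<le> T" "\<forall>\<^sub>F k in sequentially. (\<integral>\<^sup>+z. kernel_tail p \<delta> (\<rho> k) z \<partial>lborel) \<le> ennreal T"
proof -
  define E where "E R k = ennreal (R powr p) * (\<integral>\<^sup>+z. ennreal (\<rho> k z / (R powr p + norm z powr p)) \<partial>lborel)" for R k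
  have sup: "(SUP R\<in>{0<..}. limsup (E R)) < \<infinity>"
    using \<rho> by (simp add: admissible_kernels_def E_def[abs_def])
  have "limsup (E \<delta>) \<le> (SUP R\<in>{0<..}. limsup (E R))" using \<delta> by (intro SUP_upper) auto
  with sup have "limsup (E \<delta>) < \<top>" by (simp add: order_le_less_trans)
  then obtain s where s: "0 \<le> s" "limsup (E \<delta>) = ennreal s" by (auto simp: less_top_ennreal)
  have "limsup (E \<delta>) < ennreal (s + 1)" unfolding s(2) using s(1) by (intro ennreal_lessI) auto
  then have ev: "\<forall>\<^sub>F k in sequentially. E \<delta> k < ennreal (s + 1)" by (rule Limsup_lessD)
  define T where "T = 2 / \<delta> powr p * (s + 1)"
  have "\<forall>\<^sub>F k in sequentially. (\<integral>\<^sup>+z. kernel_tail p \<delta> (\<rho> k) z \<partial>lborel) \<le> ennreal T"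
    using ev
  proof eventually_elim
    case (elim k)
    have \<rho>m: "\<rho> k \<in> borel_measurable borel"
      using \<rho> by (intro Lp_locD[of _ 1]) (simp add: admissible_kernels_def)
    have gm: "(\<lambda>z. ennreal (\<rho> k z / (\<delta> powr p + norm z powr p))) \<in> borel_measurable lborel"
      using \<rho>m by measurable
    have "(\<integral>\<^sup>+z. kernel_tail p \<delta> (\<rho> k) z \<partial>lborel)
        \<le> (\<integral>\<^sup>+z. ennreal (2 / \<delta> powr p) * (ennreal (\<delta> powr p) * ennreal (\<rho> k z / (\<delta> powr p + norm z powr p))) \<partial>lborel)"
    proof (rule nn_integral_mono)
      fix z :: 'a
      show "kernel_tail p \<delta> (\<rho> k) z \<le> ennreal (2 / \<delta> powr p) * (ennreal (\<delta> powr p) * ennreal (\<rho> k z / (\<delta> powr p + norm z powr p)))"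
      proof (cases "\<delta> \<le> norm z \<and> 0 \<le> \<rho> k z")
        case True
        define a where "a = \<delta> powr p"
        define b where "b = norm z powr p"
        have a: "0 < a" "a \<le> b" using True \<delta> p by (auto simp: a_def b_def intro: powr_mono2)
        have "\<rho> k z / b \<le> 2 * (\<rho> k z / (a + b))"
          using a True by (simp add: field_simps mult_right_mono)
        also have "\<dots> = 2 / a * (a * (\<rho> k z / (a + b)))" using a by simp
        finally have "ennreal (\<rho> k z / b) \<le> ennreal (2 / a * (a * (\<rho> k z / (a + b))))" by (rule ennreal_leI)
        also have "\<dots> = ennreal (2 / a) * (ennreal a * ennreal (\<rho> k z / (a + b)))"
        proof -
          have "0 \<le> 2 / a" "0 \<le> a" using a by auto
          then show ?thesis by (simp only: ennreal_mult')
        qed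
        finally show ?thesis using True by (simp add: kernel_tail_def a_def b_def)
      next
        case False
        then have "kernel_tail p \<delta> (\<rho> k) z = 0"
          by (auto simp: kernel_tail_def intro!: ennreal_neg divide_nonpos_nonneg)
        then show ?thesis by simp
      qed
    qed
    also have "\<dots> = ennreal (2 / \<delta> powr p) * E \<delta> k"
      unfolding E_def using gm by (simp add: nn_integral_cmult)
    also have "\<dots> \<le> ennreal (2 / \<delta> powr p) * ennreal (s + 1)"
      using elim by (intro mult_left_mono) auto
    also have "\<dots> = ennreal T" unfolding T_def using s(1) by (intro ennreal_mult[symmetric]) auto
    finally show ?case .
  qed
  moreover have "0 \<le> T" using s(1) by (simp add: T_def)
  ultimately show thesis using that by blast
qed

lemma powr_diff_le:
  fixes a b p :: real
  assumes "1 \<le> p"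
  shows "\<bar>a - b\<bar> powr p \<le> 2 powr p * (\<bar>a\<bar> powr p + \<bar>b\<bar> powr p)"
proof -
  have "\<bar>a - b\<bar> powr p \<le> (2 * max \<bar>a\<bar> \<bar>b\<bar>) powr p" using assms by (intro powr_mono2) auto
  also have "\<dots> = 2 powr p * (max \<bar>a\<bar> \<bar>b\<bar>) powr p" by (simp add: powr_mult)
  also have "(max \<bar>a\<bar> \<bar>b\<bar>) powr p \<le> \<bar>a\<bar> powr p + \<bar>b\<bar> powr p" by (auto simp: max_def)
  finally show ?thesis by simp
qed

lemma far_energy_bound:
  fixes U \<rho> :: "'a::euclidean_space \<Rightarrow> real"
  assumes p: "1 \<le> p" and U: "U \<in> borel_measurable borel" and \<rho>: "\<rho> \<in> borel_measurable borel"
  shows "(\<integral>\<^sup>+x. (\<integral>\<^sup>+y. (if \<delta> \<le> norm (x - y) then ennreal (\<bar>U x - U y\<bar> powr p / norm (x - y) powr p * \<rho> (x - y)) else 0) \<partial>lborel) \<partial>lborel)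
    \<le> ennreal (2 * 2 powr p) * (\<integral>\<^sup>+x. ennreal (\<bar>U x\<bar> powr p) \<partial>lborel) * (\<integral>\<^sup>+z. kernel_tail p \<delta> \<rho> z \<partial>lborel)"
proof -
  let ?k = "kernel_tail p \<delta> \<rho>"
  define a where "a x = ennreal (\<bar>U x\<bar> powr p)" for x
  have am [measurable]: "a \<in> borel_measurable borel" unfolding a_def using U by measurable
  have km [measurable]: "?k \<in> borel_measurable borel" by (rule kernel_tail_borel[OF \<rho>])
  define T where "T = (\<integral>\<^sup>+z. ?k z \<partial>lborel)"
  define S where "S = (\<integral>\<^sup>+x. a x \<partial>lborel)"
  have m1: "(\<lambda>y. ?k (x - y)) \<in> borel_measurable lborel" for x :: 'a by measurable
  have m2: "(\<lambda>y. a y * ?k (x - y)) \<in> borel_measurable lborel" for x :: 'a by measurable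
  have "(\<integral>\<^sup>+x. (\<integral>\<^sup>+y. (if \<delta> \<le> norm (x - y) then ennreal (\<bar>U x - U y\<bar> powr p / norm (x - y) powr p * \<rho> (x - y)) else 0) \<partial>lborel) \<partial>lborel)
      \<le> (\<integral>\<^sup>+x. (\<integral>\<^sup>+y. ennreal (2 powr p) * (a x * ?k (x - y) + a y * ?k (x - y)) \<partial>lborel) \<partial>lborel)"
  proof (intro nn_integral_mono)
    fix x y :: 'a
    show "(if \<delta> \<le> norm (x - y) then ennreal (\<bar>U x - U y\<bar> powr p / norm (x - y) powr p * \<rho> (x - y)) else 0)
        \<le> ennreal (2 powr p) * (a x * ?k (x - y) + a y * ?k (x - y))"
    proof (cases "\<delta> \<le> norm (x - y) \<and> 0 \<le> \<rho> (x - y)")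
      case True
      define c where "c = \<rho> (x - y) / norm (x - y) powr p"
      have c: "0 \<le> c" using True by (simp add: c_def)
      have "\<bar>U x - U y\<bar> powr p / norm (x - y) powr p * \<rho> (x - y) = \<bar>U x - U y\<bar> powr p * c"
        by (simp add: c_def)
      also have "\<dots> \<le> 2 powr p * (\<bar>U x\<bar> powr p + \<bar>U y\<bar> powr p) * c"
        using c powr_diff_le[OF p, of "U x" "U y"] by (intro mult_right_mono)
      finally have "ennreal (\<bar>U x - U y\<bar> powr p / norm (x - y) powr p * \<rho> (x - y))
          \<le> ennreal (2 powr p * (\<bar>U x\<bar> powr p + \<bar>U y\<bar> powr p) * c)" by (rule ennreal_leI)
      also have "\<dots> = ennreal (2 powr p) * (a x * ennreal c + a y * ennreal c)"
        using c by (simp add: a_def ennreal_mult ennreal_plus[symmetric] distrib_right[symmetric] mult.assoc del: ennreal_plus)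
      also have "ennreal c = ?k (x - y)" using True by (simp add: kernel_tail_def c_def)
      finally show ?thesis using True by simp
    next
      case False
      then have "(if \<delta> \<le> norm (x - y) then ennreal (\<bar>U x - U y\<bar> powr p / norm (x - y) powr p * \<rho> (x - y)) else 0) = 0"
        by (auto intro!: ennreal_neg divide_nonpos_nonneg mult_nonneg_nonpos)
      then show ?thesis by (simp only: zero_le)
    qed
  qed
  also have "\<dots> = (\<integral>\<^sup>+x. ennreal (2 powr p) * (a x * T + (\<integral>\<^sup>+y. a y * ?k (x - y) \<partial>lborel)) \<partial>lborel)"
  proof (rule nn_integral_cong)
    fix x :: 'a
    have m3: "(\<lambda>y. a x * ?k (x - y)) \<in> borel_measurable lborel" by measurable
    have m4: "(\<lambda>y. a x * ?k (x - y) + a y * ?k (x - y)) \<in> borel_measurable lborel" by measurable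
    have T: "(\<integral>\<^sup>+y. ?k (x - y) \<partial>lborel) = T"
      unfolding T_def by (rule nn_integral_lborel_reflect[OF km])
    show "(\<integral>\<^sup>+y. ennreal (2 powr p) * (a x * ?k (x - y) + a y * ?k (x - y)) \<partial>lborel)
        = ennreal (2 powr p) * (a x * T + (\<integral>\<^sup>+y. a y * ?k (x - y) \<partial>lborel))"
      unfolding nn_integral_cmult[OF m4] nn_integral_add[OF m3 m2] nn_integral_cmult[OF m1] T by (rule refl)
  qed
  also have "\<dots> = ennreal (2 powr p) * ((\<integral>\<^sup>+x. a x * T \<partial>lborel) + (\<integral>\<^sup>+x. (\<integral>\<^sup>+y. a y * ?k (x - y) \<partial>lborel) \<partial>lborel))"
  proof -
    have m5: "(\<lambda>x. a x * T) \<in> borel_measurable lborel" by measurable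
    have m6: "(\<lambda>x. \<integral>\<^sup>+y. a y * ?k (x - y) \<partial>lborel) \<in> borel_measurable lborel" by measurable
    have m7: "(\<lambda>x. a x * T + (\<integral>\<^sup>+y. a y * ?k (x - y) \<partial>lborel)) \<in> borel_measurable lborel" using m5 m6 by measurable
    show ?thesis unfolding nn_integral_cmult[OF m7] nn_integral_add[OF m5 m6] by (rule refl)
  qed
  also have "(\<integral>\<^sup>+x. a x * T \<partial>lborel) = S * T"
    unfolding S_def by (rule nn_integral_multc) measurable
  also have "(\<integral>\<^sup>+x. (\<integral>\<^sup>+y. a y * ?k (x - y) \<partial>lborel) \<partial>lborel) = (\<integral>\<^sup>+y. (\<integral>\<^sup>+x. a y * ?k (x - y) \<partial>lborel) \<partial>lborel)"
    by (rule lborel_pair.Fubini') measurable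
  also have "\<dots> = (\<integral>\<^sup>+y. a y * T \<partial>lborel)"
  proof (rule nn_integral_cong)
    fix y :: 'a
    have m8: "(\<lambda>x. ?k (x - y)) \<in> borel_measurable lborel" by measurable
    have "(\<integral>\<^sup>+x. ?k (x - y) \<partial>lborel) = T"
      using nn_integral_lborel_shift[OF km, of "- y"] by (simp add: T_def)
    then show "(\<integral>\<^sup>+x. a y * ?k (x - y) \<partial>lborel) = a y * T"
      unfolding nn_integral_cmult[OF m8] by simp
  qed
  also have "\<dots> = S * T" unfolding S_def by (rule nn_integral_multc) measurable
  also have "ennreal (2 powr p) * (S * T + S * T) = ennreal (2 * 2 powr p) * S * T"
    by (simp add: ennreal_mult' mult_2[symmetric] mult_ac)
  finally show ?thesis by (simp only: S_def T_def a_def)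
qed

text \<open>
  Where both \<open>x\<close> and \<open>y\<close> lie outside \<open>\<Omega>\<close> the integrand vanishes, so the weight needs a lower bound only at the other
  pairs.
\<close>

lemma near_energy_bound:
  fixes U \<rho> :: "'a::euclidean_space \<Rightarrow> real" and wk :: "'a \<times> 'a \<Rightarrow> real"
  assumes U [measurable]: "U \<in> borel_measurable borel" and \<rho> [measurable]: "\<rho> \<in> borel_measurable borel"
    and wk: "wk \<in> borel_measurable borel" and c: "0 < c"
    and zero: "AE x in lborel. x \<notin> \<Omega> \<longrightarrow> U x = 0"
    and low: "AE z in lborel. dist (fst z) (snd z) < \<delta> \<and> (fst z \<in> \<Omega> \<or> snd z \<in> \<Omega>) \<longrightarrow> c \<le> wk z"
  shows "(\<integral>\<^sup>+x. (\<integral>\<^sup>+y. (if norm (x - y) < \<delta> then ennreal (\<bar>U x - U y\<bar> powr p / norm (x - y) powr p * \<rho> (x - y)) else 0) \<partial>lborel) \<partial>lborel)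
    \<le> ennreal (1 / c) * nonlocal_energy p \<rho> wk U"
proof -
  have wkm [measurable]: "wk \<in> borel_measurable (borel \<Otimes>\<^sub>M borel)" using wk(1) by (simp add: borel_prod)
  define q where "q x y = \<bar>U x - U y\<bar> powr p / norm (x - y) powr p * \<rho> (x - y)" for x y
  have qm: "(\<lambda>y. ennreal (q x y * wk (x, y))) \<in> borel_measurable lborel" for x
    unfolding q_def by measurable
  have "AE z in lborel \<Otimes>\<^sub>M lborel. dist (fst z) (snd z) < \<delta> \<and> (fst z \<in> \<Omega> \<or> snd z \<in> \<Omega>) \<longrightarrow> c \<le> wk z"
    unfolding lborel_prod by (rule low)
  from lborel_pair.AE_pair[OF this] have AE2:
    "AE x in lborel. AE y in lborel. dist (fst (x, y)) (snd (x, y)) < \<delta> \<and> (fst (x, y) \<in> \<Omega> \<or> snd (x, y) \<in> \<Omega>) \<longrightarrow> c \<le> wk (x, y)" .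
  have "(\<integral>\<^sup>+x. (\<integral>\<^sup>+y. (if norm (x - y) < \<delta> then ennreal (q x y) else 0) \<partial>lborel) \<partial>lborel)
      \<le> (\<integral>\<^sup>+x. (\<integral>\<^sup>+y. ennreal (1 / c) * ennreal (q x y * wk (x, y)) \<partial>lborel) \<partial>lborel)"
  proof (rule nn_integral_mono_AE)
    show "AE x in lborel. (\<integral>\<^sup>+y. (if norm (x - y) < \<delta> then ennreal (q x y) else 0) \<partial>lborel)
        \<le> (\<integral>\<^sup>+y. ennreal (1 / c) * ennreal (q x y * wk (x, y)) \<partial>lborel)"
      using AE2 zero
    proof eventually_elim
      case (elim x)
      note Ux = elim(2)
      have "AE y in lborel. (if norm (x - y) < \<delta> then ennreal (q x y) else 0) \<le> ennreal (1 / c) * ennreal (q x y * wk (x, y))"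
        using elim(1) zero
      proof eventually_elim
        case (elim y)
        show ?case
        proof (cases "norm (x - y) < \<delta> \<and> U x \<noteq> U y \<and> 0 \<le> \<rho> (x - y)")
          case True
          then have "x \<in> \<Omega> \<or> y \<in> \<Omega>" using Ux elim(2) by auto
          then have "c \<le> wk (x, y)" using elim(1) True by (simp add: dist_norm)
          moreover have "0 \<le> q x y" using True by (simp add: q_def)
          ultimately have "q x y * c \<le> q x y * wk (x, y)" by (intro mult_left_mono)
          then have "q x y \<le> 1 / c * (q x y * wk (x, y))" using c by (simp add: field_simps)
          then have "ennreal (q x y) \<le> ennreal (1 / c * (q x y * wk (x, y)))" by (rule ennreal_leI)
          also have "\<dots> = ennreal (1 / c) * ennreal (q x y * wk (x, y))" using c by (intro ennreal_mult') simp
          finally show ?thesis using True by simp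
        next
          case False
          then have "(if norm (x - y) < \<delta> then ennreal (q x y) else 0) = 0"
            by (cases "U x = U y") (auto simp: q_def intro!: ennreal_neg divide_nonpos_nonneg mult_nonneg_nonpos)
          then show ?thesis by (simp only: zero_le)
        qed
      qed
      then show ?case by (rule nn_integral_mono_AE)
    qed
  qed
  also have "\<dots> = (\<integral>\<^sup>+x. ennreal (1 / c) * (\<integral>\<^sup>+y. ennreal (q x y * wk (x, y)) \<partial>lborel) \<partial>lborel)"
    unfolding nn_integral_cmult[OF qm] by (rule refl)
  also have "\<dots> = ennreal (1 / c) * (\<integral>\<^sup>+x. (\<integral>\<^sup>+y. ennreal (q x y * wk (x, y)) \<partial>lborel) \<partial>lborel)"
    unfolding q_def by (rule nn_integral_cmult) measurable
  finally show ?thesis by (simp only: q_def nonlocal_energy_def)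
qed

text \<open>
  The compactness hypothesis speaks of the unweighted energy, whereas the weights are bounded below only near the diagonal
  of \<open>\<Omega>\<close>. Long-range interactions are controlled by the norm of \<open>U\<close> and the tail of the kernel instead.
\<close>

lemma unweighted_energy_bound:
  fixes U \<rho> :: "'a::euclidean_space \<Rightarrow> real" and wk :: "'a \<times> 'a \<Rightarrow> real"
  assumes p: "1 \<le> p" and U [measurable]: "U \<in> borel_measurable borel" and \<rho> [measurable]: "\<rho> \<in> borel_measurable borel"
    and wk: "wk \<in> borel_measurable borel" and c: "0 < c"
    and zero: "AE x in lborel. x \<notin> \<Omega> \<longrightarrow> U x = 0"
    and low: "AE z in lborel. dist (fst z) (snd z) < \<delta> \<and> (fst z \<in> \<Omega> \<or> snd z \<in> \<Omega>) \<longrightarrow> c \<le> wk z"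
  shows "nonlocal_energy p \<rho> (\<lambda>_. 1) U \<le> ennreal (1 / c) * nonlocal_energy p \<rho> wk U
    + ennreal (2 * 2 powr p) * (\<integral>\<^sup>+x. ennreal (\<bar>U x\<bar> powr p) \<partial>lborel) * (\<integral>\<^sup>+z. kernel_tail p \<delta> \<rho> z \<partial>lborel)"
proof -
  define q where "q x y = \<bar>U x - U y\<bar> powr p / norm (x - y) powr p * \<rho> (x - y)" for x y
  define near where "near x y = (if norm (x - y) < \<delta> then ennreal (q x y) else 0)" for x y
  define far where "far x y = (if \<delta> \<le> norm (x - y) then ennreal (q x y) else 0)" for x y
  have nm: "near x \<in> borel_measurable lborel" and fm: "far x \<in> borel_measurable lborel" for x
    unfolding near_def far_def q_def by measurable
  have nm2: "(\<lambda>x. \<integral>\<^sup>+y. near x y \<partial>lborel) \<in> borel_measurable lborel"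
    unfolding near_def q_def by measurable
  have fm2: "(\<lambda>x. \<integral>\<^sup>+y. far x y \<partial>lborel) \<in> borel_measurable lborel"
    unfolding far_def q_def by measurable
  have "nonlocal_energy p \<rho> (\<lambda>_. 1) U = (\<integral>\<^sup>+x. (\<integral>\<^sup>+y. near x y + far x y \<partial>lborel) \<partial>lborel)"
    unfolding nonlocal_energy_def by (intro nn_integral_cong) (simp add: near_def far_def q_def not_less)
  also have "\<dots> = (\<integral>\<^sup>+x. (\<integral>\<^sup>+y. near x y \<partial>lborel) \<partial>lborel) + (\<integral>\<^sup>+x. (\<integral>\<^sup>+y. far x y \<partial>lborel) \<partial>lborel)"
    unfolding nn_integral_add[OF nm fm] by (rule nn_integral_add[OF nm2 fm2])
  also have "\<dots> \<le> ennreal (1 / c) * nonlocal_energy p \<rho> wk U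
    + ennreal (2 * 2 powr p) * (\<integral>\<^sup>+x. ennreal (\<bar>U x\<bar> powr p) \<partial>lborel) * (\<integral>\<^sup>+z. kernel_tail p \<delta> \<rho> z \<partial>lborel)"
    unfolding near_def far_def q_def
    by (intro add_mono near_energy_bound[OF U \<rho> wk c zero low] far_energy_bound[OF p U \<rho>])
  finally show ?thesis .
qed

text \<open>
  Half of \<open>\<eta>\<close> is for the uniform distance of \<open>wk\<close> and \<open>w\<close>, the other half for the modulus of continuity. Both diagonal
  values are compared, because only one of the two points may lie in \<open>\<Omega>\<close>.
\<close>

lemma weights_near_diagonal:
  fixes wk :: "nat \<Rightarrow> 'a::euclidean_space \<times> 'a \<Rightarrow> real"
  assumes w: "admissible_weights wk w" and \<eta>: "0 < \<eta>"
  obtains \<delta> k0 where "0 < \<delta>" "\<And>k. k0 \<le> k \<Longrightarrow> AE z in lborel. dist (fst z) (snd z) < \<delta> \<longrightarrow>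
    w (fst z, fst z) \<le> wk k z + \<eta> \<and> w (snd z, snd z) \<le> wk k z + \<eta>"
proof -
  obtain \<omega> where \<omega>: "\<omega> 0 = 0" "(\<omega> \<longlongrightarrow> 0) (at_right 0)"
    "\<And>x x' y y'. \<bar>w (x, y) - w (x', y')\<bar> \<le> \<omega> (norm (x - x') + norm (y - y'))"
    using w unfolding admissible_weights_def by blast
  have "\<forall>\<^sub>F t in at_right 0. \<omega> t < \<eta> / 2" using \<eta> by (intro order_tendstoD(2)[OF \<omega>(2)]) simp
  then obtain \<delta> where \<delta>: "0 < \<delta>" "\<And>t. 0 < t \<Longrightarrow> t < \<delta> \<Longrightarrow> \<omega> t < \<eta> / 2"
    by (auto simp: eventually_at_right_field)
  have \<omega>_small: "\<omega> t < \<eta> / 2" if "0 \<le> t" "t < \<delta>" for t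
    using that \<delta>(2)[of t] \<omega>(1) \<eta> by (cases "t = 0") auto
  have "(\<lambda>k. esssup lborel (\<lambda>z. ennreal \<bar>wk k z - w z\<bar>)) \<longlonglongrightarrow> 0"
    using w by (simp add: admissible_weights_def)
  then have "\<forall>\<^sub>F k in sequentially. esssup lborel (\<lambda>z. ennreal \<bar>wk k z - w z\<bar>) < ennreal (\<eta> / 2)"
    using \<eta> by (intro order_tendstoD(2)) auto
  then obtain k0 where k0: "\<And>k. k0 \<le> k \<Longrightarrow> esssup lborel (\<lambda>z. ennreal \<bar>wk k z - w z\<bar>) < ennreal (\<eta> / 2)"
    by (auto simp: eventually_sequentially)
  have "AE z in lborel. dist (fst z) (snd z) < \<delta> \<longrightarrow> w (fst z, fst z) \<le> wk k z + \<eta> \<and> w (snd z, snd z) \<le> wk k z + \<eta>"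
    if "k0 \<le> k" for k
    using esssup_AE[of "\<lambda>z. ennreal \<bar>wk k z - w z\<bar>" lborel]
  proof eventually_elim
    case (elim z)
    have "ennreal \<bar>wk k z - w z\<bar> < ennreal (\<eta> / 2)" using elim k0[OF that] by (rule order_le_less_trans)
    then have 1: "\<bar>wk k z - w z\<bar> < \<eta> / 2" by (simp add: ennreal_less_iff)
    show ?case
    proof (intro impI conjI)
      assume d: "dist (fst z) (snd z) < \<delta>"
      have "\<bar>w (fst z, fst z) - w (fst z, snd z)\<bar> < \<eta> / 2"
        using \<omega>(3)[of "fst z" "fst z" "fst z" "snd z"] \<omega>_small[of "dist (fst z) (snd z)"] d by (simp add: dist_norm)
      then show "w (fst z, fst z) \<le> wk k z + \<eta>" using 1 by (simp only: prod.collapse)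
      have "\<bar>w (snd z, snd z) - w (fst z, snd z)\<bar> < \<eta> / 2"
        using \<omega>(3)[of "snd z" "snd z" "fst z" "snd z"] \<omega>_small[of "dist (fst z) (snd z)"] d
        by (simp add: dist_norm norm_minus_commute)
      then show "w (snd z, snd z) \<le> wk k z + \<eta>" using 1 by (simp only: prod.collapse)
    qed
  qed
  with \<delta>(1) show thesis by (rule that)
qed

lemma nonlocal_energy_scale:
  fixes U \<rho> :: "'a::euclidean_space \<Rightarrow> real" and wk :: "'a \<times> 'a \<Rightarrow> real"
  assumes U [measurable]: "U \<in> borel_measurable borel" and \<rho> [measurable]: "\<rho> \<in> borel_measurable borel"
    and wk: "wk \<in> borel_measurable borel"
  shows "nonlocal_energy p \<rho> wk (\<lambda>x. c * U x) = ennreal (\<bar>c\<bar> powr p) * nonlocal_energy p \<rho> wk U"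
proof -
  have wkm [measurable]: "wk \<in> borel_measurable (borel \<Otimes>\<^sub>M borel)" using wk(1) by (simp add: borel_prod)
  define q where "q x y = \<bar>U x - U y\<bar> powr p / norm (x - y) powr p * \<rho> (x - y) * wk (x, y)" for x y
  have qm: "(\<lambda>y. ennreal (q x y)) \<in> borel_measurable lborel" for x unfolding q_def by measurable
  have "nonlocal_energy p \<rho> wk (\<lambda>x. c * U x) = (\<integral>\<^sup>+x. (\<integral>\<^sup>+y. ennreal (\<bar>c\<bar> powr p) * ennreal (q x y) \<partial>lborel) \<partial>lborel)"
    unfolding nonlocal_energy_def
  proof (intro nn_integral_cong)
    fix x y :: 'a
    have "\<bar>c * U x - c * U y\<bar> powr p = \<bar>c\<bar> powr p * \<bar>U x - U y\<bar> powr p"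
      by (simp add: right_diff_distrib[symmetric] abs_mult powr_mult)
    then have "\<bar>c * U x - c * U y\<bar> powr p / norm (x - y) powr p * \<rho> (x - y) * wk (x, y) = \<bar>c\<bar> powr p * q x y"
      by (simp add: q_def)
    then show "ennreal (\<bar>c * U x - c * U y\<bar> powr p / norm (x - y) powr p * \<rho> (x - y) * wk (x, y)) = ennreal (\<bar>c\<bar> powr p) * ennreal (q x y)"
      by (simp add: ennreal_mult')
  qed
  also have "\<dots> = (\<integral>\<^sup>+x. ennreal (\<bar>c\<bar> powr p) * (\<integral>\<^sup>+y. ennreal (q x y) \<partial>lborel) \<partial>lborel)"
    unfolding nn_integral_cmult[OF qm] by (rule refl)
  also have "\<dots> = ennreal (\<bar>c\<bar> powr p) * (\<integral>\<^sup>+x. (\<integral>\<^sup>+y. ennreal (q x y) \<partial>lborel) \<partial>lborel)"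
    unfolding q_def by (rule nn_integral_cmult) measurable
  finally show ?thesis by (simp only: q_def nonlocal_energy_def)
qed

section \<open>The liminf inequality\<close>

text \<open>
  The lower half of the convergence of the nonlocal energies to the local one. Integrate the pointwise bound \<open>difference_quotient_energy_liminf\<close> against \<open>\<rho> (r j)\<close> over the ball of
  radius \<open>\<delta>\<close>: the left-hand side is at least an integral over the angular measure, the right-hand side at most
  the nonlocal energy. Let first \<open>j\<close> tend to infinity and then \<open>\<delta>\<close> to \<open>0\<close>; the angular measures become \<open>\<mu>\<close>. The
  unweighted bound \<open>B\<close> pays for the error \<open>\<eta>\<close> in the weights.
\<close>

lemma liminf_local_energy:
  fixes \<rho> :: "nat \<Rightarrow> 'a::euclidean_space \<Rightarrow> real" and wk :: "nat \<Rightarrow> 'a \<times> 'a \<Rightarrow> real"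
  assumes p: "1 \<le> p" and \<rho>: "admissible_kernels p \<rho>" and \<mu>: "angular_limit \<rho> \<mu>" and w: "admissible_weights wk w"
    and r: "strict_mono (r :: nat \<Rightarrow> nat)"
    and v: "v \<in> Sp p" "integrable lborel v" and U: "\<And>j. integrable lborel (U j)"
    and conv: "(\<lambda>j. \<integral>x. \<bar>U j x - v x\<bar> \<partial>lborel) \<longlonglongrightarrow> 0"
    and c: "0 \<le> c" "\<And>j. nonlocal_energy p (\<rho> (r j)) (wk (r j)) (U j) \<le> ennreal c"
    and B: "0 \<le> B" "\<And>j. nonlocal_energy p (\<rho> (r j)) (\<lambda>_. 1) (U j) \<le> ennreal B"
  shows "local_energy p (\<lambda>x. w (x, x)) \<mu> v \<le> ennreal c"
proof -
  define w0 where "w0 x = w (x, x)" for x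
  have wc: "continuous_on UNIV w" "bounded (range w)" "\<And>z. 0 \<le> w z"
    using w by (auto simp: admissible_weights_def)
  have w0c: "continuous_on UNIV w0"
    unfolding w0_def by (intro continuous_on_compose2[OF wc(1)] continuous_intros) auto
  obtain K where "\<And>z. \<bar>w z\<bar> \<le> K" using wc(2) by (auto simp: bounded_iff)
  then have K: "\<bar>w0 x\<bar> \<le> K" for x by (simp add: w0_def)
  have w0p: "0 \<le> w0 x" for x by (simp add: w0_def wc(3))
  have w0m: "w0 \<in> borel_measurable borel" by (rule borel_measurable_continuous_onI[OF w0c])
  obtain M h where grad: "gradient_density p v M h"
    and le: "\<And>\<mu> w0. continuous_on UNIV w0 \<Longrightarrow> (\<And>x. 0 \<le> w0 x) \<Longrightarrow> local_energy p w0 \<mu> v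
      = (\<integral>\<^sup>+\<sigma>. (\<integral>\<^sup>+x. ennreal (w0 x * \<bar>\<sigma> \<bullet> h x\<bar> powr p) \<partial>M) \<partial>\<mu>)"
  proof (rule gradient_density_exists[OF p v(1)], goal_cases)
    case (1 M h)
    show thesis by (rule 1(1)[OF 1(2)]) (rule 1(3))
  qed
  define f where "f = directional_energy p w0 M h"
  have f_cont: "continuous_on UNIV f" unfolding f_def by (rule directional_energy_continuous[OF p grad w0c K])
  have energy: "local_energy p w0 \<mu> v = (\<integral>\<^sup>+\<sigma>. ennreal (f \<sigma>) \<partial>\<mu>)"
    unfolding le[OF w0c w0p] f_def nn_integral_directional_energy[OF p grad w0c K w0p] by (rule refl)
  obtain \<nu> where fin: "finite_sphere_measure \<mu>"
    and \<nu>: "\<forall>\<^sub>F \<delta> in at_right 0. finite_sphere_measure (\<nu> \<delta>) \<and> sphere_weak_star (\<lambda>k. angular_measure (\<rho> k) \<delta>) (\<nu> \<delta>) sequentially"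
      "sphere_weak_star \<nu> \<mu> (at_right 0)"
    using \<mu> unfolding angular_limit_def by blast
  interpret \<mu>: finite_measure \<mu> using fin by (simp add: finite_sphere_measure_def)
  have "space \<mu> = space (restrict_space borel (sphere (0::'a) 1))"
    using fin by (intro sets_eq_imp_space_eq) (simp add: finite_sphere_measure_def)
  then have space_\<mu>: "space \<mu> = sphere 0 1" by (simp add: space_restrict_space)
  define m where "m = measure \<mu> (space \<mu>)"
  have bound: "(\<integral>\<^sup>+\<sigma>. ennreal (f \<sigma>) \<partial>\<mu>) \<le> ennreal (c + 2 * \<eta> * B + \<eta> * m)" if \<eta>: "0 < \<eta>" for \<eta>
  proof -
    \<comment> \<open>The weak-* convergences speak of real integrals of continuous functions. The truncation \<open>g\<close> of \<open>f - \<eta>\<close>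
      is one, and it is non-negative, so that the bounds for its integral in the extended reals carry over.\<close>
    define g where "g \<sigma> = max 0 (f \<sigma> - \<eta>)" for \<sigma>
    have g_cont: "continuous_on UNIV g" unfolding g_def by (intro continuous_intros f_cont)
    have gS: "continuous_on (sphere 0 1) g" using g_cont by (rule continuous_on_subset) auto
    have gm: "g \<in> borel_measurable borel" by (rule borel_measurable_continuous_onI[OF g_cont])
    have g_enn: "ennreal (g \<sigma>) = ennreal (f \<sigma> - \<eta>)" for \<sigma> by (simp add: g_def max_def ennreal_neg)
    obtain \<delta>0 J where \<delta>0: "0 < \<delta>0" and quot: "\<And>j z. J \<le> j \<Longrightarrow> z \<noteq> 0 \<Longrightarrow> norm z < \<delta>0 \<Longrightarrow>
        ennreal (f (sgn z) - \<eta>) \<le> (\<integral>\<^sup>+x. ennreal ((w0 x + \<eta>) * (\<bar>U j x - U j (x - z)\<bar> powr p / norm z powr p)) \<partial>lborel)"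
      using difference_quotient_energy_liminf[OF p grad w0c K w0p v(2) U conv \<eta>] unfolding f_def by blast
    obtain \<delta>1 k0 where \<delta>1: "0 < \<delta>1" and near: "\<And>k. k0 \<le> k \<Longrightarrow> AE z in lborel. dist (fst z) (snd z) < \<delta>1 \<longrightarrow>
        w (fst z, fst z) \<le> wk k z + \<eta> \<and> w (snd z, snd z) \<le> wk k z + \<eta>"
      using weights_near_diagonal[OF w \<eta>] by blast
    have angular: "(\<integral>\<sigma>. g \<sigma> \<partial>angular_measure (\<rho> (r j)) \<delta>) \<le> c + 2 * \<eta> * B"
      if \<delta>: "0 < \<delta>" "\<delta> < \<delta>0" "\<delta> < \<delta>1" and j: "J \<le> j" "k0 \<le> j" for \<delta> j
    proof -
      have \<rho>m: "\<rho> (r j) \<in> borel_measurable borel"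
        using \<rho> by (intro Lp_locD[of _ 1]) (simp add: admissible_kernels_def)
      have wkm: "wk (r j) \<in> borel_measurable borel" "AE z in lborel. 0 \<le> wk (r j) z"
        using w by (auto simp: admissible_weights_def Linfty_def)
      have Um: "U j \<in> borel_measurable borel" using borel_measurable_integrable[OF U[of j]] by simp
      have "k0 \<le> r j" using j(2) seq_suble[OF r, of j] by simp
      from near[OF this] have close: "AE z in lborel. dist (fst z) (snd z) < \<delta> \<longrightarrow> w0 (fst z) \<le> wk (r j) z + \<eta>"
        by eventually_elim (use \<delta> in \<open>auto simp: w0_def\<close>)
      have "(\<integral>\<^sup>+\<sigma>. ennreal (g \<sigma>) \<partial>angular_measure (\<rho> (r j)) \<delta>)
          \<le> (\<integral>\<^sup>+z. (if z \<noteq> 0 \<and> norm z < \<delta> then ennreal (\<rho> (r j) z) * ennreal (g (sgn z)) else 0) \<partial>lborel)"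
        by (rule nn_integral_angular_measure_le[OF \<rho>m gm])
      also have "\<dots> \<le> (\<integral>\<^sup>+z. (if z \<noteq> 0 \<and> norm z < \<delta> then ennreal (\<rho> (r j) z)
        * (\<integral>\<^sup>+x. ennreal ((w0 x + \<eta>) * (\<bar>U j x - U j (x - z)\<bar> powr p / norm z powr p)) \<partial>lborel) else 0) \<partial>lborel)"
      proof (rule nn_integral_mono)
        fix z :: 'a
        show "(if z \<noteq> 0 \<and> norm z < \<delta> then ennreal (\<rho> (r j) z) * ennreal (g (sgn z)) else 0)
          \<le> (if z \<noteq> 0 \<and> norm z < \<delta> then ennreal (\<rho> (r j) z)
        * (\<integral>\<^sup>+x. ennreal ((w0 x + \<eta>) * (\<bar>U j x - U j (x - z)\<bar> powr p / norm z powr p)) \<partial>lborel) else 0)"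
        proof (cases "z \<noteq> 0 \<and> norm z < \<delta>")
          case True
          then have "ennreal (g (sgn z)) \<le> (\<integral>\<^sup>+x. ennreal ((w0 x + \<eta>) * (\<bar>U j x - U j (x - z)\<bar> powr p / norm z powr p)) \<partial>lborel)"
            unfolding g_enn using \<delta> by (intro quot[OF j(1)]) auto
          then show ?thesis unfolding if_P[OF True] by (rule mult_left_mono) simp
        next
          case False
          then show ?thesis unfolding if_not_P[OF False] by simp
        qed
      qed
      also have "\<dots> \<le> nonlocal_energy p (\<rho> (r j)) (wk (r j)) (U j)
          + ennreal (\<eta> + \<bar>\<eta>\<bar>) * nonlocal_energy p (\<rho> (r j)) (\<lambda>_. 1) (U j)"
        by (rule nonlocal_energy_lower_bound[OF Um \<rho>m w0m w0p wkm _ close]) (use \<eta> in simp)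
      also have "\<dots> \<le> ennreal c + ennreal (\<eta> + \<bar>\<eta>\<bar>) * ennreal B"
        by (intro add_mono mult_left_mono c B) simp
      also have "\<dots> = ennreal (c + 2 * \<eta> * B)"
        using \<eta> c(1) B(1) by (simp add: ennreal_mult)
      finally have le_c: "(\<integral>\<^sup>+\<sigma>. ennreal (g \<sigma>) \<partial>angular_measure (\<rho> (r j)) \<delta>) \<le> ennreal (c + 2 * \<eta> * B)" .
      show ?thesis
      \<comment> \<open>A single angular measure may be infinite; a non-integrable \<open>g\<close> has integral \<open>0\<close> and obeys the bound.\<close>
      proof (cases "integrable (angular_measure (\<rho> (r j)) \<delta>) g")
        case True
        have "ennreal (\<integral>\<sigma>. g \<sigma> \<partial>angular_measure (\<rho> (r j)) \<delta>) \<le> ennreal (c + 2 * \<eta> * B)"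
          using ennreal_integral_le_nn_integral[OF True] le_c by (rule order_trans)
        then show ?thesis using \<eta> c(1) B(1) by (subst (asm) ennreal_le_iff) auto
      next
        case False
        then show ?thesis using \<eta> c(1) B(1) by (simp add: not_integrable_integral_eq)
      qed
    qed
    have "\<forall>\<^sub>F \<delta> in at_right 0. 0 < \<delta> \<and> \<delta> < min \<delta>0 \<delta>1"
      using \<delta>0 \<delta>1 unfolding eventually_at_right_field by (intro exI[of _ "min \<delta>0 \<delta>1"]) auto
    with \<nu>(1) have "\<forall>\<^sub>F \<delta> in at_right 0. (\<integral>\<sigma>. g \<sigma> \<partial>\<nu> \<delta>) \<le> c + 2 * \<eta> * B"
    proof eventually_elim
      case (elim \<delta>)
      have "(\<lambda>k. \<integral>\<sigma>. g \<sigma> \<partial>angular_measure (\<rho> k) \<delta>) \<longlonglongrightarrow> (\<integral>\<sigma>. g \<sigma> \<partial>\<nu> \<delta>)"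
        using elim(1) gS by (simp add: sphere_weak_star_def)
      from LIMSEQ_subseq_LIMSEQ[OF this r]
      have lim: "(\<lambda>j. \<integral>\<sigma>. g \<sigma> \<partial>angular_measure (\<rho> (r j)) \<delta>) \<longlonglongrightarrow> (\<integral>\<sigma>. g \<sigma> \<partial>\<nu> \<delta>)" by (simp add: o_def)
      show ?case
        by (rule LIMSEQ_le_const2[OF lim]) (use elim(2) angular in \<open>auto intro!: exI[of _ "max J k0"]\<close>)
    qed
    moreover have "((\<lambda>\<delta>. \<integral>\<sigma>. g \<sigma> \<partial>\<nu> \<delta>) \<longlongrightarrow> (\<integral>\<sigma>. g \<sigma> \<partial>\<mu>)) (at_right 0)"
      using \<nu>(2) gS by (simp add: sphere_weak_star_def)
    ultimately have g_le: "(\<integral>\<sigma>. g \<sigma> \<partial>\<mu>) \<le> c + 2 * \<eta> * B"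
      by (intro tendsto_upperbound[OF _ _ trivial_limit_at_right_real])
    have g\<mu>: "g \<in> borel_measurable \<mu>" by (rule finite_sphere_measure_borel[OF fin gm])
    have "compact (g ` sphere 0 1)" by (rule compact_continuous_image[OF gS compact_sphere])
    then have "bounded (g ` sphere 0 1)" by (rule compact_imp_bounded)
    then obtain G where "\<forall>y\<in>g ` sphere 0 1. norm y \<le> G" unfolding bounded_iff by blast
    then have G: "\<bar>g \<sigma>\<bar> \<le> G" if "\<sigma> \<in> sphere 0 1" for \<sigma>
      using that by (metis imageI real_norm_def)
    have g_int: "integrable \<mu> g"
      by (rule \<mu>.integrable_const_bound[of _ G]) (use G g\<mu> in \<open>auto intro!: AE_I2 simp: space_\<mu>\<close>)
    have gm': "(\<lambda>\<sigma>. ennreal (g \<sigma>)) \<in> borel_measurable \<mu>" using g\<mu> by measurable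
    have "(\<integral>\<^sup>+\<sigma>. ennreal (f \<sigma>) \<partial>\<mu>) \<le> (\<integral>\<^sup>+\<sigma>. ennreal (g \<sigma>) + ennreal \<eta> \<partial>\<mu>)"
    proof (rule nn_integral_mono)
      fix \<sigma>
      have "ennreal (f \<sigma>) \<le> ennreal (g \<sigma> + \<eta>)" by (rule ennreal_leI) (simp add: g_def)
      then show "ennreal (f \<sigma>) \<le> ennreal (g \<sigma>) + ennreal \<eta>" using \<eta> by (simp add: g_def)
    qed
    also have "\<dots> = (\<integral>\<^sup>+\<sigma>. ennreal (g \<sigma>) \<partial>\<mu>) + (\<integral>\<^sup>+\<sigma>. ennreal \<eta> \<partial>\<mu>)"
      using gm' by (rule nn_integral_add) simp
    also have "(\<integral>\<^sup>+\<sigma>. ennreal (g \<sigma>) \<partial>\<mu>) = ennreal (\<integral>\<sigma>. g \<sigma> \<partial>\<mu>)"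
      using g_int by (rule nn_integral_eq_integral) (simp add: g_def)
    also have "(\<integral>\<^sup>+\<sigma>. ennreal \<eta> \<partial>\<mu>) = ennreal (\<eta> * m)"
      using \<eta> by (simp add: m_def \<mu>.emeasure_eq_measure ennreal_mult)
    also have "ennreal (\<integral>\<sigma>. g \<sigma> \<partial>\<mu>) + ennreal (\<eta> * m) = ennreal ((\<integral>\<sigma>. g \<sigma> \<partial>\<mu>) + \<eta> * m)"
      using \<eta> by (intro ennreal_plus[symmetric] integral_nonneg_AE) (auto simp: g_def m_def)
    also have "\<dots> \<le> ennreal (c + 2 * \<eta> * B + \<eta> * m)"
      using g_le by (intro ennreal_leI) simp
    finally show ?thesis .
  qed
  have "(\<integral>\<^sup>+\<sigma>. ennreal (f \<sigma>) \<partial>\<mu>) \<le> ennreal c"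
  proof (rule LIMSEQ_le_const)
    have "(\<lambda>n. c + 2 * (1 / real (Suc n)) * B + (1 / real (Suc n)) * m) \<longlonglongrightarrow> c + 2 * 0 * B + 0 * m"
      by (intro tendsto_intros LIMSEQ_Suc[OF lim_1_over_n])
    then show "(\<lambda>n. ennreal (c + 2 * (1 / real (Suc n)) * B + (1 / real (Suc n)) * m)) \<longlonglongrightarrow> ennreal c"
      by (intro tendsto_ennrealI) simp
    show "\<exists>N. \<forall>n\<ge>N. (\<integral>\<^sup>+\<sigma>. ennreal (f \<sigma>) \<partial>\<mu>) \<le> ennreal (c + 2 * (1 / real (Suc n)) * B + (1 / real (Suc n)) * m)"
      by (intro exI allI impI bound) simp
  qed
  then show ?thesis unfolding energy[symmetric] by (simp add: w0_def[abs_def])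
qed

section \<open>Convergence in norm\<close>

lemma Lp_norm_powr:
  assumes "1 \<le> p"
  shows "Lp_norm M p f powr p = (\<integral>x. norm (f x) powr p \<partial>M)"
  using assms by (simp add: Lp_norm_def powr_powr)

lemma Lp_norm_tendsto_0_iff:
  assumes p: "1 \<le> p"
  shows "(\<lambda>j. Lp_norm (M j) p (f j)) \<longlonglongrightarrow> 0 \<longleftrightarrow> (\<lambda>j. \<integral>x. norm (f j x) powr p \<partial>M j) \<longlonglongrightarrow> 0"
proof
  assume "(\<lambda>j. Lp_norm (M j) p (f j)) \<longlonglongrightarrow> 0"
  then have "(\<lambda>j. Lp_norm (M j) p (f j) powr p) \<longlonglongrightarrow> 0 powr p"
    using p by (intro tendsto_powr' tendsto_const) (auto simp: Lp_norm_def)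
  then show "(\<lambda>j. \<integral>x. norm (f j x) powr p \<partial>M j) \<longlonglongrightarrow> 0" using p by (simp add: Lp_norm_powr)
next
  assume "(\<lambda>j. \<integral>x. norm (f j x) powr p \<partial>M j) \<longlonglongrightarrow> 0"
  then have "(\<lambda>j. (\<integral>x. norm (f j x) powr p \<partial>M j) powr (1 / p)) \<longlonglongrightarrow> 0 powr (1 / p)"
    using p by (intro tendsto_powr' tendsto_const) (auto intro!: always_eventually integral_nonneg_AE)
  then show "(\<lambda>j. Lp_norm (M j) p (f j)) \<longlonglongrightarrow> 0" by (simp add: Lp_norm_def)
qed

lemma Lp_diff:
  fixes u v :: "'a \<Rightarrow> real"
  assumes p: "1 \<le> p" and u: "u \<in> Lp M p" and v: "v \<in> Lp M p"
  shows "(\<lambda>x. u x - v x) \<in> Lp M p"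
proof -
  have m: "u \<in> borel_measurable M" "v \<in> borel_measurable M"
    and i: "integrable M (\<lambda>x. \<bar>u x\<bar> powr p)" "integrable M (\<lambda>x. \<bar>v x\<bar> powr p)"
    using u v by (auto simp: Lp_def)
  have "integrable M (\<lambda>x. \<bar>u x - v x\<bar> powr p)"
  proof (rule Bochner_Integration.integrable_bound)
    show "integrable M (\<lambda>x. 2 powr p * (\<bar>u x\<bar> powr p + \<bar>v x\<bar> powr p))" using i by simp
    show "(\<lambda>x. \<bar>u x - v x\<bar> powr p) \<in> borel_measurable M" using m by measurable
    show "AE x in M. norm (\<bar>u x - v x\<bar> powr p) \<le> norm (2 powr p * (\<bar>u x\<bar> powr p + \<bar>v x\<bar> powr p))"
      using powr_diff_le[OF p] by (intro AE_I2) (simp add: order_trans[OF _ abs_ge_self])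
  qed
  then show ?thesis using m by (simp add: Lp_def)
qed

text \<open>
  Splitting at the level \<open>\<tau>\<close>: \<open>t \<le> \<tau> + \<tau>\<^sup>1\<^sup>-\<^sup>p t\<^sup>p\<close>. This serves as a substitute for Hoelder's inequality.
\<close>

lemma Lp_bounded_support_L1:
  fixes d :: "'a::euclidean_space \<Rightarrow> real"
  assumes p: "1 \<le> p" and d: "d \<in> Lp lborel p" and supp: "AE x in lborel. x \<notin> ball 0 R \<longrightarrow> d x = 0" and \<tau>: "0 < \<tau>"
  shows "integrable lborel d"
    "(\<integral>x. \<bar>d x\<bar> \<partial>lborel) \<le> \<tau> * measure lborel (ball (0::'a) R) + \<tau> powr (1 - p) * (\<integral>x. \<bar>d x\<bar> powr p \<partial>lborel)"
proof -
  have m: "d \<in> borel_measurable lborel" and i: "integrable lborel (\<lambda>x. \<bar>d x\<bar> powr p)"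
    using d by (auto simp: Lp_def)
  have ib: "integrable lborel (\<lambda>x. indicator (ball (0::'a) R) x :: real)"
    using emeasure_bounded_finite[of "ball (0::'a) R"] by (intro integrable_real_indicator) auto
  have pt: "t \<le> \<tau> + \<tau> powr (1 - p) * t powr p" if "0 \<le> t" for t
  proof (cases "t \<le> \<tau>")
    case False
    then have t: "0 < t" "\<tau> \<le> t" using \<tau> by auto
    have "t = t powr (1 - p) * t powr p" using t(1) by (simp add: powr_add[symmetric])
    also have "\<dots> \<le> \<tau> powr (1 - p) * t powr p"
      using powr_mono2'[of "1 - p" \<tau> t] p \<tau> t by (intro mult_right_mono) auto
    finally show ?thesis using \<tau> by simp
  qed (use \<tau> in \<open>simp add: order_trans[of t \<tau>]\<close>)
  have AE: "AE x in lborel. \<bar>d x\<bar> \<le> \<tau> * indicator (ball 0 R) x + \<tau> powr (1 - p) * \<bar>d x\<bar> powr p"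
    using supp
  proof eventually_elim
    case (elim x)
    show ?case
    proof (cases "x \<in> ball 0 R")
      case True
      then show ?thesis using pt[of "\<bar>d x\<bar>"] by simp
    next
      case False
      then show ?thesis using elim by simp
    qed
  qed
  have maj: "integrable lborel (\<lambda>x. \<tau> * indicator (ball 0 R) x + \<tau> powr (1 - p) * \<bar>d x\<bar> powr p)"
    using ib i by (intro Bochner_Integration.integrable_add integrable_mult_right)
  show id: "integrable lborel d"
  proof (rule Bochner_Integration.integrable_bound[OF maj m])
    show "AE x in lborel. norm (d x) \<le> norm (\<tau> * indicator (ball 0 R) x + \<tau> powr (1 - p) * \<bar>d x\<bar> powr p)"
      using AE by eventually_elim (simp only: real_norm_def order_trans[OF _ abs_ge_self])
  qed
  have "(\<integral>x. \<bar>d x\<bar> \<partial>lborel) \<le> (\<integral>x. \<tau> * indicator (ball 0 R) x + \<tau> powr (1 - p) * \<bar>d x\<bar> powr p \<partial>lborel)"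
    using id maj AE by (intro integral_mono_AE) auto
  also have "\<dots> = \<tau> * measure lborel (ball (0::'a) R) + \<tau> powr (1 - p) * (\<integral>x. \<bar>d x\<bar> powr p \<partial>lborel)"
    using ib i by (subst Bochner_Integration.integral_add) auto
  finally show "(\<integral>x. \<bar>d x\<bar> \<partial>lborel) \<le> \<tau> * measure lborel (ball (0::'a) R) + \<tau> powr (1 - p) * (\<integral>x. \<bar>d x\<bar> powr p \<partial>lborel)" .
qed

lemma Lp_bounded_support_L1_tendsto:
  fixes d :: "nat \<Rightarrow> 'a::euclidean_space \<Rightarrow> real"
  assumes p: "1 \<le> p" and d: "\<And>j. d j \<in> Lp lborel p" and supp: "\<And>j. AE x in lborel. x \<notin> ball 0 R \<longrightarrow> d j x = 0"
    and lim: "(\<lambda>j. \<integral>x. \<bar>d j x\<bar> powr p \<partial>lborel) \<longlonglongrightarrow> 0"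
  shows "(\<lambda>j. \<integral>x. \<bar>d j x\<bar> \<partial>lborel) \<longlonglongrightarrow> 0"
proof (rule LIMSEQ_I)
  fix e :: real assume e: "0 < e"
  define b where "b = measure lborel (ball (0::'a) R)"
  define \<tau> where "\<tau> = e / (2 * (b + 1))"
  have b: "0 \<le> b" by (simp add: b_def)
  have \<tau>: "0 < \<tau>" using e b by (simp add: \<tau>_def)
  have "\<tau> * b \<le> \<tau> * (b + 1)" using \<tau> by simp
  also have "\<dots> = e / 2" using b by (simp add: \<tau>_def field_simps)
  finally have \<tau>b: "\<tau> * b \<le> e / 2" .
  have "(\<lambda>j. \<tau> powr (1 - p) * (\<integral>x. \<bar>d j x\<bar> powr p \<partial>lborel)) \<longlonglongrightarrow> 0"
    using tendsto_mult_right_zero[OF lim] by simp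
  then have "\<forall>\<^sub>F j in sequentially. \<tau> powr (1 - p) * (\<integral>x. \<bar>d j x\<bar> powr p \<partial>lborel) < e / 2"
    using e by (intro order_tendstoD(2)) auto
  then obtain N where N: "\<And>j. N \<le> j \<Longrightarrow> \<tau> powr (1 - p) * (\<integral>x. \<bar>d j x\<bar> powr p \<partial>lborel) < e / 2"
    by (auto simp: eventually_sequentially)
  have "norm ((\<integral>x. \<bar>d j x\<bar> \<partial>lborel) - 0) < e" if "N \<le> j" for j
  proof -
    have "0 \<le> (\<integral>x. \<bar>d j x\<bar> \<partial>lborel)" by simp
    moreover have "(\<integral>x. \<bar>d j x\<bar> \<partial>lborel) < e"
      using Lp_bounded_support_L1(2)[OF p d supp \<tau>, of j] N[OF that] \<tau>b by (simp add: b_def)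
    ultimately show ?thesis by simp
  qed
  then show "\<exists>N. \<forall>j\<ge>N. norm ((\<integral>x. \<bar>d j x\<bar> \<partial>lborel) - 0) < e" by blast
qed

text \<open>
  Distinguish whether the perturbation \<open>\<bar>a - b\<bar>\<close> is smaller than \<open>\<tau> \<bar>b\<bar>\<close>. The coefficient of \<open>\<bar>b\<bar> powr p\<close> tends to \<open>1\<close> with
  \<open>\<tau>\<close>, so integrals of \<open>p\<close>-th powers converge without Minkowski's inequality.
\<close>

lemma powr_perturbation:
  fixes a b p \<tau> :: real
  assumes p: "1 \<le> p" and \<tau>: "0 < \<tau>"
  shows "\<bar>a\<bar> powr p \<le> (1 + \<tau>) powr p * \<bar>b\<bar> powr p + (1 + 1 / \<tau>) powr p * \<bar>a - b\<bar> powr p"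
proof (cases "\<bar>a - b\<bar> \<le> \<tau> * \<bar>b\<bar>")
  case True
  have "\<bar>a\<bar> \<le> \<bar>b\<bar> + \<bar>a - b\<bar>" by linarith
  then have "\<bar>a\<bar> \<le> (1 + \<tau>) * \<bar>b\<bar>" using True by (simp add: distrib_right)
  then have "\<bar>a\<bar> powr p \<le> ((1 + \<tau>) * \<bar>b\<bar>) powr p" using p by (intro powr_mono2) auto
  then show ?thesis using \<tau> by (simp add: powr_mult add_increasing2)
next
  case False
  then have "\<bar>b\<bar> \<le> 1 / \<tau> * \<bar>a - b\<bar>" using \<tau> by (simp add: field_simps)
  moreover have "\<bar>a\<bar> \<le> \<bar>b\<bar> + \<bar>a - b\<bar>" by linarith
  ultimately have "\<bar>a\<bar> \<le> (1 + 1 / \<tau>) * \<bar>a - b\<bar>" by (simp add: distrib_right)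
  then have "\<bar>a\<bar> powr p \<le> ((1 + 1 / \<tau>) * \<bar>a - b\<bar>) powr p" using p by (intro powr_mono2) auto
  then show ?thesis using \<tau> by (simp add: powr_mult add_increasing)
qed

lemma Lp_limit_norm_ge:
  fixes u :: "nat \<Rightarrow> 'a \<Rightarrow> real"
  assumes p: "1 \<le> p" and u: "\<And>j. u j \<in> Lp M p" and v: "v \<in> Lp M p"
    and norm: "\<And>j. (\<integral>x. \<bar>u j x\<bar> powr p \<partial>M) = 1"
    and lim: "(\<lambda>j. \<integral>x. \<bar>u j x - v x\<bar> powr p \<partial>M) \<longlonglongrightarrow> 0"
  shows "1 \<le> (\<integral>x. \<bar>v x\<bar> powr p \<partial>M)"
proof -
  define V where "V = (\<integral>x. \<bar>v x\<bar> powr p \<partial>M)"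
  have iv: "integrable M (\<lambda>x. \<bar>v x\<bar> powr p)" using v by (simp add: Lp_def)
  have iu: "integrable M (\<lambda>x. \<bar>u j x\<bar> powr p)" for j using u[of j] by (simp add: Lp_def)
  have id: "integrable M (\<lambda>x. \<bar>u j x - v x\<bar> powr p)" for j using Lp_diff[OF p u v, of j] by (simp add: Lp_def)
  have 1: "1 \<le> (1 + \<tau>) powr p * V" if \<tau>: "0 < \<tau>" for \<tau>
  proof (rule LIMSEQ_le_const)
    have "(\<lambda>j. (1 + \<tau>) powr p * V + (1 + 1 / \<tau>) powr p * (\<integral>x. \<bar>u j x - v x\<bar> powr p \<partial>M)) \<longlonglongrightarrow> (1 + \<tau>) powr p * V + (1 + 1 / \<tau>) powr p * 0"
      by (intro tendsto_intros lim)
    then show "(\<lambda>j. (1 + \<tau>) powr p * V + (1 + 1 / \<tau>) powr p * (\<integral>x. \<bar>u j x - v x\<bar> powr p \<partial>M)) \<longlonglongrightarrow> (1 + \<tau>) powr p * V"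
      by simp
    have "1 \<le> (1 + \<tau>) powr p * V + (1 + 1 / \<tau>) powr p * (\<integral>x. \<bar>u j x - v x\<bar> powr p \<partial>M)" for j
    proof -
      have "1 = (\<integral>x. \<bar>u j x\<bar> powr p \<partial>M)" by (rule norm[symmetric])
      also have "\<dots> \<le> (\<integral>x. (1 + \<tau>) powr p * \<bar>v x\<bar> powr p + (1 + 1 / \<tau>) powr p * \<bar>u j x - v x\<bar> powr p \<partial>M)"
        using iu iv id powr_perturbation[OF p \<tau>]
        by (intro integral_mono Bochner_Integration.integrable_add integrable_mult_right)
      also have "\<dots> = (1 + \<tau>) powr p * V + (1 + 1 / \<tau>) powr p * (\<integral>x. \<bar>u j x - v x\<bar> powr p \<partial>M)"
        using iv id by (subst Bochner_Integration.integral_add) (auto simp: V_def)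
      finally show ?thesis .
    qed
    then show "\<exists>N. \<forall>j\<ge>N. 1 \<le> (1 + \<tau>) powr p * V + (1 + 1 / \<tau>) powr p * (\<integral>x. \<bar>u j x - v x\<bar> powr p \<partial>M)" by blast
  qed
  have "1 \<le> V"
  proof (rule LIMSEQ_le_const)
    have "(\<lambda>n. (1 + 1 / real (Suc n)) powr p * V) \<longlonglongrightarrow> (1 + 0) powr p * V"
      by (intro tendsto_intros LIMSEQ_Suc[OF lim_1_over_n]) auto
    then show "(\<lambda>n. (1 + 1 / real (Suc n)) powr p * V) \<longlonglongrightarrow> V" by simp
    show "\<exists>N. \<forall>n\<ge>N. 1 \<le> (1 + 1 / real (Suc n)) powr p * V" by (intro exI allI impI 1) simp
  qed
  then show ?thesis by (simp add: V_def)
qed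

section \<open>Compactness and the conclusion\<close>

text \<open>
  By homogeneity of both sides in \<open>u\<close>. The strict failure of the inequality forces \<open>u\<close> to be non-zero and of
  finite energy, so that dividing by its norm makes sense.
\<close>

lemma normalized_violator:
  fixes u \<rho> :: "'a::euclidean_space \<Rightarrow> real" and wk :: "'a \<times> 'a \<Rightarrow> real"
  assumes p: "1 \<le> p" and u: "u \<in> Lp_zero p \<Omega>" and \<rho>: "\<rho> \<in> borel_measurable borel"
    and wk: "wk \<in> borel_measurable borel" and a: "0 < a"
    and bad: "\<not> ennreal (Lp_norm lborel p u powr p) \<le> ennreal a * nonlocal_energy p \<rho> wk u"
  obtains u' where "u' \<in> Lp_zero p \<Omega>" "(\<integral>x. \<bar>u' x\<bar> powr p \<partial>lborel) = 1"
    "nonlocal_energy p \<rho> wk u' \<le> ennreal (1 / a)"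
proof -
  define I where "I = (\<integral>x. \<bar>u x\<bar> powr p \<partial>lborel)"
  have uL: "u \<in> Lp lborel p" "AE x in lborel. x \<notin> \<Omega> \<longrightarrow> u x = 0" using u by (auto simp: Lp_zero_def)
  have um: "u \<in> borel_measurable borel" and ui: "integrable lborel (\<lambda>x. \<bar>u x\<bar> powr p)"
    using uL(1) by (auto simp: Lp_def)
  have less: "ennreal a * nonlocal_energy p \<rho> wk u < ennreal I"
    using bad Lp_norm_powr[OF p, of lborel u] by (simp add: I_def not_le)
  then have I: "0 < I" by (metis ennreal_eq_0_iff not_le not_less_zero)
  have "nonlocal_energy p \<rho> wk u \<noteq> \<top>"
    using less a by (auto simp: ennreal_mult_eq_top_iff)
  then obtain e where e: "0 \<le> e" "nonlocal_energy p \<rho> wk u = ennreal e"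
    by (cases "nonlocal_energy p \<rho> wk u") auto
  have ae: "a * e < I"
    using less a e I by (simp add: ennreal_mult[symmetric] ennreal_less_iff)
  define c where "c = I powr (- 1 / p)"
  have cp: "\<bar>c\<bar> powr p = 1 / I"
  proof -
    have "\<bar>c\<bar> powr p = I powr (- 1 / p * p)" by (simp only: c_def abs_of_nonneg[OF powr_ge_zero] powr_powr)
    also have "- 1 / p * p = - 1" using p by simp
    also have "I powr - 1 = 1 / I" using I by (simp add: powr_minus_divide)
    finally show ?thesis .
  qed
  define u' where "u' x = c * u x" for x
  have u'p: "\<bar>u' x\<bar> powr p = 1 / I * \<bar>u x\<bar> powr p" for x
    unfolding u'_def abs_mult powr_mult cp by (rule refl)
  have "u' \<in> Lp lborel p"
  proof -
    have "(\<lambda>x. c * u x) \<in> borel_measurable borel" using um by measurable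
    then have "u' \<in> borel_measurable lborel" by (simp add: u'_def[abs_def])
    moreover have "integrable lborel (\<lambda>x. \<bar>u' x\<bar> powr p)"
      unfolding u'p by (rule integrable_mult_right[OF ui])
    ultimately show ?thesis by (simp add: Lp_def)
  qed
  moreover have "AE x in lborel. x \<notin> \<Omega> \<longrightarrow> u' x = 0" using uL(2) by eventually_elim (simp add: u'_def)
  ultimately have "u' \<in> Lp_zero p \<Omega>" by (simp add: Lp_zero_def)
  moreover have "(\<integral>x. \<bar>u' x\<bar> powr p \<partial>lborel) = 1"
    unfolding u'p integral_mult_right_zero I_def[symmetric] using I by simp
  moreover have "nonlocal_energy p \<rho> wk u' \<le> ennreal (1 / a)"
  proof -
    have "nonlocal_energy p \<rho> wk u' = ennreal (1 / I) * ennreal e"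
      unfolding u'_def[abs_def] nonlocal_energy_scale[OF um \<rho> wk] cp e(2) by (rule refl)
    also have "\<dots> = ennreal (e / I)" using I e(1) by (simp add: ennreal_mult[symmetric])
    also have "\<dots> \<le> ennreal (1 / a)"
      using ae a I by (intro ennreal_leI) (simp add: field_simps)
    finally show ?thesis .
  qed
  ultimately show thesis by (rule that)
qed

lemma integral_restrict_Lp_le:
  fixes d :: "'a::euclidean_space \<Rightarrow> real"
  assumes d: "d \<in> Lp lborel p" and E: "E \<in> sets borel"
  shows "(\<integral>x. norm (d x) powr p \<partial>restrict_space lborel E) \<le> (\<integral>x. norm (d x) powr p \<partial>lborel)"
    "d \<in> Lp (restrict_space lborel E) p"
proof -
  have i: "integrable lborel (\<lambda>x. norm (d x) powr p)" and m: "d \<in> borel_measurable lborel"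
    using d by (auto simp: Lp_def)
  have ES: "E \<inter> space lborel \<in> sets lborel" using E by simp
  have ie: "integrable lborel (\<lambda>x. indicator E x *\<^sub>R norm (d x) powr p)"
    by (rule integrable_mult_indicator[OF _ i]) (use E in simp)
  have "(\<integral>x. norm (d x) powr p \<partial>restrict_space lborel E) = (\<integral>x. indicator E x *\<^sub>R norm (d x) powr p \<partial>lborel)"
    by (rule integral_restrict_space[OF ES])
  also have "\<dots> \<le> (\<integral>x. norm (d x) powr p \<partial>lborel)"
    using ie i by (intro integral_mono) (auto simp: indicator_def)
  finally show "(\<integral>x. norm (d x) powr p \<partial>restrict_space lborel E) \<le> (\<integral>x. norm (d x) powr p \<partial>lborel)" .
  have "integrable (restrict_space lborel E) (\<lambda>x. norm (d x) powr p)"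
    using ie by (subst integrable_restrict_space[OF ES])
  then show "d \<in> Lp (restrict_space lborel E) p"
    using measurable_restrict_space1[OF m, of E] by (simp add: Lp_def)
qed

lemma Lp_extend_by_zero:
  fixes v :: "'a::euclidean_space \<Rightarrow> real"
  assumes p: "1 \<le> p" and v: "v \<in> Lp (restrict_space lborel E) p" and E: "E \<in> sets borel"
  shows "(\<lambda>x. indicator E x *\<^sub>R v x) \<in> Lp lborel p"
proof -
  have ES: "E \<inter> space lborel \<in> sets lborel" using E by simp
  have "(\<lambda>x. indicator E x *\<^sub>R v x) \<in> borel_measurable lborel"
    using v borel_measurable_restrict_space_iff[OF ES, of v] by (simp add: Lp_def)
  moreover have "integrable lborel (\<lambda>x. indicator E x *\<^sub>R norm (v x) powr p)"
    using v integrable_restrict_space[OF ES, of "\<lambda>x. norm (v x) powr p"] by (simp add: Lp_def)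
  moreover have "indicator E x *\<^sub>R norm (v x) powr p = norm (indicator E x *\<^sub>R v x) powr p" for x
    using p by (simp add: indicator_def)
  ultimately show ?thesis by (simp add: Lp_def)
qed

lemma nonlocal_energy_zero:
  fixes \<rho> :: "'a::euclidean_space \<Rightarrow> real"
  shows "1 \<le> p \<Longrightarrow> nonlocal_energy p \<rho> v (\<lambda>_. 0) = 0"
  by (simp add: nonlocal_energy_def)

lemma zero_in_Lp_zero:
  fixes \<Omega> :: "'a::euclidean_space set"
  shows "1 \<le> p \<Longrightarrow> (\<lambda>_. 0) \<in> Lp_zero p \<Omega>"
  by (simp add: Lp_zero_def Lp_def)

text \<open>
  Local compactness is compactness here, since all functions vanish outside the compact set \<open>closure \<Omega>\<close>; the limit,
  extended by \<open>0\<close>, is a limit on all compact sets, and strong compactness gives its regularity.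
\<close>

lemma compactness_of_normalized_sequence:
  fixes \<rho> :: "nat \<Rightarrow> 'a::euclidean_space \<Rightarrow> real" and u :: "nat \<Rightarrow> 'a \<Rightarrow> real"
  assumes p: "1 \<le> p" and \<Omega>: "bounded \<Omega>" and comp: "strongly_p_compact p \<rho>" and r: "strict_mono (r :: nat \<Rightarrow> nat)"
    and u: "\<And>k. u k \<in> Lp_zero p \<Omega>" and norm: "\<And>k. (\<integral>x. \<bar>u k x\<bar> powr p \<partial>lborel) \<le> 1"
    and B: "\<And>k. nonlocal_energy p (\<rho> k) (\<lambda>_. 1) (u k) \<le> ennreal B"
  obtains s v where "strict_mono (s :: nat \<Rightarrow> nat)" "v \<in> Sp_zero p \<Omega>"
    "(\<lambda>j. \<integral>x. \<bar>u (r (s j)) x - v x\<bar> powr p \<partial>lborel) \<longlonglongrightarrow> 0"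
proof -
  have uL: "u k \<in> Lp lborel p" "AE x in lborel. x \<notin> \<Omega> \<longrightarrow> u k x = 0" for k
    using u[of k] by (auto simp: Lp_zero_def)
  have bounded: "energy_bounded p \<rho> u"
    unfolding energy_bounded_def
  proof (intro conjI allI uL)
    have "ennreal (Lp_norm lborel p (u k)) + nonlocal_energy p (\<rho> k) (\<lambda>_. 1) (u k) \<le> 1 + ennreal B" for k
    proof (rule add_mono[OF _ B])
      have "Lp_norm lborel p (u k) \<le> 1 powr (1 / p)"
        unfolding Lp_norm_def using norm[of k] p by (intro powr_mono2) (auto intro!: integral_nonneg_AE)
      then show "ennreal (Lp_norm lborel p (u k)) \<le> 1" by simp
    qed
    then have "(SUP k. ennreal (Lp_norm lborel p (u k)) + nonlocal_energy p (\<rho> k) (\<lambda>_. 1) (u k)) \<le> 1 + ennreal B"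
      by (rule SUP_least)
    also have "\<dots> < \<infinity>" by simp
    finally show "(SUP k. ennreal (Lp_norm lborel p (u k)) + nonlocal_energy p (\<rho> k) (\<lambda>_. 1) (u k)) < \<infinity>" .
  qed
  define E where "E = closure \<Omega>"
  have E: "compact E" "E \<in> sets borel" "\<Omega> \<subseteq> E"
    using \<Omega> by (auto simp: E_def compact_closure closure_subset)
  obtain s v where s: "strict_mono (s :: nat \<Rightarrow> nat)" and v: "v \<in> Lp (restrict_space lborel E) p"
    and conv: "(\<lambda>j. Lp_norm (restrict_space lborel E) p (\<lambda>x. u (r (s j)) x - v x)) \<longlonglongrightarrow> 0"
    using comp bounded E(1) r unfolding strongly_p_compact_def p_compact_def by blast
  define v' where "v' x = indicator E x *\<^sub>R v x" for x
  have v'L: "v' \<in> Lp lborel p" unfolding v'_def by (rule Lp_extend_by_zero[OF p v E(2)])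
  have dL: "(\<lambda>x. u (r (s j)) x - v' x) \<in> Lp lborel p" for j by (rule Lp_diff[OF p uL(1) v'L])
  have d_eq: "(\<integral>x. norm (u (r (s j)) x - v' x) powr p \<partial>lborel)
      = (\<integral>x. norm (u (r (s j)) x - v x) powr p \<partial>restrict_space lborel E)" for j
  proof -
    have um: "u (r (s j)) \<in> borel_measurable lborel" using uL(1)[of "r (s j)"] by (simp add: Lp_def)
    have ES: "E \<inter> space lborel \<in> sets lborel" using E by simp
    have "(\<integral>x. norm (u (r (s j)) x - v x) powr p \<partial>restrict_space lborel E)
        = (\<integral>x. indicator E x *\<^sub>R norm (u (r (s j)) x - v x) powr p \<partial>lborel)"
      by (rule integral_restrict_space[OF ES])
    also have "\<dots> = (\<integral>x. indicator E x *\<^sub>R norm (u (r (s j)) x - v' x) powr p \<partial>lborel)"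
      by (intro Bochner_Integration.integral_cong refl) (simp add: v'_def indicator_def)
    also have "\<dots> = (\<integral>x. norm (u (r (s j)) x - v' x) powr p \<partial>lborel)"
    proof (rule integral_cong_AE)
      have dm: "(\<lambda>x. norm (u (r (s j)) x - v' x) powr p) \<in> borel_measurable lborel"
        using dL[of j] by (auto simp: Lp_def)
      then show "(\<lambda>x. norm (u (r (s j)) x - v' x) powr p) \<in> borel_measurable lborel" .
      show "(\<lambda>x. indicator E x *\<^sub>R norm (u (r (s j)) x - v' x) powr p) \<in> borel_measurable lborel"
        using dm E(2) by (intro borel_measurable_scaleR borel_measurable_indicator) auto
      show "AE x in lborel. indicator E x *\<^sub>R norm (u (r (s j)) x - v' x) powr p = norm (u (r (s j)) x - v' x) powr p"
        using uL(2)[of "r (s j)"]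
      proof eventually_elim
        case (elim x)
        then show ?case using E(3) p by (cases "x \<in> E") (auto simp: v'_def)
      qed
    qed
    finally show ?thesis by simp
  qed
  have lim: "(\<lambda>j. \<integral>x. norm (u (r (s j)) x - v' x) powr p \<partial>lborel) \<longlonglongrightarrow> 0"
    unfolding d_eq by (rule iffD1[OF Lp_norm_tendsto_0_iff[OF p] conv])
  have "v' \<in> Sp p"
  proof -
    have "v' \<in> Lp_loc p"
      using integral_restrict_Lp_le(2)[OF v'L] v'L by (auto simp: Lp_loc_def Lp_def compact_imp_closed)
    moreover have "(\<lambda>j. Lp_norm (restrict_space lborel E') p (\<lambda>x. u (r (s j)) x - v' x)) \<longlonglongrightarrow> 0" if "compact E'" for E'
      unfolding Lp_norm_tendsto_0_iff[OF p]
    proof (rule tendsto_sandwich[OF _ _ tendsto_const lim])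
      have "E' \<in> sets borel" using that by (simp add: compact_imp_closed)
      then show "\<forall>\<^sub>F j in sequentially. (\<integral>x. norm (u (r (s j)) x - v' x) powr p \<partial>restrict_space lborel E')
          \<le> (\<integral>x. norm (u (r (s j)) x - v' x) powr p \<partial>lborel)"
        by (intro always_eventually allI integral_restrict_Lp_le(1)[OF dL])
      show "\<forall>\<^sub>F j in sequentially. 0 \<le> (\<integral>x. norm (u (r (s j)) x - v' x) powr p \<partial>restrict_space lborel E')"
        by (intro always_eventually allI integral_nonneg_AE) simp
    qed
    moreover have "strict_mono (\<lambda>j. r (s j))" using r s by (simp add: strict_mono_def)
    moreover have limits: "\<forall>u v. \<forall>r :: nat \<Rightarrow> nat. energy_bounded p \<rho> u \<and> strict_mono r \<and> v \<in> Lp_loc p \<and>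
        (\<forall>E. compact E \<longrightarrow>
           (\<lambda>j. Lp_norm (restrict_space lborel E) p (\<lambda>x. u (r j) x - v x)) \<longlonglongrightarrow> 0) \<longrightarrow> v \<in> Sp p"
      using comp unfolding strongly_p_compact_def by (rule conjunct2)
    ultimately show ?thesis
      using bounded limits[THEN spec, THEN spec, THEN spec, THEN mp, of u "\<lambda>j. r (s j)" v'] by blast
  qed
  moreover have "AE x in lborel. x \<notin> \<Omega> \<longrightarrow> v' x = 0"
  proof -
    have v'm: "v' \<in> borel_measurable lborel" and v'i: "integrable lborel (\<lambda>x. norm (v' x) powr p)"
      using v'L by (auto simp: Lp_def)
    have di: "integrable lborel (\<lambda>x. norm (u (r (s j)) x - v' x) powr p)" for j using dL[of j] by (simp add: Lp_def)
    have AEj: "AE x in lborel. \<forall>j. x \<notin> \<Omega> \<longrightarrow> u (r (s j)) x = 0"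
      unfolding AE_all_countable using uL(2) by blast
    \<comment> \<open>The common zero set of the \<open>u (r (s j))\<close> is measurable and almost everywhere contains the
      complement of \<open>\<Omega>\<close>, so it can stand for that complement under the integral.\<close>
    define Z where "Z = {x. \<forall>j. u (r (s j)) x = 0}"
    have um: "u k \<in> borel_measurable borel" for k using uL(1)[of k] by (simp add: Lp_def)
    have "{x \<in> space borel. \<forall>j. u (r (s j)) x = 0} \<in> sets borel"
      using um by (intro sets.sets_Collect_countable_All borel_measurable_eq) auto
    then have Z: "Z \<in> sets lborel" by (simp add: Z_def)
    have iZ: "integrable lborel (\<lambda>x. indicator Z x *\<^sub>R norm (v' x) powr p)"
      by (rule integrable_mult_indicator[OF Z v'i])
    have "(\<integral>x. indicator Z x *\<^sub>R norm (v' x) powr p \<partial>lborel) \<le> (\<integral>x. norm (u (r (s j)) x - v' x) powr p \<partial>lborel)" for j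
      using iZ di by (intro integral_mono) (auto simp: indicator_def Z_def)
    then have le0: "(\<integral>x. indicator Z x *\<^sub>R norm (v' x) powr p \<partial>lborel) \<le> 0"
      by (intro LIMSEQ_le_const[OF lim]) blast
    have ge0: "0 \<le> (\<integral>x. indicator Z x *\<^sub>R norm (v' x) powr p \<partial>lborel)"
      by (intro integral_nonneg_AE) simp
    have "(\<integral>x. indicator Z x *\<^sub>R norm (v' x) powr p \<partial>lborel) = 0" by (rule antisym[OF le0 ge0])
    then have "AE x in lborel. indicator Z x *\<^sub>R norm (v' x) powr p = 0"
      using iZ by (subst (asm) integral_nonneg_eq_0_iff_AE) auto
    with AEj show ?thesis
      by eventually_elim (auto simp: Z_def indicator_def split: if_splits)
  qed
  ultimately have "v' \<in> Sp_zero p \<Omega>" using v'L by (simp add: Sp_zero_def Lp_zero_def)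
  moreover have "(\<lambda>j. \<integral>x. \<bar>u (r (s j)) x - v' x\<bar> powr p \<partial>lborel) \<longlonglongrightarrow> 0" using lim by simp
  ultimately show thesis using s that by blast
qed

theorem theorem1p8:
  fixes p :: real
    and \<Omega> :: "'a::euclidean_space set"
    and \<rho> :: "nat \<Rightarrow> 'a \<Rightarrow> real"
    and wk :: "nat \<Rightarrow> 'a \<times> 'a \<Rightarrow> real"
    and w :: "'a \<times> 'a \<Rightarrow> real"
    and \<mu> :: "'a measure"
  assumes "1 \<le> p"
    and "\<Omega> \<noteq> {}" "open \<Omega>" "bounded \<Omega>"
    and "admissible_kernels p \<rho>"
    and "angular_limit \<rho> \<mu>"
    and "admissible_weights wk w"
    and "0 < (INF x\<in>\<Omega>. w (x, x))"
    and "strongly_p_compact p \<rho>"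
    and "poincare_measure p \<mu> \<Omega>"
  shows "\<forall>\<epsilon>>0. \<exists>k\<^sub>\<epsilon>. \<forall>u\<in>Lp_zero p \<Omega>. \<forall>k\<ge>k\<^sub>\<epsilon>.
    ennreal (Lp_norm lborel p u powr p) \<le>
      ennreal (optimal_poincare_constant p (\<lambda>x. w (x, x)) \<mu> \<Omega> + \<epsilon>) * nonlocal_energy p (\<rho> k) (wk k) u"
proof (intro allI impI)
  fix \<epsilon> :: real assume \<epsilon>: "0 < \<epsilon>"
  note p = assms(1) and \<rho> = assms(5) and \<mu> = assms(6) and w = assms(7)
  define w0 where "w0 x = w (x, x)" for x
  define PC where "PC = poincare_constants p w0 \<mu> \<Omega>"
  define A where "A = Inf PC"
  define a where "a = A + \<epsilon>"
  have wc: "continuous_on UNIV w" "bounded (range w)" "\<And>z. 0 \<le> w z"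
    using w by (auto simp: admissible_weights_def)
  have w0c: "continuous_on UNIV w0"
    unfolding w0_def by (intro continuous_on_compose2[OF wc(1)] continuous_intros) auto
  obtain K where "\<And>z. \<bar>w z\<bar> \<le> K" using wc(2) by (auto simp: bounded_iff)
  then have K: "\<bar>w0 x\<bar> \<le> K" for x by (simp add: w0_def)
  have w0p: "0 \<le> w0 x" for x by (simp add: w0_def wc(3))
  define c where "c = (INF x\<in>\<Omega>. w0 x)"
  have c: "0 < c" using assms(8) by (simp add: c_def w0_def)
  have c_le: "c \<le> w0 x" if "x \<in> \<Omega>" for x
    unfolding c_def using that w0p by (intro cINF_lower bdd_belowI2[of _ 0]) auto
  have fin: "finite_sphere_measure \<mu>" using \<mu> by (simp add: angular_limit_def)
  have PC_ne: "PC \<noteq> {}"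
    unfolding PC_def by (rule poincare_constants_weighted_nonempty[OF p fin w0c K w0p c c_le assms(10)])
  have PC_pos: "0 < C" if "C \<in> PC" for C using that by (simp add: PC_def poincare_constants_def)
  have A: "0 \<le> A" unfolding A_def using PC_pos by (intro cInf_greatest[OF PC_ne]) (auto intro: less_imp_le)
  then have a: "0 < a" using \<epsilon> by (simp add: a_def)
  have \<rho>m: "\<rho> k \<in> borel_measurable borel" for k
    using \<rho> by (intro Lp_locD[of _ 1]) (simp add: admissible_kernels_def)
  have wkm: "wk k \<in> borel_measurable borel" for k
    using w by (simp add: admissible_weights_def Linfty_def)
  have c2: "0 < c / 2" using c by simp
  obtain \<delta> k1 where \<delta>: "0 < \<delta>" and near: "\<And>k. k1 \<le> k \<Longrightarrow> AE z in lborel. dist (fst z) (snd z) < \<delta> \<longrightarrow>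
      w (fst z, fst z) \<le> wk k z + c / 2 \<and> w (snd z, snd z) \<le> wk k z + c / 2"
    using weights_near_diagonal[OF w c2] by blast
  obtain T where T: "0 \<le> T" "\<forall>\<^sub>F k in sequentially. (\<integral>\<^sup>+z. kernel_tail p \<delta> (\<rho> k) z \<partial>lborel) \<le> ennreal T"
    using kernel_tail_bound[OF p \<rho> \<delta>] by blast
  from T(2) obtain k2 where k2: "\<And>k. k2 \<le> k \<Longrightarrow> (\<integral>\<^sup>+z. kernel_tail p \<delta> (\<rho> k) z \<partial>lborel) \<le> ennreal T"
    by (auto simp: eventually_sequentially)
  \<comment> \<open>the bound of \<open>unweighted_energy_bound\<close> for a function of norm \<open>1\<close> and weighted energy at most \<open>1 / a\<close>\<close>
  define B where "B = 1 / (c / 2) * (1 / a) + 2 * 2 powr p * 1 * T"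
  have B: "0 \<le> B" using c a T(1) by (simp add: B_def)
  define violates where "violates k u \<longleftrightarrow> u \<in> Lp_zero p \<Omega> \<and>
    \<not> ennreal (Lp_norm lborel p u powr p) \<le> ennreal a * nonlocal_energy p (\<rho> k) (wk k) u" for k u
  show "\<exists>k\<^sub>\<epsilon>. \<forall>u\<in>Lp_zero p \<Omega>. \<forall>k\<ge>k\<^sub>\<epsilon>.
    ennreal (Lp_norm lborel p u powr p) \<le>
      ennreal (optimal_poincare_constant p (\<lambda>x. w (x, x)) \<mu> \<Omega> + \<epsilon>) * nonlocal_energy p (\<rho> k) (wk k) u"
  proof (rule ccontr)
    assume contra: "\<not> ?thesis"
    have a_eq: "optimal_poincare_constant p (\<lambda>x. w (x, x)) \<mu> \<Omega> + \<epsilon> = a"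
      by (simp add: a_def A_def PC_def optimal_poincare_constant_def w0_def[abs_def])
    have often: "\<exists>k\<ge>m. \<exists>u. violates k u" for m
      using contra unfolding a_eq violates_def by blast
    define S where "S = {k. max k1 k2 \<le> k \<and> (\<exists>u. violates k u)}"
    have "infinite S"
      unfolding infinite_nat_iff_unbounded_le
    proof
      fix m
      obtain k where "max m (max k1 k2) \<le> k" "\<exists>u. violates k u" using often[of "max m (max k1 k2)"] by blast
      then show "\<exists>n\<ge>m. n \<in> S" by (intro exI[of _ k]) (simp add: S_def)
    qed
    then obtain r :: "nat \<Rightarrow> nat" where r: "strict_mono r" "\<And>n. r n \<in> S" using infinite_enumerate by blast
    have "\<exists>u. u \<in> Lp_zero p \<Omega> \<and> (\<integral>x. \<bar>u x\<bar> powr p \<partial>lborel) = 1 \<and>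
        nonlocal_energy p (\<rho> k) (wk k) u \<le> ennreal (1 / a) \<and> nonlocal_energy p (\<rho> k) (\<lambda>_. 1) u \<le> ennreal B"
      if k: "k \<in> S" for k
    proof -
      obtain u0 where u0: "violates k u0" and kk: "k1 \<le> k" "k2 \<le> k" using k by (auto simp: S_def)
      obtain u where u: "u \<in> Lp_zero p \<Omega>" "(\<integral>x. \<bar>u x\<bar> powr p \<partial>lborel) = 1"
        "nonlocal_energy p (\<rho> k) (wk k) u \<le> ennreal (1 / a)"
        using normalized_violator[OF p _ \<rho>m wkm a] u0 unfolding violates_def by metis
      have um: "u \<in> borel_measurable borel" and ui: "integrable lborel (\<lambda>x. \<bar>u x\<bar> powr p)"
        and zero: "AE x in lborel. x \<notin> \<Omega> \<longrightarrow> u x = 0"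
        using u(1) by (auto simp: Lp_zero_def Lp_def)
      have low: "AE z in lborel. dist (fst z) (snd z) < \<delta> \<and> (fst z \<in> \<Omega> \<or> snd z \<in> \<Omega>) \<longrightarrow> c / 2 \<le> wk k z"
        using near[OF kk(1)]
      proof eventually_elim
        case (elim z)
        then show ?case using c_le[of "fst z"] c_le[of "snd z"] unfolding w0_def by force
      qed
      have int1: "(\<integral>\<^sup>+x. ennreal (\<bar>u x\<bar> powr p) \<partial>lborel) = ennreal 1"
        using nn_integral_eq_integral[OF ui] u(2) by simp
      have "nonlocal_energy p (\<rho> k) (\<lambda>_. 1) u \<le> ennreal (1 / (c / 2)) * nonlocal_energy p (\<rho> k) (wk k) u
          + ennreal (2 * 2 powr p) * (\<integral>\<^sup>+x. ennreal (\<bar>u x\<bar> powr p) \<partial>lborel) * (\<integral>\<^sup>+z. kernel_tail p \<delta> (\<rho> k) z \<partial>lborel)"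
        by (rule unweighted_energy_bound[OF p um \<rho>m wkm c2 zero low])
      also have "\<dots> \<le> ennreal (1 / (c / 2)) * ennreal (1 / a) + ennreal (2 * 2 powr p) * ennreal 1 * ennreal T"
        unfolding int1 by (intro add_mono mult_left_mono u(3) k2 kk(2)) simp_all
      also have "\<dots> = ennreal B"
      proof -
        have n: "0 \<le> 1 / (c / 2)" "0 \<le> 1 / a" "0 \<le> 2 * 2 powr p" using c a by simp_all
        have n': "0 \<le> 1 / (c / 2) * (1 / a)" "0 \<le> 2 * 2 powr p * 1" "0 \<le> 2 * 2 powr p * 1 * T"
          using mult_nonneg_nonneg[OF n(1,2)] T(1) by simp_all
        show ?thesis
          unfolding B_def ennreal_plus[OF n'(1,3)] ennreal_mult[OF n(1,2)] ennreal_mult[OF n'(2) T(1)]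
            ennreal_mult[OF n(3) zero_le_one] by (rule refl)
      qed
      finally show ?thesis using u by blast
    qed
    then obtain U where U: "\<And>k. k \<in> S \<Longrightarrow> U k \<in> Lp_zero p \<Omega> \<and> (\<integral>x. \<bar>U k x\<bar> powr p \<partial>lborel) = 1 \<and>
        nonlocal_energy p (\<rho> k) (wk k) (U k) \<le> ennreal (1 / a) \<and> nonlocal_energy p (\<rho> k) (\<lambda>_. 1) (U k) \<le> ennreal B"
      by metis
    \<comment> \<open>Energy boundedness speaks of one function for each index, so the indices outside \<open>S\<close> get \<open>0\<close>.\<close>
    define u where "u k = (if k \<in> S then U k else (\<lambda>_. 0))" for k
    have u_zero: "u k \<in> Lp_zero p \<Omega>" for k
    proof (cases "k \<in> S")
      case True then show ?thesis using U[OF True] by (simp add: u_def)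
    next
      case False then show ?thesis using zero_in_Lp_zero[OF p, of \<Omega>] by (simp add: u_def)
    qed
    have u_norm: "(\<integral>x. \<bar>u k x\<bar> powr p \<partial>lborel) \<le> 1" for k using U[of k] p by (simp add: u_def)
    have u_B: "nonlocal_energy p (\<rho> k) (\<lambda>_. 1) (u k) \<le> ennreal B" for k
    proof (cases "k \<in> S")
      case True then show ?thesis using U[OF True] by (simp add: u_def)
    next
      case False then show ?thesis using nonlocal_energy_zero[OF p, of "\<rho> k"] by (simp add: u_def)
    qed
    have u_r: "(\<integral>x. \<bar>u (r n) x\<bar> powr p \<partial>lborel) = 1" "nonlocal_energy p (\<rho> (r n)) (wk (r n)) (u (r n)) \<le> ennreal (1 / a)" for n
      using U[OF r(2)] r(2) by (simp_all add: u_def)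
    obtain s v where s: "strict_mono (s :: nat \<Rightarrow> nat)" and v: "v \<in> Sp_zero p \<Omega>"
      and lim: "(\<lambda>j. \<integral>x. \<bar>u (r (s j)) x - v x\<bar> powr p \<partial>lborel) \<longlonglongrightarrow> 0"
      by (rule compactness_of_normalized_sequence[OF p assms(4,9) r(1) u_zero u_norm u_B]) (rule that)
    have uL: "u k \<in> Lp lborel p" and u0: "AE x in lborel. x \<notin> \<Omega> \<longrightarrow> u k x = 0" for k
      using u_zero[of k] by (auto simp: Lp_zero_def)
    have vL: "v \<in> Lp lborel p" and v0: "AE x in lborel. x \<notin> \<Omega> \<longrightarrow> v x = 0" and vS: "v \<in> Sp p"
      using v by (auto simp: Sp_zero_def Lp_zero_def)
    obtain R where R: "\<And>x. x \<in> \<Omega> \<Longrightarrow> x \<in> ball 0 R"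
      using bounded_subset_ballD[OF assms(4), of 0] by blast
    have suppR: "AE x in lborel. x \<notin> ball 0 R \<longrightarrow> f x = 0" if "AE x in lborel. x \<notin> \<Omega> \<longrightarrow> f x = 0" for f :: "'a \<Rightarrow> real"
      using that by eventually_elim (use R in blast)
    have u1: "integrable lborel (u k)" for k
      by (rule Lp_bounded_support_L1(1)[OF p uL suppR[OF u0], of 1]) simp
    have v1: "integrable lborel v"
      by (rule Lp_bounded_support_L1(1)[OF p vL suppR[OF v0], of 1]) simp
    have d0: "AE x in lborel. x \<notin> \<Omega> \<longrightarrow> u (r (s j)) x - v x = 0" for j
      using u0[of "r (s j)"] v0 by eventually_elim simp
    have conv: "(\<lambda>j. \<integral>x. \<bar>u (r (s j)) x - v x\<bar> \<partial>lborel) \<longlonglongrightarrow> 0"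
      by (rule Lp_bounded_support_L1_tendsto[OF p Lp_diff[OF p uL vL] suppR[OF d0] lim])
    have rs: "strict_mono (\<lambda>j. r (s j))" using r(1) s by (simp add: strict_mono_def)
    have "local_energy p w0 \<mu> v \<le> ennreal (1 / a)"
      unfolding w0_def
      by (rule liminf_local_energy[OF p \<rho> \<mu> w rs vS v1 u1 conv _ u_r(2) B u_B]) (use a in simp)
    moreover have "1 \<le> (\<integral>x. \<bar>v x\<bar> powr p \<partial>lborel)"
      by (rule Lp_limit_norm_ge[OF p uL vL u_r(1) lim])
    ultimately have "a \<le> C" if C: "C \<in> PC" for C
    proof -
      have "ennreal 1 \<le> ennreal (Lp_norm lborel p v powr p)"
        using \<open>1 \<le> (\<integral>x. \<bar>v x\<bar> powr p \<partial>lborel)\<close> Lp_norm_powr[OF p, of lborel v] by (intro ennreal_leI) simp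
      also have "\<dots> \<le> ennreal C * local_energy p w0 \<mu> v"
        using C v by (simp add: PC_def poincare_constants_def)
      also have "\<dots> \<le> ennreal C * ennreal (1 / a)"
        by (rule mult_left_mono[OF \<open>local_energy p w0 \<mu> v \<le> ennreal (1 / a)\<close>]) simp
      also have "\<dots> = ennreal (C / a)" using PC_pos[OF C] a by (simp add: ennreal_mult[symmetric])
      finally have "1 \<le> C / a" using PC_pos[OF C] a by (subst (asm) ennreal_le_iff) auto
      then show ?thesis using a by simp
    qed
    then have "a \<le> A" unfolding A_def by (intro cInf_greatest[OF PC_ne])
    then show False using \<epsilon> by (simp add: a_def)
  qed
qed

end
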